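(* Let $\mathfrak A$ be a Banach algebra of finite real dimension $n\ge 3$, and let $\phi$ be an $\mathfrak A$-valued ordered measure such that $$\int|\phi|<\frac{2}{1-\left(\dfrac{2^{-2-n}}{n}\left(\dfrac{1-\frac2n}{\mathrm e}\right)\dfrac{\Lambda_n}{\vartheta_n}\right)}.$$ Then $\phi$ is $M$-controlled; in particular, its Magnus expansion $\sum_{k\ge1}\mu_{k,\mathrm R}(\phi)$ is convergent, and the logarithmic Magnus formula $\log\exp_{\mathrm R}(\phi)=\sum_{k\ge1}\mu_{k,\mathrm R}(\phi)$ holds.
   Context: Banach algebras are unital, over $\mathbb R$ or $\mathbb C$, with a submultiplicative norm $|\cdot|$. An $\mathfrak A$-valued ordered measure $\phi$ is a continuous (atomless) $\mathfrak A$-valued measure of finite variation on a bounded interval $I\subset\mathbb R$; its cumulative norm is the total variation $\int|\phi|$. Time-ordered exponential: $\exp_{\mathrm R}(\phi)=1+\sum_{k\ge1}\int_{t_1\le\dots\le t_k}\phi(t_1)\cdots\phi(t_k)$. Magnus terms: for $t_1,\dots,t_k\in I$ let $\mathrm{asc}(t_1,\dots,t_k)$ (resp. $\mathrm{des}(t_1,\dots,t_k)$) be the number of $i<k$ with $t_i<t_{i+1}$ (resp. $t_i>t_{i+1}$). Then $$\mu_{k,\mathrm R}(\phi)=\int_{(t_1,\dots,t_k)\in I^k}(-1)^{\mathrm{des}(t_1,\dots,t_k)}\frac{\mathrm{asc}(t_1,\dots,t_k)!\,\mathrm{des}(t_1,\dots,t_k)!}{k!}\,\phi(t_1)\cdots\phi(t_k).$$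 Equivalently, $\sum_k t^k\mu_{k,\mathrm R}(\phi)=\log\exp_{\mathrm R}(t\phi)$ as formal power series in $t$. The Magnus expansion (series) of $\phi$ is $\sum_{k\ge1}\mu_{k,\mathrm R}(\phi)$. Logarithm: $\log A=\int_0^1\frac{A-1}{\lambda+(1-\lambda)A}\,\mathrm d\lambda$, defined when $\lambda+(1-\lambda)A$ is invertible for all $\lambda\in[0,1]$. The measure $\phi$ is $M$-controlled if for every complex $t$ with $|t|\le1$, $\log\exp_{\mathrm R}(t\phi)$ is defined in this sense, i.e. $\lambda+(1-\lambda)\exp_{\mathrm R}(t\phi)$ is invertible for all $\lambda\in[0,1]$ (in the complexification of $\mathfrak A$ if $\mathfrak A$ is real). The constant $\Lambda_n$: for $d\ge3$ let $\mathrm C^{\{\{d\}\}}_{\mathbb R}$ be the infimum of the cumulative norms of all ordered measures, with values in $d$-dimensional Banach algebras over $\mathbb R$, whose Magnus expansion is not absolutely convergent (it is known that $2\le \mathrm C^{\{\{d\}\}}_{\mathbb R}<\infty$). For $\lambda\in[0,1]$ put $\mathrm C_\infty^{(\lambda)}=\frac{1}{1-2\lambda}\log\frac{1-\lambda}{\lambda}$ if $\lambda\in(0,1)\setminus\{\frac12\}$, $\mathrm C_\infty^{(1/2)}=2$, and $\mathrm C_\infty^{(0)}=\mathrm C_\infty^{(1)}=+\infty$; on $(0,\frac12]$ this is continuous and strictly decreasing from $+\infty$ to $2$. Then $\Lambda_d$ is the unique number with $0<\Lambda_d\le\frac12$ and $\mathrm C_\infty^{(\Lambda_d)}=\mathrm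 C^{\{\{d\}\}}_{\mathbb R}$. The constant $\vartheta_n$ ($n\ge3$): any one of the following increasing upper bounds of Rogers for the minimal density of a covering of $\mathbb R^n$ by translates of a centrally symmetric compact convex body: $\min_{0<\eta<1/n}(1+\eta)^n(1+n\log(1/\eta))$; $\ \left(1+\frac1{n\log n}\right)^n(1+n\log(n\log n))$; $\ n\log n+n\log\log n+2n+1$; $\ n\log n+n\log\log n+5n$. (As shown by Rogers and Zong, if $H$ is such a body and $0<r<1$, then $H$ can be covered by at most $(1+r^{-1})^n\vartheta_n$ translates of $rH$.) *)

theory Defs
  imports "HOL-Analysis.Analysis"
begin

text \<open>An algebra is given by a multiplication \<open>m\<close> and a unit \<open>e\<close> on a real vector space
  type; this allows the same definitions to be used for a Banach algebra type, for its
  complexification, and for the algebras over which the constant \<open>C_fin\<close> is an infimum.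
  The algebras concerned are finite-dimensional, so convergence with respect to their norm \<open>N\<close>
  is convergence in the topology of the ambient type.\<close>

section \<open>Ordered measures\<close>

definition vector_measure :: "'t measure \<Rightarrow> ('t set \<Rightarrow> 'v::real_normed_vector) \<Rightarrow> bool" where
  "vector_measure M \<phi> \<longleftrightarrow>
     (\<forall>E::nat \<Rightarrow> 't set. range E \<subseteq> sets M \<longrightarrow> disjoint_family E \<longrightarrow>
        (\<lambda>i. \<phi> (E i)) sums \<phi> (\<Union>i. E i))"

abbreviation borel_on :: "real set \<Rightarrow> real measure" where
  "borel_on I \<equiv> restrict_space borel I"

definition variation :: "('v \<Rightarrow> real) \<Rightarrow> real set \<Rightarrow> (real set \<Rightarrow> 'v) \<Rightarrow> ereal" where
  "variation N I \<phi> =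
     (SUP P\<in>{P. finite P \<and> partition_on I P \<and> P \<subseteq> sets (borel_on I)}.
        ereal (\<Sum>E\<in>P. N (\<phi> E)))"

definition ordered_measure ::
    "('v::real_normed_vector \<Rightarrow> real) \<Rightarrow> real set \<Rightarrow> (real set \<Rightarrow> 'v) \<Rightarrow> bool" where
  "ordered_measure N I \<phi> \<longleftrightarrow>
     is_interval I \<and> bounded I \<and>
     vector_measure (borel_on I) \<phi> \<and> (\<forall>t\<in>I. \<phi> {t} = 0) \<and> variation N I \<phi> < \<infinity>"

section \<open>Iterated integrals\<close>

abbreviation power_space :: "real set \<Rightarrow> nat \<Rightarrow> (nat \<Rightarrow> real) measure" where
  "power_space I k \<equiv> (\<Pi>\<^sub>M i\<in>{..<k}. borel_on I)"

text \<open>The measure \<open>\<phi>(t\<^sub>1) \<cdots> \<phi>(t\<^sub>k)\<close> on \<open>I\<^sup>k\<close>: the unique vector measure whose value on a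
  rectangle is the product, in this order, of the values of \<open>\<phi>\<close> on the sides. The points
  \<open>t\<^sub>1, \<dots>, t\<^sub>k\<close> are indexed from \<open>0\<close>; the value \<open>0\<close> on non-measurable sets only serves
  uniqueness.\<close>

definition product_measure_of ::
    "('v::real_normed_vector \<Rightarrow> 'v \<Rightarrow> 'v) \<Rightarrow> 'v \<Rightarrow> real set \<Rightarrow> (real set \<Rightarrow> 'v) \<Rightarrow> nat
       \<Rightarrow> (nat \<Rightarrow> real) set \<Rightarrow> 'v" where
  "product_measure_of m e I \<phi> k =
     (THE \<Phi>. vector_measure (power_space I k) \<Phi> \<and>
        (\<forall>E. (\<forall>i<k. E i \<in> sets (borel_on I)) \<longrightarrow>
           \<Phi> (\<Pi>\<^sub>E i\<in>{..<k}. E i) = foldr m (map (\<lambda>i. \<phi> (E i)) [0..<k]) e) \<and>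
        (\<forall>X. X \<notin> sets (power_space I k) \<longrightarrow> \<Phi> X = 0))"

text \<open>The integral of a function with finitely many values.\<close>

definition simple_vintegral ::
    "'t measure \<Rightarrow> ('t set \<Rightarrow> 'v::real_vector) \<Rightarrow> ('t \<Rightarrow> real) \<Rightarrow> 'v" where
  "simple_vintegral M \<Phi> f = (\<Sum>c\<in>f ` space M. c *\<^sub>R \<Phi> {t \<in> space M. f t = c})"

definition time_ordered_exp ::
    "('v::real_normed_vector \<Rightarrow> 'v \<Rightarrow> 'v) \<Rightarrow> 'v \<Rightarrow> real set \<Rightarrow> (real set \<Rightarrow> 'v) \<Rightarrow> 'v" where
  "time_ordered_exp m e I \<phi> =
     e + (\<Sum>k. product_measure_of m e I \<phi> (Suc k)
                {t \<in> space (power_space I (Suc k)). \<forall>i<k. t i \<le> t (Suc i)})"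

definition asc :: "nat \<Rightarrow> (nat \<Rightarrow> real) \<Rightarrow> nat" where
  "asc k t = card {i. Suc i < k \<and> t i < t (Suc i)}"

definition des :: "nat \<Rightarrow> (nat \<Rightarrow> real) \<Rightarrow> nat" where
  "des k t = card {i. Suc i < k \<and> t i > t (Suc i)}"

definition magnus_term ::
    "('v::real_normed_vector \<Rightarrow> 'v \<Rightarrow> 'v) \<Rightarrow> 'v \<Rightarrow> real set \<Rightarrow> (real set \<Rightarrow> 'v) \<Rightarrow> nat \<Rightarrow> 'v" where
  "magnus_term m e I \<phi> k =
     simple_vintegral (power_space I k) (product_measure_of m e I \<phi> k)
       (\<lambda>t. (- 1) ^ des k t * (fact (asc k t) * fact (des k t) / fact k))"

section \<open>Logarithm and M-controlled measures\<close>

definition alg_invertible :: "('v \<Rightarrow> 'v \<Rightarrow> 'v) \<Rightarrow> 'v \<Rightarrow> 'v \<Rightarrow> bool" where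
  "alg_invertible m e x \<longleftrightarrow> (\<exists>y. m x y = e \<and> m y x = e)"

definition alg_inverse :: "('v \<Rightarrow> 'v \<Rightarrow> 'v) \<Rightarrow> 'v \<Rightarrow> 'v \<Rightarrow> 'v" where
  "alg_inverse m e x = (THE y. m x y = e \<and> m y x = e)"

definition log_defined :: "('v::real_vector \<Rightarrow> 'v \<Rightarrow> 'v) \<Rightarrow> 'v \<Rightarrow> 'v \<Rightarrow> bool" where
  "log_defined m e A \<longleftrightarrow> (\<forall>l\<in>{0..1::real}. alg_invertible m e (l *\<^sub>R e + (1 - l) *\<^sub>R A))"

definition alg_log :: "('v::real_normed_vector \<Rightarrow> 'v \<Rightarrow> 'v) \<Rightarrow> 'v \<Rightarrow> 'v \<Rightarrow> 'v" where
  "alg_log m e A =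
     integral {0..1::real} (\<lambda>l. m (A - e) (alg_inverse m e (l *\<^sub>R e + (1 - l) *\<^sub>R A)))"

text \<open>For a complex algebra with scalar multiplication \<open>s\<close>.\<close>

definition M_controlled_complex ::
    "('v::real_normed_vector \<Rightarrow> 'v \<Rightarrow> 'v) \<Rightarrow> 'v \<Rightarrow> (complex \<Rightarrow> 'v \<Rightarrow> 'v) \<Rightarrow>
       real set \<Rightarrow> (real set \<Rightarrow> 'v) \<Rightarrow> bool" where
  "M_controlled_complex m e s I \<phi> \<longleftrightarrow>
     (\<forall>t. cmod t \<le> 1 \<longrightarrow> log_defined m e (time_ordered_exp m e I (\<lambda>E. s t (\<phi> E))))"

text \<open>The complexification of a real algebra \<open>'a\<close> is \<open>'a \<times> 'a\<close>, with \<open>(a, b)\<close> standing for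
  \<open>a + \<i> b\<close>.\<close>

definition cplx_mult :: "'a::real_algebra \<times> 'a \<Rightarrow> 'a \<times> 'a \<Rightarrow> 'a \<times> 'a" where
  "cplx_mult x y = (fst x * fst y - snd x * snd y, fst x * snd y + snd x * fst y)"

definition cplx_scale :: "complex \<Rightarrow> 'a::real_vector \<times> 'a \<Rightarrow> 'a \<times> 'a" where
  "cplx_scale z x =
     (Re z *\<^sub>R fst x - Im z *\<^sub>R snd x, Re z *\<^sub>R snd x + Im z *\<^sub>R fst x)"

definition M_controlled ::
    "real set \<Rightarrow> (real set \<Rightarrow> 'a::{real_normed_algebra, real_algebra_1}) \<Rightarrow> bool" where
  "M_controlled I \<phi> \<longleftrightarrow>
     M_controlled_complex cplx_mult (1, 0) cplx_scale I (\<lambda>E. (\<phi> E, 0))"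

text \<open>\<open>s\<close> makes the real Banach algebra \<open>'a\<close> a complex Banach algebra.\<close>

definition complex_structure ::
    "(complex \<Rightarrow> 'a \<Rightarrow> 'a::{real_normed_algebra, real_algebra_1}) \<Rightarrow> bool" where
  "complex_structure s \<longleftrightarrow>
     vector_space s \<and>
     (\<forall>r a. s (complex_of_real r) a = r *\<^sub>R a) \<and>
     (\<forall>z a b. s z a * b = s z (a * b) \<and> a * s z b = s z (a * b)) \<and>
     (\<forall>z a. norm (s z a) = cmod z * norm a)"

section \<open>The constants\<close>

text \<open>A unital algebra structure with submultiplicative norm \<open>N\<close> on a subspace \<open>V\<close>;
  it is automatically complete when \<open>V\<close> is finite-dimensional.\<close>

definition normed_algebra_on ::
    "'v::real_vector set \<Rightarrow> ('v \<Rightarrow> 'v \<Rightarrow> 'v) \<Rightarrow> 'v \<Rightarrow> ('v \<Rightarrow> real) \<Rightarrow> bool" where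
  "normed_algebra_on V m e N \<longleftrightarrow>
     subspace V \<and> e \<in> V \<and> (\<forall>x\<in>V. \<forall>y\<in>V. m x y \<in> V) \<and>
     (\<forall>x\<in>V. \<forall>y\<in>V. \<forall>z\<in>V. m (x + y) z = m x z + m y z \<and> m z (x + y) = m z x + m z y) \<and>
     (\<forall>x\<in>V. \<forall>y\<in>V. \<forall>r. m (r *\<^sub>R x) y = r *\<^sub>R m x y \<and> m x (r *\<^sub>R y) = r *\<^sub>R m x y) \<and>
     (\<forall>x\<in>V. \<forall>y\<in>V. \<forall>z\<in>V. m (m x y) z = m x (m y z)) \<and>
     (\<forall>x\<in>V. m e x = x \<and> m x e = x) \<and>
     (\<forall>x\<in>V. 0 \<le> N x \<and> (N x = 0 \<longleftrightarrow> x = 0)) \<and>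
     (\<forall>x\<in>V. \<forall>r. N (r *\<^sub>R x) = \<bar>r\<bar> * N x) \<and>
     (\<forall>x\<in>V. \<forall>y\<in>V. N (x + y) \<le> N x + N y \<and> N (m x y) \<le> N x * N y)"

text \<open>For \<open>d > 0\<close>. The space of bounded real sequences only serves as a vector space with
  subspaces \<open>V\<close> of every finite dimension, so that every \<open>d\<close>-dimensional real Banach algebra is
  isometrically isomorphic to some \<open>(V, m, e, N)\<close>. The library's \<open>dim V\<close> is \<open>0\<close> for
  infinite-dimensional \<open>V\<close>.\<close>

definition C_fin :: "nat \<Rightarrow> ereal" where
  "C_fin d = Inf {variation N I \<phi> | (V :: (nat \<Rightarrow>\<^sub>C real) set) m e N I \<phi>.
     normed_algebra_on V m e N \<and> dim V = d \<and>
     ordered_measure N I \<phi> \<and> (\<forall>E\<in>sets (borel_on I). \<phi> E \<in> V) \<and>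
     \<not> summable (\<lambda>k. N (magnus_term m e I \<phi> (Suc k)))}"

definition C_inf :: "real \<Rightarrow> ereal" where
  "C_inf l =
     (if l = 0 \<or> l = 1 then \<infinity>
      else if l = 1/2 then 2
      else ereal (1 / (1 - 2 * l) * ln ((1 - l) / l)))"

definition Lambda :: "nat \<Rightarrow> real" where
  "Lambda d = (THE l. 0 < l \<and> l \<le> 1/2 \<and> C_inf l = C_fin d)"

text \<open>The first bound is a minimum over an open interval; it is attained for \<open>n \<ge> 3\<close>, so
  it coincides with the infimum.\<close>

definition rogers_bounds :: "nat \<Rightarrow> real set" where
  "rogers_bounds n =
     {INF \<eta>\<in>{0<..<1 / real n}. (1 + \<eta>) ^ n * (1 + n * ln (1 / \<eta>)),
      (1 + 1 / (n * ln n)) ^ n * (1 + n * ln (n * ln n)),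
      n * ln n + n * ln (ln n) + 2 * n + 1,
      n * ln n + n * ln (ln n) + 5 * n}"

end

theory Submission
  imports Defs "HOL-Probability.Distribution_Functions" "HOL-Complex_Analysis.Complex_Analysis"
    "Jordan_Normal_Form.Determinant"
begin

text \<open>
  Suppose that \<open>\<lambda> + (1 - \<lambda>) exp\<^sub>R \<phi>\<close> annihilates a vector \<open>v\<close>. Applying to \<open>v\<close> the
  time-ordered exponentials of the final segments of \<open>\<phi>\<close>, parametrized by the cumulative norm, gives a
  curve \<open>y\<close> on \<open>[0, w]\<close> with \<open>\<parallel>y t - y s\<parallel> \<le> \<integral> \<parallel>y\<parallel>\<close> over \<open>[s, t]\<close> and \<open>\<lambda> y w + (1 - \<lambda>) y 0 = 0\<close>.
  Such a curve vanishes if \<open>w < 2\<close>. If \<open>w\<close> exceeds \<open>2\<close> by very little, the curve is almost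
  extremal, so that points on it have almost the largest possible distances; norming functionals of
  such points then show that \<open>d + 1\<close> of them are linearly independent, which is impossible in
  dimension \<open>d\<close>. This excludes every excess below an explicit gap that is polynomial in \<open>1 / d\<close>,
  whereas the excess allowed in the theorem is exponentially small in \<open>n\<close>: no covering argument is
  needed, and of the constants only \<open>\<Lambda> \<le> 1/2\<close> and \<open>\<theta> \<ge> 4\<close> matter.

  In the complexification the same argument applies to \<open>z \<phi>\<close> for all \<open>z\<close> in a disc of radius
  larger than \<open>1\<close>, so that by Cramer's rule the coordinates of the integrand of the logarithm are
  holomorphic there, and Cauchy's inequality makes the Magnus terms decay geometrically. The
  number \<open>\<Lambda>\<close> is well defined because the critical cumulative norm is at least \<open>2\<close>, by the same
  argument, and finite, by an example with triangular \<open>2 \<times> 2\<close> matrices.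
\<close>

section \<open>Finite-dimensional normed spaces\<close>

text \<open>The bound \<open>2\<close> comes from the identity
  \<open>(1 + k) y r = k (y r - y 0) + (y r - y w)\<close>, valid for \<open>y w = - k y 0\<close>,
  at a point \<open>r\<close> where the norm is maximal. For \<open>k = 1\<close> the two increments
  together are at most \<open>w\<close> times the maximum. For \<open>k < 1\<close> the maximum is
  taken relative to an exponential weight that decreases from \<open>1\<close> to \<open>k\<close>;
  the resulting lower bound on \<open>w\<close> exceeds \<open>2\<close> by a multiple of the square
  of \<open>(1 - k) / (1 + k)\<close>, so a small excess forces \<open>k\<close> close to
  \<open>1\<close>. The same identity bounds the integral of the amount by which the norm of
  \<open>y\<close> stays below the weight: this is the meaning of almost extremal.

  The Magnus terms meet the resolvent coefficient by coefficient. Give each ascent the weight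
  \<open>l\<close> and each descent the weight \<open>l - 1\<close>. The integral of the product
  measure against the product of these weights is a Taylor coefficient in \<open>z\<close> of
  \<open>(A - 1) / (l + (1 - l) A)\<close>, where \<open>A\<close> is the exponential of
  \<open>z \<phi>\<close>, and integration over \<open>l\<close> turns the weights, by a Beta
  integral, into those of the Magnus term.\<close>

lemma exists_coordinates:
  fixes B :: "'v::real_vector set"
  assumes "finite B"
  obtains B0 and c :: "'v \<Rightarrow> 'v \<Rightarrow> real" where
    "finite B0" "B0 \<subseteq> span B" "independent B0" "card B0 = dim (span B)"
    "\<And>b. b \<in> B0 \<Longrightarrow> linear (c b)"
    "\<And>x. x \<in> span B \<Longrightarrow> x = (\<Sum>b\<in>B0. c b x *\<^sub>R b)"
    "\<And>b b'. b \<in> B0 \<Longrightarrow> b' \<in> B0 \<Longrightarrow> c b b' = (if b = b' then 1 else 0)"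
proof -
  obtain B0 where B0: "B0 \<subseteq> span B" "independent B0" "span B \<subseteq> span B0" "card B0 = dim (span B)"
    using basis_exists by blast
  have fin: "finite B0"
    using independent_span_bound[OF assms B0(2,1)] by blast
  have "\<exists>g. \<forall>b\<in>B0. linear (g b) \<and> (\<forall>b'\<in>B0. g b b' = (if b = b' then 1 else (0::real)))"
  proof (rule bchoice, rule ballI)
    fix b assume "b \<in> B0"
    show "\<exists>g. linear g \<and> (\<forall>b'\<in>B0. g b' = (if b = b' then 1 else (0::real)))"
      using linear_independent_extend[OF B0(2), of "\<lambda>b'. if b = b' then 1 else (0::real)"] by blast
  qed
  then obtain c where c: "\<And>b. b \<in> B0 \<Longrightarrow> linear (c b)"
      "\<And>b b'. b \<in> B0 \<Longrightarrow> b' \<in> B0 \<Longrightarrow> c b b' = (if b = b' then 1 else (0::real))"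
    by blast
  have "x = (\<Sum>b\<in>B0. c b x *\<^sub>R b)" if x: "x \<in> span B" for x
  proof -
    have "x \<in> span B0" using x B0(3) by blast
    then obtain u where u: "x = (\<Sum>b\<in>B0. u b *\<^sub>R b)"
      using span_finite[OF fin] by auto
    have "c b x = u b" if b: "b \<in> B0" for b
    proof -
      interpret linear "c b" using c(1)[OF b] .
      have "c b x = (\<Sum>b'\<in>B0. u b' * c b b')"
        unfolding u sum by (simp add: scale)
      also have "\<dots> = (\<Sum>b'\<in>B0. if b = b' then u b' else 0)"
        using c(2)[OF b] by (intro sum.cong) auto
      also have "\<dots> = u b" using fin b by simp
      finally show ?thesis .
    qed
    then show ?thesis using u by simp
  qed
  then show ?thesis using that[of B0 c] B0 fin c by blast
qed

text \<open>A norm on \<open>V\<close> that is extended to a seminorm on the whole type, so that its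
  homogeneity and the triangle inequality need no side conditions.\<close>

definition norm_on :: "'v::real_vector set \<Rightarrow> ('v \<Rightarrow> real) \<Rightarrow> bool" where
  "norm_on V N \<longleftrightarrow> subspace V \<and> (\<forall>x y. N (x + y) \<le> N x + N y) \<and>
     (\<forall>r x. N (r *\<^sub>R x) = \<bar>r\<bar> * N x) \<and> (\<forall>x\<in>V. N x = 0 \<longrightarrow> x = 0)"

lemma norm_onD:
  assumes "norm_on V N"
  shows "subspace V" "N (x + y) \<le> N x + N y" "N (r *\<^sub>R x) = \<bar>r\<bar> * N x" "x \<in> V \<Longrightarrow> N x = 0 \<Longrightarrow> x = 0"
    "N 0 = 0" "N (- x) = N x" "N (x - y) \<le> N x + N y" "N (x - y) = N (y - x)" "0 \<le> N x" "N x - N y \<le> N (x - y)"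
    "finite A \<Longrightarrow> N (sum f A) \<le> (\<Sum>a\<in>A. N (f a))"
proof -
  note a = assms[unfolded norm_on_def]
  show "subspace V" "N (x + y) \<le> N x + N y" "x \<in> V \<Longrightarrow> N x = 0 \<Longrightarrow> x = 0" using a by auto
  have h: "N (r *\<^sub>R x) = \<bar>r\<bar> * N x" for r x using a by auto
  have tri: "N (x + y) \<le> N x + N y" for x y using a by auto
  show "N (r *\<^sub>R x) = \<bar>r\<bar> * N x" by (rule h)
  show z: "N 0 = 0" using h[of 0 0] by simp
  have m: "N (- x) = N x" for x using h[of "-1" x] by simp
  show "N (- x) = N x" by (rule m)
  show "N (x - y) \<le> N x + N y" using tri[of x "-y"] m[of y] by simp
  show "N (x - y) = N (y - x)" using m[of "x - y"] by simp
  show "0 \<le> N x" using tri[of x "-x"] m[of x] z by simp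
  show "N x - N y \<le> N (x - y)" using tri[of "x - y" y] by simp
  show "finite A \<Longrightarrow> N (sum f A) \<le> (\<Sum>a\<in>A. N (f a))"
  proof (induction A rule: finite_induct)
    case (insert a A)
    then show ?case using tri[of "f a" "sum f A"] by simp
  qed (simp add: z)
qed

lemma norm_on_subset: "norm_on V N \<Longrightarrow> subspace W \<Longrightarrow> W \<subseteq> V \<Longrightarrow> norm_on W N"
  by (auto simp: norm_on_def)

text \<open>\<open>N\<close> is any norm on the span, unrelated to a topology of the type. In the
  induction step the new vector \<open>b\<close> has positive distance to the old span: otherwise
  vectors approximating \<open>b\<close> have Cauchy coordinates by the induction hypothesis, and
  their limit \<open>z\<close> in the span satisfies \<open>N (b - z) = 0\<close>. The distance then
  bounds the coefficient of \<open>b\<close>.\<close>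

lemma linear_bounded_on_span:
  fixes B :: "'v::real_vector set" and l :: "'v \<Rightarrow> real"
  assumes "finite B" "norm_on (span B) N" "linear l"
  shows "\<exists>C\<ge>0. \<forall>x\<in>span B. \<bar>l x\<bar> \<le> C * N x"
  using assms
proof (induction B arbitrary: l rule: finite_induct)
  case empty
  then show ?case using linear_0 norm_onD(5)[OF empty(1)] by (intro exI[of _ 0]) auto
next
  case (insert b B)
  note n = norm_onD[OF insert.prems(1)]
  have nB: "norm_on (span B) N"
    using norm_on_subset[OF insert.prems(1)] span_mono[of B "insert b B"] by auto
  show ?case
  proof (cases "b \<in> span B")
    case True
    then show ?thesis using insert.IH[OF nB insert.prems(2)] by (simp add: span_redundant)
  next
    case False
    obtain B0 and c :: "'v \<Rightarrow> 'v \<Rightarrow> real" where B0: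
      "finite B0" "B0 \<subseteq> span B"
      "\<And>b. b \<in> B0 \<Longrightarrow> linear (c b)"
      "\<And>x. x \<in> span B \<Longrightarrow> x = (\<Sum>b\<in>B0. c b x *\<^sub>R b)"
      by (rule exists_coordinates[OF insert.hyps(1)]) blast
    have "\<exists>d>0. \<forall>x\<in>span B. d \<le> N (b - x)"
    proof (rule ccontr)
      assume "\<not> ?thesis"
      then have no: "\<not> (0 < d \<and> (\<forall>x\<in>span B. d \<le> N (b - x)))" for d by blast
      have "\<exists>x. x \<in> span B \<and> N (b - x) < 1 / real (Suc n)" for n
        using no[of "1 / real (Suc n)"] by (auto simp: not_le)
      then obtain x where x0: "\<And>n. x n \<in> span B \<and> N (b - x n) < 1 / real (Suc n)"
        using choice[of "\<lambda>n x. x \<in> span B \<and> N (b - x) < 1 / real (Suc n)"] by blast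
      then have x: "\<And>n. x n \<in> span B" "\<And>n. N (b - x n) < 1 / real (Suc n)" by blast+
      have lim: "(\<lambda>n. N (b - x n)) \<longlonglongrightarrow> 0"
      proof (rule tendsto_sandwich[OF _ _ tendsto_const])
        show "(\<lambda>n. 1 / real (Suc n)) \<longlonglongrightarrow> 0" using LIMSEQ_inverse_real_of_nat by (simp add: inverse_eq_divide)
        show "\<forall>\<^sub>F n in sequentially. 0 \<le> N (b - x n)" using n(9) by simp
        show "\<forall>\<^sub>F n in sequentially. N (b - x n) \<le> 1 / real (Suc n)" using x(2) less_imp_le by (intro always_eventually) blast
      qed
      have "\<exists>a. (\<lambda>n. c b' (x n)) \<longlonglongrightarrow> a" if b': "b' \<in> B0" for b'
      proof -
        interpret cl: linear "c b'" using B0(3)[OF b'] .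
        obtain C where C: "C \<ge> 0" "\<And>y. y \<in> span B \<Longrightarrow> \<bar>c b' y\<bar> \<le> C * N y"
          using insert.IH[OF nB B0(3)[OF b']] by blast
        have "Cauchy (\<lambda>n. c b' (x n))"
        proof (rule metric_CauchyI)
          fix e :: real assume e: "e > 0"
          have "\<forall>\<^sub>F n in sequentially. N (b - x n) < e / (2 * (C + 1))"
            using lim by (rule order_tendstoD(2)) (use e C in simp)
          then obtain M where M: "\<And>n. n \<ge> M \<Longrightarrow> N (b - x n) < e / (2 * (C + 1))"
            by (auto simp: eventually_sequentially)
          have "dist (c b' (x i)) (c b' (x j)) < e" if "i \<ge> M" "j \<ge> M" for i j
          proof -
            have "N (x i - x j) \<le> N (b - x i) + N (b - x j)"
              using n(7)[of "b - x j" "b - x i"] by simp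
            also have "\<dots> < e / (2 * (C + 1)) + e / (2 * (C + 1))"
              using M[OF that(1)] M[OF that(2)] by simp
            also have "\<dots> = e / (C + 1)" using C(1) by (simp add: divide_simps)
            finally have "N (x i - x j) < e / (C + 1)" .
            then have "(C + 1) * N (x i - x j) < e" using C by (simp add: field_simps)
            moreover have "\<bar>c b' (x i - x j)\<bar> \<le> C * N (x i - x j)"
              using C(2) x(1) span_diff by blast
            moreover have "0 \<le> N (x i - x j)" by (rule n(9))
            ultimately show ?thesis
              by (simp add: dist_real_def cl.diff algebra_simps)
          qed
          then show "\<exists>M. \<forall>m\<ge>M. \<forall>n\<ge>M. dist (c b' (x m)) (c b' (x n)) < e" by blast
        qed
        then show ?thesis using Cauchy_convergent convergent_def by blast
      qed
      then obtain a where a: "\<And>b'. b' \<in> B0 \<Longrightarrow> (\<lambda>n. c b' (x n)) \<longlonglongrightarrow> a b'"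
        using bchoice[of B0 "\<lambda>b' a. (\<lambda>n. c b' (x n)) \<longlonglongrightarrow> a"] by blast
      define z where "z = (\<Sum>b'\<in>B0. a b' *\<^sub>R b')"
      have zs: "z \<in> span B" unfolding z_def using B0(2) by (intro span_sum span_scale) auto
      have "N (b - z) \<le> N (b - x n) + (\<Sum>b'\<in>B0. \<bar>c b' (x n) - a b'\<bar> * N b')" for n
      proof -
        have "x n - z = (\<Sum>b'\<in>B0. (c b' (x n) - a b') *\<^sub>R b')"
          unfolding z_def using B0(4)[OF x(1)[of n]] by (simp add: scaleR_left_diff_distrib sum_subtractf)
        then have "N (x n - z) \<le> (\<Sum>b'\<in>B0. \<bar>c b' (x n) - a b'\<bar> * N b')"
          using n(11)[OF B0(1), of "\<lambda>b'. (c b' (x n) - a b') *\<^sub>R b'"] n(3) by simp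
        then show ?thesis using n(2)[of "b - x n" "x n - z"] by simp
      qed
      moreover have "(\<lambda>n. N (b - x n) + (\<Sum>b'\<in>B0. \<bar>c b' (x n) - a b'\<bar> * N b')) \<longlonglongrightarrow> 0 + (\<Sum>b'\<in>B0. \<bar>a b' - a b'\<bar> * N b')"
        by (intro tendsto_intros lim a)
      ultimately have "N (b - z) \<le> 0"
        by (intro LIMSEQ_le_const[where X="\<lambda>n. N (b - x n) + (\<Sum>b'\<in>B0. \<bar>c b' (x n) - a b'\<bar> * N b')"]) auto
      then have "N (b - z) = 0" using n(9)[of "b - z"] by simp
      moreover have "b - z \<in> span (insert b B)"
        using zs span_mono[of B "insert b B"] by (intro span_diff) (auto simp: span_base)
      ultimately have "b = z" using n(4)[of "b - z"] by simp
      then show False using zs False by simp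
    qed
    then obtain d where d: "d > 0" "\<And>x. x \<in> span B \<Longrightarrow> d \<le> N (b - x)" by blast
    obtain C where C: "C \<ge> 0" "\<And>y. y \<in> span B \<Longrightarrow> \<bar>l y\<bar> \<le> C * N y"
      using insert.IH[OF nB insert.prems(2)] by blast
    interpret ll: linear l using insert.prems(2) .
    have "\<bar>l y\<bar> \<le> (\<bar>l b\<bar> / d + C * (1 + N b / d)) * N y" if yi: "y \<in> span (insert b B)" for y
    proof -
      obtain t where t: "y - t *\<^sub>R b \<in> span B" using yi span_breakdown_eq[of y b B] by blast
      define x where "x = y - t *\<^sub>R b"
      have y: "y = t *\<^sub>R b + x" by (simp add: x_def)
      have td: "\<bar>t\<bar> * d \<le> N y"
      proof (cases "t = 0")
        case False
        have "(-1/t) *\<^sub>R x \<in> span B" using t span_scale unfolding x_def by blast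
        then have "d \<le> N (b - (-1/t) *\<^sub>R x)" using d(2) by blast
        then have "\<bar>t\<bar> * d \<le> \<bar>t\<bar> * N (b - (-1/t) *\<^sub>R x)" by (simp add: mult_left_mono)
        also have "\<dots> = N (t *\<^sub>R (b - (-1/t) *\<^sub>R x))" by (simp add: n(3))
        also have "t *\<^sub>R (b - (-1/t) *\<^sub>R x) = y" using False by (simp add: y scaleR_diff_right scaleR_add_right)
        finally show ?thesis .
      qed (simp add: n(9))
      then have t': "\<bar>t\<bar> \<le> N y / d" using d(1) by (simp add: field_simps)
      have nx: "N x \<le> N y + \<bar>t\<bar> * N b" unfolding x_def using n(7)[of y "t *\<^sub>R b"] n(3) by simp
      have "\<bar>l y\<bar> \<le> \<bar>t\<bar> * \<bar>l b\<bar> + \<bar>l x\<bar>"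
        unfolding y ll.add ll.scale by (metis abs_mult abs_triangle_ineq real_scaleR_def)
      also have "\<bar>l x\<bar> \<le> C * N x" using C(2) t x_def by blast
      also have "C * N x \<le> C * (N y + N y / d * N b)"
        using nx mult_right_mono[OF t' n(9)[of b]] C(1) by (intro mult_left_mono) auto
      also have "\<bar>t\<bar> * \<bar>l b\<bar> \<le> N y / d * \<bar>l b\<bar>" using t' by (intro mult_right_mono) auto
      finally show ?thesis by (simp add: field_simps)
    qed
    moreover have "\<bar>l b\<bar> / d + C * (1 + N b / d) \<ge> 0" using d C n(9)[of b] by simp
    ultimately show ?thesis by blast
  qed
qed

text \<open>The extension by one dimension at a time; finiteness of \<open>S\<close> takes the place
  of Zorn's lemma. The value \<open>s\<close> at the new vector \<open>b\<close> must lie between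
  all \<open>l x - N (x - b)\<close> and all \<open>N (y + b) - l y\<close>; the supremum of the
  former is taken.\<close>

lemma hahn_banach_finite:
  fixes S :: "'v::real_vector set"
  assumes "finite S" "norm_on (span (insert x0 S)) N"
  shows "\<exists>l. linear l \<and> l x0 = N x0 \<and> (\<forall>x\<in>span (insert x0 S). l x \<le> N x)"
  using assms
proof (induction S rule: finite_induct)
  case empty
  note n = norm_onD[OF empty(1)]
  show ?case
  proof (cases "x0 = 0")
    case True
    then show ?thesis using n(5) by (intro exI[of _ "\<lambda>_. 0"]) (auto simp: linear_zero)
  next
    case False
    then have "independent {x0}" by simp
    then obtain g :: "'v \<Rightarrow> real" where g: "linear g" "g x0 = N x0"
      using linear_independent_extend[of "{x0}" "\<lambda>_. N x0"] by auto
    have "g x \<le> N x" if "x \<in> span {x0}" for x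
    proof -
      obtain k where "x = k *\<^sub>R x0" using \<open>x \<in> span {x0}\<close> by (auto simp: span_singleton)
      then have "g x = k * N x0" "N x = \<bar>k\<bar> * N x0" using g linear_scale[OF g(1)] n(3) by auto
      then show ?thesis using n(9)[of x0] by (simp add: mult_right_mono)
    qed
    then show ?thesis using g by blast
  qed
next
  case (insert b S)
  note n = norm_onD[OF insert.prems(1)]
  let ?W = "span (insert x0 S)"
  have eq: "insert x0 (insert b S) = insert b (insert x0 S)" by auto
  have nW: "norm_on ?W N"
    by (rule norm_on_subset[OF insert.prems(1)]) (simp, rule span_mono, blast)
  obtain l where l: "linear l" "l x0 = N x0" "\<And>x. x \<in> ?W \<Longrightarrow> l x \<le> N x"
    using insert.IH[OF nW] by blast
  show ?case
  proof (cases "b \<in> ?W")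
    case True
    then show ?thesis using l unfolding eq by (metis span_redundant)
  next
    case False
    obtain T where T: "T \<subseteq> ?W" "independent T" "?W \<subseteq> span T" "card T = dim ?W"
      using basis_exists by blast
    have sT: "span T = ?W" using T by (metis span_span span_mono subset_antisym)
    then have "independent (insert b T)" using False T(2) by (simp add: independent_insertI)
    \<comment> \<open>\<open>g\<close> reads off the coefficient of \<open>b\<close> and vanishes on
      \<open>?W\<close>. Adding a multiple of it corrects the value of \<open>l\<close> at
      \<open>b\<close> and keeps the functional linear on the whole type.\<close>
    then obtain g :: "'v \<Rightarrow> real" where g0: "linear g" "\<forall>x\<in>insert b T. g x = (if x = b then 1 else 0)"
      using linear_independent_extend[of "insert b T" "\<lambda>x. if x = b then 1 else 0"] by metis
    have bT: "b \<notin> T" using False sT span_base by blast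
    have gW: "g x = 0" if "x \<in> ?W" for x
    proof (rule linear_eq_0_on_span[OF g0(1)])
      show "\<And>x. x \<in> T \<Longrightarrow> g x = 0" using g0(2) bT by auto
      show "x \<in> span T" using that sT by simp
    qed
    have gb: "g b = 1" using g0(2) by simp
    interpret ll: linear l using l(1) .
    define A where "A = (\<lambda>x. l x - N (x - b)) ` ?W"
    have ub: "l x - N (x - b) \<le> N (y + b) - l y" if "x \<in> ?W" "y \<in> ?W" for x y
    proof -
      have "l x + l y = l (x + y)" by (simp add: ll.add)
      also have "\<dots> \<le> N (x + y)" using l(3) that span_add by blast
      also have "\<dots> \<le> N (x - b) + N (y + b)" using n(2)[of "x - b" "y + b"] by simp
      finally show ?thesis by simp
    qed
    have bdd: "bdd_above A" unfolding A_def using ub[OF _ span_zero] by (intro bdd_aboveI2) blast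
    have ne: "A \<noteq> {}" unfolding A_def using span_zero by blast
    define s where "s = Sup A"
    have s1: "l x - N (x - b) \<le> s" if "x \<in> ?W" for x
      unfolding s_def using bdd that by (intro cSup_upper) (auto simp: A_def)
    have s2: "s \<le> N (y + b) - l y" if "y \<in> ?W" for y
      unfolding s_def using ne ub that by (intro cSup_least) (auto simp: A_def)
    define l' where "l' = (\<lambda>x. l x + (s - l b) * g x)"
    have lin: "linear l'" unfolding l'_def
      by (intro linear_compose_add l(1) linear_compose[OF g0(1), unfolded o_def]) (simp add: linear_iff algebra_simps)
    have "l' x \<le> N x" if xi: "x \<in> span (insert b (insert x0 S))" for x
    proof -
      obtain t where t: "x - t *\<^sub>R b \<in> ?W" using xi span_breakdown_eq[of x b "insert x0 S"] by blast
      define y where "y = x - t *\<^sub>R b"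
      have x: "x = y + t *\<^sub>R b" by (simp add: y_def)
      have yW: "y \<in> ?W" using t y_def by simp
      interpret gl: linear g using g0(1) .
      have "l' x = l y + t * s" unfolding l'_def x
        by (simp add: ll.add ll.scale gl.add gl.scale gW[OF yW] gb algebra_simps)
      moreover have "l y + t * s \<le> N x"
      proof -
        consider "t = 0" | "t > 0" | "t < 0" by linarith
        then show ?thesis
        proof cases
          case 1
          then show ?thesis using l(3)[OF yW] x by simp
        next
          case 2
          have "s \<le> N ((1/t) *\<^sub>R y + b) - l ((1/t) *\<^sub>R y)" using s2 span_scale[OF yW] by blast
          then have "t * s \<le> t * (N ((1/t) *\<^sub>R y + b) - l ((1/t) *\<^sub>R y))" using 2 by simp
          also have "\<dots> = N (t *\<^sub>R ((1/t) *\<^sub>R y + b)) - l y"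
            using 2 by (simp only: n(3) ll.scale right_diff_distrib) simp
          also have "t *\<^sub>R ((1/t) *\<^sub>R y + b) = x" using 2 by (simp add: x scaleR_add_right)
          finally show ?thesis by simp
        next
          case 3
          have "l ((-1/t) *\<^sub>R y) - N ((-1/t) *\<^sub>R y - b) \<le> s" using s1 span_scale[OF yW] by blast
          then have "(-t) * (l ((-1/t) *\<^sub>R y) - N ((-1/t) *\<^sub>R y - b)) \<le> (-t) * s" using 3 by (intro mult_left_mono) auto
          moreover have "(-t) * l ((-1/t) *\<^sub>R y) = l y" using 3 by (simp only: ll.scale) simp
          moreover have "(-t) * N ((-1/t) *\<^sub>R y - b) = N ((-t) *\<^sub>R ((-1/t) *\<^sub>R y - b))"
            using 3 by (simp only: n(3))
          moreover have "(-t) *\<^sub>R ((-1/t) *\<^sub>R y - b) = x" using 3 by (simp add: x scaleR_diff_right scaleR_add_right)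
          ultimately show ?thesis by (simp add: right_diff_distrib)
        qed
      qed
      ultimately show ?thesis by simp
    qed
    moreover have "l' x0 = N x0" unfolding l'_def using gW[of x0] l(2) by (simp add: span_base)
    ultimately show ?thesis using lin unfolding eq by blast
  qed
qed

lemma norming_functional:
  fixes B :: "'v::real_vector set"
  assumes "finite B" "norm_on (span B) N" "x0 \<in> span B"
  obtains l where "linear l" "l x0 = N x0" "\<And>x. x \<in> span B \<Longrightarrow> l x \<le> N x" "\<And>x. x \<in> span B \<Longrightarrow> \<bar>l x\<bar> \<le> N x"
proof -
  have eq: "span (insert x0 B) = span B" by (rule span_redundant[OF assms(3)])
  obtain l where l: "linear l" "l x0 = N x0" "\<And>x. x \<in> span B \<Longrightarrow> l x \<le> N x"
    using hahn_banach_finite[of B x0 N] assms eq by auto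
  have "\<bar>l x\<bar> \<le> N x" if x: "x \<in> span B" for x
  proof -
    have "l (- x) \<le> N (- x)" using l(3) span_neg[OF x] by blast
    then show ?thesis using l(3)[OF x] linear_neg[OF l(1)] norm_onD(6)[OF assms(2)] by auto
  qed
  then show ?thesis using that l by blast
qed

text \<open>Stated for a family because the points of a curve may coincide; a repeated value gives
  the coefficients \<open>1\<close> and \<open>-1\<close>.\<close>

lemma family_dependent:
  fixes y :: "'i \<Rightarrow> 'v::real_vector"
  assumes "finite J" "finite B" "\<And>j. j \<in> J \<Longrightarrow> y j \<in> span B" "card B < card J"
  obtains a where "\<exists>j\<in>J. a j \<noteq> 0" "(\<Sum>j\<in>J. a j *\<^sub>R y j) = 0"
proof (cases "inj_on y J")
  case True
  have "\<not> independent (y ` J)"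
    using independent_span_bound[OF assms(2), of "y ` J"] assms(3,4) card_image[OF True] by force
  then obtain u where u: "\<exists>v\<in>y ` J. u v \<noteq> 0" "(\<Sum>v\<in>y ` J. u v *\<^sub>R v) = 0"
    using dependent_finite[of "y ` J"] assms(1) by blast
  show ?thesis
  proof (rule that[of "\<lambda>j. u (y j)"])
    show "(\<Sum>j\<in>J. u (y j) *\<^sub>R y j) = 0" using u(2) sum.reindex[OF True, of "\<lambda>v. u v *\<^sub>R v"] by simp
  qed (use u(1) in auto)
next
  case False
  then obtain i k where ik: "i \<in> J" "k \<in> J" "i \<noteq> k" "y i = y k" by (auto simp: inj_on_def)
  show ?thesis
  proof (rule that[of "\<lambda>j. if j = i then 1 else if j = k then -1 else 0"])
    have "(\<Sum>j\<in>J. (if j = i then 1 else if j = k then -1 else 0) *\<^sub>R y j)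
        = (\<Sum>j\<in>{i,k}. (if j = i then 1 else if j = k then -1 else 0) *\<^sub>R y j)"
      by (rule sum.mono_neutral_right) (use ik assms(1) in auto)
    then show "(\<Sum>j\<in>J. (if j = i then 1 else if j = k then -1 else 0) *\<^sub>R y j) = 0" using ik by simp
  qed (use ik in auto)
qed

section \<open>Short curves with opposite ends\<close>

text \<open>The first two terms of the series of \<open>2 artanh z\<close>. The cubic term is the
  gain that later confines \<open>k\<close> to a neighbourhood of \<open>1\<close>.\<close>

lemma ln_quotient_lower_bound:
  fixes z :: real
  assumes "0 \<le> z" "z < 1"
  shows "2 * z + 2 * z ^ 3 / 3 \<le> ln ((1 + z) / (1 - z))"
proof -
  define f where "f = (\<lambda>z::real. ln (1 + z) - ln (1 - z) - 2 * z - 2 * z ^ 3 / 3)"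
  have "f 0 \<le> f z"
  proof (rule DERIV_nonneg_imp_nondecreasing[OF assms(1)])
    fix x assume x: "0 \<le> x" "x \<le> z"
    have x1: "x < 1" using x assms by simp
    have "(f has_real_derivative (1 / (1 + x) + 1 / (1 - x) - 2 - 2 * x ^ 2)) (at x)"
      unfolding f_def by (rule derivative_eq_intros refl | use x x1 in simp)+
    moreover have "1 / (1 + x) + 1 / (1 - x) - 2 - 2 * x ^ 2 \<ge> 0"
    proof -
      have "(2 + 2 * x\<^sup>2) * ((1 + x) * (1 - x)) = 2 - 2 * x ^ 4"
        by (simp add: algebra_simps eval_nat_numeral)
      also have "\<dots> \<le> 2" by simp
      finally have "2 + 2 * x\<^sup>2 \<le> 2 / ((1 + x) * (1 - x))" using x x1 by (simp add: pos_le_divide_eq)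
      moreover have "1 / (1 + x) + 1 / (1 - x) = 2 / ((1 + x) * (1 - x))" using x x1 by (simp add: add_frac_eq)
      ultimately show ?thesis by simp
    qed
    ultimately show "\<exists>y. (f has_real_derivative y) (at x) \<and> 0 \<le> y" by metis
  qed
  then show ?thesis using assms by (simp add: f_def ln_div)
qed

text \<open>The weight is \<open>p r = k powr (r / w)\<close> and \<tau> is its primitive. An
  exponential is affine in its primitive, so \<open>k * \<tau> r + (T - \<tau> r) = T * p r\<close>:
  the estimate at a maximum does not depend on where the maximum lies. The last claim is the
  logarithm bound for \<open>z = (1 - k) / (1 + k)\<close>, where
  \<open>(1 + z) / (1 - z) = 1 / k\<close>.\<close>

lemma exponential_weight:
  fixes k w :: real
  assumes k: "0 < k" "k \<le> 1" and w: "0 < w"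
  obtains p \<tau> :: "real \<Rightarrow> real" and T where
    "continuous_on {0..w} p" "\<And>r. r \<in> {0..w} \<Longrightarrow> k \<le> p r \<and> p r \<le> 1"
    "\<And>s t. s \<le> t \<Longrightarrow> (p has_integral (\<tau> t - \<tau> s)) {s..t}"
    "\<tau> 0 = 0" "\<tau> w = T" "\<And>r. (1 - k) * \<tau> r = T * (1 - p r)" "0 < T"
    "T * (1 + ((1 - k) / (1 + k)) ^ 2 / 3) \<le> w * (1 + k) / 2"
proof (cases "k = 1")
  case True
  have "((\<lambda>_. 1) has_integral (t - s)) {s..t}" if "s \<le> t" for s t :: real
    using has_integral_const_real[of "1::real" s t] that by simp
  then show ?thesis
    by (intro that[of "\<lambda>_. 1" "\<lambda>r. r" w]) (use True w in auto)
next
  case False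
  then have k1: "k < 1" using k by simp
  define L where "L = - ln k"
  have L: "L > 0" unfolding L_def using k k1 by simp
  define c where "c = L / w"
  have c: "c > 0" using L w by (simp add: c_def)
  define p where "p = (\<lambda>r. exp (- c * r))"
  define \<tau> where "\<tau> = (\<lambda>r. (1 - p r) / c)"
  have pw: "p w = k" unfolding p_def c_def L_def using w k by simp
  define z where "z = (1 - k) / (1 + k)"
  have z: "0 \<le> z" "z < 1" using k k1 by (auto simp: z_def field_simps)
  have "k * (1 + z) = 1 - z" using k by (simp add: z_def field_simps)
  then have "(1 + z) / (1 - z) = 1 / k" using k z by (simp add: frac_eq_eq mult.commute)
  then have "2 * z + 2 * z ^ 3 / 3 \<le> L"
    using ln_quotient_lower_bound[OF z] k by (simp add: L_def ln_div)
  then have Lz: "2 * z * (1 + z\<^sup>2 / 3) \<le> L" by (simp add: algebra_simps power2_eq_square power3_eq_cube)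
  show ?thesis
  proof (rule that[of p \<tau> "(1 - k) / c"])
    show "continuous_on {0..w} p" unfolding p_def by (intro continuous_intros)
    show "k \<le> p r \<and> p r \<le> 1" if "r \<in> {0..w}" for r
    proof -
      have "exp (- c * w) \<le> exp (- c * r)" using that c by simp
      moreover have "exp (- c * r) \<le> 1" using that c by simp
      ultimately show ?thesis using pw unfolding p_def by linarith
    qed
    show "(p has_integral (\<tau> t - \<tau> s)) {s..t}" if "s \<le> t" for s t
    proof (rule fundamental_theorem_of_calculus[OF that])
      fix x assume "x \<in> {s..t}"
      have "(\<tau> has_real_derivative p x) (at x within {s..t})"
        unfolding \<tau>_def p_def by (rule derivative_eq_intros refl | use c in simp)+
      then show "(\<tau> has_vector_derivative p x) (at x within {s..t})"
        by (simp add: has_real_derivative_iff_has_vector_derivative)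
    qed
    show "\<tau> 0 = 0" by (simp add: \<tau>_def p_def)
    show "\<tau> w = (1 - k) / c" by (simp add: \<tau>_def pw)
    show "(1 - k) * \<tau> r = (1 - k) / c * (1 - p r)" for r by (simp add: \<tau>_def)
    show "0 < (1 - k) / c" using c k1 by simp
    have zk: "1 - k = (1 + k) * z" using k by (simp add: z_def)
    have "(1 - k) / c * (1 + z ^ 2 / 3) = w * ((1 - k) * (1 + z\<^sup>2 / 3)) / L"
      by (simp add: c_def)
    also have "(1 - k) * (1 + z\<^sup>2 / 3) = (1 + k) / 2 * (2 * z * (1 + z\<^sup>2 / 3))"
      unfolding zk by simp
    also have "w * \<dots> / L \<le> w * ((1 + k) / 2 * L) / L"
      using Lz w k L by (intro divide_right_mono mult_left_mono) auto
    also have "\<dots> = w * (1 + k) / 2" using L by simp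
    finally show "(1 - k) / c * (1 + ((1 - k) / (1 + k))\<^sup>2 / 3) \<le> w * (1 + k) / 2" by (simp add: z_def)
  qed
qed

text \<open>The factors stand for the \<open>d + 1\<close> dependent vectors, the spacing of order
  \<open>1 / (d + 3)\<close> of the sample points and an error of order \<open>d + 4\<close> times
  the excess. With the factor \<open>3\<close> the last inequality of the argument becomes
  \<open>729 < 2000 / 3\<close>, which is false.\<close>

definition girth_gap :: "nat \<Rightarrow> real" where
  "girth_gap d = 1 / (3 * (real d + 1) * (real d + 3) * (real d + 4))"

text \<open>As a function of \<open>\<tau> i\<close> the kernel is affine except for a corner at
  \<open>\<tau> j\<close>. A divided second difference kills affine parts, and the corner
  contributes the jump \<open>2\<close> of the slope exactly when \<open>i = j\<close>.\<close>

lemma second_difference_tent: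
  fixes p \<tau> :: "nat \<Rightarrow> real"
  assumes aff: "\<And>i. p i = 1 - c * \<tau> i" and mono: "\<And>i j. i < j \<Longrightarrow> \<tau> i < \<tau> j" and "0 < i"
  defines "K \<equiv> \<lambda>i j. p i - \<bar>\<tau> j - \<tau> i\<bar>"
  shows "(K i j - K (i - 1) j) / (\<tau> i - \<tau> (i - 1)) + (K i j - K (Suc i) j) / (\<tau> (Suc i) - \<tau> i)
     = (if j = i then 2 else 0)"
proof -
  define h1 where "h1 = \<tau> i - \<tau> (i - 1)"
  define h2 where "h2 = \<tau> (Suc i) - \<tau> i"
  have h: "h1 > 0" "h2 > 0" using mono[of "i - 1" i] mono[of i "Suc i"] assms(3) by (auto simp: h1_def h2_def)
  have p1: "p i - p (i - 1) = - c * h1" "p i - p (Suc i) = c * h2" unfolding aff h1_def h2_def by (auto simp: algebra_simps)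
  consider "j < i" | "j = i" | "i < j" by linarith
  then show ?thesis
  proof cases
    case 1
    then have "j \<le> i - 1" by simp
    then have "\<tau> j \<le> \<tau> (i - 1)" using mono less_imp_le by (metis le_neq_implies_less order_refl)
    then have "K i j - K (i - 1) j = (- c - 1) * h1" "K i j - K (Suc i) j = (c + 1) * h2"
      using p1 h unfolding K_def h1_def h2_def by (auto simp: algebra_simps)
    then show ?thesis using h 1 unfolding h1_def[symmetric] h2_def[symmetric] by simp
  next
    case 2
    then have "K i j - K (i - 1) j = (- c + 1) * h1" "K i j - K (Suc i) j = (c + 1) * h2"
      using p1 h unfolding K_def h1_def h2_def by (auto simp: algebra_simps)
    then show ?thesis using h 2 unfolding h1_def[symmetric] h2_def[symmetric] by simp
  next
    case 3
    then have "Suc i \<le> j" by simp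
    then have "\<tau> (Suc i) \<le> \<tau> j" using mono less_imp_le by (metis le_neq_implies_less order_refl)
    then have "K i j - K (i - 1) j = (- c + 1) * h1" "K i j - K (Suc i) j = (c - 1) * h2"
      using p1 h unfolding K_def h1_def h2_def by (auto simp: algebra_simps)
    then show ?thesis using h 3 unfolding h1_def[symmetric] h2_def[symmetric] by simp
  qed
qed

text \<open>The curve \<open>y\<close> stays below \<open>p\<close>, with contact at \<open>r0\<close>. If \<open>w\<close> is close to \<open>2\<close> then the
  functional norming \<open>y (r i)\<close> takes nearly the value \<open>p (r i) - \<bar>\<tau> (r j) - \<tau> (r i)\<bar>\<close> at
  \<open>y (r j)\<close>. This tent-shaped kernel has a nonsingular second difference, so the vectors
  \<open>y (r j)\<close> are independent, which is impossible for more than \<open>d\<close> of them.\<close>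

lemma antiperiodic_curve_aux:
  fixes y :: "real \<Rightarrow> 'v::real_vector"
  assumes B: "finite B" "card B \<le> d" "6 \<le> d" and N: "norm_on (span B) N"
    and k: "0 < k" "k \<le> 1" and w: "0 < w" "w < 2 + girth_gap d"
    and yV: "\<And>r. r \<in> {0..w} \<Longrightarrow> y r \<in> span B"
    and cont: "continuous_on {0..w} (\<lambda>r. N (y r))"
    and lip: "\<And>s t. 0 \<le> s \<Longrightarrow> s \<le> t \<Longrightarrow> t \<le> w \<Longrightarrow> N (y t - y s) \<le> integral {s..t} (\<lambda>r. N (y r))"
    and anti: "y w = - k *\<^sub>R y 0"
    and p: "continuous_on {0..w} p" "\<And>r. r \<in> {0..w} \<Longrightarrow> k \<le> p r \<and> p r \<le> 1"
    and pint: "\<And>s t. s \<le> t \<Longrightarrow> (p has_integral (\<tau> t - \<tau> s)) {s..t}"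
    and \<tau>: "\<tau> 0 = 0" "\<tau> w = T" "\<And>r. (1 - k) * \<tau> r = T * (1 - p r)" "0 < T"
      "T * (1 + ((1 - k) / (1 + k)) ^ 2 / 3) \<le> w * (1 + k) / 2"
    and le: "\<And>r. r \<in> {0..w} \<Longrightarrow> N (y r) \<le> p r" and rm: "rm \<in> {0..w}" "N (y rm) = p rm"
  shows False
proof -
  note n = norm_onD[OF N]
  \<comment> \<open>The deficit of the curve below its weight. Its integral \<open>J s t\<close>
    improves the bound on the increment from \<open>s\<close> to \<open>t\<close> by the same
    amount.\<close>
  define q where "q = (\<lambda>r. p r - N (y r))"
  have q0: "0 \<le> q r" if "r \<in> {0..w}" for r using le[OF that] by (simp add: q_def)
  have qc: "continuous_on {0..w} q" unfolding q_def by (intro continuous_intros p cont)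
  have qi: "q integrable_on {s..t}" if "0 \<le> s" "t \<le> w" for s t
    by (rule integrable_continuous_interval, rule continuous_on_subset[OF qc]) (use that in auto)
  define J where "J = (\<lambda>s t. integral {s..t} q)"
  have J0: "0 \<le> J s t" if "0 \<le> s" "t \<le> w" for s t
    unfolding J_def by (rule integral_nonneg[OF qi]) (use that q0 in auto)
  have Jmono: "J s t \<le> J 0 w" if "0 \<le> s" "t \<le> w" for s t
    unfolding J_def by (rule integral_subset_le) (use that q0 qi in auto)
  have lip1: "N (y t - y s) \<le> \<tau> t - \<tau> s - J s t" if "0 \<le> s" "s \<le> t" "t \<le> w" for s t
  proof -
    have "integral {s..t} (\<lambda>r. N (y r)) = integral {s..t} (\<lambda>r. p r - q r)" by (simp add: q_def)
    also have "\<dots> = integral {s..t} p - integral {s..t} q"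
      using pint[OF that(2)] qi[OF that(1,3)] by (intro integral_diff) auto
    also have "\<dots> = \<tau> t - \<tau> s - J s t" using pint[OF that(2)] by (simp add: J_def integral_unique)
    finally show ?thesis using lip[OF that] by simp
  qed
  have lip2: "N (y t - y s) \<le> \<tau> t - \<tau> s" if "0 \<le> s" "s \<le> t" "t \<le> w" for s t
    using lip1[OF that] J0[of s t] that by simp
  \<comment> \<open>The excess of \<open>T\<close>. The identity at the contact point
    \<open>rm\<close> yields \<open>k * J 0 w \<le> p rm * S\<close>: hence \<open>S\<close> is
    nonnegative and pays for the whole deficit.\<close>
  define S where "S = T - (1 + k)"
  have main: "(1 + k) * p rm \<le> k * (\<tau> rm - J 0 rm) + (T - \<tau> rm - J rm w)"
  proof -
    have "(1 + k) *\<^sub>R y rm = k *\<^sub>R (y rm - y 0) + (y rm - y w)"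
      unfolding anti by (simp add: algebra_simps)
    then have "N ((1 + k) *\<^sub>R y rm) \<le> N (k *\<^sub>R (y rm - y 0)) + N (y rm - y w)" using n(2) by simp
    also have "N (y rm - y w) = N (y w - y rm)" by (rule n(8))
    finally have "(1 + k) * p rm \<le> k * N (y rm - y 0) + N (y w - y rm)"
      using k rm(2) by (simp add: n(3))
    moreover have "k * N (y rm - y 0) \<le> k * (\<tau> rm - J 0 rm)"
      using lip1[of 0 rm] rm(1) \<tau>(1) k by (intro mult_left_mono) auto
    moreover have "N (y w - y rm) \<le> T - \<tau> rm - J rm w" using lip1[of rm w] rm(1) \<tau>(2) by auto
    ultimately show ?thesis by simp
  qed
  have Jadd: "J 0 rm + J rm w = J 0 w"
    unfolding J_def using rm(1) qi by (intro Henstock_Kurzweil_Integration.integral_combine) auto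
  have kJ: "k * J rm w \<le> J rm w" using k J0[of rm w] rm(1) by (simp add: mult_left_le_one_le)
  have kJw: "k * J 0 w \<le> p rm * S"
  proof -
    have "k * J 0 w = k * J 0 rm + k * J rm w" using Jadd by (simp add: distrib_left flip: Jadd)
    moreover have "T * p rm = T - (1 - k) * \<tau> rm" using \<tau>(3)[of rm] by (simp add: algebra_simps)
    ultimately show ?thesis using main kJ unfolding S_def by (simp add: algebra_simps)
  qed
  have p0: "0 < p rm" "p rm \<le> 1" using p(2)[OF rm(1)] k by auto
  have "0 \<le> k * J 0 w" using J0[of 0 w] k by (intro mult_nonneg_nonneg) auto
  then have "0 \<le> p rm * S" using kJw by linarith
  then have S0: "0 \<le> S" using p0(1) by (simp add: zero_le_mult_iff)
  have kJS: "J 0 w \<le> S / k"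
  proof -
    have "p rm * S \<le> S" using p0(2) S0 by (simp add: mult_left_le_one_le p0 less_imp_le)
    then show ?thesis using kJw k by (simp add: field_simps)
  qed
  define z where "z = (1 - k) / (1 + k)"
  have T1: "1 + k \<le> T" using S0 by (simp add: S_def)
  have "(1 + k) * (1 + z\<^sup>2 / 3) \<le> T * (1 + z\<^sup>2 / 3)" using T1 by (intro mult_right_mono) auto
  also have "\<dots> \<le> w * (1 + k) / 2" using \<tau>(5) by (simp add: z_def)
  also have "\<dots> = (1 + k) * (w / 2)" by simp
  finally have "1 + z\<^sup>2 / 3 \<le> w / 2" using k by (simp only: mult_le_cancel_left_pos add_pos_pos zero_less_one)
  then have zw: "z\<^sup>2 \<le> 3 * (w / 2 - 1)" by simp
  have "0 \<le> 3 * (w / 2 - 1)" by (rule order_trans[OF zero_le_power2 zw])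
  then have w2: "2 \<le> w" by simp
  have d6: "6 \<le> real d" using B(3) by simp
  have "1890 \<le> 3 * (real d + 1) * (real d + 3) * (real d + 4)"
  proof -
    have "(3::real) * 7 * 9 * 10 \<le> 3 * (real d + 1) * (real d + 3) * (real d + 4)"
      using d6 by (intro mult_mono) auto
    then show ?thesis by simp
  qed
  then have gap: "girth_gap d \<le> 1 / 1890" unfolding girth_gap_def by (intro divide_left_mono) auto
  \<comment> \<open>\<open>k < 9/10\<close> would give \<open>z > 1/19\<close>, whereas
    \<open>z\<^sup>2\<close> is at most \<open>3/2\<close> of the gap, hence at most
    \<open>1/1260\<close>.\<close>
  have k9: "9 / 10 \<le> k"
  proof (rule ccontr)
    assume "\<not> ?thesis"
    then have "1 / 19 \<le> z" using k by (simp add: z_def field_simps)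
    then have "(1/19)\<^sup>2 \<le> z\<^sup>2" by (intro power_mono) auto
    then show False using zw gap w by (simp add: power2_eq_square)
  qed
  have "T * 1 \<le> T * (1 + z\<^sup>2 / 3)" using \<tau>(4) by (intro mult_left_mono) auto
  then have "T * 1 \<le> w * (1 + k) / 2" using \<tau>(5) unfolding z_def by (rule order_trans)
  then have "S \<le> (1 + k) * (w / 2 - 1)" by (simp add: S_def algebra_simps)
  also have "\<dots> \<le> 2 * (w / 2 - 1)" using k w2 by (intro mult_right_mono) auto
  finally have Sgap: "S < girth_gap d" using w by simp
  \<comment> \<open>The interval is cut into \<open>2 (d + 3)\<close> cells. In each even cell a
    point of least deficit is taken, so that its deficit is at most \<open>J 0 w / g\<close>; the
    odd cells keep different points at distance at least \<open>g\<close>.\<close>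
  define g where "g = w / (2 * (real d + 3))"
  have "2 * (real d + 3) \<le> w * (real d + 3)" using w2 by (intro mult_right_mono) auto
  then have g: "0 < g" "1 / (real d + 3) \<le> g" using w by (auto simp: g_def field_simps)
  have gsub: "0 \<le> 2 * real i * g \<and> (2 * real i + 1) * g \<le> w \<and> 2 * real i * g \<le> (2 * real i + 1) * g"
    if "i \<le> d + 2" for i
  proof -
    have "(2 * real i + 1) * g \<le> (2 * (real d + 3)) * g" using that g by (intro mult_right_mono) auto
    also have "\<dots> = w" by (simp add: g_def)
    finally show ?thesis using g by (auto simp: algebra_simps)
  qed
  have "\<exists>r. r \<in> {2 * real i * g..(2 * real i + 1) * g} \<and> g * q r \<le> J 0 w" if ii: "i \<le> d + 2" for i
  proof -
    let ?I = "{2 * real i * g..(2 * real i + 1) * g}"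
    have sub: "?I \<subseteq> {0..w}" using gsub[OF ii] by auto
    obtain r where r: "r \<in> ?I" "\<And>x. x \<in> ?I \<Longrightarrow> q r \<le> q x"
      using continuous_attains_inf[of ?I q] continuous_on_subset[OF qc sub] gsub[OF ii] by auto
    have "integral ?I (\<lambda>_. q r) \<le> integral ?I q"
      by (rule integral_le) (use r qi gsub[OF ii] in auto)
    then have "g * q r \<le> integral ?I q" using gsub[OF ii] by (simp add: algebra_simps)
    also have "\<dots> \<le> J 0 w" using Jmono gsub[OF ii] unfolding J_def by blast
    finally show ?thesis using r by blast
  qed
  then obtain r where r: "\<And>i. i \<le> d + 2 \<Longrightarrow> r i \<in> {2 * real i * g..(2 * real i + 1) * g}"
      "\<And>i. i \<le> d + 2 \<Longrightarrow> g * q (r i) \<le> J 0 w" by metis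
  have rw: "r i \<in> {0..w}" if "i \<le> d + 2" for i using r(1)[OF that] gsub[OF that] by (meson atLeastAtMost_iff order_trans)
  have step: "g \<le> r j - r i" if "i < j" "j \<le> d + 2" for i j
  proof -
    have "real i + 1 \<le> real j" using that by simp
    then have "(2 * real i + 2) * g \<le> 2 * real j * g" using g by (intro mult_right_mono) auto
    then show ?thesis using r(1)[of i] r(1)[of j] that by (auto simp: algebra_simps)
  qed
  have \<tau>step: "k * (t - s) \<le> \<tau> t - \<tau> s" if "0 \<le> s" "s \<le> t" "t \<le> w" for s t
  proof -
    have "integral {s..t} (\<lambda>_. k) \<le> integral {s..t} p"
      by (rule integral_le) (use that pint[OF that(2)] p(2) in auto)
    then show ?thesis using pint[OF that(2)] that by (simp add: integral_unique algebra_simps)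
  qed
  define h where "h = k * g"
  have h: "0 < h" using k g by (simp add: h_def)
  \<comment> \<open>Continued beyond \<open>d + 2\<close> by increasing values because
    \<open>second_difference_tent\<close> asks for monotonicity at all indices.\<close>
  define tt where "tt = (\<lambda>i. if i \<le> d + 2 then \<tau> (r i) else \<tau> w + real i)"
  have tts: "h \<le> tt j - tt i" if "i < j" "j \<le> d + 2" for i j
  proof -
    have "h \<le> k * (r j - r i)" using step[OF that] k by (simp add: h_def)
    also have "\<dots> \<le> \<tau> (r j) - \<tau> (r i)" using rw[of i] rw[of j] step[OF that] g that by (intro \<tau>step) auto
    finally show ?thesis using that by (simp add: tt_def)
  qed
  have ttm: "tt i < tt j" if "i < j" for i j
  proof (cases "j \<le> d + 2")
    case True
    then show ?thesis using tts[OF that] h by simp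
  next
    case False
    show ?thesis
    proof (cases "i \<le> d + 2")
      case True
      have "\<tau> (r i) \<le> \<tau> w" using \<tau>step[of "r i" w] rw[OF True] k by (smt (verit) atLeastAtMost_iff mult_nonneg_nonneg)
      then show ?thesis using True False by (simp add: tt_def)
    qed (use False that in \<open>simp add: tt_def\<close>)
  qed
  define c where "c = (1 - k) / T"
  define pp where "pp = (\<lambda>i. 1 - c * tt i)"
  have ppr: "pp i = p (r i)" if "i \<le> d + 2" for i
    using \<tau>(3)[of "r i"] \<tau>(4) that by (simp add: pp_def tt_def c_def field_simps)
  have "\<exists>l. linear l \<and> l (y (r i)) = N (y (r i)) \<and> (\<forall>x\<in>span B. l x \<le> N x)" if "i \<le> d + 2" for i
    using norming_functional[OF B(1) N yV[OF rw[OF that]]] by metis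
  then obtain l where l: "\<And>i. i \<le> d + 2 \<Longrightarrow> linear (l i)" "\<And>i. i \<le> d + 2 \<Longrightarrow> l i (y (r i)) = N (y (r i))"
     "\<And>i x. i \<le> d + 2 \<Longrightarrow> x \<in> span B \<Longrightarrow> l i x \<le> N x" by metis
  define K where "K = (\<lambda>i j. pp i - \<bar>tt j - tt i\<bar>)"
  define e where "e = (S + S / (k * g)) / k"
  \<comment> \<open>The lower bound is the Lipschitz bound from \<open>r i\<close> to
    \<open>r j\<close>. For the upper bound one goes the other way round: from \<open>r j\<close> to
    an end of the interval, by antiperiodicity to the other end, and from there to
    \<open>r i\<close>. As \<open>T\<close> is nearly \<open>1 + k\<close>, this detour loses only
    \<open>S\<close> and the deficit at \<open>r i\<close>, up to a factor
    \<open>1 / k\<close>.\<close>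
  have err: "\<bar>l i (y (r j)) - K i j\<bar> \<le> e" if i: "i \<le> d + 2" and j: "j \<le> d + 2" for i j
  proof -
    interpret li: linear "l i" using l(1)[OF i] .
    let ?s = "r j" and ?r = "r i"
    note ri = rw[OF i] and rj = rw[OF j]
    have z0: "0 \<in> {0..w}" and zw: "w \<in> {0..w}" using w by auto
    have ld: "l i (y a) - l i (y b) \<le> \<bar>\<tau> a - \<tau> b\<bar>" if "a \<in> {0..w}" "b \<in> {0..w}" for a b
    proof -
      have "l i (y a) - l i (y b) = l i (y a - y b)" by (simp add: li.diff)
      also have "\<dots> \<le> N (y a - y b)" using l(3)[OF i] yV that span_diff by blast
      also have "\<dots> \<le> \<bar>\<tau> a - \<tau> b\<bar>"
        using lip2[of a b] lip2[of b a] n(8)[of "y a" "y b"] that by (cases "a \<le> b") auto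
      finally show ?thesis .
    qed
    have mono: "\<tau> a \<le> \<tau> b" if "a \<in> {0..w}" "b \<in> {0..w}" "a \<le> b" for a b
      using \<tau>step[of a b] that k by (smt (verit) atLeastAtMost_iff mult_nonneg_nonneg)
    have la: "l i (y ?r) = p ?r - q ?r" using l(2)[OF i] by (simp add: q_def)
    have lw: "l i (y w) = - k * l i (y 0)" unfolding anti by (simp add: li.scale li.neg)
    have Kij: "K i j = p ?r - \<bar>\<tau> ?s - \<tau> ?r\<bar>" using i j by (simp add: K_def ppr tt_def)
    have qr: "0 \<le> q ?r" using q0[OF ri] .
    have lower: "p ?r - q ?r - \<bar>\<tau> ?s - \<tau> ?r\<bar> \<le> l i (y ?s)"
      using ld[OF ri rj] la by (simp add: abs_minus_commute)
    have TT: "T - (1 - k) * \<tau> ?r - (1 + k) * p ?r = p ?r * S"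
      using \<tau>(3)[of ?r] by (simp add: S_def algebra_simps)
    have pS: "p ?r * S \<le> S" using p(2)[OF ri] S0 by (simp add: mult_left_le_one_le k order_trans[OF less_imp_le[OF k(1)]])
    have upper: "k * (l i (y ?s) - K i j) \<le> S + q ?r"
    proof (cases "?r \<le> ?s")
      case True
      have a1: "l i (y ?s) \<le> l i (y w) + (T - \<tau> ?s)" using ld[OF rj zw] mono[OF rj zw] rj \<tau>(2) by simp
      have a2: "p ?r - q ?r - \<tau> ?r \<le> l i (y 0)" using ld[OF ri z0] la \<tau>(1) mono[OF z0 ri] ri by simp
      have "l i (y ?s) \<le> T - \<tau> ?s - k * (p ?r - q ?r - \<tau> ?r)"
        using a1 lw mult_left_mono[OF a2 less_imp_le[OF k(1)]] by linarith
      then have "l i (y ?s) - K i j \<le> p ?r * S + k * q ?r"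
        using Kij mono[OF ri rj True] TT by (simp add: algebra_simps)
      then have b: "l i (y ?s) - K i j \<le> S + q ?r" using pS k qr mult_left_le_one_le[of "q ?r" k] by simp
      show ?thesis
      proof (cases "0 \<le> l i (y ?s) - K i j")
        case True
        then show ?thesis using b k mult_left_le_one_le[of "l i (y ?s) - K i j" k] by simp
      next
        case False
        then have "k * (l i (y ?s) - K i j) \<le> 0" using k by (simp add: mult_le_0_iff)
        then show ?thesis using S0 qr by simp
      qed
    next
      case False
      then have sr: "?s \<le> ?r" by simp
      have a1: "l i (y ?s) \<le> l i (y 0) + \<tau> ?s" using ld[OF rj z0] mono[OF z0 rj] rj \<tau>(1) by simp
      have a2: "p ?r - q ?r - (T - \<tau> ?r) \<le> l i (y w)" using ld[OF ri zw] la \<tau>(2) mono[OF ri zw] ri by simp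
      have "k * l i (y ?s) \<le> k * l i (y 0) + k * \<tau> ?s" using mult_left_mono[OF a1, of k] k by (simp add: algebra_simps)
      also have "k * l i (y 0) \<le> T - \<tau> ?r - p ?r + q ?r" using a2 lw by simp
      finally have b: "k * l i (y ?s) \<le> T - \<tau> ?r - p ?r + q ?r + k * \<tau> ?s" by simp
      have Keq: "K i j = p ?r - (\<tau> ?r - \<tau> ?s)" using Kij mono[OF rj ri sr] by simp
      have "k * (l i (y ?s) - K i j) \<le> p ?r * S + q ?r"
        unfolding Keq using b TT by (simp add: algebra_simps)
      then show ?thesis using pS by simp
    qed
    have qg: "q ?r \<le> S / (k * g)"
      using order_trans[OF r(2)[OF i] kJS] g k by (simp add: field_simps)
    have e1: "(S + q ?r) / k \<le> e" unfolding e_def using qg k by (intro divide_right_mono) auto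
    have "l i (y ?s) - K i j \<le> (S + q ?r) / k" using upper k by (simp add: field_simps)
    moreover have "q ?r \<le> (S + q ?r) / k" using S0 k qr mult_left_le_one_le[of "q ?r" k] by (simp add: field_simps)
    then have "- ((S + q ?r) / k) \<le> l i (y ?s) - K i j" using lower Kij by linarith
    ultimately show ?thesis using e1 by (simp add: abs_le_iff)
  qed
  have e0: "0 \<le> e" using S0 k g by (simp add: e_def)
  \<comment> \<open>The \<open>d + 1\<close> inner indices; \<open>0\<close> and
    \<open>d + 2\<close> only serve as neighbours in second differences.\<close>
  define A where "A = {1..d + 1}"
  have A: "finite A" "A \<noteq> {}" "card B < card A" "card A = d + 1" using B by (auto simp: A_def)
  obtain a where a: "\<exists>j\<in>A. a j \<noteq> 0" "(\<Sum>j\<in>A. a j *\<^sub>R y (r j)) = 0"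
    by (rule family_dependent[of A B "\<lambda>j. y (r j)"]) (use A B yV rw in \<open>auto simp: A_def\<close>)
  \<comment> \<open>Diagonal dominance. For an index \<open>i\<close> with a coefficient of largest
    modulus, the second difference \<open>L\<close> of the norming functionals is \<open>2\<close>
    at \<open>y (r i)\<close> and \<open>0\<close> at the other vectors, each up to
    \<open>4 * e / h\<close>. Applied to the linear dependence it gives
    \<open>2 \<le> (d + 1) * (4 * e / h)\<close>.\<close>
  define am where "am = Max ((\<lambda>j. \<bar>a j\<bar>) ` A)"
  have "am \<in> (\<lambda>j. \<bar>a j\<bar>) ` A" unfolding am_def using A by (intro Max_in) auto
  then obtain i where i: "i \<in> A" "\<bar>a i\<bar> = am" by auto
  have amle: "\<bar>a j\<bar> \<le> am" if "j \<in> A" for j unfolding am_def using that A by (intro Max_ge) auto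
  have am0: "0 < am" using a(1) amle by force
  have ib: "0 < i" "i \<le> d + 2" "i - 1 \<le> d + 2" "Suc i \<le> d + 2" using i(1) by (auto simp: A_def)
  define h1 where "h1 = tt i - tt (i - 1)"
  define h2 where "h2 = tt (Suc i) - tt i"
  have h12: "h \<le> h1" "h \<le> h2" using tts[of "i - 1" i] tts[of i "Suc i"] ib by (auto simp: h1_def h2_def)
  define L where "L = (\<lambda>x. (l i x - l (i - 1) x) / h1 + (l i x - l (Suc i) x) / h2)"
  have Llin: "linear L" unfolding L_def
    by (rule linearI) (simp_all only: linear_add[OF l(1)[OF ib(2)]] linear_scale[OF l(1)[OF ib(2)]]
       linear_add[OF l(1)[OF ib(3)]] linear_scale[OF l(1)[OF ib(3)]]
       linear_add[OF l(1)[OF ib(4)]] linear_scale[OF l(1)[OF ib(4)]], simp_all add: add_divide_distrib diff_divide_distrib algebra_simps)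
  have KL: "(K i j - K (i - 1) j) / h1 + (K i j - K (Suc i) j) / h2 = (if j = i then 2 else 0)" for j
    using second_difference_tent[of pp c tt i j] ttm ib unfolding K_def h1_def h2_def pp_def by simp
  have Lerr: "\<bar>L (y (r j)) - (if j = i then 2 else 0)\<bar> \<le> 4 * e / h" if j: "j \<in> A" for j
  proof -
    have j': "j \<le> d + 2" using j by (simp add: A_def)
    have 1: "\<bar>(l i (y (r j)) - K i j) - (l (i - 1) (y (r j)) - K (i - 1) j)\<bar> \<le> 2 * e"
      using err[OF ib(2) j'] err[OF ib(3) j'] by linarith
    have 2: "\<bar>(l i (y (r j)) - K i j) - (l (Suc i) (y (r j)) - K (Suc i) j)\<bar> \<le> 2 * e"
      using err[OF ib(2) j'] err[OF ib(4) j'] by linarith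
    have "L (y (r j)) - (if j = i then 2 else 0) =
       ((l i (y (r j)) - K i j) - (l (i - 1) (y (r j)) - K (i - 1) j)) / h1
       + ((l i (y (r j)) - K i j) - (l (Suc i) (y (r j)) - K (Suc i) j)) / h2"
      unfolding KL[of j, symmetric] L_def by (simp add: diff_divide_distrib)
    also have "\<bar>\<dots>\<bar> \<le> 2 * e / h1 + 2 * e / h2"
      using 1 2 h h12 by (intro order_trans[OF abs_triangle_ineq] add_mono) (auto simp: abs_divide intro!: divide_right_mono)
    also have "\<dots> \<le> 2 * e / h + 2 * e / h" using h h12 e0 by (intro add_mono divide_left_mono) auto
    finally show ?thesis by simp
  qed
  have "0 = L (\<Sum>j\<in>A. a j *\<^sub>R y (r j))" using a(2) linear_0[OF Llin] by simp
  also have "\<dots> = (\<Sum>j\<in>A. a j * L (y (r j)))" by (simp add: linear_sum[OF Llin] linear_scale[OF Llin])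
  finally have L0: "(\<Sum>j\<in>A. a j * L (y (r j))) = 0" by simp
  have "(\<Sum>j\<in>A. a j * (if j = i then 2 else 0)) = 2 * a i"
    using i(1) A(1) by (simp add: if_distrib cong: if_cong)
  then have "2 * a i = - (\<Sum>j\<in>A. a j * (L (y (r j)) - (if j = i then 2 else 0)))"
    using L0 by (simp add: right_diff_distrib sum_subtractf)
  then have "2 * am = \<bar>\<Sum>j\<in>A. a j * (L (y (r j)) - (if j = i then 2 else 0))\<bar>" using i(2) by (simp add: abs_if split: if_splits)
  also have "\<dots> \<le> (\<Sum>j\<in>A. am * (4 * e / h))"
    by (rule order_trans[OF sum_abs], rule sum_mono) (simp only: abs_mult, intro mult_mono amle Lerr, auto simp: am0 less_imp_le)
  also have "\<dots> = am * ((real d + 1) * (4 * e / h))" using A(4) by simp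
  finally have "2 \<le> (real d + 1) * (4 * e / h)" using am0 by (simp only: mult.commute[of 2] mult_le_cancel_left_pos)
  then have fin: "h \<le> 2 * (real d + 1) * e" using h by (simp add: field_simps)
  have hk: "9 / (10 * (real d + 3)) \<le> h"
  proof -
    have "9 / 10 * (1 / (real d + 3)) \<le> k * g" using k9 g k by (intro mult_mono) auto
    then show ?thesis by (simp add: h_def)
  qed
  have "1 / h \<le> 1 / (9 / (10 * (real d + 3)))" using hk h by (intro divide_left_mono) auto
  then have h': "1 / h \<le> 10 * (real d + 3) / 9" by simp
  have "e = S * (1 + 1 / h) / k" by (simp add: e_def h_def field_simps)
  also have "\<dots> \<le> S * (1 + 10 * (real d + 3) / 9) / (9 / 10)"
    by (rule frac_le[OF _ mult_left_mono[OF add_left_mono[OF h'] S0]]) (use S0 k9 in auto)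
  finally have e2: "e \<le> S * (1 + 10 * (real d + 3) / 9) * (10 / 9)" by simp
  have "9 / (10 * (real d + 3)) \<le> 2 * (real d + 1) * (S * (1 + 10 * (real d + 3) / 9) * (10 / 9))"
    by (rule order_trans[OF hk order_trans[OF fin mult_left_mono[OF e2]]]) simp
  then have "9 * 81 \<le> S * (real d + 1) * (real d + 3) * (200 * (9 + 10 * (real d + 3)))"
    by (simp add: field_simps)
  also have "\<dots> \<le> S * (real d + 1) * (real d + 3) * (2000 * (real d + 4))"
    using S0 by (intro mult_left_mono) auto
  also have "\<dots> < girth_gap d * (real d + 1) * (real d + 3) * (2000 * (real d + 4))"
    using Sgap by (intro mult_strict_right_mono) auto
  also have "\<dots> = 2000 / 3"
  proof -
    have gen: "1 / (3 * X * Y * Z) * X * Y * (2000 * Z) = 2000 / 3" if "X > 0" "Y > 0" "Z > 0" for X Y Z :: real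
      using that by (simp add: field_simps)
    show ?thesis unfolding girth_gap_def by (rule gen) auto
  qed
  finally show False by simp
qed


lemma antiperiodic_curve_le_1:
  fixes y :: "real \<Rightarrow> 'v::real_vector"
  assumes B: "finite B" "card B \<le> d" "6 \<le> d" and N: "norm_on (span B) N"
    and k: "0 < k" "k \<le> 1" and w: "0 < w" "w < 2 + girth_gap d"
    and yV: "\<And>r. r \<in> {0..w} \<Longrightarrow> y r \<in> span B"
    and cont: "continuous_on {0..w} (\<lambda>r. N (y r))"
    and lip: "\<And>s t. 0 \<le> s \<Longrightarrow> s \<le> t \<Longrightarrow> t \<le> w \<Longrightarrow> N (y t - y s) \<le> integral {s..t} (\<lambda>r. N (y r))"
    and anti: "y w = - k *\<^sub>R y 0" and r1: "r1 \<in> {0..w}"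
  shows "y r1 = 0"
proof (rule ccontr)
  assume ne: "y r1 \<noteq> 0"
  note n = norm_onD[OF N]
  obtain p \<tau> T where p: "continuous_on {0..w} p" "\<And>r. r \<in> {0..w} \<Longrightarrow> k \<le> p r \<and> p r \<le> 1"
    and pint: "\<And>s t. s \<le> t \<Longrightarrow> (p has_integral (\<tau> t - \<tau> s)) {s..t}"
    and \<tau>: "\<tau> 0 = 0" "\<tau> w = T" "\<And>r. (1 - k) * \<tau> r = T * (1 - p r)" "0 < T"
      "T * (1 + ((1 - k) / (1 + k)) ^ 2 / 3) \<le> w * (1 + k) / 2"
    using exponential_weight[OF k w(1)] by metis
  have pp: "0 < p r" if "r \<in> {0..w}" for r using p(2)[OF that] k by simp
  have "continuous_on {0..w} (\<lambda>r. N (y r) / p r)"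
    by (intro continuous_intros cont p(1)) (use pp in force)
  then obtain r0 where r0: "r0 \<in> {0..w}" "\<And>r. r \<in> {0..w} \<Longrightarrow> N (y r) / p r \<le> N (y r0) / p r0"
    using continuous_attains_sup[of "{0..w}" "\<lambda>r. N (y r) / p r"] w by auto
  \<comment> \<open>Dividing by the maximum of \<open>N (y r) / p r\<close> makes the curve touch
    its weight at \<open>r0\<close> without crossing it.\<close>
  define M where "M = N (y r0) / p r0"
  have "0 < N (y r1)" using ne n(4)[OF yV[OF r1]] n(9)[of "y r1"] by (auto simp: less_le)
  then have "0 < N (y r1) / p r1" using pp[OF r1] by simp
  then have M: "0 < M" using r0(2)[OF r1] by (simp add: M_def)
  have nM: "N ((1 / M) *\<^sub>R x) = N x / M" for x using M by (simp add: n(3))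
  show False
  proof (rule antiperiodic_curve_aux[where y="\<lambda>r. (1 / M) *\<^sub>R y r" and rm=r0, OF B N k w _ _ _ _ p pint \<tau>])
    show "(1 / M) *\<^sub>R y r \<in> span B" if "r \<in> {0..w}" for r using yV[OF that] span_scale by blast
    show "continuous_on {0..w} (\<lambda>r. N ((1 / M) *\<^sub>R y r))"
      unfolding nM by (intro continuous_intros cont) (use M in auto)
    show "N ((1 / M) *\<^sub>R y t - (1 / M) *\<^sub>R y s) \<le> integral {s..t} (\<lambda>r. N ((1 / M) *\<^sub>R y r))"
      if "0 \<le> s" "s \<le> t" "t \<le> w" for s t
      using lip[OF that] M unfolding nM scaleR_diff_right[symmetric] by (simp add: divide_right_mono)
    show "(1 / M) *\<^sub>R y w = - k *\<^sub>R (1 / M) *\<^sub>R y 0" using anti by simp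
    show "N ((1 / M) *\<^sub>R y r) \<le> p r" if "r \<in> {0..w}" for r
      using r0(2)[OF that] pp[OF that] M unfolding nM M_def[symmetric] by (simp add: field_simps)
    show "N ((1 / M) *\<^sub>R y r0) = p r0" using M pp[OF r0(1)] unfolding nM by (simp add: M_def field_simps)
  qed (use r0 in auto)
qed

lemma integral_affine:
  fixes f :: "real \<Rightarrow> real"
  assumes "continuous_on {a..b} f" "a \<le> b"
  shows "integral {w - b..w - a} (\<lambda>r. f (w - r)) = integral {a..b} f"
    and "0 < K \<Longrightarrow> integral {K * a..K * b} (\<lambda>r. f (r / K)) = K * integral {a..b} f"
proof -
  have i: "(f has_integral integral {a..b} f) (cbox a b)"
    using integrable_integral[OF integrable_continuous_interval[OF assms(1)]] by simp
  have "((\<lambda>r. f (- r)) has_integral integral {a..b} f) (cbox (- b) (- a))"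
    using i by (simp add: has_integral_reflect_real)
  then have "((\<lambda>r. f (- (1 * r + - w))) has_integral (integral {a..b} f /\<^sub>R 1 ^ DIM(real)))
      (cbox ((- b - - w) /\<^sub>R 1) ((- a - - w) /\<^sub>R 1))"
    using has_integral_affinity'[of "\<lambda>r. f (- r)" _ "- b" "- a" 1 "- w"] by simp
  then show "integral {w - b..w - a} (\<lambda>r. f (w - r)) = integral {a..b} f"
    by (simp add: integral_unique add.commute)
  assume K: "0 < K"
  have "((\<lambda>r. f (1 / K * r + 0)) has_integral (integral {a..b} f /\<^sub>R (1 / K) ^ DIM(real)))
      (cbox ((a - 0) /\<^sub>R (1 / K)) ((b - 0) /\<^sub>R (1 / K)))"
    using has_integral_affinity'[OF i, of "1 / K" 0] K by simp
  then show "integral {K * a..K * b} (\<lambda>r. f (r / K)) = K * integral {a..b} f"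
    by (simp add: integral_unique)
qed

text \<open>Gronwall's argument, for \<open>l = 0\<close> and, run backwards, for
  \<open>l = 1\<close>, where one end of the curve is \<open>0\<close>. At the maximum
  \<open>r0\<close> of \<open>N (y r) * exp (- 2 * r)\<close> the integral bound is at most half of
  \<open>N (y r0)\<close>.\<close>

lemma curve_from_0_vanishes:
  fixes y :: "real \<Rightarrow> 'v::real_vector"
  assumes N: "norm_on V N" and w: "0 \<le> w"
    and yV: "\<And>r. r \<in> {0..w} \<Longrightarrow> y r \<in> V"
    and cont: "continuous_on {0..w} (\<lambda>r. N (y r))"
    and lip: "\<And>s t. 0 \<le> s \<Longrightarrow> s \<le> t \<Longrightarrow> t \<le> w \<Longrightarrow> N (y t - y s) \<le> integral {s..t} (\<lambda>r. N (y r))"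
    and y0: "y 0 = 0" and r1: "r1 \<in> {0..w}"
  shows "y r1 = 0"
proof -
  note n = norm_onD[OF N]
  define q where "q = (\<lambda>r. N (y r) * exp (- 2 * r))"
  have "continuous_on {0..w} q" unfolding q_def by (intro continuous_intros cont)
  then obtain r0 where r0: "r0 \<in> {0..w}" "\<And>r. r \<in> {0..w} \<Longrightarrow> q r \<le> q r0"
    using continuous_attains_sup[of "{0..w}" q] w by auto
  have le: "N (y r) \<le> q r0 * exp (2 * r)" if "r \<in> {0..w}" for r
  proof -
    have "q r * exp (2 * r) \<le> q r0 * exp (2 * r)" using r0(2)[OF that] by simp
    moreover have "q r * exp (2 * r) = N (y r)" unfolding q_def by (simp add: mult.assoc flip: exp_add)
    ultimately show ?thesis by simp
  qed
  have q0: "0 \<le> q r0" unfolding q_def by (simp add: n(9))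
  have hi: "((\<lambda>r. q r0 * exp (2 * r)) has_integral (q r0 * exp (2 * r0) / 2 - q r0 * exp (2 * 0) / 2)) {0..r0}"
    by (rule fundamental_theorem_of_calculus)
      (use r0(1) in \<open>auto intro!: derivative_eq_intros simp flip: has_real_derivative_iff_has_vector_derivative\<close>)
  have "N (y r0) \<le> integral {0..r0} (\<lambda>r. N (y r))" using lip[of 0 r0] r0(1) y0 by simp
  also have "\<dots> \<le> integral {0..r0} (\<lambda>r. q r0 * exp (2 * r))"
    by (rule integral_le)
      (use r0(1) le hi in \<open>auto intro!: integrable_continuous_interval continuous_on_subset[OF cont] continuous_intros\<close>)
  also have "\<dots> = q r0 * exp (2 * r0) / 2 - q r0 / 2" using integral_unique[OF hi] by (simp only: mult_zero_right exp_zero mult_1_right)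
  also have "q r0 * exp (2 * r0) = N (y r0)" unfolding q_def by (simp add: mult.assoc flip: exp_add)
  finally have "N (y r0) \<le> 0" using q0 by simp
  then have "q r0 \<le> 0" by (simp add: q_def mult_le_0_iff)
  then have "N (y r1) \<le> 0" using le[OF r1] mult_nonpos_nonneg[of "q r0" "exp (2 * r1)"] by simp
  then show ?thesis using n(4)[OF yV[OF r1]] n(9)[of "y r1"] by simp
qed

text \<open>One of the ratios \<open>(1 - l) / l\<close> and \<open>l / (1 - l)\<close> is at most
  \<open>1\<close>; in the second case the curve is run backwards, which exchanges its ends.\<close>

lemma antiperiodic_curve:
  fixes y :: "real \<Rightarrow> 'v::real_vector"
  assumes B: "finite B" "card B \<le> d" "6 \<le> d" and N: "norm_on (span B) N"
    and l: "l \<in> {0..1}" and w: "0 < w" "w < 2 + girth_gap d"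
    and yV: "\<And>r. r \<in> {0..w} \<Longrightarrow> y r \<in> span B"
    and cont: "continuous_on {0..w} (\<lambda>r. N (y r))"
    and lip: "\<And>s t. 0 \<le> s \<Longrightarrow> s \<le> t \<Longrightarrow> t \<le> w \<Longrightarrow> N (y t - y s) \<le> integral {s..t} (\<lambda>r. N (y r))"
    and bd: "l *\<^sub>R y w + (1 - l) *\<^sub>R y 0 = 0" and r1: "r1 \<in> {0..w}"
  shows "y r1 = 0"
proof -
  define x where "x = (\<lambda>r. y (w - r))"
  have xV: "\<And>r. r \<in> {0..w} \<Longrightarrow> x r \<in> span B" unfolding x_def using yV by auto
  have xc: "continuous_on {0..w} (\<lambda>r. N (x r))" unfolding x_def
    by (rule continuous_on_compose2[OF cont]) (auto intro!: continuous_intros)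
  have xlip: "N (x t - x s) \<le> integral {s..t} (\<lambda>r. N (x r))" if "0 \<le> s" "s \<le> t" "t \<le> w" for s t
  proof -
    have "continuous_on {w - t..w - s} (\<lambda>r. N (y r))" by (rule continuous_on_subset[OF cont]) (use that in auto)
    then have "integral {s..t} (\<lambda>r. N (x r)) = integral {w - t..w - s} (\<lambda>r. N (y r))"
      using integral_affine(1)[of "w - t" "w - s" "\<lambda>r. N (y r)" w] that by (simp add: x_def)
    then show ?thesis using lip[of "w - t" "w - s"] that norm_onD(8)[OF N] by (simp add: x_def)
  qed
  have x1: "w - r1 \<in> {0..w}" using r1 by auto
  consider "l = 0" | "l = 1" | "l \<in> {0<..<1}" "(1 - l) / l \<le> 1" | "l \<in> {0<..<1}" "l / (1 - l) \<le> 1"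
  proof -
    have "(1 - l) / l \<le> 1 \<or> l / (1 - l) \<le> 1" if "0 < l" "l < 1" using that by (auto simp: field_simps)
    then show ?thesis using that l by force
  qed
  then show ?thesis
  proof cases
    case 1
    then show ?thesis using curve_from_0_vanishes[OF N _ yV cont lip _ r1] w bd by simp
  next
    case 2
    then show ?thesis using curve_from_0_vanishes[OF N _ xV xc xlip _ x1] w bd by (simp add: x_def)
  next
    case 3
    have "l *\<^sub>R (y w + ((1 - l) / l) *\<^sub>R y 0) = 0" using bd 3 by (simp add: scaleR_add_right)
    then have "y w = - ((1 - l) / l) *\<^sub>R y 0" using 3 by (simp add: eq_neg_iff_add_eq_0)
    then show ?thesis using antiperiodic_curve_le_1[OF B N _ 3(2) w yV cont lip _ r1] 3 by simp
  next
    case 4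
    have "(1 - l) *\<^sub>R (x w + (l / (1 - l)) *\<^sub>R x 0) = 0" using bd 4 by (simp add: scaleR_add_right x_def add.commute)
    then have "x w = - (l / (1 - l)) *\<^sub>R x 0" using 4 by (simp add: eq_neg_iff_add_eq_0)
    then show ?thesis using antiperiodic_curve_le_1[OF B N _ 4(2) w xV xc xlip _ x1] 4 by (simp add: x_def)
  qed
qed

text \<open>Stretching the parameter to \<open>{0..K * w}\<close> absorbs the Lipschitz constant.
  \<open>K\<close> is kept apart from \<open>w\<close> because it becomes a multiple of
  \<open>cmod z\<close> for the measure \<open>z \<phi>\<close>, with one and the same
  parametrization.\<close>

theorem short_curve_vanishes:
  fixes y :: "real \<Rightarrow> 'v::real_vector"
  assumes B: "finite B" "card B \<le> d" "6 \<le> d" and N: "norm_on (span B) N"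
    and l: "l \<in> {0..1}" and w: "0 \<le> w" "0 \<le> K" "K * w < 2 + girth_gap d"
    and yV: "\<And>r. r \<in> {0..w} \<Longrightarrow> y r \<in> span B"
    and cont: "continuous_on {0..w} (\<lambda>r. N (y r))"
    and lip: "\<And>s t. 0 \<le> s \<Longrightarrow> s \<le> t \<Longrightarrow> t \<le> w \<Longrightarrow> N (y t - y s) \<le> K * integral {s..t} (\<lambda>r. N (y r))"
    and bd: "l *\<^sub>R y w + (1 - l) *\<^sub>R y 0 = 0" and r1: "r1 \<in> {0..w}"
  shows "y r1 = 0"
proof (cases "K = 0 \<or> w = 0")
  case True
  note n = norm_onD[OF N]
  have "y t = y 0" if t: "t \<in> {0..w}" for t
  proof -
    have "N (y t - y 0) \<le> 0" using lip[of 0 t] t True by auto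
    moreover have "y t - y 0 \<in> span B" using span_diff[OF yV[of t] yV[of 0]] t w by auto
    ultimately show ?thesis using n(4)[of "y t - y 0"] n(9)[of "y t - y 0"] by simp
  qed
  moreover have "y 0 = 0" using bd calculation[of w] w by (simp flip: scaleR_add_left)
  ultimately show ?thesis using r1 by simp
next
  case False
  then have K: "0 < K" "0 < w" using w by auto
  define x where "x = (\<lambda>r. y (r / K))"
  have dom: "r / K \<in> {0..w}" if "r \<in> {0..K * w}" for r using that K by (simp add: field_simps)
  have "x (K * r1) = 0"
  proof (rule antiperiodic_curve[OF B N l _ w(3)])
    show "0 < K * w" using K by simp
    show "x r \<in> span B" if "r \<in> {0..K * w}" for r using yV[OF dom[OF that]] by (simp add: x_def)
    show "continuous_on {0..K * w} (\<lambda>r. N (x r))" unfolding x_def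
      by (rule continuous_on_compose2[OF cont]) (use dom K in \<open>auto intro!: continuous_intros\<close>)
    show "N (x t - x s) \<le> integral {s..t} (\<lambda>r. N (x r))" if st: "0 \<le> s" "s \<le> t" "t \<le> K * w" for s t
    proof -
      have st': "0 \<le> s / K" "s / K \<le> t / K" "t / K \<le> w" using st K by (auto simp: field_simps)
      have "continuous_on {s / K..t / K} (\<lambda>r. N (y r))" by (rule continuous_on_subset[OF cont]) (use st' in auto)
      then have "integral {s..t} (\<lambda>r. N (x r)) = K * integral {s / K..t / K} (\<lambda>r. N (y r))"
        using integral_affine(2)[of "s / K" "t / K" "\<lambda>r. N (y r)" K] st' K by (simp add: x_def)
      then show ?thesis using lip[OF st'] by (simp add: x_def)
    qed
    show "l *\<^sub>R x (K * w) + (1 - l) *\<^sub>R x 0 = 0" using bd K by (simp add: x_def)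
    show "K * r1 \<in> {0..K * w}" using r1 K by simp
  qed
  then show ?thesis using K by (simp add: x_def)
qed

section \<open>Weak integrals in finite-dimensional algebras\<close>

text \<open>Products are bilinear, associative and \<open>V\<close>-valued on the whole type, which
  spares side conditions. \<open>N\<close> is only asked to be a vector space norm, so that the
  Taylor norm of the complexification qualifies; the bound on products that the curves require
  enters with the density, as \<open>mult_u\<close>.\<close>

locale fd_algebra =
  fixes V :: "'v::real_normed_vector set" and m :: "'v \<Rightarrow> 'v \<Rightarrow> 'v" and e :: 'v and N :: "'v \<Rightarrow> real"
    and B :: "'v set" and c :: "'v \<Rightarrow> 'v \<Rightarrow> real"
  assumes N: "norm_on V N"
    and B: "finite B" "B \<subseteq> V" "span B = V"
    and c_linear: "b \<in> B \<Longrightarrow> linear (c b)"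
    and c_expand: "x \<in> V \<Longrightarrow> x = (\<Sum>b\<in>B. c b x *\<^sub>R b)"
    and c_delta: "b \<in> B \<Longrightarrow> b' \<in> B \<Longrightarrow> c b b' = (if b = b' then 1 else 0)"
    and m_bilinear: "bilinear m"
    and m_assoc: "m (m x y) z = m x (m y z)"
    and m_V: "m x y \<in> V"
    and e_V: "e \<in> V"
    and m_e: "x \<in> V \<Longrightarrow> m e x = x" "x \<in> V \<Longrightarrow> m x e = x"
begin

lemmas n = norm_onD[OF N]

lemma V_closed: "0 \<in> V" "x \<in> V \<Longrightarrow> y \<in> V \<Longrightarrow> x + y \<in> V" "x \<in> V \<Longrightarrow> y \<in> V \<Longrightarrow> x - y \<in> V"
  "x \<in> V \<Longrightarrow> r *\<^sub>R x \<in> V" "(\<And>i. i \<in> A \<Longrightarrow> f i \<in> V) \<Longrightarrow> sum f A \<in> V"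
  using n(1) by (auto simp: subspace_0 subspace_add subspace_diff subspace_scale intro: subspace_sum)

lemma m_simps:
  "m (x + y) z = m x z + m y z" "m z (x + y) = m z x + m z y"
  "m (x - y) z = m x z - m y z" "m z (x - y) = m z x - m z y"
  "m (r *\<^sub>R x) y = r *\<^sub>R m x y" "m x (r *\<^sub>R y) = r *\<^sub>R m x y" "m 0 x = 0" "m x 0 = 0"
  "m (- x) y = - m x y" "m x (- y) = - m x y"
  using m_bilinear
  by (auto simp: bilinear_ladd bilinear_radd bilinear_lsub bilinear_rsub bilinear_lmul bilinear_rmul
     bilinear_lzero bilinear_rzero bilinear_lneg bilinear_rneg)

lemma m_linear: "linear (m x)" "linear (\<lambda>x. m x y)"
  using m_bilinear by (auto simp: bilinear_def)

lemma m_sum: "m (sum f A) y = (\<Sum>a\<in>A. m (f a) y)" "m y (sum f A) = (\<Sum>a\<in>A. m y (f a))"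
  using linear_sum[OF m_linear(2)] linear_sum[OF m_linear(1)] by auto

lemma B_V: "b \<in> B \<Longrightarrow> b \<in> V" using B by auto

lemma linear_expand:
  assumes "linear l" "x \<in> V"
  shows "l x = (\<Sum>b\<in>B. c b x *\<^sub>R l b)"
proof -
  have "l x = l (\<Sum>b\<in>B. c b x *\<^sub>R b)" using c_expand[OF assms(2)] by simp
  also have "\<dots> = (\<Sum>b\<in>B. c b x *\<^sub>R l b)" by (simp add: linear_sum[OF assms(1)] linear_scale[OF assms(1)])
  finally show ?thesis .
qed

lemma c_sum: "b \<in> B \<Longrightarrow> c b (\<Sum>b\<in>B. a b *\<^sub>R b) = a b"
proof -
  assume b: "b \<in> B"
  have "c b (\<Sum>b\<in>B. a b *\<^sub>R b) = (\<Sum>b'\<in>B. a b' * c b b')"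
    by (simp add: linear_sum[OF c_linear[OF b]] linear_scale[OF c_linear[OF b]])
  also have "\<dots> = (\<Sum>b'\<in>B. if b = b' then a b' else 0)" using c_delta[OF b] by (intro sum.cong) auto
  also have "\<dots> = a b" using B(1) b by simp
  finally show ?thesis .
qed

lemma V_eqI: "x \<in> V \<Longrightarrow> y \<in> V \<Longrightarrow> (\<And>b. b \<in> B \<Longrightarrow> c b x = c b y) \<Longrightarrow> x = y"
  by (subst c_expand, assumption, subst (2) c_expand, assumption) (simp cong: sum.cong)

lemma functional_bounded:
  fixes l :: "'v \<Rightarrow> real"
  assumes "linear l"
  shows "\<exists>C\<ge>0. \<forall>x\<in>V. \<bar>l x\<bar> \<le> C * N x"
  using linear_bounded_on_span[OF B(1) _ assms, of N] N B(3) by simp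

lemma coord_bound: "\<exists>C\<ge>0. \<forall>x\<in>V. \<forall>b\<in>B. \<bar>c b x\<bar> \<le> C * N x"
proof -
  have "\<forall>b\<in>B. \<exists>C. C \<ge> 0 \<and> (\<forall>x\<in>V. \<bar>c b x\<bar> \<le> C * N x)" using functional_bounded[OF c_linear] by blast
  then obtain C where C: "\<And>b. b \<in> B \<Longrightarrow> C b \<ge> 0 \<and> (\<forall>x\<in>V. \<bar>c b x\<bar> \<le> C b * N x)"
    using bchoice[of B "\<lambda>b C. C \<ge> 0 \<and> (\<forall>x\<in>V. \<bar>c b x\<bar> \<le> C * N x)"] by blast
  have "\<bar>c b x\<bar> \<le> sum C B * N x" if "x \<in> V" "b \<in> B" for x b
  proof -
    have "\<bar>c b x\<bar> \<le> C b * N x" using C that by blast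
    also have "\<dots> \<le> sum C B * N x"
      using C B(1) that n(9) by (intro mult_right_mono member_le_sum) auto
    finally show ?thesis .
  qed
  moreover have "sum C B \<ge> 0" using C by (intro sum_nonneg) auto
  ultimately show ?thesis by blast
qed

lemma N_le_coord: "x \<in> V \<Longrightarrow> N x \<le> (\<Sum>b\<in>B. \<bar>c b x\<bar> * N b)"
  using n(11)[OF B(1), of "\<lambda>b. c b x *\<^sub>R b"] c_expand[of x] n(3) by simp

text \<open>The integral is taken coordinatewise: the type of values need not be second countable,
  so the Bochner integral is not available.\<close>

definition wint :: "'t measure \<Rightarrow> ('t \<Rightarrow> 'v) \<Rightarrow> 'v" where
  "wint M f = (\<Sum>b\<in>B. (\<integral>x. c b (f x) \<partial>M) *\<^sub>R b)"

definition nice :: "'t measure \<Rightarrow> ('t \<Rightarrow> 'v) \<Rightarrow> bool" where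
  "nice M f \<longleftrightarrow> (\<forall>x\<in>space M. f x \<in> V) \<and> (\<forall>b\<in>B. (\<lambda>x. c b (f x)) \<in> borel_measurable M) \<and>
     (\<exists>C. \<forall>x\<in>space M. N (f x) \<le> C)"

lemma wint_V: "wint M f \<in> V"
  unfolding wint_def by (intro V_closed) (auto intro: B_V)

lemma c_wint: "b \<in> B \<Longrightarrow> c b (wint M f) = (\<integral>x. c b (f x) \<partial>M)"
  unfolding wint_def by (rule c_sum)

lemma niceD:
  assumes "nice M f"
  shows "x \<in> space M \<Longrightarrow> f x \<in> V" "b \<in> B \<Longrightarrow> (\<lambda>x. c b (f x)) \<in> borel_measurable M"
    "\<exists>C\<ge>0. \<forall>x\<in>space M. N (f x) \<le> C"
proof -
  obtain C where "\<forall>x\<in>space M. N (f x) \<le> C" using assms by (auto simp: nice_def)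
  then have "\<forall>x\<in>space M. N (f x) \<le> max C 0" by auto
  then show "\<exists>C\<ge>0. \<forall>x\<in>space M. N (f x) \<le> C" by (intro exI[of _ "max C 0"]) auto
qed (use assms in \<open>auto simp: nice_def\<close>)

lemma nice_functional:
  fixes l :: "'v \<Rightarrow> real"
  assumes f: "nice M f" and l: "linear l"
  shows "(\<lambda>x. l (f x)) \<in> borel_measurable M" "\<exists>C. \<forall>x\<in>space M. \<bar>l (f x)\<bar> \<le> C"
proof -
  have "(\<lambda>x. \<Sum>b\<in>B. c b (f x) * l b) \<in> borel_measurable M"
    using niceD(2)[OF f] by (intro borel_measurable_sum borel_measurable_times) auto
  then show "(\<lambda>x. l (f x)) \<in> borel_measurable M"
    by (rule measurable_cong[THEN iffD1, rotated]) (use linear_expand[OF l niceD(1)[OF f]] in simp)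
  obtain C where C: "C \<ge> 0" "\<And>x. x \<in> V \<Longrightarrow> \<bar>l x\<bar> \<le> C * N x" using functional_bounded[OF l] by blast
  obtain C' where C': "\<forall>x\<in>space M. N (f x) \<le> C'" using niceD(3)[OF f] by blast
  have "\<bar>l (f x)\<bar> \<le> C * C'" if x: "x \<in> space M" for x
    using order_trans[OF C(2)[OF niceD(1)[OF f x]] mult_left_mono[OF _ C(1)]] C' x by blast
  then show "\<exists>C. \<forall>x\<in>space M. \<bar>l (f x)\<bar> \<le> C" by blast
qed

lemma nice_integrable:
  fixes l :: "'v \<Rightarrow> real"
  assumes "finite_measure M" "nice M f" "linear l"
  shows "integrable M (\<lambda>x. l (f x))"
proof -
  interpret finite_measure M by fact
  obtain C where "\<forall>x\<in>space M. \<bar>l (f x)\<bar> \<le> C" using nice_functional(2)[OF assms(2,3)] by blast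
  then show ?thesis using nice_functional(1)[OF assms(2,3)] by (intro integrable_const_bound[of _ C]) auto
qed

lemma functional_wint:
  fixes l :: "'v \<Rightarrow> real"
  assumes "finite_measure M" "nice M f" "linear l"
  shows "l (wint M f) = (\<integral>x. l (f x) \<partial>M)"
proof -
  have "l (wint M f) = (\<Sum>b\<in>B. (\<integral>x. c b (f x) \<partial>M) * l b)"
    unfolding wint_def by (simp add: linear_sum[OF assms(3)] linear_scale[OF assms(3)])
  also have "\<dots> = (\<integral>x. (\<Sum>b\<in>B. c b (f x) * l b) \<partial>M)"
    using nice_integrable[OF assms(1,2) c_linear] by (subst Bochner_Integration.integral_sum) auto
  also have "\<dots> = (\<integral>x. l (f x) \<partial>M)"
    by (rule Bochner_Integration.integral_cong) (use linear_expand[OF assms(3) niceD(1)[OF assms(2)]] in auto)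
  finally show ?thesis .
qed

lemma linear_wint:
  assumes M: "finite_measure M" and f: "nice M f" and L: "linear L" and LV: "\<And>x. x \<in> V \<Longrightarrow> L x \<in> V"
  shows "L (wint M f) = wint M (\<lambda>x. L (f x))"
proof (rule V_eqI)
  fix b assume b: "b \<in> B"
  have "linear (\<lambda>x. c b (L x))" using linear_compose[OF L c_linear[OF b]] by (simp add: o_def)
  then show "c b (L (wint M f)) = c b (wint M (\<lambda>x. L (f x)))"
    using functional_wint[OF M f, of "\<lambda>x. c b (L x)"] by (simp add: c_wint[OF b])
qed (auto intro: wint_V LV)

lemma wint_m_left: "finite_measure M \<Longrightarrow> nice M f \<Longrightarrow> m y (wint M f) = wint M (\<lambda>x. m y (f x))"
  by (rule linear_wint) (auto intro: m_linear m_V)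

lemma wint_m_right: "finite_measure M \<Longrightarrow> nice M f \<Longrightarrow> m (wint M f) y = wint M (\<lambda>x. m (f x) y)"
  by (rule linear_wint[where L="\<lambda>x. m x y"]) (auto intro: m_linear m_V)

lemma wint_scale: "wint M (\<lambda>x. r *\<^sub>R f x) = r *\<^sub>R wint M f"
  by (rule V_eqI) (auto simp: c_wint linear_scale[OF c_linear] intro!: wint_V V_closed)

lemma wint_diff: "finite_measure M \<Longrightarrow> nice M f \<Longrightarrow> nice M g \<Longrightarrow> wint M (\<lambda>x. f x - g x) = wint M f - wint M g"
  by (rule V_eqI) (auto simp: c_wint linear_diff[OF c_linear] nice_integrable[OF _ _ c_linear] intro!: wint_V V_closed)

lemma wint_sum: "finite_measure M \<Longrightarrow> (\<And>i. i \<in> A \<Longrightarrow> nice M (f i)) \<Longrightarrow> wint M (\<lambda>x. \<Sum>i\<in>A. f i x) = (\<Sum>i\<in>A. wint M (f i))"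
  by (rule V_eqI) (auto simp: c_wint linear_sum[OF c_linear] nice_integrable[OF _ _ c_linear] intro!: wint_V V_closed
      Bochner_Integration.integral_sum)

lemma wint_cong: "(\<And>x. x \<in> space M \<Longrightarrow> f x = g x) \<Longrightarrow> wint M f = wint M g"
  unfolding wint_def by (intro sum.cong refl arg_cong2[where f=scaleR] Bochner_Integration.integral_cong) auto

lemma wint_cong_AE:
  assumes "nice M f" "nice M g" "AE x in M. f x = g x"
  shows "wint M f = wint M g"
  unfolding wint_def
  by (intro sum.cong refl arg_cong2[where f=scaleR] integral_cong_AE niceD(2)[OF assms(1)] niceD(2)[OF assms(2)])
     (use assms(3) in auto)

lemma niceI:
  assumes "\<And>x. x \<in> space M \<Longrightarrow> f x \<in> V" "\<And>b. b \<in> B \<Longrightarrow> (\<lambda>x. c b (f x)) \<in> borel_measurable M"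
    "\<And>x. x \<in> space M \<Longrightarrow> N (f x) \<le> C"
  shows "nice M f"
  using assms by (auto simp: nice_def)

lemma nice_const: "x \<in> V \<Longrightarrow> nice M (\<lambda>_. x)"
  by (rule niceI[of _ _ "N x"]) auto

lemma nice_add: "nice M f \<Longrightarrow> nice M g \<Longrightarrow> nice M (\<lambda>x. f x + g x)"
proof -
  assume a: "nice M f" "nice M g"
  obtain C where "\<forall>x\<in>space M. N (f x) \<le> C" using niceD(3)[OF a(1)] by blast
  moreover obtain C' where "\<forall>x\<in>space M. N (g x) \<le> C'" using niceD(3)[OF a(2)] by blast
  ultimately show ?thesis
    by (intro niceI[of _ _ "C + C'"])
      (auto simp: linear_add[OF c_linear] intro!: V_closed niceD[OF a(1)] niceD[OF a(2)] borel_measurable_add order_trans[OF n(2)] add_mono)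
qed

lemma nice_scaleR:
  assumes f: "nice M f" and g: "g \<in> borel_measurable M" "\<And>x. x \<in> space M \<Longrightarrow> \<bar>g x\<bar> \<le> D"
  shows "nice M (\<lambda>x. g x *\<^sub>R f x)"
proof -
  obtain C where C: "C \<ge> 0" "\<forall>x\<in>space M. N (f x) \<le> C" using niceD(3)[OF f] by blast
  show ?thesis
  proof (rule niceI[of _ _ "D * C"])
    fix x assume x: "x \<in> space M"
    have "\<bar>g x\<bar> * N (f x) \<le> D * C" using g(2)[OF x] C x n(9) by (intro mult_mono) (auto intro: order_trans[OF abs_ge_zero])
    then show "N (g x *\<^sub>R f x) \<le> D * C" by (simp add: n(3))
  qed (auto simp: linear_scale[OF c_linear] intro!: V_closed niceD[OF f] borel_measurable_times g)
qed

lemma nice_indicator: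
  assumes "nice M f" "X \<in> sets M"
  shows "nice M (\<lambda>x. indicator X x *\<^sub>R f x)"
  by (rule nice_scaleR[OF assms(1), of _ 1]) (use assms(2) in \<open>auto simp: indicator_def\<close>)

lemma nice_scale: "nice M f \<Longrightarrow> nice M (\<lambda>x. r *\<^sub>R f x)"
  by (rule nice_scaleR[of _ _ "\<lambda>_. r" "\<bar>r\<bar>"]) auto

lemma nice_sum: "(\<And>i. i \<in> A \<Longrightarrow> nice M (f i)) \<Longrightarrow> nice M (\<lambda>x. \<Sum>i\<in>A. f i x)"
  by (induction A rule: infinite_finite_induct) (auto intro: nice_add nice_const V_closed)

lemma m_expand: "x \<in> V \<Longrightarrow> y \<in> V \<Longrightarrow> m x y = (\<Sum>b\<in>B. \<Sum>b'\<in>B. (c b x * c b' y) *\<^sub>R m b b')"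
  by (subst linear_expand[OF m_linear(2), of x], assumption, subst linear_expand[OF m_linear(1), of y], assumption)
    (simp add: scaleR_sum_right)

text \<open>Continuity of the product, in place of submultiplicativity of \<open>N\<close>.\<close>

lemma m_bounded: "\<exists>C\<ge>0. \<forall>x\<in>V. \<forall>y\<in>V. N (m x y) \<le> C * N x * N y"
proof -
  obtain D where D: "D \<ge> 0" "\<forall>x\<in>V. \<forall>b\<in>B. \<bar>c b x\<bar> \<le> D * N x" using coord_bound by blast
  define S where "S = (\<Sum>b\<in>B. \<Sum>b'\<in>B. N (m b b'))"
  have S: "S \<ge> 0" unfolding S_def by (intro sum_nonneg n(9))
  have "N (m x y) \<le> (D * D * S) * N x * N y" if "x \<in> V" "y \<in> V" for x y
  proof -
    have "N (m x y) \<le> (\<Sum>b\<in>B. \<Sum>b'\<in>B. \<bar>c b x * c b' y\<bar> * N (m b b'))"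
      unfolding m_expand[OF that]
      by (rule order_trans[OF n(11)[OF B(1)]], rule sum_mono, rule order_trans[OF n(11)[OF B(1)]]) (simp add: n(3))
    also have "\<dots> \<le> (\<Sum>b\<in>B. \<Sum>b'\<in>B. (D * N x * (D * N y)) * N (m b b'))"
      unfolding abs_mult using D that n(9) by (intro sum_mono mult_right_mono mult_mono) auto
    also have "\<dots> = (D * D * S) * N x * N y" unfolding S_def by (simp add: sum_distrib_left sum_distrib_right mult_ac)
    finally show ?thesis .
  qed
  moreover have "D * D * S \<ge> 0" using D S by simp
  ultimately show ?thesis by blast
qed

lemma nice_m:
  assumes f: "nice M f" and g: "nice M g"
  shows "nice M (\<lambda>x. m (f x) (g x))"
proof -
  obtain C where C: "C \<ge> 0" "\<forall>x\<in>space M. N (f x) \<le> C" using niceD(3)[OF f] by blast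
  obtain C' where C': "\<forall>x\<in>space M. N (g x) \<le> C'" using niceD(3)[OF g] by blast
  obtain D where D: "D \<ge> 0" "\<forall>x\<in>V. \<forall>y\<in>V. N (m x y) \<le> D * N x * N y" using m_bounded by blast
  show ?thesis
  proof (rule niceI[of _ _ "D * C * C'"])
    fix x assume x: "x \<in> space M"
    have "N (m (f x) (g x)) \<le> D * N (f x) * N (g x)" using D niceD(1)[OF f x] niceD(1)[OF g x] by blast
    also have "\<dots> \<le> D * C * C'" using C C' D x n(9) by (intro mult_mono mult_left_mono) auto
    finally show "N (m (f x) (g x)) \<le> D * C * C'" .
  next
    fix b assume b: "b \<in> B"
    have "(\<lambda>x. \<Sum>b'\<in>B. \<Sum>b''\<in>B. (c b' (f x) * c b'' (g x)) * c b (m b' b'')) \<in> borel_measurable M"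
      using niceD(2)[OF f] niceD(2)[OF g] by (intro borel_measurable_sum borel_measurable_times) auto
    then show "(\<lambda>x. c b (m (f x) (g x))) \<in> borel_measurable M"
      by (rule measurable_cong[THEN iffD1, rotated])
        (simp add: m_expand niceD(1)[OF f] niceD(1)[OF g] linear_sum[OF c_linear[OF b]] linear_scale[OF c_linear[OF b]])
  qed (rule m_V)
qed

text \<open>A functional that norms the integral reduces the bound to monotonicity of a real
  integral.\<close>

lemma wint_norm_le:
  assumes M: "finite_measure M" and f: "nice M f" and g: "integrable M g" "\<And>x. x \<in> space M \<Longrightarrow> N (f x) \<le> g x"
  shows "N (wint M f) \<le> (\<integral>x. g x \<partial>M)"
proof -
  obtain l where l: "linear l" "l (wint M f) = N (wint M f)" "\<And>x. x \<in> V \<Longrightarrow> l x \<le> N x"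
    using norming_functional[OF B(1), of N "wint M f"] N B(3) wint_V[of M f] by metis
  have "N (wint M f) = (\<integral>x. l (f x) \<partial>M)" using functional_wint[OF M f l(1)] l(2) by simp
  also have "\<dots> \<le> (\<integral>x. g x \<partial>M)"
    using nice_integrable[OF M f l(1)] g l(3) niceD(1)[OF f] by (intro integral_mono) (auto intro: order_trans)
  finally show ?thesis .
qed

lemma nice_wint:
  assumes M: "finite_measure M" and fV: "\<And>s r. s \<in> space K \<Longrightarrow> r \<in> space M \<Longrightarrow> f s r \<in> V"
    and meas: "\<And>b. b \<in> B \<Longrightarrow> (\<lambda>(s, r). c b (f s r)) \<in> borel_measurable (K \<Otimes>\<^sub>M M)"
    and bd: "\<And>s r. s \<in> space K \<Longrightarrow> r \<in> space M \<Longrightarrow> N (f s r) \<le> C"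
  shows "nice K (\<lambda>s. wint M (f s))"
proof (rule niceI[of _ _ "C * measure M (space M)"])
  interpret finite_measure M by fact
  fix s assume s: "s \<in> space K"
  have "nice M (f s)"
  proof (rule niceI[of _ _ C])
    fix b assume "b \<in> B"
    show "(\<lambda>x. c b (f s x)) \<in> borel_measurable M" using measurable_compose_Pair1[OF s meas[OF \<open>b \<in> B\<close>]] by simp
  qed (use s fV bd in auto)
  then have "N (wint M (f s)) \<le> (\<integral>x. C \<partial>M)" using bd[OF s] by (intro wint_norm_le M) auto
  then show "N (wint M (f s)) \<le> C * measure M (space M)" by (simp add: mult.commute)
next
  interpret finite_measure M by fact
  fix b assume "b \<in> B"
  then show "(\<lambda>x. c b (wint M (f x))) \<in> borel_measurable K"
    unfolding c_wint[OF \<open>b \<in> B\<close>] using meas by (intro borel_measurable_lebesgue_integral) simp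
qed (rule wint_V)

end

section \<open>Uniqueness of vector measures, and vector measures with a density\<close>

lemma vector_measure_empty:
  assumes "vector_measure M \<Phi>"
  shows "\<Phi> {} = 0"
proof -
  have "(\<lambda>i::nat. \<Phi> {}) sums \<Phi> (\<Union>i::nat. {})"
    using assms unfolding vector_measure_def by (elim allE[of _ "\<lambda>_::nat. {}"]) (simp add: disjoint_family_on_def)
  then have "summable (\<lambda>i::nat. \<Phi> {})" by (auto simp: sums_iff)
  then show ?thesis by (simp add: summable_const_iff)
qed

lemma vector_measure_Un:
  assumes v: "vector_measure M \<Phi>" and A: "A \<in> sets M" "A' \<in> sets M" "A \<inter> A' = {}"
  shows "\<Phi> (A \<union> A') = \<Phi> A + \<Phi> A'"
proof -
  define E where "E = (\<lambda>i::nat. if i = 0 then A else if i = 1 then A' else {})"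
  have "(\<lambda>i. \<Phi> (E i)) sums \<Phi> (\<Union>i. E i)"
  proof -
    have "disjoint_family E"
      unfolding disjoint_family_on_def E_def using A(3) by (intro ballI impI) (simp, blast)
    moreover have "range E \<subseteq> sets M" using A by (auto simp: E_def)
    ultimately show ?thesis using v unfolding vector_measure_def by blast
  qed
  moreover have "(\<Union>i. E i) = A \<union> A'" by (auto simp: E_def split: if_splits)
  moreover have "(\<lambda>i. \<Phi> (E i)) sums (\<Sum>i\<in>{0,1}. \<Phi> (E i))"
    by (rule sums_finite) (auto simp: E_def vector_measure_empty[OF v])
  ultimately show ?thesis using sums_unique2 by (fastforce simp: E_def)
qed

text \<open>Dynkin's argument on an intersection-stable generator. Applied to rectangles it
  justifies the definite description in \<open>product_measure_of\<close>.\<close>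

lemma vector_measure_unique:
  assumes v: "vector_measure M \<Phi>" "vector_measure M \<Psi>"
    and G: "Int_stable G" "G \<subseteq> Pow (space M)" "sets M = sigma_sets (space M) G"
    and eq: "\<And>X. X \<in> G \<Longrightarrow> \<Phi> X = \<Psi> X" "\<Phi> (space M) = \<Psi> (space M)" and X: "X \<in> sets M"
  shows "\<Phi> X = \<Psi> X"
proof -
  have "X \<in> sigma_sets (space M) G" using X G by simp
  from G(1,2) this show ?thesis
  proof (induction rule: sigma_sets_induct_disjoint)
    case (basic A)
    then show ?case by (rule eq)
  next
    case empty
    then show ?case using v by (simp add: vector_measure_empty)
  next
    case (compl A)
    have A: "A \<in> sets M" using compl G(3) by simp
    then have "A \<union> (space M - A) = space M" using sets.sets_into_space by blast
    then have "\<Phi> (space M) = \<Phi> A + \<Phi> (space M - A)" "\<Psi> (space M) = \<Psi> A + \<Psi> (space M - A)"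
      using vector_measure_Un[OF v(1) A, of "space M - A"] vector_measure_Un[OF v(2) A, of "space M - A"] A by auto
    then show ?case using compl eq by simp
  next
    case (union A)
    have "range A \<subseteq> sets M" using union(2) G(3) by auto
    then have "(\<lambda>i. \<Phi> (A i)) sums \<Phi> (\<Union>i. A i)" "(\<lambda>i. \<Psi> (A i)) sums \<Psi> (\<Union>i. A i)"
      using v union(1) unfolding vector_measure_def by auto
    moreover have "(\<lambda>i. \<Phi> (A i)) = (\<lambda>i. \<Psi> (A i))" using union(3) by simp
    ultimately show ?case using sums_unique2 by metis
  qed
qed

text \<open>Dominated convergence in each coordinate, with majorant
  \<open>\<bar>c b (f x)\<bar>\<close>; the finitely many scalar series are then recombined with the
  fixed vectors of \<open>B\<close>, so that convergence holds in the topology of the type.\<close>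

lemma (in fd_algebra) vector_measure_wint:
  assumes M: "finite_measure M" and f: "nice M f" and \<Phi>: "\<And>X. X \<in> sets M \<Longrightarrow> \<Phi> X = wint M (\<lambda>x. indicator X x *\<^sub>R f x)"
  shows "vector_measure M \<Phi>"
  unfolding vector_measure_def
proof (intro allI impI)
  fix E :: "nat \<Rightarrow> 'a set" assume E: "range E \<subseteq> sets M" "disjoint_family E"
  have U: "(\<Union>i. E i) \<in> sets M" using E(1) by auto
  have "(\<lambda>i. \<integral>x. indicator (E i) x * c b (f x) \<partial>M) sums (\<integral>x. indicator (\<Union>i. E i) x * c b (f x) \<partial>M)" if b: "b \<in> B" for b
  proof -
    have int: "integrable M (\<lambda>x. c b (f x))" by (rule nice_integrable[OF M f c_linear[OF b]])
    have inti: "integrable M (\<lambda>x. indicator X x * c b (f x))" if "X \<in> sets M" for X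
      using integrable_mult_indicator[OF that int] by simp
    have "(\<lambda>n. \<integral>x. (\<Sum>i<n. indicator (E i) x * c b (f x)) \<partial>M) \<longlonglongrightarrow> (\<integral>x. indicator (\<Union>i. E i) x * c b (f x) \<partial>M)"
    proof (rule integral_dominated_convergence[where w="\<lambda>x. \<bar>c b (f x)\<bar>"])
      have eq: "(\<Sum>i<n. indicator (E i) x * c b (f x)) = indicator (\<Union>i<n. E i) x * c b (f x)" for n x
      proof -
        have "(\<Sum>i<n. indicator (E i) x * c b (f x)) = (\<Sum>i<n. indicator (E i) x) * c b (f x)"
          by (simp add: sum_distrib_right)
        also have "(\<Sum>i<n. indicator (E i) x) = (indicator (\<Union>i<n. E i) x :: real)"
          by (rule indicator_UN_disjoint[symmetric]) (auto intro: disjoint_family_on_mono[OF _ E(2)])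
        finally show ?thesis .
      qed
      show "AE x in M. (\<lambda>n. \<Sum>i<n. indicator (E i) x * c b (f x)) \<longlonglongrightarrow> indicator (\<Union>i. E i) x * c b (f x)"
        unfolding eq by (intro AE_I2 tendsto_mult tendsto_const LIMSEQ_indicator_UN)
      show "AE x in M. norm (\<Sum>i<n. indicator (E i) x * c b (f x)) \<le> \<bar>c b (f x)\<bar>" for n
        unfolding eq by (intro AE_I2) (auto simp: indicator_def)
      show "(\<lambda>x. \<Sum>i<n. indicator (E i) x * c b (f x)) \<in> borel_measurable M" for n
        using inti E(1) by (intro borel_measurable_sum) auto
    qed (use inti[OF U] int in auto)
    also have "(\<lambda>n. \<integral>x. (\<Sum>i<n. indicator (E i) x * c b (f x)) \<partial>M) = (\<lambda>n. \<Sum>i<n. \<integral>x. indicator (E i) x * c b (f x) \<partial>M)"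
      using inti E(1) by (intro ext Bochner_Integration.integral_sum) auto
    finally show ?thesis by (simp add: sums_def)
  qed
  then have "(\<lambda>i. \<Sum>b\<in>B. (\<integral>x. indicator (E i) x * c b (f x) \<partial>M) *\<^sub>R b) sums (\<Sum>b\<in>B. (\<integral>x. indicator (\<Union>i. E i) x * c b (f x) \<partial>M) *\<^sub>R b)"
    by (intro sums_sum sums_scaleR_left)
  moreover have "\<Phi> X = (\<Sum>b\<in>B. (\<integral>x. indicator X x * c b (f x) \<partial>M) *\<^sub>R b)" if "X \<in> sets M" for X
    unfolding \<Phi>[OF that] wint_def by (intro sum.cong refl) (simp add: linear_scale[OF c_linear])
  ultimately show "(\<lambda>i. \<Phi> (E i)) sums \<Phi> (\<Union>i. E i)" using E(1) U by (simp add: image_subset_iff)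
qed

section \<open>Iterated integrals of a density\<close>

text \<open>The measure \<phi> is \<open>u\<close> times the positive measure \<nu>. The constant
  \<open>K\<close> bounds left multiplication by \<open>u t\<close> rather than
  \<open>N (u t)\<close>; in this form the locale also covers \<open>z \<phi>\<close> in the
  complexification, with the same \<nu> and with \<open>K\<close> multiplied by
  \<open>cmod z\<close>.\<close>

locale ordered_density = fd_algebra V m e N B c
  for V :: "'v::real_normed_vector set" and m e N B c +
  fixes I :: "real set" and \<nu> :: "real measure" and u :: "real \<Rightarrow> 'v" and \<phi> :: "real set \<Rightarrow> 'v" and K :: real
  assumes sets_\<nu>: "sets \<nu> = sets (borel_on I)" and finite_\<nu>: "finite_measure \<nu>"
    and atomless: "t \<in> I \<Longrightarrow> emeasure \<nu> {t} = 0"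
    and u_V: "t \<in> I \<Longrightarrow> u t \<in> V"
    and u_meas: "b \<in> B \<Longrightarrow> (\<lambda>t. c b (u t)) \<in> borel_measurable \<nu>"
    and K: "0 \<le> K" and mult_u: "t \<in> I \<Longrightarrow> N (m (u t) x) \<le> K * N x"
    and \<phi>: "E \<in> sets \<nu> \<Longrightarrow> \<phi> E = wint \<nu> (\<lambda>t. indicator E t *\<^sub>R u t)"
begin

lemma space_\<nu>: "space \<nu> = I"
  using sets_eq_imp_space_eq[OF sets_\<nu>] by (simp add: space_restrict_space)

sublocale \<nu>: finite_measure \<nu> by (rule finite_\<nu>)

sublocale P: product_sigma_finite "\<lambda>_::nat. \<nu>" by standard

lemma u_nice: "nice \<nu> u"
proof (rule niceI[of _ _ "K * N e"])
  fix t assume "t \<in> space \<nu>"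
  then show "N (u t) \<le> K * N e" using mult_u[of t e] u_V[of t] by (simp add: space_\<nu> m_e)
qed (auto simp: space_\<nu> u_V u_meas)

lemma id_meas: "(\<lambda>x. x) \<in> borel_measurable \<nu>"
  by (subst measurable_cong_sets[OF sets_\<nu> refl]) (intro measurable_restrict_space1 measurable_ident_sets refl)

abbreviation "PV n \<equiv> PiM {..<n} (\<lambda>_::nat. \<nu>)"

lemma sets_PV: "sets (PV n) = sets (power_space I n)"
  by (rule sets_PiM_cong) (auto simp: sets_\<nu>)

lemma space_PV: "space (PV n) = space (power_space I n)"
  by (rule sets_eq_imp_space_eq[OF sets_PV])

lemma finite_PV: "finite_measure (PV n)"
proof
  interpret finite_product_sigma_finite "\<lambda>_::nat. \<nu>" "{..<n}" by standard simp
  have "emeasure (PV n) (space (PV n)) = (\<Prod>i\<in>{..<n}. emeasure \<nu> (space \<nu>))"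
    unfolding space_PiM by (rule measure_times) auto
  also have "\<dots> \<noteq> \<infinity>" by (simp add: \<nu>.emeasure_eq_measure ennreal_power)
  finally show "emeasure (PV n) (space (PV n)) \<noteq> \<infinity>" .
qed

lemma PV_component: "t \<in> space (PV n) \<Longrightarrow> i < n \<Longrightarrow> t i \<in> I"
  by (auto simp: space_PiM space_\<nu>)

lemma component_meas: "i < n \<Longrightarrow> (\<lambda>t. t i) \<in> measurable (PV n) \<nu>"
  by (rule measurable_component_singleton) simp

lemma component_borel: "i < n \<Longrightarrow> (\<lambda>t. t i) \<in> borel_measurable (PV n)"
  using measurable_compose[OF component_meas id_meas] .

definition Uk :: "nat \<Rightarrow> (nat \<Rightarrow> real) \<Rightarrow> 'v" where
  "Uk k t = foldr m (map (\<lambda>i. u (t i)) [0..<k]) e"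

lemma foldr_V: "foldr m xs e \<in> V"
  by (cases xs) (auto simp: e_V m_V)

lemma Uk_V: "Uk k t \<in> V" unfolding Uk_def by (rule foldr_V)

lemma foldr_snoc: "x \<in> V \<Longrightarrow> foldr m (xs @ [x]) e = m (foldr m xs e) x"
  by (induction xs) (auto simp: m_e m_assoc)

lemma Uk_Suc: "t k \<in> I \<Longrightarrow> Uk (Suc k) t = m (Uk k t) (u (t k))"
  unfolding Uk_def by (simp add: foldr_snoc[OF u_V] del: foldr_append)

lemma Uk_cong: "(\<And>i. i < k \<Longrightarrow> t i = t' i) \<Longrightarrow> Uk k t = Uk k t'"
  unfolding Uk_def by (intro arg_cong[where f="\<lambda>xs. foldr m xs e"] map_cong) auto

lemma u_component_nice: "i < n \<Longrightarrow> nice (PV n) (\<lambda>t. u (t i))"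
proof -
  assume i: "i < n"
  obtain C where "\<forall>x\<in>space \<nu>. N (u x) \<le> C" using niceD(3)[OF u_nice] by blast
  then show ?thesis
    using measurable_compose[OF component_meas[OF i] u_meas] i
    by (intro niceI[of _ _ C]) (auto simp: space_\<nu> PV_component u_V)
qed

lemma Uk_nice: "k \<le> n \<Longrightarrow> nice (PV n) (Uk k)"
proof (induction k)
  case 0
  then show ?case by (simp add: Uk_def nice_const e_V)
next
  case (Suc k)
  have "nice (PV n) (\<lambda>t. m (Uk k t) (u (t k)))" using Suc by (intro nice_m u_component_nice) auto
  moreover have "Uk (Suc k) t = m (Uk k t) (u (t k))" if "t \<in> space (PV n)" for t
    using PV_component[OF that, of k] Suc by (intro Uk_Suc) auto
  ultimately show ?case unfolding nice_def by (simp cong: measurable_cong)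
qed

lemma wint_PV_Suc:
  assumes "nice (PV (Suc k)) f"
  shows "wint (PV (Suc k)) f = wint (PV k) (\<lambda>t. wint \<nu> (\<lambda>r. f (t(k := r))))"
proof (rule V_eqI)
  fix b assume b: "b \<in> B"
  have "integrable (PiM (insert k {..<k}) (\<lambda>_. \<nu>)) (\<lambda>t. c b (f t))"
    using nice_integrable[OF finite_PV assms c_linear[OF b]] by (simp add: lessThan_Suc)
  then show "c b (wint (PV (Suc k)) f) = c b (wint (PV k) (\<lambda>t. wint \<nu> (\<lambda>r. f (t(k := r)))))"
    using P.product_integral_insert[of "{..<k}" k "\<lambda>t. c b (f t)"] by (simp add: c_wint[OF b] lessThan_Suc)
qed (auto intro: wint_V)

lemma wint_PiM_empty: "f (\<lambda>_. undefined) \<in> V \<Longrightarrow> wint (PiM {} (\<lambda>_. \<nu>)) f = f (\<lambda>_. undefined)"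
  by (rule V_eqI) (auto simp: c_wint PiM_empty lebesgue_integral_count_space_finite intro: wint_V)

definition \<Phi> :: "nat \<Rightarrow> (nat \<Rightarrow> real) set \<Rightarrow> 'v" where
  "\<Phi> k X = (if X \<in> sets (PV k) then wint (PV k) (\<lambda>t. indicator X t *\<^sub>R Uk k t) else 0)"

text \<open>Fubini integrates out the last variable, whose factor leaves the product on the right by
  associativity.\<close>

lemma \<Phi>_rectangle:
  assumes "\<And>i. i < k \<Longrightarrow> E i \<in> sets \<nu>"
  shows "\<Phi> k (\<Pi>\<^sub>E i\<in>{..<k}. E i) = foldr m (map (\<lambda>i. \<phi> (E i)) [0..<k]) e"
  using assms
proof (induction k)
  case 0
  then show ?case
    by (simp add: \<Phi>_def Uk_def sets_PiM_empty wint_PiM_empty e_V)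
next
  case (Suc k)
  let ?X = "\<lambda>k. \<Pi>\<^sub>E i\<in>{..<k}. E i"
  have X: "?X k \<in> sets (PV k)" "?X (Suc k) \<in> sets (PV (Suc k))" using Suc.prems by (auto intro!: sets_PiM_I_finite)
  have nu: "nice \<nu> (\<lambda>r. indicator (E k) r *\<^sub>R u r)" using Suc.prems by (intro nice_indicator u_nice) auto
  have inner: "wint \<nu> (\<lambda>r. indicator (?X (Suc k)) (t(k := r)) *\<^sub>R Uk (Suc k) (t(k := r)))
      = m (indicator (?X k) t *\<^sub>R Uk k t) (\<phi> (E k))" if t: "t \<in> space (PV k)" for t
  proof -
    have "indicator (?X (Suc k)) (t(k := r)) *\<^sub>R Uk (Suc k) (t(k := r))
      = m (indicator (?X k) t *\<^sub>R Uk k t) (indicator (E k) r *\<^sub>R u r)" if r: "r \<in> space \<nu>" for r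
    proof -
      have "t(k := r) \<in> ?X (Suc k) \<longleftrightarrow> t \<in> ?X k \<and> r \<in> E k"
        using t by (auto simp: space_PiM PiE_def extensional_def Pi_def less_Suc_eq)
      then have "indicator (?X (Suc k)) (t(k := r)) = indicator (?X k) t * (indicator (E k) r :: real)"
        by (simp add: indicator_def)
      moreover have "Uk (Suc k) (t(k := r)) = m (Uk k t) (u r)"
        using Uk_Suc[of "t(k := r)" k] Uk_cong[of k "t(k := r)" t] r by (simp add: space_\<nu>)
      ultimately show ?thesis by (simp add: m_simps)
    qed
    then have "wint \<nu> (\<lambda>r. indicator (?X (Suc k)) (t(k := r)) *\<^sub>R Uk (Suc k) (t(k := r)))
      = wint \<nu> (\<lambda>r. m (indicator (?X k) t *\<^sub>R Uk k t) (indicator (E k) r *\<^sub>R u r))" by (rule wint_cong)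
    also have "\<dots> = m (indicator (?X k) t *\<^sub>R Uk k t) (\<phi> (E k))"
      using \<phi>[of "E k"] Suc.prems by (simp add: wint_m_left[OF finite_\<nu> nu])
    finally show ?thesis .
  qed
  have "\<Phi> (Suc k) (?X (Suc k)) = wint (PV k) (\<lambda>t. m (indicator (?X k) t *\<^sub>R Uk k t) (\<phi> (E k)))"
    using X inner unfolding \<Phi>_def
    by (simp add: wint_PV_Suc[OF nice_indicator[OF Uk_nice X(2)]] cong: wint_cong)
  also have "\<dots> = m (\<Phi> k (?X k)) (\<phi> (E k))"
    using X by (simp add: \<Phi>_def wint_m_right[OF finite_PV nice_indicator[OF Uk_nice]])
  also have "\<dots> = foldr m (map (\<lambda>i. \<phi> (E i)) [0..<Suc k]) e"
  proof -
    have "\<phi> (E k) \<in> V" using \<phi>[of "E k"] Suc.prems by (simp add: wint_V)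
    then show ?thesis using Suc by (simp add: foldr_snoc del: foldr_append)
  qed
  finally show ?case .
qed

lemma vector_measure_\<Phi>: "vector_measure (power_space I k) (\<Phi> k)"
proof -
  have "vector_measure (PV k) (\<Phi> k)"
    by (rule vector_measure_wint[OF finite_PV Uk_nice]) (auto simp: \<Phi>_def)
  then show ?thesis by (simp add: vector_measure_def sets_PV)
qed

lemma product_measure_of_eq: "product_measure_of m e I \<phi> k = \<Phi> k"
  unfolding product_measure_of_def
proof (rule the_equality, intro conjI allI impI)
  show "vector_measure (power_space I k) (\<Phi> k)" by (rule vector_measure_\<Phi>)
  show "\<Phi> k (\<Pi>\<^sub>E i\<in>{..<k}. E i) = foldr m (map (\<lambda>i. \<phi> (E i)) [0..<k]) e"
    if "\<forall>i<k. E i \<in> sets (borel_on I)" for E using that by (intro \<Phi>_rectangle) (simp add: sets_\<nu>)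
  show "\<Phi> k X = 0" if "X \<notin> sets (power_space I k)" for X using that by (simp add: \<Phi>_def sets_PV)
next
  fix \<Psi> assume \<Psi>: "vector_measure (power_space I k) \<Psi> \<and>
        (\<forall>E. (\<forall>i<k. E i \<in> sets (borel_on I)) \<longrightarrow>
           \<Psi> (\<Pi>\<^sub>E i\<in>{..<k}. E i) = foldr m (map (\<lambda>i. \<phi> (E i)) [0..<k]) e) \<and>
        (\<forall>X. X \<notin> sets (power_space I k) \<longrightarrow> \<Psi> X = 0)"
  let ?G = "prod_algebra {..<k} (\<lambda>_. borel_on I)"
  have rect: "\<Psi> X = \<Phi> k X" if XG: "X \<in> ?G" for X
  proof -
    obtain E where E: "X = Pi\<^sub>E {..<k} E" "E \<in> (\<Pi> i\<in>{..<k}. sets (borel_on I))" using prod_algebraE_all[OF XG] by blast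
    then have "\<forall>i<k. E i \<in> sets (borel_on I)" by auto
    then show ?thesis using \<Psi> \<Phi>_rectangle[of k E] by (simp add: E(1) sets_\<nu>)
  qed
  have sp: "space (power_space I k) \<in> ?G" unfolding space_PiM by (rule prod_algebraI_finite) auto
  have "\<Psi> X = \<Phi> k X" if X: "X \<in> sets (power_space I k)" for X
  proof (rule vector_measure_unique[OF _ vector_measure_\<Phi> Int_stable_prod_algebra _ _ rect _ X])
    show "?G \<subseteq> Pow (space (power_space I k))" unfolding space_PiM by (rule prod_algebra_sets_into_space)
    show "sets (power_space I k) = sigma_sets (space (power_space I k)) ?G" unfolding space_PiM by (rule sets_PiM)
  qed (use \<Psi> rect[OF sp] in auto)
  moreover have "\<Psi> X = \<Phi> k X" if "X \<notin> sets (power_space I k)" for X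
    using that \<Psi> by (simp add: \<Phi>_def sets_PV)
  ultimately show "\<Psi> = \<Phi> k" by blast
qed

section \<open>Chains of weights as iterated kernel operators\<close>

definition kernel_op :: "(real \<Rightarrow> real \<Rightarrow> real) \<Rightarrow> (real \<Rightarrow> 'v) \<Rightarrow> real \<Rightarrow> 'v" where
  "kernel_op \<kappa> G s = wint \<nu> (\<lambda>r. \<kappa> s r *\<^sub>R m (u r) (G r))"

lemma kernel_op_cong: "(\<And>r. r \<in> I \<Longrightarrow> G r = G' r) \<Longrightarrow> kernel_op \<kappa> G s = kernel_op \<kappa> G' s"
  unfolding kernel_op_def by (rule wint_cong) (simp add: space_\<nu>)

definition good_kernel :: "(real \<Rightarrow> real \<Rightarrow> real) \<Rightarrow> bool" where
  "good_kernel \<kappa> \<longleftrightarrow> (\<lambda>p. \<kappa> (fst p) (snd p)) \<in> borel_measurable (borel \<Otimes>\<^sub>M borel) \<and> (\<exists>D. \<forall>s r. \<bar>\<kappa> s r\<bar> \<le> D)"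

lemma kernel_nice:
  assumes "good_kernel \<kappa>" "nice \<nu> G"
  shows "nice \<nu> (\<lambda>r. \<kappa> s r *\<^sub>R m (u r) (G r))"
proof -
  obtain D where D: "\<forall>s r. \<bar>\<kappa> s r\<bar> \<le> D" using assms by (auto simp: good_kernel_def)
  have "(\<lambda>r. (s, r)) \<in> measurable \<nu> (borel \<Otimes>\<^sub>M borel)" by (intro measurable_Pair id_meas) simp
  moreover have "(\<lambda>p. \<kappa> (fst p) (snd p)) \<in> borel_measurable (borel \<Otimes>\<^sub>M borel)"
    using assms(1) unfolding good_kernel_def by blast
  ultimately have "(\<lambda>r. \<kappa> (fst (s, r)) (snd (s, r))) \<in> borel_measurable \<nu>" by (rule measurable_compose)
  then have "(\<lambda>r. \<kappa> s r) \<in> borel_measurable \<nu>" by (simp only: fst_conv snd_conv)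
  then show ?thesis using D by (intro nice_scaleR[OF nice_m[OF u_nice assms(2)], of _ D]) auto
qed

lemma kernel_op_nice_on:
  assumes \<kappa>: "good_kernel \<kappa>" and G: "nice \<nu> G" and M: "(\<lambda>x. x) \<in> borel_measurable M"
  shows "nice M (kernel_op \<kappa> G)"
proof -
  obtain D where D: "\<forall>s r. \<bar>\<kappa> s r\<bar> \<le> D" using \<kappa> by (auto simp: good_kernel_def)
  have uG: "nice \<nu> (\<lambda>r. m (u r) (G r))" by (intro nice_m u_nice G)
  then obtain C where C: "C \<ge> 0" "\<forall>x\<in>space \<nu>. N (m (u x) (G x)) \<le> C" using niceD(3)[OF uG] by blast
  have "(\<lambda>p. (fst p, snd p)) \<in> measurable (M \<Otimes>\<^sub>M \<nu>) (borel \<Otimes>\<^sub>M borel)"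
    by (intro measurable_Pair measurable_compose[OF measurable_fst M] measurable_compose[OF measurable_snd id_meas])
  moreover have "(\<lambda>p. \<kappa> (fst p) (snd p)) \<in> borel_measurable (borel \<Otimes>\<^sub>M borel)"
    using \<kappa> unfolding good_kernel_def by blast
  ultimately have "(\<lambda>p. \<kappa> (fst (fst p, snd p)) (snd (fst p, snd p))) \<in> borel_measurable (M \<Otimes>\<^sub>M \<nu>)"
    by (rule measurable_compose)
  then have \<kappa>m: "(\<lambda>p. \<kappa> (fst p) (snd p)) \<in> borel_measurable (M \<Otimes>\<^sub>M \<nu>)" by (simp only: fst_conv snd_conv)
  show ?thesis unfolding kernel_op_def
  proof (rule nice_wint[OF finite_\<nu>, of _ _ "D * C"])
    fix b assume b: "b \<in> B"
    have "(\<lambda>p. \<kappa> (fst p) (snd p) * c b (m (u (snd p)) (G (snd p)))) \<in> borel_measurable (M \<Otimes>\<^sub>M \<nu>)"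
      by (intro borel_measurable_times \<kappa>m measurable_compose[OF measurable_snd niceD(2)[OF uG b]])
    then show "(\<lambda>(s, r). c b (\<kappa> s r *\<^sub>R m (u r) (G r))) \<in> borel_measurable (M \<Otimes>\<^sub>M \<nu>)"
      by (simp add: linear_scale[OF c_linear[OF b]] case_prod_beta)
  next
    fix s r assume "r \<in> space \<nu>"
    then show "N (\<kappa> s r *\<^sub>R m (u r) (G r)) \<le> D * C"
      unfolding n(3) using D C n(9) by (intro mult_mono) (auto intro: order_trans[OF abs_ge_zero])
  qed (auto intro!: V_closed m_V)
qed

lemma kernel_op_nice: "good_kernel \<kappa> \<Longrightarrow> nice \<nu> G \<Longrightarrow> nice \<nu> (kernel_op \<kappa> G)"
  using kernel_op_nice_on id_meas by blast

lemma kernel_iter_nice: "good_kernel \<kappa> \<Longrightarrow> nice \<nu> G \<Longrightarrow> nice \<nu> ((kernel_op \<kappa> ^^ k) G)"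
  by (induction k) (auto intro: kernel_op_nice)

definition chain :: "(real \<Rightarrow> real \<Rightarrow> real) \<Rightarrow> nat \<Rightarrow> (nat \<Rightarrow> real) \<Rightarrow> real" where
  "chain \<kappa> k t = (\<Prod>i<k. \<kappa> (t i) (t (Suc i)))"

lemma chain_nice:
  assumes \<kappa>: "good_kernel \<kappa>" and f: "nice (PV (Suc k)) f"
  shows "nice (PV (Suc k)) (\<lambda>t. chain \<kappa> k t *\<^sub>R f t)"
proof -
  obtain D where D: "\<forall>s r. \<bar>\<kappa> s r\<bar> \<le> D" using \<kappa> by (auto simp: good_kernel_def)
  have "(\<lambda>t. \<kappa> (t i) (t (Suc i))) \<in> borel_measurable (PV (Suc k))" if "i < k" for i
  proof -
    have "(\<lambda>t. (t i, t (Suc i))) \<in> measurable (PV (Suc k)) (borel \<Otimes>\<^sub>M borel)"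
      using that by (intro measurable_Pair component_borel) auto
    moreover have "(\<lambda>p. \<kappa> (fst p) (snd p)) \<in> borel_measurable (borel \<Otimes>\<^sub>M borel)"
      using \<kappa> unfolding good_kernel_def by blast
    ultimately have "(\<lambda>t. \<kappa> (fst (t i, t (Suc i))) (snd (t i, t (Suc i)))) \<in> borel_measurable (PV (Suc k))"
      by (rule measurable_compose)
    then show ?thesis by (simp only: fst_conv snd_conv)
  qed
  moreover have "\<bar>chain \<kappa> k t\<bar> \<le> D ^ k" for t
  proof -
    have "\<bar>chain \<kappa> k t\<bar> \<le> (\<Prod>i<k. D)" unfolding chain_def abs_prod using D by (intro prod_mono) auto
    then show ?thesis by simp
  qed
  ultimately show ?thesis
    by (intro nice_scaleR[OF f, of _ "D ^ k"]) (auto simp: chain_def intro!: borel_measurable_prod)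
qed

text \<open>The weight of a chain couples only neighbouring variables, so integrating out the last
  one replaces \<open>G\<close> by \<open>kernel_op \<kappa> G\<close>. An integral over
  \<open>k + 1\<close> variables thus becomes the \<open>k\<close>-th iterate of one operator
  followed by a single integral, a form in which recursions can be derived.\<close>

lemma wint_chain:
  assumes \<kappa>: "good_kernel \<kappa>" and "nice \<nu> G"
  shows "wint (PV (Suc k)) (\<lambda>t. chain \<kappa> k t *\<^sub>R m (Uk (Suc k) t) (G (t k)))
     = wint \<nu> (\<lambda>s. m (u s) ((kernel_op \<kappa> ^^ k) G s))"
  using assms(2)
proof (induction k arbitrary: G)
  case 0
  have nc: "nice (PV (Suc 0)) (\<lambda>t. chain \<kappa> 0 t *\<^sub>R m (Uk (Suc 0) t) (G (t 0)))"
  proof (intro chain_nice \<kappa> nice_m Uk_nice)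
    obtain C where "\<forall>x\<in>space \<nu>. N (G x) \<le> C" using niceD(3)[OF 0] by blast
    then show "nice (PV (Suc 0)) (\<lambda>t. G (t 0))"
      using measurable_compose[OF component_meas niceD(2)[OF 0]] PV_component[of _ "Suc 0" 0] niceD(1)[OF 0]
      by (intro niceI[of _ _ C]) (auto simp: space_\<nu>)
  qed simp
  have "Uk (Suc 0) (t(0 := r)) = u r" if "r \<in> I" for r t
    using that by (simp add: Uk_def m_e u_V)
  then have "wint \<nu> (\<lambda>r. chain \<kappa> 0 (t(0 := r)) *\<^sub>R m (Uk (Suc 0) (t(0 := r))) (G ((t(0 := r)) 0))) = wint \<nu> (\<lambda>s. m (u s) (G s))" for t
    by (intro wint_cong) (simp add: chain_def space_\<nu>)
  then show ?case by (simp add: wint_PV_Suc[OF nc] wint_PiM_empty wint_V)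
next
  case (Suc k)
  have nc: "nice (PV (Suc (Suc k))) (\<lambda>t. chain \<kappa> (Suc k) t *\<^sub>R m (Uk (Suc (Suc k)) t) (G (t (Suc k))))"
  proof (intro chain_nice \<kappa> nice_m Uk_nice)
    obtain C where "\<forall>x\<in>space \<nu>. N (G x) \<le> C" using niceD(3)[OF Suc.prems] by blast
    then show "nice (PV (Suc (Suc k))) (\<lambda>t. G (t (Suc k)))"
      using measurable_compose[OF component_meas niceD(2)[OF Suc.prems]] PV_component[of _ "Suc (Suc k)" "Suc k"] niceD(1)[OF Suc.prems]
      by (intro niceI[of _ _ C]) (auto simp: space_\<nu>)
  qed simp
  have "wint \<nu> (\<lambda>r. chain \<kappa> (Suc k) (t(Suc k := r)) *\<^sub>R m (Uk (Suc (Suc k)) (t(Suc k := r))) (G ((t(Suc k := r)) (Suc k))))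
     = chain \<kappa> k t *\<^sub>R m (Uk (Suc k) t) (kernel_op \<kappa> G (t k))" for t
  proof -
    have "wint \<nu> (\<lambda>r. chain \<kappa> (Suc k) (t(Suc k := r)) *\<^sub>R m (Uk (Suc (Suc k)) (t(Suc k := r))) (G ((t(Suc k := r)) (Suc k))))
      = wint \<nu> (\<lambda>r. chain \<kappa> k t *\<^sub>R m (Uk (Suc k) t) (\<kappa> (t k) r *\<^sub>R m (u r) (G r)))"
    proof (rule wint_cong)
      fix r assume r: "r \<in> space \<nu>"
      have "chain \<kappa> (Suc k) (t(Suc k := r)) = chain \<kappa> k t * \<kappa> (t k) r" unfolding chain_def by simp
      moreover have "Uk (Suc (Suc k)) (t(Suc k := r)) = m (Uk (Suc k) t) (u r)"
        using Uk_Suc[of "t(Suc k := r)" "Suc k"] Uk_cong[of "Suc k" "t(Suc k := r)" t] r by (simp add: space_\<nu>)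
      ultimately show "chain \<kappa> (Suc k) (t(Suc k := r)) *\<^sub>R m (Uk (Suc (Suc k)) (t(Suc k := r))) (G ((t(Suc k := r)) (Suc k)))
         = chain \<kappa> k t *\<^sub>R m (Uk (Suc k) t) (\<kappa> (t k) r *\<^sub>R m (u r) (G r))"
        by (simp add: m_simps m_assoc)
    qed
    also have "\<dots> = chain \<kappa> k t *\<^sub>R m (Uk (Suc k) t) (kernel_op \<kappa> G (t k))"
      unfolding kernel_op_def wint_scale by (simp add: wint_m_left[OF finite_\<nu> kernel_nice[OF \<kappa> Suc.prems]])
    finally show ?thesis .
  qed
  then have "wint (PV (Suc (Suc k))) (\<lambda>t. chain \<kappa> (Suc k) t *\<^sub>R m (Uk (Suc (Suc k)) t) (G (t (Suc k))))
     = wint (PV (Suc k)) (\<lambda>t. chain \<kappa> k t *\<^sub>R m (Uk (Suc k) t) (kernel_op \<kappa> G (t k)))"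
    by (simp add: wint_PV_Suc[OF nc])
  also have "\<dots> = wint \<nu> (\<lambda>s. m (u s) ((kernel_op \<kappa> ^^ Suc k) G s))"
    using Suc.IH[OF kernel_op_nice[OF \<kappa> Suc.prems]] by (simp add: funpow_swap1)
  finally show ?case .
qed

definition kle :: "real \<Rightarrow> real \<Rightarrow> real" where "kle s r = of_bool (s \<le> r)"

text \<open>This weighting produces the coefficients of the integrand
  \<open>(A - 1) / (l + (1 - l) A)\<close> of the logarithm, with \<open>A\<close> the time-ordered
  exponential. The reason is that \<open>klam l\<close> differs from the time-ordered kernel
  \<open>kle\<close> by the constant \<open>1 - l\<close> only.\<close>

definition klam :: "real \<Rightarrow> real \<Rightarrow> real \<Rightarrow> real" where "klam l s r = (if s \<le> r then l else l - 1)"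

lemma good_kle: "good_kernel kle"
proof -
  have "(\<lambda>p. kle (fst p) (snd p)) \<in> borel_measurable (borel \<Otimes>\<^sub>M borel)" unfolding kle_def of_bool_def
    by (intro measurable_If borel_measurable_const borel_measurable_le measurable_fst measurable_snd) 
  then show ?thesis unfolding good_kernel_def by (auto simp: kle_def intro!: exI[of _ 1])
qed

lemma good_klam: "good_kernel (klam l)"
proof -
  have "(\<lambda>p. klam l (fst p) (snd p)) \<in> borel_measurable (borel \<Otimes>\<^sub>M borel)" unfolding klam_def
    by (intro measurable_If borel_measurable_const borel_measurable_le measurable_fst measurable_snd)
  then show ?thesis unfolding good_kernel_def by (auto simp: klam_def intro!: exI[of _ "\<bar>l\<bar> + \<bar>l - 1\<bar>"])
qed

definition total :: "(real \<Rightarrow> real \<Rightarrow> real) \<Rightarrow> nat \<Rightarrow> 'v" where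
  "total \<kappa> k = wint \<nu> (\<lambda>s. m (u s) ((kernel_op \<kappa> ^^ k) (\<lambda>_. e) s))"

lemma total_V: "total \<kappa> k \<in> V" unfolding total_def by (rule wint_V)

lemma total_eq: "good_kernel \<kappa> \<Longrightarrow> total \<kappa> k = wint (PV (Suc k)) (\<lambda>t. chain \<kappa> k t *\<^sub>R Uk (Suc k) t)"
  unfolding total_def by (subst wint_chain[symmetric]) (auto intro!: nice_const e_V wint_cong simp: m_e Uk_V)

lemma time_ordered_exp_eq: "time_ordered_exp m e I \<phi> = e + (\<Sum>k. total kle k)"
proof -
  have "product_measure_of m e I \<phi> (Suc k) {t \<in> space (power_space I (Suc k)). \<forall>i<k. t i \<le> t (Suc i)} = total kle k" for k
  proof -
    let ?X = "{t \<in> space (PV (Suc k)). \<forall>i<k. t i \<le> t (Suc i)}"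
    have "{t \<in> space (PV (Suc k)). t i \<le> t (Suc i)} \<in> sets (PV (Suc k))" if "i < k" for i
      by (rule borel_measurable_le) (use that in \<open>auto intro: component_borel\<close>)
    then have "{t \<in> space (PV (Suc k)). \<forall>i\<in>{..<k}. t i \<le> t (Suc i)} \<in> sets (PV (Suc k))"
      by (intro sets.sets_Collect_finite_All) auto
    then have X: "?X \<in> sets (PV (Suc k))" unfolding Ball_def lessThan_iff .
    have "chain kle k t = indicator ?X t" if t: "t \<in> space (PV (Suc k))" for t
    proof (cases "\<forall>i<k. t i \<le> t (Suc i)")
      case True
      then have "chain kle k t = 1" by (simp add: chain_def kle_def)
      then show ?thesis using t True by simp
    next
      case False
      then obtain i where "i < k" "\<not> t i \<le> t (Suc i)" by blast
      then have "chain kle k t = 0" unfolding chain_def by (intro prod_zero) (auto simp: kle_def)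
      then show ?thesis using t False by simp
    qed
    note ch = this
    have "product_measure_of m e I \<phi> (Suc k) {t \<in> space (power_space I (Suc k)). \<forall>i<k. t i \<le> t (Suc i)} = \<Phi> (Suc k) ?X"
      by (simp only: product_measure_of_eq space_PV)
    also have "\<dots> = wint (PV (Suc k)) (\<lambda>t. indicator ?X t *\<^sub>R Uk (Suc k) t)"
      unfolding \<Phi>_def using X by (rule if_P)
    also have "\<dots> = wint (PV (Suc k)) (\<lambda>t. chain kle k t *\<^sub>R Uk (Suc k) t)"
      by (rule wint_cong) (simp only: ch)
    also have "\<dots> = total kle k" by (rule total_eq[OF good_kle, symmetric])
    finally show ?thesis .
  qed
  then show ?thesis by (simp add: time_ordered_exp_def)
qed

lemma kernel_op_klam:
  assumes G: "nice \<nu> G"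
  shows "kernel_op (klam l) G s = kernel_op kle G s - (1 - l) *\<^sub>R wint \<nu> (\<lambda>r. m (u r) (G r))"
proof -
  have "kernel_op (klam l) G s = wint \<nu> (\<lambda>r. kle s r *\<^sub>R m (u r) (G r) - (1 - l) *\<^sub>R m (u r) (G r))"
    unfolding kernel_op_def by (intro wint_cong) (auto simp: klam_def kle_def algebra_simps)
  also have "\<dots> = kernel_op kle G s - wint \<nu> (\<lambda>r. (1 - l) *\<^sub>R m (u r) (G r))"
    unfolding kernel_op_def by (intro wint_diff finite_\<nu> kernel_nice good_kle G nice_scale nice_m u_nice)
  finally show ?thesis by (simp add: wint_scale)
qed

lemma kernel_op_comb:
  assumes \<kappa>: "good_kernel \<kappa>" and G: "nice \<nu> G" "\<And>i. i \<in> A \<Longrightarrow> nice \<nu> (H i)" "\<And>i. i \<in> A \<Longrightarrow> x i \<in> V"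
  shows "kernel_op \<kappa> (\<lambda>s. G s - l *\<^sub>R (\<Sum>i\<in>A. m (H i s) (x i))) s
     = kernel_op \<kappa> G s - l *\<^sub>R (\<Sum>i\<in>A. m (kernel_op \<kappa> (H i) s) (x i))"
proof -
  let ?f = "\<lambda>i r. \<kappa> s r *\<^sub>R m (u r) (H i r)"
  have f: "nice \<nu> (?f i)" if "i \<in> A" for i by (rule kernel_nice[OF \<kappa> G(2)[OF that]])
  have f': "nice \<nu> (\<lambda>r. m (?f i r) (x i))" if "i \<in> A" for i by (intro nice_m f nice_const G(3) that)
  have "kernel_op \<kappa> (\<lambda>s. G s - l *\<^sub>R (\<Sum>i\<in>A. m (H i s) (x i))) s
    = wint \<nu> (\<lambda>r. \<kappa> s r *\<^sub>R m (u r) (G r) - l *\<^sub>R (\<Sum>i\<in>A. m (?f i r) (x i)))"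
    unfolding kernel_op_def by (simp add: m_simps m_sum m_assoc scaleR_diff_right scaleR_sum_right mult.commute)
  also have "\<dots> = wint \<nu> (\<lambda>r. \<kappa> s r *\<^sub>R m (u r) (G r)) - wint \<nu> (\<lambda>r. l *\<^sub>R (\<Sum>i\<in>A. m (?f i r) (x i)))"
    using f' by (intro wint_diff finite_\<nu> kernel_nice \<kappa> G nice_scale nice_sum)
  also have "wint \<nu> (\<lambda>r. l *\<^sub>R (\<Sum>i\<in>A. m (?f i r) (x i))) = l *\<^sub>R (\<Sum>i\<in>A. wint \<nu> (\<lambda>r. m (?f i r) (x i)))"
    unfolding wint_scale by (simp add: wint_sum[OF finite_\<nu> f'])
  also have "(\<Sum>i\<in>A. wint \<nu> (\<lambda>r. m (?f i r) (x i))) = (\<Sum>i\<in>A. m (kernel_op \<kappa> (H i) s) (x i))"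
    unfolding kernel_op_def by (intro sum.cong refl) (simp add: wint_m_right[OF finite_\<nu> f])
  finally show ?thesis by (simp add: kernel_op_def)
qed

text \<open>The coefficient of \<open>z^k\<close> in the time-ordered exponential of
  \<open>z \<phi>\<close>; the shift occurs because \<open>total kle k\<close> has
  \<open>k + 1\<close> factors.\<close>

definition EE :: "nat \<Rightarrow> 'v" where "EE k = (case k of 0 \<Rightarrow> e | Suc k \<Rightarrow> total kle k)"

lemma EE_simps [simp]: "EE 0 = e" "EE (Suc k) = total kle k" by (auto simp: EE_def)

lemma EE_V: "EE k \<in> V" by (cases k) (auto simp: e_V total_V)

text \<open>The \<open>k\<close>-fold term of the time-ordered exponential over the part of
  \<open>I\<close> from \<open>s\<close> on.\<close>

abbreviation "evol k \<equiv> (kernel_op kle ^^ k) (\<lambda>_. e)"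

text \<open>At each step the constant difference of the two kernels splits off a full integral
  \<open>total (klam l) j\<close>, which stays on the right under further applications of the
  operator; a convolution remains.\<close>

lemma klam_iter:
  assumes "s \<in> I"
  shows "(kernel_op (klam l) ^^ k) (\<lambda>_. e) s
    = evol k s - (1 - l) *\<^sub>R (\<Sum>j<k. m (evol (k - Suc j) s) (total (klam l) j))"
  using assms
proof (induction k arbitrary: s)
  case (Suc k)
  let ?G = "\<lambda>s. evol k s - (1 - l) *\<^sub>R (\<Sum>j<k. m (evol (k - Suc j) s) (total (klam l) j))"
  have ne: "nice \<nu> (\<lambda>_. e)" by (rule nice_const[OF e_V])
  have "(kernel_op (klam l) ^^ Suc k) (\<lambda>_. e) s = kernel_op (klam l) ((kernel_op (klam l) ^^ k) (\<lambda>_. e)) s" by simp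
  also have "\<dots> = kernel_op kle ((kernel_op (klam l) ^^ k) (\<lambda>_. e)) s - (1 - l) *\<^sub>R total (klam l) k"
    unfolding total_def by (rule kernel_op_klam[OF kernel_iter_nice[OF good_klam ne]])
  also have "kernel_op kle ((kernel_op (klam l) ^^ k) (\<lambda>_. e)) s = kernel_op kle ?G s"
    by (rule kernel_op_cong) (rule Suc.IH)
  also have "\<dots> = evol (Suc k) s - (1 - l) *\<^sub>R (\<Sum>j<k. m (evol (Suc (k - Suc j)) s) (total (klam l) j))"
    using kernel_op_comb[where \<kappa>=kle and G="evol k" and H="\<lambda>j. evol (k - Suc j)" and x="total (klam l)" and A="{..<k}" and l="1 - l" and s=s,
      OF good_kle kernel_iter_nice[OF good_kle ne] kernel_iter_nice[OF good_kle ne] total_V] by simp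
  also have "(\<Sum>j<k. m (evol (Suc (k - Suc j)) s) (total (klam l) j)) = (\<Sum>j<k. m (evol (Suc k - Suc j) s) (total (klam l) j))"
    by (intro sum.cong refl) (simp add: Suc_diff_Suc)
  also have "evol (Suc k) s - (1 - l) *\<^sub>R (\<Sum>j<k. m (evol (Suc k - Suc j) s) (total (klam l) j)) - (1 - l) *\<^sub>R total (klam l) k
     = evol (Suc k) s - (1 - l) *\<^sub>R (\<Sum>j<Suc k. m (evol (Suc k - Suc j) s) (total (klam l) j))"
    unfolding sum.lessThan_Suc diff_self_eq_0 funpow_0 m_e(1)[OF total_V] by (simp add: scaleR_add_right)
  finally show ?case .
qed simp

text \<open>This is the coefficient of \<open>z^(k+1)\<close> in
  \<open>(l + (1 - l) A) R = A - 1\<close>, where \<open>EE j\<close> is the coefficient of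
  \<open>z^j\<close> in \<open>A\<close> and \<open>total (klam l) j\<close> that of
  \<open>z^(j+1)\<close> in \<open>R\<close>. The recursion later identifies the coefficients with
  those of a Cramer quotient.\<close>

lemma klam_total:
  "total (klam l) k = EE (Suc k) - (1 - l) *\<^sub>R (\<Sum>j<k. m (EE (k - j)) (total (klam l) j))"
proof -
  have ne: "nice \<nu> (\<lambda>_. e)" by (rule nice_const[OF e_V])
  have f: "nice \<nu> (\<lambda>s. m (u s) (evol i s))" for i by (intro nice_m u_nice kernel_iter_nice good_kle ne)
  have f': "nice \<nu> (\<lambda>s. m (m (u s) (evol i s)) (total (klam l) j))" for i j
    by (rule nice_m[OF f nice_const[OF total_V]])
  have "total (klam l) k = wint \<nu> (\<lambda>s. m (u s) (evol k s) - (1 - l) *\<^sub>R (\<Sum>j<k. m (m (u s) (evol (k - Suc j) s)) (total (klam l) j)))"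
    unfolding total_def[of "klam l" k] by (intro wint_cong) (simp add: klam_iter space_\<nu> m_simps m_sum m_assoc)
  also have "\<dots> = wint \<nu> (\<lambda>s. m (u s) (evol k s))
      - wint \<nu> (\<lambda>s. (1 - l) *\<^sub>R (\<Sum>j<k. m (m (u s) (evol (k - Suc j) s)) (total (klam l) j)))"
    by (rule wint_diff[OF finite_\<nu> f nice_scale[OF nice_sum[OF f']]])
  also have "wint \<nu> (\<lambda>s. m (u s) (evol k s)) = total kle k" by (simp only: total_def)
  also have "wint \<nu> (\<lambda>s. (1 - l) *\<^sub>R (\<Sum>j<k. m (m (u s) (evol (k - Suc j) s)) (total (klam l) j)))
      = (1 - l) *\<^sub>R (\<Sum>j<k. wint \<nu> (\<lambda>s. m (m (u s) (evol (k - Suc j) s)) (total (klam l) j)))"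
    unfolding wint_scale by (rule arg_cong[where f="scaleR (1 - l)"], rule wint_sum[OF finite_\<nu> f'])
  also have "(\<Sum>j<k. wint \<nu> (\<lambda>s. m (m (u s) (evol (k - Suc j) s)) (total (klam l) j)))
      = (\<Sum>j<k. m (total kle (k - Suc j)) (total (klam l) j))"
    unfolding total_def[of kle] by (rule sum.cong[OF refl], rule wint_m_right[OF finite_\<nu> f, symmetric])
  also have "(\<Sum>j<k. m (total kle (k - Suc j)) (total (klam l) j)) = (\<Sum>j<k. m (EE (k - j)) (total (klam l) j))"
    by (intro sum.cong refl) (simp add: Suc_diff_Suc flip: EE_simps(2))
  finally show ?thesis by simp
qed

end

section \<open>Ascents, descents and the Beta integral\<close>

text \<open>Integration by parts lowers \<open>b\<close>. For \<open>a\<close> ascents and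
  \<open>b\<close> descents without ties there are \<open>a + b + 1\<close> variables, so the value
  is exactly the weight in the Magnus term.\<close>

lemma beta_integral:
  "((\<lambda>l::real. l ^ a * (l - 1) ^ b) has_integral ((- 1) ^ b * (fact a * fact b / fact (a + b + 1)))) {0..1}"
proof (induction b arbitrary: a)
  case 0
  have "((\<lambda>l::real. l ^ a) has_integral (1 ^ Suc a / real (Suc a) - 0 ^ Suc a / real (Suc a))) {0..1}"
    by (rule fundamental_theorem_of_calculus)
      (auto intro!: derivative_eq_intros simp flip: has_real_derivative_iff_has_vector_derivative simp del: of_nat_Suc power_Suc)
  then show ?case by (simp add: fact_reduce field_simps del: of_nat_Suc)
next
  case (Suc b)
  have "((\<lambda>l::real. (real (Suc a) * l ^ a) * (l - 1) ^ Suc b + l ^ Suc a * (real (Suc b) * (l - 1) ^ b))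
     has_integral (1 ^ Suc a * (1 - 1) ^ Suc b - 0 ^ Suc a * (0 - 1) ^ Suc b)) {0..1}"
    by (rule fundamental_theorem_of_calculus)
      (auto intro!: derivative_eq_intros simp flip: has_real_derivative_iff_has_vector_derivative simp del: of_nat_Suc power_Suc
         simp: algebra_simps)
  from has_integral_diff[OF this has_integral_mult_right[OF Suc.IH[of "Suc a"], of "real (Suc b)"]]
  have "((\<lambda>l::real. real (Suc a) * (l ^ a * (l - 1) ^ Suc b)) has_integral
      (0 - real (Suc b) * ((- 1) ^ b * (fact (Suc a) * fact b / fact (Suc a + b + 1))))) {0..1}"
    by (simp add: algebra_simps del: of_nat_Suc fact_Suc)
  from has_integral_mult_right[OF this, of "1 / real (Suc a)"]
  have "((\<lambda>l::real. l ^ a * (l - 1) ^ Suc b) has_integral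
      (1 / real (Suc a) * (0 - real (Suc b) * ((- 1) ^ b * (fact (Suc a) * fact b / fact (Suc a + b + 1)))))) {0..1}"
    by (simp del: of_nat_Suc fact_Suc power_Suc)
  moreover have "1 / real (Suc a) * (0 - real (Suc b) * ((- 1) ^ b * (fact (Suc a) * fact b / fact (Suc a + b + 1))))
     = (- 1) ^ Suc b * (fact a * fact (Suc b) / fact (a + Suc b + 1) :: real)"
    by (simp only: fact_Suc[of a] fact_Suc[of b] add_Suc add_Suc_right power_Suc) (simp del: of_nat_Suc fact_Suc)
  ultimately show ?case by (simp only:)
qed

lemma sets_Collect_count:
  fixes k :: nat
  assumes "\<And>i. i < k \<Longrightarrow> {x \<in> space M. P i x} \<in> sets M"
  shows "{x \<in> space M. card {i. i < k \<and> P i x} = a} \<in> sets M"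
proof -
  let ?g = "\<lambda>x. \<Sum>i<k. indicator {x \<in> space M. P i x} x :: real"
  have g: "?g \<in> borel_measurable M" using assms by (intro borel_measurable_sum borel_measurable_indicator) auto
  have "?g x = real (card {i. i < k \<and> P i x})" if "x \<in> space M" for x
  proof -
    have "?g x = (\<Sum>i<k. if P i x then 1 else 0)" using that by (intro sum.cong) (auto simp: indicator_def)
    also have "\<dots> = real (card {i. i < k \<and> P i x})"
      by (subst sum.inter_filter[symmetric]) (auto simp: conj_commute)
    finally show ?thesis .
  qed
  then have "{x \<in> space M. card {i. i < k \<and> P i x} = a} = ?g -` {real a} \<inter> space M" by auto
  then show ?thesis using measurable_sets[OF g, of "{real a}"] by simp
qed

lemma (in fd_algebra) nice_cong: "(\<And>x. x \<in> space M \<Longrightarrow> f x = g x) \<Longrightarrow> nice M f = nice M g"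
  unfolding nice_def by (simp cong: measurable_cong)

context ordered_density
begin

lemma singleton_sets: "t \<in> I \<Longrightarrow> {t} \<in> sets \<nu>"
  unfolding sets_\<nu> sets_restrict_space by (rule image_eqI[of _ _ "{t}"]) auto

text \<open>Fubini in the variable \<open>t (Suc i)\<close>: a tie fixes it to one point, which is
  null because \<nu> has no atoms. Away from ties the number of descents is \<open>k\<close> minus
  the number of ascents.\<close>

lemma tie_null:
  assumes i: "i < k"
  shows "AE t in PV (Suc k). t i \<noteq> t (Suc i)"
proof -
  let ?Z = "{t \<in> space (PV (Suc k)). t i = t (Suc i)}"
  let ?J = "{..<Suc k} - {Suc i}"
  have Z: "?Z \<in> sets (PV (Suc k))"
    by (rule borel_measurable_eq) (use i in \<open>auto intro: component_borel\<close>)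
  have J: "insert (Suc i) ?J = {..<Suc k}" using i by auto
  have "emeasure (PV (Suc k)) ?Z = (\<integral>\<^sup>+t. indicator ?Z t \<partial>PiM (insert (Suc i) ?J) (\<lambda>_. \<nu>))"
    unfolding J using Z by (intro nn_integral_indicator[symmetric])
  also have "\<dots> = (\<integral>\<^sup>+x. (\<integral>\<^sup>+y. indicator ?Z (x(Suc i := y)) \<partial>\<nu>) \<partial>PiM ?J (\<lambda>_. \<nu>))"
  proof (rule P.product_nn_integral_insert)
    show "(\<lambda>t. indicator ?Z t :: ennreal) \<in> borel_measurable (PiM (insert (Suc i) ?J) (\<lambda>_. \<nu>))"
      unfolding J by (rule borel_measurable_indicator[OF Z])
  qed auto
  also have "\<dots> = (\<integral>\<^sup>+x. 0 \<partial>PiM ?J (\<lambda>_. \<nu>))"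
  proof (rule nn_integral_cong)
    fix x assume x: "x \<in> space (PiM ?J (\<lambda>_. \<nu>))"
    have "x \<in> (\<Pi>\<^sub>E i\<in>?J. I)" using x by (simp only: space_PiM space_\<nu>)
    then have xi: "x i \<in> I" by (rule PiE_mem) (use i in simp)
    have "(\<integral>\<^sup>+y. indicator ?Z (x(Suc i := y)) \<partial>\<nu>) \<le> (\<integral>\<^sup>+y. indicator {x i} y \<partial>\<nu>)"
      by (intro nn_integral_mono) (auto simp: indicator_def)
    also have "\<dots> = 0" using singleton_sets[OF xi] atomless[OF xi] by simp
    finally show "(\<integral>\<^sup>+y. indicator ?Z (x(Suc i := y)) \<partial>\<nu>) = 0" by simp
  qed
  finally have "emeasure (PV (Suc k)) ?Z = 0" by simp
  then show ?thesis using Z by (intro AE_I[of _ _ ?Z]) auto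
qed

lemma ties_null: "AE t in PV (Suc k). \<forall>i\<in>{..<k}. t i \<noteq> t (Suc i)"
  by (rule AE_ball_countable') (auto intro: tie_null)

definition mweight :: "nat \<Rightarrow> nat \<Rightarrow> real" where
  "mweight k a = (- 1) ^ (k - a) * (fact a * fact (k - a) / fact (Suc k))"

definition asc_part :: "nat \<Rightarrow> nat \<Rightarrow> 'v" where
  "asc_part k a = wint (PV (Suc k)) (\<lambda>t. indicator {t \<in> space (PV (Suc k)). asc (Suc k) t = a} t *\<^sub>R Uk (Suc k) t)"

lemma asc_sets: "{t \<in> space (PV (Suc k)). asc (Suc k) t = a} \<in> sets (PV (Suc k))"
  unfolding asc_def Suc_less_eq
  by (rule sets_Collect_count, rule borel_measurable_less) (auto intro: component_borel)

lemma des_sets: "{t \<in> space (PV (Suc k)). des (Suc k) t = a} \<in> sets (PV (Suc k))"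
  unfolding des_def Suc_less_eq
  by (rule sets_Collect_count, rule borel_measurable_less) (auto intro: component_borel)

lemma asc_le: "asc (Suc k) t \<le> k"
  unfolding asc_def Suc_less_eq using card_mono[of "{..<k}" "{i. i < k \<and> t i < t (Suc i)}"] by auto

lemma des_le: "des (Suc k) t \<le> k"
  unfolding des_def Suc_less_eq using card_mono[of "{..<k}" "{i. i < k \<and> t (Suc i) < t i}"] by auto

text \<open>Off the null set of ties both the chain weight of \<open>klam l\<close> and the Magnus
  weight depend on the number of ascents only. The integrals \<open>asc_part k a\<close> are
  therefore common to both, and only scalar weights remain to be compared.\<close>

lemma wint_weights:
  assumes f: "nice (PV (Suc k)) (\<lambda>t. g t *\<^sub>R Uk (Suc k) t)"
    and eq: "\<And>t. \<forall>i\<in>{..<k}. t i \<noteq> t (Suc i) \<Longrightarrow> g t = h (asc (Suc k) t)"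
  shows "wint (PV (Suc k)) (\<lambda>t. g t *\<^sub>R Uk (Suc k) t) = (\<Sum>a\<le>k. h a *\<^sub>R asc_part k a)"
proof -
  let ?X = "\<lambda>a. {t \<in> space (PV (Suc k)). asc (Suc k) t = a}"
  let ?f = "\<lambda>a t. indicator (?X a) t *\<^sub>R Uk (Suc k) t"
  have nf: "nice (PV (Suc k)) (?f a)" for a by (intro nice_indicator Uk_nice asc_sets) simp
  have nf': "nice (PV (Suc k)) (\<lambda>t. h a *\<^sub>R ?f a t)" for a by (rule nice_scale[OF nf])
  have pt: "(\<Sum>a\<le>k. h a *\<^sub>R ?f a t) = h (asc (Suc k) t) *\<^sub>R Uk (Suc k) t" if t: "t \<in> space (PV (Suc k))" for t
  proof -
    have "(\<Sum>a\<le>k. h a *\<^sub>R ?f a t) = (\<Sum>a\<le>k. if a = asc (Suc k) t then h a *\<^sub>R Uk (Suc k) t else 0)"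
      using t by (intro sum.cong refl) (auto simp: indicator_def)
    also have "\<dots> = h (asc (Suc k) t) *\<^sub>R Uk (Suc k) t" using asc_le[of k t] by simp
    finally show ?thesis .
  qed
  have "wint (PV (Suc k)) (\<lambda>t. g t *\<^sub>R Uk (Suc k) t) = wint (PV (Suc k)) (\<lambda>t. \<Sum>a\<le>k. h a *\<^sub>R ?f a t)"
  proof (rule wint_cong_AE[OF f nice_sum[OF nf']])
    show "AE t in PV (Suc k). g t *\<^sub>R Uk (Suc k) t = (\<Sum>a\<le>k. h a *\<^sub>R ?f a t)"
      using ties_null[of k] AE_space
    proof eventually_elim
      case (elim t)
      then show ?case using eq[OF elim(1)] pt[OF elim(2)] by simp
    qed
  qed
  also have "\<dots> = (\<Sum>a\<le>k. wint (PV (Suc k)) (\<lambda>t. h a *\<^sub>R ?f a t))" by (rule wint_sum[OF finite_PV nf'])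
  also have "\<dots> = (\<Sum>a\<le>k. h a *\<^sub>R asc_part k a)" unfolding wint_scale asc_part_def ..
  finally show ?thesis .
qed

lemma total_klam_eq: "total (klam l) k = (\<Sum>a\<le>k. (l ^ a * (l - 1) ^ (k - a)) *\<^sub>R asc_part k a)"
  unfolding total_eq[OF good_klam]
proof (rule wint_weights[OF chain_nice[OF good_klam Uk_nice[OF order_refl]]])
  fix t :: "nat \<Rightarrow> real" assume t: "\<forall>i\<in>{..<k}. t i \<noteq> t (Suc i)"
  let ?A = "{i. i < k \<and> t i < t (Suc i)}"
  have "chain (klam l) k t = (\<Prod>i<k. if t i < t (Suc i) then l else l - 1)"
    unfolding chain_def klam_def by (rule prod.cong) (use t in \<open>auto simp: less_le\<close>)
  also have "\<dots> = l ^ card ({..<k} \<inter> {i. t i < t (Suc i)}) * (l - 1) ^ card ({..<k} \<inter> - {i. t i < t (Suc i)})"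
    by (subst prod.If_cases) auto
  also have "{..<k} \<inter> {i. t i < t (Suc i)} = ?A" by auto
  also have "{..<k} \<inter> - {i. t i < t (Suc i)} = {..<k} - ?A" by auto
  also have "card ({..<k} - ?A) = k - card ?A" by (subst card_Diff_subset) auto
  finally show "chain (klam l) k t = l ^ asc (Suc k) t * (l - 1) ^ (k - asc (Suc k) t)"
    by (simp add: asc_def)
qed

lemma magnus_term_eq: "magnus_term m e I \<phi> (Suc k) = (\<Sum>a\<le>k. mweight k a *\<^sub>R asc_part k a)"
proof -
  define w where "w = (\<lambda>a d. (- 1) ^ d * (fact a * fact d / fact (Suc k)) :: real)"
  define f where "f = (\<lambda>t. w (asc (Suc k) t) (des (Suc k) t))"
  let ?S = "space (PV (Suc k))"
  have fin: "finite (f ` ?S)"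
  proof (rule finite_subset)
    show "f ` ?S \<subseteq> (\<lambda>(a, d). w a d) ` ({..k} \<times> {..k})"
      unfolding f_def using asc_le des_le by (force intro!: image_eqI)
  qed simp
  have fs: "{t \<in> ?S. f t = x} \<in> sets (PV (Suc k))" for x
  proof -
    have "{t \<in> ?S. f t = x} = (\<Union>(a, d)\<in>{(a, d) \<in> {..k} \<times> {..k}. w a d = x}.
        {t \<in> ?S. asc (Suc k) t = a} \<inter> {t \<in> ?S. des (Suc k) t = d})"
      unfolding f_def using asc_le des_le by auto
    also have "\<dots> \<in> sets (PV (Suc k))"
      by (intro sets.finite_UN) (auto intro!: sets.Int asc_sets des_sets intro: finite_subset[of _ "{..k} \<times> {..k}"])
    finally show ?thesis .
  qed
  have pt: "(\<Sum>x\<in>f ` ?S. x *\<^sub>R indicator {t \<in> ?S. f t = x} t *\<^sub>R Uk (Suc k) t) = f t *\<^sub>R Uk (Suc k) t" if t: "t \<in> ?S" for t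
  proof -
    have "(\<Sum>x\<in>f ` ?S. x *\<^sub>R indicator {t \<in> ?S. f t = x} t *\<^sub>R Uk (Suc k) t) = (\<Sum>x\<in>f ` ?S. if x = f t then f t *\<^sub>R Uk (Suc k) t else 0)"
      using t by (intro sum.cong refl) (auto simp: indicator_def)
    also have "\<dots> = f t *\<^sub>R Uk (Suc k) t" using t fin by simp
    finally show ?thesis .
  qed
  have nf: "nice (PV (Suc k)) (\<lambda>t. x *\<^sub>R indicator {t \<in> ?S. f t = x} t *\<^sub>R Uk (Suc k) t)" for x
    by (intro nice_scale nice_indicator Uk_nice fs) simp
  have ns: "nice (PV (Suc k)) (\<lambda>t. f t *\<^sub>R Uk (Suc k) t)"
  proof -
    have "nice (PV (Suc k)) (\<lambda>t. \<Sum>x\<in>f ` ?S. x *\<^sub>R indicator {t \<in> ?S. f t = x} t *\<^sub>R Uk (Suc k) t)"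
      by (rule nice_sum, rule nf)
    then show ?thesis by (rule nice_cong[THEN iffD1, rotated]) (rule pt)
  qed
  have "magnus_term m e I \<phi> (Suc k) = (\<Sum>x\<in>f ` ?S. x *\<^sub>R \<Phi> (Suc k) {t \<in> ?S. f t = x})"
    unfolding magnus_term_def simple_vintegral_def product_measure_of_eq space_PV[symmetric] f_def w_def ..
  also have "\<dots> = (\<Sum>x\<in>f ` ?S. wint (PV (Suc k)) (\<lambda>t. x *\<^sub>R indicator {t \<in> ?S. f t = x} t *\<^sub>R Uk (Suc k) t))"
    unfolding \<Phi>_def wint_scale using fs by simp
  also have "\<dots> = wint (PV (Suc k)) (\<lambda>t. \<Sum>x\<in>f ` ?S. x *\<^sub>R indicator {t \<in> ?S. f t = x} t *\<^sub>R Uk (Suc k) t)"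
    by (rule wint_sum[OF finite_PV nf, symmetric])
  also have "\<dots> = wint (PV (Suc k)) (\<lambda>t. f t *\<^sub>R Uk (Suc k) t)" by (rule wint_cong[OF pt])
  also have "\<dots> = (\<Sum>a\<le>k. mweight k a *\<^sub>R asc_part k a)"
  proof (rule wint_weights[OF ns])
    fix t :: "nat \<Rightarrow> real" assume t: "\<forall>i\<in>{..<k}. t i \<noteq> t (Suc i)"
    have "{i. i < k \<and> t (Suc i) < t i} = {..<k} - {i. i < k \<and> t i < t (Suc i)}"
      using t by (auto simp: not_less less_le)
    then have "des (Suc k) t = k - asc (Suc k) t"
      unfolding des_def asc_def Suc_less_eq by (simp add: card_Diff_subset subset_eq)
    then show "f t = mweight k (asc (Suc k) t)" by (simp add: f_def w_def mweight_def)
  qed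
  finally show ?thesis .
qed

text \<open>The link between the Magnus terms and the resolvent: integrating the factor
  \<open>l ^ a * (l - 1) ^ (k - a)\<close> of \<open>asc_part k a\<close> over \<open>l\<close>
  gives its Magnus weight.\<close>

lemma magnus_term_has_integral:
  assumes l: "linear (L :: 'v \<Rightarrow> real)"
  shows "((\<lambda>l. L (total (klam l) k)) has_integral L (magnus_term m e I \<phi> (Suc k))) {0..1}"
proof -
  have "((\<lambda>l. \<Sum>a\<le>k. (l ^ a * (l - 1) ^ (k - a)) * L (asc_part k a)) has_integral (\<Sum>a\<le>k. mweight k a * L (asc_part k a))) {0..1}"
  proof (intro has_integral_sum has_integral_mult_left finite_atMost)
    fix a assume "a \<in> {..k}"
    then show "((\<lambda>l. l ^ a * (l - 1) ^ (k - a)) has_integral mweight k a) {0..1}"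
      using beta_integral[of a "k - a"] by (simp add: mweight_def del: fact_Suc)
  qed
  then show ?thesis
    by (simp add: magnus_term_eq total_klam_eq linear_sum[OF l] linear_scale[OF l])
qed

lemma magnus_term_V: "magnus_term m e I \<phi> (Suc k) \<in> V"
  unfolding magnus_term_eq asc_part_def by (intro V_closed wint_V)

end

section \<open>Densities of vector measures\<close>

context fd_algebra
begin

text \<open>Countable additivity of a vector measure refers to the norm of the type, not to
  \<open>N\<close>; on the finite-dimensional \<open>V\<close> a linear functional is bounded for
  that norm as well.\<close>

lemma functional_sums:
  fixes l :: "'v \<Rightarrow> real"
  assumes l: "linear l" and x: "\<And>i. x i \<in> V" "y \<in> V" "x sums y"
  shows "(\<lambda>i. l (x i)) sums l y"
proof -
  have "norm_on V norm" using n(1) by (auto simp: norm_on_def norm_triangle_ineq)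
  then obtain C where C: "C \<ge> 0" "\<And>x. x \<in> V \<Longrightarrow> \<bar>l x\<bar> \<le> C * norm x"
    using linear_bounded_on_span[OF B(1) _ l, of norm] B(3) by auto
  have "(\<lambda>k. (\<Sum>i<k. x i) - y) \<longlonglongrightarrow> 0" using x(3) by (simp add: sums_def LIM_zero_iff)
  then have lim: "(\<lambda>k. C * norm ((\<Sum>i<k. x i) - y)) \<longlonglongrightarrow> 0"
    using tendsto_mult[OF tendsto_const[of C] tendsto_norm_zero] by fastforce
  have "(\<lambda>k. l (\<Sum>i<k. x i) - l y) \<longlonglongrightarrow> 0"
  proof (rule Lim_null_comparison[OF always_eventually lim], rule allI)
    fix k
    have "(\<Sum>i<k. x i) - y \<in> V" by (intro V_closed x)
    then show "norm (l (\<Sum>i<k. x i) - l y) \<le> C * norm ((\<Sum>i<k. x i) - y)"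
      using C(2)[of "(\<Sum>i<k. x i) - y"] by (simp add: linear_diff[OF l])
  qed
  then show ?thesis by (simp add: sums_def LIM_zero_iff linear_sum[OF l])
qed

lemma norming:
  assumes "x \<in> V"
  shows "\<exists>l. linear l \<and> l x = N x \<and> (\<forall>y\<in>V. l y \<le> N y \<and> \<bar>l y\<bar> \<le> N y)"
proof -
  have "norm_on (span B) N" "x \<in> span B" using N B(3) assms by auto
  from norming_functional[OF B(1) this] obtain l where "linear l" "l x = N x"
    "\<And>x. x \<in> span B \<Longrightarrow> l x \<le> N x" "\<And>x. x \<in> span B \<Longrightarrow> \<bar>l x\<bar> \<le> N x" by blast
  then show ?thesis using B(3) by (intro exI[of _ l]) auto
qed

lemma N_sums_le:
  assumes x: "\<And>i. x i \<in> V" "y \<in> V" "x sums y" and s: "summable (\<lambda>i. N (x i))"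
  shows "N y \<le> (\<Sum>i. N (x i))"
proof -
  obtain l where l: "linear l" "l y = N y" "\<And>y. y \<in> V \<Longrightarrow> l y \<le> N y" using norming[OF x(2)] by blast
  have "(\<lambda>i. l (x i)) sums N y" using functional_sums[OF l(1) x] l(2) by simp
  then show ?thesis by (rule sums_le[OF _ _ summable_sums[OF s], rotated]) (rule l(3)[OF x(1)])
qed

text \<open>Since the vectors with rational coordinates are dense, countably many functionals suffice
  to compute \<open>N\<close>; this turns the almost everywhere bounds for single functionals into one for \<open>N\<close>.\<close>

lemma countable_norming:
  obtains L :: "('v \<Rightarrow> real) set" where "countable L" "\<And>l. l \<in> L \<Longrightarrow> linear l"
    "\<And>l y. l \<in> L \<Longrightarrow> y \<in> V \<Longrightarrow> l y \<le> N y" "\<And>y. y \<in> V \<Longrightarrow> (\<And>l. l \<in> L \<Longrightarrow> l y \<le> 1) \<Longrightarrow> N y \<le> 1"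
proof -
  define D where "D = (\<lambda>a. \<Sum>b\<in>B. a b *\<^sub>R b) ` (\<Pi>\<^sub>E b\<in>B. \<rat> :: real set)"
  have cD: "countable D" unfolding D_def by (intro countable_image countable_PiE B) (auto intro: countable_rat)
  have DV: "D \<subseteq> V" unfolding D_def by (auto intro!: V_closed(5) V_closed(4)[OF B_V])
  have "\<forall>x\<in>D. \<exists>l. linear l \<and> l x = N x \<and> (\<forall>y\<in>V. l y \<le> N y \<and> \<bar>l y\<bar> \<le> N y)"
    by (intro ballI norming) (use DV in blast)
  then obtain f where f: "\<And>x. x \<in> D \<Longrightarrow> linear (f x) \<and> f x x = N x \<and> (\<forall>y\<in>V. f x y \<le> N y \<and> \<bar>f x y\<bar> \<le> N y)"
    using bchoice[of D "\<lambda>x l. linear l \<and> l x = N x \<and> (\<forall>y\<in>V. l y \<le> N y \<and> \<bar>l y\<bar> \<le> N y)"] by blast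
  show ?thesis
  proof (rule that[of "f ` D"])
    fix y assume y: "y \<in> V" and le: "\<And>l. l \<in> f ` D \<Longrightarrow> l y \<le> 1"
    show "N y \<le> 1"
    proof (rule field_le_epsilon)
      fix d :: real assume d: "0 < d"
      define S where "S = 1 + (\<Sum>b\<in>B. N b)"
      have S: "0 < S" unfolding S_def using n(9) by (intro add_pos_nonneg sum_nonneg) auto
      have "\<forall>b\<in>B. \<exists>q. q \<in> \<rat> \<and> \<bar>c b y - q\<bar> < d / (2 * S)"
      proof
        fix b
        have "c b y - d / (2 * S) < c b y" using d S by simp
        then obtain q where "q \<in> \<rat>" "c b y - d / (2 * S) < q" "q < c b y" using Rats_dense_in_real by blast
        then show "\<exists>q. q \<in> \<rat> \<and> \<bar>c b y - q\<bar> < d / (2 * S)" by (intro exI[of _ q]) auto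
      qed
      then obtain q where q: "\<And>b. b \<in> B \<Longrightarrow> q b \<in> \<rat> \<and> \<bar>c b y - q b\<bar> < d / (2 * S)"
        using bchoice[of B "\<lambda>b q. q \<in> \<rat> \<and> \<bar>c b y - q\<bar> < d / (2 * S)"] by blast
      define x where "x = (\<Sum>b\<in>B. q b *\<^sub>R b)"
      have "x = (\<Sum>b\<in>B. restrict q B b *\<^sub>R b)" unfolding x_def by (rule sum.cong) auto
      moreover have "restrict q B \<in> (\<Pi>\<^sub>E b\<in>B. \<rat>)" using q by auto
      ultimately have xD: "x \<in> D" unfolding D_def by blast
      have xV: "x \<in> V" using xD DV by blast
      have "y - x = (\<Sum>b\<in>B. (c b y - q b) *\<^sub>R b)"
        using c_expand[OF y] by (simp add: x_def scaleR_diff_left sum_subtractf)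
      then have "N (y - x) \<le> (\<Sum>b\<in>B. \<bar>c b y - q b\<bar> * N b)"
        using n(11)[OF B(1), of "\<lambda>b. (c b y - q b) *\<^sub>R b"] by (simp add: n(3))
      also have "\<dots> \<le> (\<Sum>b\<in>B. d / (2 * S) * N b)" using q n(9) by (intro sum_mono mult_right_mono) (auto intro: less_imp_le)
      also have "\<dots> = d / (2 * S) * (\<Sum>b\<in>B. N b)" by (simp add: sum_distrib_left)
      also have "\<dots> \<le> d / (2 * S) * S" using d S by (intro mult_left_mono) (auto simp: S_def)
      finally have yx: "N (y - x) \<le> d / 2" using S by simp
      have "N y \<le> N x + N (y - x)" using n(2)[of x "y - x"] by simp
      also have "N x = f x x" using f[OF xD] by simp
      also have "f x x = f x y - f x (y - x)" using linear_diff[of "f x" y x] f[OF xD] by simp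
      also have "\<dots> \<le> 1 + N (y - x)" using le[of "f x"] xD f[OF xD] V_closed(3)[OF y xV] by (fastforce simp: abs_le_iff)
      finally show "N y \<le> 1 + d" using yx by simp
    qed
  qed (use cD f in auto)
qed

end

section \<open>Total variation and the Radon-Nikodym density of a vector measure\<close>

locale vmeas = fd_algebra V m e N B c for V :: "'v::real_normed_vector set" and m e N B c +
  fixes M :: "'t measure" and \<phi> :: "'t set \<Rightarrow> 'v" and w :: real
  assumes vm: "vector_measure M \<phi>" and \<phi>_V: "E \<in> sets M \<Longrightarrow> \<phi> E \<in> V"
    and var: "finite P \<Longrightarrow> P \<subseteq> sets M \<Longrightarrow> disjoint P \<Longrightarrow> (\<Sum>A\<in>P. N (\<phi> A)) \<le> w"
begin

definition parts :: "'t set \<Rightarrow> 't set set set" where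
  "parts E = {P. finite P \<and> P \<subseteq> sets M \<and> disjoint P \<and> \<Union>P \<subseteq> E}"

definition tv :: "'t set \<Rightarrow> real" where "tv E = (SUP P\<in>parts E. \<Sum>A\<in>P. N (\<phi> A))"

lemma parts_empty: "{} \<in> parts E" by (simp add: parts_def)

lemma tv_upper: "P \<in> parts E \<Longrightarrow> (\<Sum>A\<in>P. N (\<phi> A)) \<le> tv E"
  unfolding tv_def using var by (intro cSUP_upper bdd_aboveI2[of _ _ w]) (auto simp: parts_def)

lemma tv_least: "(\<And>P. P \<in> parts E \<Longrightarrow> (\<Sum>A\<in>P. N (\<phi> A)) \<le> x) \<Longrightarrow> tv E \<le> x"
  unfolding tv_def using parts_empty by (intro cSUP_least) auto

lemma tv_nonneg: "0 \<le> tv E" using tv_upper[OF parts_empty] by simp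

lemma tv_le_w: "tv E \<le> w" by (rule tv_least) (auto simp: parts_def intro: var)

lemma tv_mono: "E \<subseteq> E' \<Longrightarrow> tv E \<le> tv E'"
  by (rule tv_least, rule tv_upper) (auto simp: parts_def)

lemma N_le_tv: "E \<in> sets M \<Longrightarrow> N (\<phi> E) \<le> tv E"
  using tv_upper[of "{E}" E] by (simp add: parts_def disjoint_def)

lemma \<phi>_empty: "\<phi> {} = 0" by (rule vector_measure_empty[OF vm])

lemma tv_superadditive:
  assumes "E \<inter> E' = {}"
  shows "tv E + tv E' \<le> tv (E \<union> E')"
proof -
  have a: "(\<Sum>A\<in>P. N (\<phi> A)) + (\<Sum>A\<in>Q. N (\<phi> A)) \<le> tv (E \<union> E')" if P: "P \<in> parts E" and Q: "Q \<in> parts E'" for P Q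
  proof -
    have PE: "\<And>A. A \<in> P \<Longrightarrow> A \<subseteq> E" "\<And>A. A \<in> Q \<Longrightarrow> A \<subseteq> E'" and d: "disjoint P" "disjoint Q"
      using P Q by (auto simp: parts_def)
    \<comment> \<open>The two families may share the empty set, whose term vanishes.\<close>
    have "(\<Sum>A\<in>P \<inter> Q. N (\<phi> A)) = 0"
    proof (rule sum.neutral, rule ballI)
      fix A assume "A \<in> P \<inter> Q"
      then have "A = {}" using PE assms by blast
      then show "N (\<phi> A) = 0" by (simp add: \<phi>_empty n(5))
    qed
    then have "(\<Sum>A\<in>P. N (\<phi> A)) + (\<Sum>A\<in>Q. N (\<phi> A)) = (\<Sum>A\<in>P \<union> Q. N (\<phi> A))"
      using P Q sum.union_inter[of P Q "\<lambda>A. N (\<phi> A)"] by (simp add: parts_def)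
    moreover have "disjoint (P \<union> Q)"
    proof (rule disjointI)
      fix A A' assume A: "A \<in> P \<union> Q" "A' \<in> P \<union> Q" "A \<noteq> A'"
      from A consider "A \<in> P" "A' \<in> P" | "A \<in> Q" "A' \<in> Q" | "A \<in> P" "A' \<in> Q" | "A \<in> Q" "A' \<in> P" by blast
      then show "A \<inter> A' = {}"
      proof cases
        case 1
        then show ?thesis using d(1) A(3) by (simp add: disjoint_def)
      next
        case 2
        then show ?thesis using d(2) A(3) by (simp add: disjoint_def)
      next
        case 3
        then show ?thesis using PE(1)[of A] PE(2)[of A'] assms by blast
      next
        case 4
        then show ?thesis using PE(1)[of A'] PE(2)[of A] assms by blast
      qed
    qed
    then have "P \<union> Q \<in> parts (E \<union> E')" using P Q by (auto simp: parts_def)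
    ultimately show ?thesis using tv_upper[of "P \<union> Q"] by simp
  qed
  have "tv E \<le> tv (E \<union> E') - tv E'"
  proof (rule tv_least)
    fix P assume P: "P \<in> parts E"
    have "tv E' \<le> tv (E \<union> E') - (\<Sum>A\<in>P. N (\<phi> A))" by (rule tv_least) (use a[OF P] in \<open>simp add: algebra_simps\<close>)
    then show "(\<Sum>A\<in>P. N (\<phi> A)) \<le> tv (E \<union> E') - tv E'" by simp
  qed
  then show ?thesis by simp
qed

text \<open>Superadditivity bounds the partial sums from above. Conversely each member
  \<open>A\<close> of a family is cut by the \<open>E i\<close>: countable additivity of \<phi>
  bounds \<open>N (\<phi> A)\<close> by the sum of all \<open>N (\<phi> (A \<inter> E i))\<close>,
  and for fixed \<open>i\<close> the pieces form a family inside \<open>E i\<close>.\<close>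

lemma tv_sums:
  assumes E: "range E \<subseteq> sets M" "disjoint_family E"
  shows "(\<lambda>i::nat. tv (E i)) sums tv (\<Union>i. E i)"
proof -
  have fin: "(\<Sum>i<k. tv (E i)) \<le> tv (\<Union>i<k. E i)" for k
  proof (induction k)
    case 0
    then show ?case by (simp add: tv_nonneg)
  next
    case (Suc k)
    have "(\<Union>i<k. E i) \<inter> E k = {}" 
    proof -
      have "E i \<inter> E k = {}" if "i < k" for i using E(2) that by (simp add: disjoint_family_on_def)
      then show ?thesis by blast
    qed
    from tv_superadditive[OF this] Suc show ?case by (simp add: lessThan_Suc Un_commute)
  qed
  have le: "(\<Sum>i<k. tv (E i)) \<le> tv (\<Union>i. E i)" for k
    by (rule order_trans[OF fin tv_mono]) auto
  have s: "summable (\<lambda>i. tv (E i))" by (rule summableI_nonneg_bounded[OF tv_nonneg le])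
  have "tv (\<Union>i. E i) \<le> (\<Sum>i. tv (E i))"
  proof (rule tv_least)
    fix P assume P: "P \<in> parts (\<Union>i. E i)"
    have AE: "A \<inter> E i \<in> sets M" if "A \<in> P" for A i using that P E(1) by (auto simp: parts_def)
    have sA: "summable (\<lambda>i. N (\<phi> (A \<inter> E i)))" if A: "A \<in> P" for A
    proof (rule summable_comparison_test'[OF s])
      fix i
      have "N (\<phi> (A \<inter> E i)) \<le> tv (E i)" by (rule order_trans[OF N_le_tv[OF AE[OF A]] tv_mono]) simp
      then show "norm (N (\<phi> (A \<inter> E i))) \<le> tv (E i)" by (simp add: n(9))
    qed
    have "(\<Sum>A\<in>P. N (\<phi> A)) \<le> (\<Sum>A\<in>P. \<Sum>i. N (\<phi> (A \<inter> E i)))"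
    proof (rule sum_mono)
      fix A assume A: "A \<in> P"
      have "A = (\<Union>i. A \<inter> E i)" using A P by (auto simp: parts_def)
      moreover have "range (\<lambda>i. A \<inter> E i) \<subseteq> sets M" using AE[OF A] by auto
      moreover have "disjoint_family (\<lambda>i. A \<inter> E i)" using E(2) unfolding disjoint_family_on_def by blast
      moreover have "(\<lambda>i. \<phi> (A \<inter> E i)) sums \<phi> (\<Union>i. A \<inter> E i)"
        using vm calculation(2,3) unfolding vector_measure_def by blast
      ultimately have "(\<lambda>i. \<phi> (A \<inter> E i)) sums \<phi> A" by metis
      then show "N (\<phi> A) \<le> (\<Sum>i. N (\<phi> (A \<inter> E i)))"
        using A P sA[OF A] AE[OF A] by (intro N_sums_le \<phi>_V) (auto simp: parts_def)
    qed
    also have "\<dots> = (\<Sum>i. \<Sum>A\<in>P. N (\<phi> (A \<inter> E i)))" by (rule suminf_sum[symmetric]) (rule sA)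
    also have "\<dots> \<le> (\<Sum>i. tv (E i))"
    proof (rule suminf_le[OF _ summable_sum[OF sA] s])
      fix i
      have "(\<Sum>A\<in>P. N (\<phi> (A \<inter> E i))) = (\<Sum>A\<in>(\<lambda>A. A \<inter> E i) ` P. N (\<phi> A))"
      proof (rule sum.reindex_nontrivial[symmetric, unfolded o_def])
        show "finite P" using P by (simp add: parts_def)
        fix A A' assume "A \<in> P" "A' \<in> P" "A \<noteq> A'" "A \<inter> E i = A' \<inter> E i"
        moreover from this have "A \<inter> A' = {}" using P by (auto simp: parts_def disjoint_def)
        ultimately have "A \<inter> E i = {}" by blast
        then show "N (\<phi> (A \<inter> E i)) = 0" by (simp add: \<phi>_empty n(5))
      qed
      also have "\<dots> \<le> tv (E i)"
      proof (rule tv_upper)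
        have "disjoint ((\<lambda>A. A \<inter> E i) ` P)"
        proof (rule disjointI)
          fix X Y assume "X \<in> (\<lambda>A. A \<inter> E i) ` P" "Y \<in> (\<lambda>A. A \<inter> E i) ` P" "X \<noteq> Y"
          then obtain A A' where A: "A \<in> P" "A' \<in> P" "X = A \<inter> E i" "Y = A' \<inter> E i" "A \<noteq> A'" by blast
          then have "A \<inter> A' = {}" using P by (auto simp: parts_def disjoint_def)
          then show "X \<inter> Y = {}" using A by blast
        qed
        then show "(\<lambda>A. A \<inter> E i) ` P \<in> parts (E i)" using P AE by (auto simp: parts_def)
      qed
      finally show "(\<Sum>A\<in>P. N (\<phi> (A \<inter> E i))) \<le> tv (E i)" .
    qed
    finally show "(\<Sum>A\<in>P. N (\<phi> A)) \<le> (\<Sum>i. tv (E i))" .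
  qed
  then have "(\<Sum>i. tv (E i)) = tv (\<Union>i. E i)" using suminf_le_const[OF s le] by (rule order_antisym[rotated])
  then show ?thesis using summable_sums[OF s] by (simp only:)
qed

lemma measure_from_sums:
  assumes f: "\<And>E. E \<in> sets M \<Longrightarrow> 0 \<le> f E" "f {} = 0"
    and s: "\<And>E::nat \<Rightarrow> 't set. range E \<subseteq> sets M \<Longrightarrow> disjoint_family E \<Longrightarrow> (\<lambda>i. f (E i)) sums f (\<Union>i. E i)"
  defines "\<mu> \<equiv> measure_of (space M) (sets M) (\<lambda>E. ennreal (f E))"
  shows "sets \<mu> = sets M" "\<And>E. E \<in> sets M \<Longrightarrow> emeasure \<mu> E = ennreal (f E)"
proof -
  show "sets \<mu> = sets M" unfolding \<mu>_def by simp
  have "countably_additive (sets M) (\<lambda>E. ennreal (f E))"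
  proof (rule countably_additiveI)
    fix A :: "nat \<Rightarrow> 't set" assume "range A \<subseteq> sets M" "disjoint_family A" "(\<Union>i. A i) \<in> sets M"
    then show "(\<Sum>i. ennreal (f (A i))) = ennreal (f (\<Union>i. A i))"
      using f(1) s by (intro suminf_ennreal_eq) (auto simp: image_subset_iff)
  qed
  moreover have "positive (sets M) (\<lambda>E. ennreal (f E))" by (simp add: positive_def f(2))
  ultimately show "emeasure \<mu> E = ennreal (f E)" if "E \<in> sets M" for E
    unfolding \<mu>_def using that by (intro emeasure_measure_of_sigma sets.sigma_algebra_axioms) auto
qed

text \<open>Radon-Nikodym is applied to each coordinate of \<phi> with respect to \<open>tv\<close>.
  Countably many functionals then bound the combined density by \<open>1\<close> almost everywhere,
  and on the exceptional null set \<open>u\<close> is put to \<open>0\<close>.\<close>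

lemma density_exists:
  obtains \<nu> u where "sets \<nu> = sets M" "finite_measure \<nu>" "\<And>E. E \<in> sets M \<Longrightarrow> emeasure \<nu> E = ennreal (tv E)"
    "\<And>t. u t \<in> V" "\<And>t. N (u t) \<le> 1" "\<And>b. b \<in> B \<Longrightarrow> (\<lambda>t. c b (u t)) \<in> borel_measurable \<nu>"
    "\<And>E. E \<in> sets M \<Longrightarrow> \<phi> E = wint \<nu> (\<lambda>t. indicator E t *\<^sub>R u t)"
proof -
  have tv0: "tv {} = 0"
  proof -
    have "tv {} + tv {} \<le> tv ({} \<union> {})" by (rule tv_superadditive) simp
    then show ?thesis using tv_nonneg[of "{}"] by simp
  qed
  define \<nu> where "\<nu> = measure_of (space M) (sets M) (\<lambda>E. ennreal (tv E))"
  have \<nu>: "sets \<nu> = sets M" "\<And>E. E \<in> sets M \<Longrightarrow> emeasure \<nu> E = ennreal (tv E)"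
    unfolding \<nu>_def using measure_from_sums[of tv] tv_nonneg tv0 tv_sums by auto
  have sp: "space \<nu> = space M" by (rule sets_eq_imp_space_eq[OF \<nu>(1)])
  have fin\<nu>: "finite_measure \<nu>" by (rule finite_measureI) (simp add: sp \<nu>(2))
  interpret \<nu>: finite_measure \<nu> by fact
  have m\<nu>: "measure \<nu> E = tv E" if "E \<in> sets M" for E using \<nu>(2)[OF that] tv_nonneg by (simp add: measure_def)
  obtain C where C: "C \<ge> 0" "\<forall>x\<in>V. \<forall>b\<in>B. \<bar>c b x\<bar> \<le> C * N x" using coord_bound by blast
  have "\<exists>g. integrable \<nu> g \<and> (\<forall>E\<in>sets M. (\<integral>t. indicator E t * g t \<partial>\<nu>) = c b (\<phi> E))" if b: "b \<in> B" for b
  proof -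
    \<comment> \<open>The multiple of \<open>tv\<close> makes the signed coordinate nonnegative; it
      is taken off the density again as the constant \<open>C\<close>.\<close>
    define f where "f = (\<lambda>E. C * tv E + c b (\<phi> E))"
    define \<eta> where "\<eta> = measure_of (space M) (sets M) (\<lambda>E. ennreal (f E))"
    have f0: "0 \<le> f E" if E: "E \<in> sets M" for E
    proof -
      have "\<bar>c b (\<phi> E)\<bar> \<le> C * N (\<phi> E)" using C b \<phi>_V[OF E] by blast
      also have "\<dots> \<le> C * tv E" using N_le_tv[OF E] C by (intro mult_left_mono)
      finally show ?thesis by (simp add: f_def)
    qed
    have fe: "f {} = 0" by (simp add: f_def tv0 \<phi>_empty linear_0[OF c_linear[OF b]])
    have fs: "(\<lambda>i. f (E i)) sums f (\<Union>i. E i)" if E: "range E \<subseteq> sets M" "disjoint_family E" for E :: "nat \<Rightarrow> 't set"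
    proof -
      have "(\<lambda>i. \<phi> (E i)) sums \<phi> (\<Union>i. E i)" using vm E by (simp add: vector_measure_def)
      moreover have "\<phi> (E i) \<in> V" "\<phi> (\<Union>i. E i) \<in> V" for i using E(1) by (auto intro!: \<phi>_V)
      ultimately have "(\<lambda>i. c b (\<phi> (E i))) sums c b (\<phi> (\<Union>i. E i))"
        by (intro functional_sums c_linear b)
      then show ?thesis unfolding f_def by (intro sums_add sums_mult tv_sums E)
    qed
    have \<eta>: "sets \<eta> = sets M" "\<And>E. E \<in> sets M \<Longrightarrow> emeasure \<eta> E = ennreal (f E)"
      unfolding \<eta>_def using measure_from_sums[of f] f0 fe fs by auto
    have "absolutely_continuous \<nu> \<eta>"
      unfolding absolutely_continuous_def
    proof
      fix E assume E: "E \<in> null_sets \<nu>"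
      then have EM: "E \<in> sets M" using \<nu>(1) by auto
      then have "tv E = 0" using E \<nu>(2)[OF EM] tv_nonneg[of E] by (simp add: null_sets_def)
      then have "N (\<phi> E) = 0" using N_le_tv[OF EM] n(9)[of "\<phi> E"] by simp
      then have "\<phi> E = 0" using n(4)[OF \<phi>_V[OF EM]] by simp
      then show "E \<in> null_sets \<eta>" using \<open>tv E = 0\<close> \<eta> EM
        by (auto simp: null_sets_def f_def linear_0[OF c_linear[OF b]])
    qed
    then obtain h where h: "h \<in> borel_measurable \<nu>" "density \<nu> h = \<eta>"
      using \<nu>.Radon_Nikodym[of \<eta>] \<eta>(1) \<nu>(1) by auto
    have hE: "(\<integral>\<^sup>+t. h t * indicator E t \<partial>\<nu>) = ennreal (f E)" if E: "E \<in> sets M" for E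
      using emeasure_density[OF h(1), of E] \<eta>(2)[OF E] E \<nu>(1) h(2) by simp
    have "(\<integral>\<^sup>+t. h t \<partial>\<nu>) = (\<integral>\<^sup>+t. h t * indicator (space M) t \<partial>\<nu>)"
      by (intro nn_integral_cong) (auto simp: sp)
    also have "\<dots> \<noteq> \<infinity>" using hE[of "space M"] by simp
    finally have hfin: "AE t in \<nu>. h t \<noteq> \<infinity>" using nn_integral_noteq_infinite[OF h(1)] by simp
    define g0 where "g0 = (\<lambda>t. enn2real (h t))"
    have g0m: "g0 \<in> borel_measurable \<nu>" unfolding g0_def using h(1) by simp
    have g0E: "(\<integral>\<^sup>+t. ennreal (indicator E t * g0 t) \<partial>\<nu>) = ennreal (f E)" if E: "E \<in> sets M" for E
    proof -
      have "(\<integral>\<^sup>+t. ennreal (indicator E t * g0 t) \<partial>\<nu>) = (\<integral>\<^sup>+t. h t * indicator E t \<partial>\<nu>)"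
        using hfin by (intro nn_integral_cong_AE) (auto simp: g0_def indicator_def less_top)
      then show ?thesis using hE[OF E] by simp
    qed
    have g0i: "integrable \<nu> (\<lambda>t. indicator E t * g0 t)" if E: "E \<in> sets M" for E
      by (rule integrableI_nonneg) (use g0m g0E[OF E] E \<nu>(1) in \<open>auto simp: g0_def intro!: borel_measurable_times borel_measurable_indicator\<close>)
    have g0I: "(\<integral>t. indicator E t * g0 t \<partial>\<nu>) = f E" if E: "E \<in> sets M" for E
      by (subst integral_eq_nn_integral) (use g0m g0E[OF E] f0[OF E] E \<nu>(1) in \<open>auto simp: g0_def intro!: borel_measurable_times borel_measurable_indicator\<close>)
    have g0: "integrable \<nu> g0"
      by (rule Bochner_Integration.integrable_cong[OF refl, THEN iffD1, OF _ g0i[OF sets.top]]) (simp add: sp)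
    define g where "g = (\<lambda>t. g0 t - C)"
    have "integrable \<nu> g" unfolding g_def using g0 by simp
    moreover have "(\<integral>t. indicator E t * g t \<partial>\<nu>) = c b (\<phi> E)" if E: "E \<in> sets M" for E
    proof -
      have "(\<integral>t. indicator E t * g t \<partial>\<nu>) = (\<integral>t. indicator E t * g0 t - C * indicator E t \<partial>\<nu>)"
        by (simp add: g_def algebra_simps)
      also have "\<dots> = f E - C * tv E"
        using g0i[OF E] g0I[OF E] E \<nu>(1) m\<nu>[OF E] by (subst Bochner_Integration.integral_diff) (auto simp: sp intro!: \<nu>.integrable_const_bound[of _ 1])
      finally show ?thesis by (simp add: f_def)
    qed
    ultimately show ?thesis by blast
  qed
  then have "\<forall>b\<in>B. \<exists>g. integrable \<nu> g \<and> (\<forall>E\<in>sets M. (\<integral>t. indicator E t * g t \<partial>\<nu>) = c b (\<phi> E))" by blast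
  then obtain g where g: "\<And>b. b \<in> B \<Longrightarrow> integrable \<nu> (g b)"
      "\<And>b E. b \<in> B \<Longrightarrow> E \<in> sets M \<Longrightarrow> (\<integral>t. indicator E t * g b t \<partial>\<nu>) = c b (\<phi> E)"
    using bchoice[of B "\<lambda>b g. integrable \<nu> g \<and> (\<forall>E\<in>sets M. (\<integral>t. indicator E t * g t \<partial>\<nu>) = c b (\<phi> E))"] by blast
  define v where "v = (\<lambda>t. \<Sum>b\<in>B. g b t *\<^sub>R b)"
  have vV: "v t \<in> V" for t unfolding v_def by (intro V_closed B_V)
  have cv: "c b (v t) = g b t" if "b \<in> B" for b t unfolding v_def by (rule c_sum[OF that])
  obtain L :: "('v \<Rightarrow> real) set" where L: "countable L" "\<And>l. l \<in> L \<Longrightarrow> linear l"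
    "\<And>l y. l \<in> L \<Longrightarrow> y \<in> V \<Longrightarrow> l y \<le> N y" "\<And>y. y \<in> V \<Longrightarrow> (\<And>l. l \<in> L \<Longrightarrow> l y \<le> 1) \<Longrightarrow> N y \<le> 1"
    by (rule countable_norming) blast
  have lv: "l (v t) = (\<Sum>b\<in>B. g b t * l b)" if "l \<in> L" for l t
    unfolding v_def by (simp add: linear_sum[OF L(2)[OF that]] linear_scale[OF L(2)[OF that]])
  have lvi: "integrable \<nu> (\<lambda>t. l (v t))" if "l \<in> L" for l unfolding lv[OF that] using g(1) by auto
  have AEl: "AE t in \<nu>. l (v t) \<le> 1" if l: "l \<in> L" for l
  proof -
    \<comment> \<open>The integral of \<open>l (v t)\<close> over this set is
      \<open>l (\<phi> ?E)\<close>, at most the measure of the set. So the integral of the positive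
      function \<open>l (v t) - 1\<close> over it is at most \<open>0\<close>, and the set is
      null.\<close>
    let ?E = "{t \<in> space M. 1 < l (v t)}"
    have E: "?E \<in> sets M" using borel_measurable_less[of "\<lambda>_. 1" \<nu> "\<lambda>t. l (v t)"] lvi[OF l] \<nu>(1) sp by auto
    let ?f = "\<lambda>t. indicator ?E t * (l (v t) - 1)"
    have fi: "integrable \<nu> ?f" using integrable_mult_indicator[of ?E \<nu> "\<lambda>t. l (v t) - 1"] lvi[OF l] E \<nu>(1) by simp
    have ii: "integrable \<nu> (\<lambda>t. indicator ?E t * g b t)" if "b \<in> B" for b
      using integrable_mult_indicator[of ?E \<nu> "g b"] g(1)[OF that] E \<nu>(1) by simp
    have "(\<integral>t. indicator ?E t * l (v t) \<partial>\<nu>) = (\<integral>t. (\<Sum>b\<in>B. (indicator ?E t * g b t) * l b) \<partial>\<nu>)"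
      by (intro Bochner_Integration.integral_cong refl) (subst lv[OF l], simp add: sum_distrib_left mult.assoc)
    also have "\<dots> = (\<Sum>b\<in>B. c b (\<phi> ?E) * l b)"
      using ii g(2)[OF _ E] by (subst Bochner_Integration.integral_sum) auto
    also have "\<dots> = l (\<phi> ?E)" using linear_expand[OF L(2)[OF l] \<phi>_V[OF E]] by simp
    also have "\<dots> \<le> N (\<phi> ?E)" by (rule L(3)[OF l \<phi>_V[OF E]])
    also have "\<dots> \<le> measure \<nu> ?E" using N_le_tv[OF E] m\<nu>[OF E] by simp
    finally have a: "(\<integral>t. indicator ?E t * l (v t) \<partial>\<nu>) \<le> measure \<nu> ?E" .
    have "(\<integral>t. ?f t \<partial>\<nu>) = (\<integral>t. indicator ?E t * l (v t) - indicator ?E t \<partial>\<nu>)" by (simp add: algebra_simps)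
    also have "\<dots> = (\<integral>t. indicator ?E t * l (v t) \<partial>\<nu>) - measure \<nu> ?E"
      using integrable_mult_indicator[of ?E \<nu> "\<lambda>t. l (v t)"] lvi[OF l] E \<nu>(1)
      by (subst Bochner_Integration.integral_diff) (auto simp: sp intro!: \<nu>.integrable_const_bound[of _ 1])
    finally have "(\<integral>t. ?f t \<partial>\<nu>) \<le> 0" using a by simp
    moreover have f0: "AE t in \<nu>. 0 \<le> ?f t" by (auto simp: indicator_def)
    ultimately have "(\<integral>t. ?f t \<partial>\<nu>) = 0" using integral_nonneg_AE[OF f0] by simp
    then have "AE t in \<nu>. ?f t = 0" using integral_nonneg_eq_0_iff_AE[OF fi f0] by simp
    then show ?thesis using AE_space by eventually_elim (auto simp: indicator_def sp split: if_splits)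
  qed
  define G where "G = {t \<in> space M. \<forall>l\<in>L. l (v t) \<le> 1}"
  have Gs: "G \<in> sets \<nu>"
  proof (cases "L = {}")
    case True
    then show ?thesis using sets.top[of \<nu>] by (simp add: G_def sp)
  next
    case False
    have "{t \<in> space \<nu>. l (v t) \<le> 1} \<in> sets \<nu>" if "l \<in> L" for l
      by (rule borel_measurable_le) (use lvi[OF that] in auto)
    then have "(\<Inter>l\<in>L. {t \<in> space \<nu>. l (v t) \<le> 1}) \<in> sets \<nu>"
      using False L(1) by (intro sets.countable_INT') auto
    moreover have "G = (\<Inter>l\<in>L. {t \<in> space \<nu>. l (v t) \<le> 1})" using False by (auto simp: G_def sp)
    ultimately show ?thesis by simp
  qed
  have AEG: "AE t in \<nu>. t \<in> G"
  proof -
    have "AE t in \<nu>. \<forall>l\<in>L. l (v t) \<le> 1" by (rule AE_ball_countable'[OF _ L(1)]) (rule AEl)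
    then show ?thesis using AE_space by eventually_elim (auto simp: G_def sp)
  qed
  define u where "u = (\<lambda>t. indicator G t *\<^sub>R v t)"
  show ?thesis
  proof (rule that[of \<nu> u, OF \<nu>(1) fin\<nu> \<nu>(2)])
    show "u t \<in> V" for t unfolding u_def by (intro V_closed vV)
    show "N (u t) \<le> 1" for t using L(4)[OF vV] by (auto simp: u_def indicator_def G_def n(5))
    show "(\<lambda>t. c b (u t)) \<in> borel_measurable \<nu>" if "b \<in> B" for b
      unfolding u_def linear_scale[OF c_linear[OF that]] cv[OF that] using g(1)[OF that] Gs by simp
    show "\<phi> E = wint \<nu> (\<lambda>t. indicator E t *\<^sub>R u t)" if E: "E \<in> sets M" for E
    proof (rule V_eqI[OF \<phi>_V[OF E] wint_V])
      fix b assume b: "b \<in> B"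
      have "(\<integral>t. c b (indicator E t *\<^sub>R u t) \<partial>\<nu>) = (\<integral>t. indicator E t * g b t \<partial>\<nu>)"
        unfolding u_def linear_scale[OF c_linear[OF b]] cv[OF b]
        using AEG g(1)[OF b] Gs E \<nu>(1) by (intro integral_cong_AE) (auto simp: indicator_def)
      then show "c b (\<phi> E) = c b (wint \<nu> (\<lambda>t. indicator E t *\<^sub>R u t))" using g(2)[OF b E] by (simp add: c_wint[OF b])
    qed
  qed
qed

end

section \<open>Reparametrization by the cumulative norm\<close>

context fd_algebra
begin

text \<open>The coordinatewise sum: it lies in \<open>V\<close> in any case and does not refer to a
  topology.\<close>

definition vsum :: "(nat \<Rightarrow> 'v) \<Rightarrow> 'v" where
  "vsum x = (\<Sum>b\<in>B. (\<Sum>k. c b (x k)) *\<^sub>R b)"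

lemma vsum_V: "vsum x \<in> V" unfolding vsum_def by (intro V_closed B_V)

lemma functional_summable:
  fixes l :: "'v \<Rightarrow> real"
  assumes "linear l" "\<And>k. x k \<in> V" "summable (\<lambda>k. N (x k))"
  shows "summable (\<lambda>k. \<bar>l (x k)\<bar>)"
proof -
  obtain C where "C \<ge> 0" "\<forall>x\<in>V. \<bar>l x\<bar> \<le> C * N x" using functional_bounded[OF assms(1)] by blast
  then show ?thesis using assms(2)
    by (intro summable_comparison_test'[OF summable_mult[OF assms(3), of C]]) auto
qed

lemma c_vsum: "b \<in> B \<Longrightarrow> c b (vsum x) = (\<Sum>k. c b (x k))"
  unfolding vsum_def by (rule c_sum)

lemma vsum_functional:
  fixes l :: "'v \<Rightarrow> real"
  assumes l: "linear l" and x: "\<And>k. x k \<in> V" "summable (\<lambda>k. N (x k))"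
  shows "(\<lambda>k. l (x k)) sums l (vsum x)"
proof -
  have "(\<lambda>k. \<Sum>b\<in>B. c b (x k) * l b) sums (\<Sum>b\<in>B. (\<Sum>k. c b (x k)) * l b)"
    using summable_rabs_cancel[OF functional_summable[OF c_linear x]]
    by (intro sums_sum sums_mult2 summable_sums) auto
  moreover have "(\<Sum>b\<in>B. c b (x k) * l b) = l (x k)" for k using linear_expand[OF l x(1)] by simp
  moreover have "(\<Sum>b\<in>B. (\<Sum>k. c b (x k)) * l b) = l (vsum x)"
    unfolding vsum_def by (simp add: linear_sum[OF l] linear_scale[OF l])
  ultimately show ?thesis by simp
qed

lemma vsum_sums:
  assumes x: "\<And>k. x k \<in> V" "summable (\<lambda>k. N (x k))"
  shows "x sums vsum x"
proof -
  have "(\<lambda>k. \<Sum>b\<in>B. c b (x k) *\<^sub>R b) sums (\<Sum>b\<in>B. (\<Sum>k. c b (x k)) *\<^sub>R b)"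
    using summable_rabs_cancel[OF functional_summable[OF c_linear x]]
    by (intro sums_sum sums_scaleR_left summable_sums) auto
  moreover have "(\<Sum>b\<in>B. c b (x k) *\<^sub>R b) = x k" for k using c_expand[OF x(1)] by simp
  ultimately show ?thesis by (simp add: vsum_def)
qed

lemma vsum_linear:
  assumes L: "linear L" "\<And>x. x \<in> V \<Longrightarrow> L x \<in> V" and x: "\<And>k. x k \<in> V" "summable (\<lambda>k. N (x k))"
  shows "L (vsum x) = vsum (\<lambda>k. L (x k))"
proof (rule V_eqI)
  fix b assume b: "b \<in> B"
  have "linear (\<lambda>x. c b (L x))" using linear_compose[OF L(1) c_linear[OF b]] by (simp add: o_def)
  from sums_unique[OF vsum_functional[OF this x]] show "c b (L (vsum x)) = c b (vsum (\<lambda>k. L (x k)))"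
    by (simp add: c_vsum[OF b])
qed (auto intro: vsum_V L)

lemma N_vsum_le:
  assumes x: "\<And>k. x k \<in> V" "summable (\<lambda>k. N (x k))"
  shows "N (vsum x) \<le> (\<Sum>k. N (x k))"
  by (rule N_sums_le[OF x(1) vsum_V vsum_sums[OF x] x(2)])

text \<open>Left multiplication by \<open>S\<close> is injective on a finite-dimensional space, so
  \<open>e\<close> lies in its range. The right inverse \<open>y\<close> is two-sided because
  \<open>S\<close> annihilates \<open>m y S - e\<close>.\<close>

lemma invertibleI:
  assumes S: "S \<in> V" and inj: "\<And>v. v \<in> V \<Longrightarrow> m S v = 0 \<Longrightarrow> v = 0"
  shows "\<exists>y\<in>V. m S y = e \<and> m y S = e"
proof -
  have indB: "independent B"
  proof (rule independent_if_scalars_zero[OF B(1)])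
    fix f b assume "(\<Sum>x\<in>B. f x *\<^sub>R x) = 0" "b \<in> B"
    then show "f b = 0" using c_sum[of b f] linear_0[OF c_linear[of b]] by simp
  qed
  have injV: "inj_on (m S) (span B)"
  proof (rule inj_onI)
    fix x y assume "x \<in> span B" "y \<in> span B" "m S x = m S y"
    then show "x = y" using inj[of "x - y"] V_closed(3)[of x y] B(3) by (simp add: m_simps)
  qed
  have ind: "independent (m S ` B)" by (rule linear_independent_injective_image[OF m_linear(1) indB injV])
  have "e \<in> span (m S ` B)"
  proof (rule ccontr)
    assume ne: "\<not> ?thesis"
    then have "independent (insert e (m S ` B))" using ind by (simp add: independent_insertI)
    moreover have "insert e (m S ` B) \<subseteq> span B" using e_V m_V B(3) by auto
    ultimately have "card (insert e (m S ` B)) \<le> card B" using independent_span_bound[OF B(1)] by blast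
    moreover have "card (m S ` B) = card B" by (rule card_image[OF inj_on_subset[OF injV span_superset]])
    moreover have "e \<notin> m S ` B"
    proof
      assume "e \<in> m S ` B"
      then have "e \<in> span (m S ` B)" by (rule span_base)
      then show False using ne by simp
    qed
    ultimately show False using B(1) by simp
  qed
  then obtain y where y: "y \<in> span B" "m S y = e"
    using linear_span_image[OF m_linear(1), of S B] by auto
  have yV: "y \<in> V" using y B(3) by simp
  have "m S (m y S - e) = 0" using y(2) S by (simp add: m_simps m_e flip: m_assoc)
  then have "m y S - e = 0" by (rule inj[rotated]) (intro V_closed(3) m_V e_V)
  then show ?thesis using yV y(2) by (intro bexI[of _ y]) auto
qed

end

section \<open>The distribution function of the cumulative norm\<close>

context ordered_density
begin

text \<open>\<nu> moved from \<open>I\<close> to the whole line, where it has a distribution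
  function.\<close>

definition \<nu>r :: "real measure" where "\<nu>r = distr \<nu> borel (\<lambda>x. x)"

sublocale r: finite_borel_measure \<nu>r
proof (rule finite_borel_measure.intro)
  show "finite_measure \<nu>r" unfolding \<nu>r_def by (rule \<nu>.finite_measure_distr[OF id_meas])
  show "finite_borel_measure_axioms \<nu>r" by (rule finite_borel_measure_axioms.intro) (simp add: \<nu>r_def)
qed

definition F :: "real \<Rightarrow> real" where "F = cdf \<nu>r"

definition w :: real where "w = measure \<nu> I"

lemma w_nonneg: "0 \<le> w" by (simp add: w_def)

lemma F_eq: "F t = measure \<nu> {r \<in> I. r \<le> t}"
  unfolding F_def cdf_def \<nu>r_def using measure_distr[OF id_meas, of "{..t}"]
  by (simp add: space_\<nu> vimage_def Int_def conj_commute)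

lemma F_mono: "s \<le> t \<Longrightarrow> F s \<le> F t"
  unfolding F_def by (rule r.cdf_nondecreasing)

lemma F_bounds: "0 \<le> F t" "F t \<le> w"
  unfolding F_eq w_def using \<nu>.bounded_measure by (auto simp: space_\<nu>)

lemma F_cont: "isCont F t"
proof -
  have "measure \<nu>r {t} = measure \<nu> ({t} \<inter> I)"
    unfolding \<nu>r_def using measure_distr[OF id_meas, of "{t}"] by (simp add: space_\<nu> vimage_def Int_def)
  also have "\<dots> = 0" using atomless[of t] by (cases "t \<in> I") (auto simp: measure_def)
  finally show ?thesis unfolding F_def by (simp add: r.isCont_cdf)
qed

lemma F_meas: "F \<in> borel_measurable \<nu>"
proof -
  have "continuous_on UNIV F" using F_cont by (simp add: continuous_at_imp_continuous_on)
  then have "F \<in> borel_measurable borel" by (rule borel_measurable_continuous_onI)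
  then show ?thesis using measurable_compose[OF id_meas] by blast
qed

text \<open>\<open>F\<close> may be constant on intervals. The sublevel set consists of the points
  of \<open>I\<close> up to the largest \<open>t0\<close> with \<open>F t0 \<le> x\<close>, and
  continuity from the right gives \<open>F t0 = x\<close>. If no such point exists, then
  \<open>x = 0\<close>, because \<open>F\<close> tends to \<open>0\<close> on the left.\<close>

lemma F_level:
  assumes "0 \<le> x" "x < w"
  shows "measure \<nu> {r \<in> I. F r \<le> x} = x"
proof -
  define T where "T = {t. F t \<le> x}"
  have "measure \<nu>r (space \<nu>r) = w"
    unfolding \<nu>r_def using measure_distr[OF id_meas, of UNIV] by (simp add: w_def space_\<nu>)
  then have top: "(F \<longlongrightarrow> w) at_top"
    using r.cdf_lim_at_top by (simp add: F_def)
  have "eventually (\<lambda>t. x < F t) at_top" using order_tendstoD(1)[OF top assms(2)] .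
  then obtain t1 where t1: "x < F t1" using eventually_happens by fastforce
  have bdd: "t \<le> t1" if "t \<in> T" for t
    using that t1 F_mono[of t1 t] by (auto simp: T_def intro: linorder_le_cases)
  show ?thesis
  proof (cases "T = {}")
    case True
    have "x = 0"
    proof (rule ccontr)
      assume "x \<noteq> 0"
      then have "eventually (\<lambda>t. F t < x) at_bot"
        using order_tendstoD(2)[OF r.cdf_lim_at_bot, of x] assms(1) by (simp add: F_def)
      then obtain t where "F t < x" using eventually_happens by fastforce
      then show False using True less_imp_le[of "F t" x] by (auto simp: T_def)
    qed
    have none: "{r \<in> I. F r \<le> x} = {}" using True by (auto simp: T_def)
    show ?thesis unfolding none using \<open>x = 0\<close> by simp
  next
    case False
    define t0 where "t0 = Sup T"
    have ba: "bdd_above T" using bdd by (rule bdd_aboveI)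
    have cl: "closed T" unfolding T_def
      by (intro closed_Collect_le continuous_at_imp_continuous_on) (auto intro: F_cont)
    have t0T: "t0 \<in> T" unfolding t0_def by (rule closed_contains_Sup[OF False ba cl])
    have iff: "F t \<le> x \<longleftrightarrow> t \<le> t0" for t
      using cSup_upper[OF _ ba, of t] t0T F_mono[of t t0] by (auto simp: T_def t0_def)
    have "x \<le> F t0"
    proof (rule tendsto_lowerbound)
      show "(F \<longlongrightarrow> F t0) (at_right t0)" using F_cont[of t0] by (simp add: isCont_def filterlim_at_split)
      show "eventually (\<lambda>t. x \<le> F t) (at_right t0)"
        using iff by (auto simp: eventually_at_right_field intro!: exI[of _ "t0 + 1"] less_imp_le) (meson not_le)
    qed simp
    then have "F t0 = x" using t0T by (simp add: T_def)
    moreover have "{r \<in> I. F r \<le> x} = {r \<in> I. r \<le> t0}" using iff by auto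
    ultimately show ?thesis using F_eq[of t0] by simp
  qed
qed

text \<open>The probability integral transform: a continuous distribution function carries its
  measure to Lebesgue measure. Integrals of functions of \<open>F\<close> become ordinary integrals
  over \<open>{0..w}\<close>.\<close>

lemma distr_F: "distr \<nu> borel F = density lborel (indicator {0..w})"
proof (rule measure_eqI_lessThan)
  fix x :: real
  have e1: "emeasure (distr \<nu> borel F) {x<..} = ennreal (measure \<nu> {r \<in> I. x < F r})"
    using emeasure_distr[OF F_meas, of "{x<..}"] by (simp add: \<nu>.emeasure_eq_measure space_\<nu> vimage_def Int_def conj_commute)
  have ms: "{r \<in> I. F r \<le> x} \<in> sets \<nu>"
    using borel_measurable_le[OF F_meas, of "\<lambda>_. x"] by (simp add: space_\<nu>)
  have "{r \<in> I. x < F r} = space \<nu> - {r \<in> I. F r \<le> x}" by (auto simp: space_\<nu>)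
  then have e2: "measure \<nu> {r \<in> I. x < F r} = w - measure \<nu> {r \<in> I. F r \<le> x}"
    using \<nu>.finite_measure_compl[OF ms] by (simp add: w_def space_\<nu>)
  have "emeasure (density lborel (indicator {0..w})) {x<..} = emeasure lborel ({0..w} \<inter> {x<..})"
    by (subst emeasure_density) (auto simp: nn_integral_indicator[symmetric] indicator_inter_arith simp del: nn_integral_indicator)
  moreover have "emeasure (distr \<nu> borel F) {x<..} = emeasure lborel ({0..w} \<inter> {x<..})"
  proof -
    consider "x < 0" | "0 \<le> x" "x < w" | "w \<le> x" by linarith
    then show ?thesis
    proof cases
      case 1
      then have none: "{r \<in> I. F r \<le> x} = {}" using F_bounds(1) by (auto simp: not_le intro: less_le_trans)
      have "measure \<nu> {r \<in> I. F r \<le> x} = 0" unfolding none by simp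
      moreover have "{0..w} \<inter> {x<..} = {0..w}" using 1 by auto
      ultimately show ?thesis using e1 e2 w_nonneg by simp
    next
      case 2
      have "{0..w} \<inter> {x<..} = {x<..w}" using 2 by auto
      then show ?thesis using e1 e2 F_level[OF 2] 2 by simp
    next
      case 3
      then have none: "{r \<in> I. x < F r} = {}" by (auto simp: not_less intro: order_trans[OF F_bounds(2)])
      have "measure \<nu> {r \<in> I. x < F r} = 0" unfolding none by simp
      moreover have "{0..w} \<inter> {x<..} = {}" using 3 by auto
      ultimately show ?thesis using e1 by simp
    qed
  qed
  ultimately show "emeasure (distr \<nu> borel F) {x<..} = emeasure (density lborel (indicator {0..w})) {x<..}" by simp
  show "emeasure (distr \<nu> borel F) {x<..} < \<infinity>" unfolding e1 by simp
qed auto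

lemma integral_F:
  assumes st: "0 \<le> s" "t \<le> w" and g: "continuous_on {s..t} g"
  shows "integrable \<nu> (\<lambda>r. indicator {s..t} (F r) * g (F r))"
    "(\<integral>r. indicator {s..t} (F r) * g (F r) \<partial>\<nu>) = integral {s..t} (g :: real \<Rightarrow> real)"
proof -
  let ?h = "\<lambda>x. indicator {s..t} x * g x"
  have hm: "?h \<in> borel_measurable borel"
    using borel_measurable_continuous_on_indicator[of "{s..t}" g] g by simp
  have hi: "set_integrable lborel {s..t} g" by (rule borel_integrable_atLeastAtMost') (rule g)
  have eq: "indicator {0..w} x *\<^sub>R ?h x = ?h x" for x using st by (auto simp: indicator_def)
  have d: "integrable (density lborel (indicator {0..w})) ?h \<longleftrightarrow> integrable lborel (\<lambda>x. indicator {0..w} x *\<^sub>R ?h x)"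
    using integrable_density[of ?h lborel "indicator {0..w} :: real \<Rightarrow> real"] hm by (simp add: ennreal_indicator)
  have "integrable lborel ?h" using hi by (simp add: set_integrable_def)
  then have "integrable (distr \<nu> borel F) ?h" unfolding distr_F d eq .
  then show "integrable \<nu> (\<lambda>r. indicator {s..t} (F r) * g (F r))"
    using integrable_distr[OF F_meas] by blast
  have "(\<integral>r. ?h (F r) \<partial>\<nu>) = (\<integral>x. ?h x \<partial>distr \<nu> borel F)" by (rule integral_distr[OF F_meas hm, symmetric])
  also have "\<dots> = (\<integral>x. indicator {0..w} x *\<^sub>R ?h x \<partial>lborel)"
    unfolding distr_F using integral_density[of ?h lborel "indicator {0..w} :: real \<Rightarrow> real"] hm by (simp add: ennreal_indicator)
  also have "\<dots> = (LINT x:{s..t}|lborel. g x)" unfolding eq by (simp add: set_lebesgue_integral_def)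
  also have "\<dots> = integral {s..t} g" by (rule set_borel_integral_eq_integral(2)[OF hi])
  finally show "(\<integral>r. ?h (F r) \<partial>\<nu>) = integral {s..t} g" .
qed

text \<open>Intervals on which \<open>F\<close> is constant are null, so comparing points agrees
  almost everywhere with comparing their values under \<open>F\<close>.\<close>

lemma AE_F_neq: "AE r in \<nu>. F r \<noteq> x"
proof -
  have "AE y in density lborel (indicator {0..w}). y \<noteq> x"
    by (subst AE_density) (auto intro: AE_mp[OF AE_lborel_singleton])
  then have "AE y in distr \<nu> borel F. y \<noteq> x" unfolding distr_F .
  then show ?thesis by (subst (asm) AE_distr_iff[OF F_meas]) auto
qed

definition step :: "(real \<Rightarrow> 'v) \<Rightarrow> real \<Rightarrow> 'v" where
  "step G x = wint \<nu> (\<lambda>r. of_bool (x \<le> F r) *\<^sub>R m (u r) (G r))"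

lemma step_nice: "nice \<nu> G \<Longrightarrow> nice \<nu> (\<lambda>r. of_bool (x \<le> F r) *\<^sub>R m (u r) (G r))"
proof (rule nice_scaleR[OF nice_m[OF u_nice], of _ _ 1])
  have "{r \<in> space \<nu>. x \<le> F r} \<in> sets \<nu>" by (rule borel_measurable_le[OF _ F_meas]) simp
  then have "(indicator {r \<in> space \<nu>. x \<le> F r} :: real \<Rightarrow> real) \<in> borel_measurable \<nu>" by (rule borel_measurable_indicator)
  then show "(\<lambda>r. of_bool (x \<le> F r) :: real) \<in> borel_measurable \<nu>"
    by (rule measurable_cong[THEN iffD1, rotated]) (simp add: indicator_def)
qed auto

lemma step_V: "step G x \<in> V" unfolding step_def by (rule wint_V)

lemma step_nice_borel:
  assumes G: "nice \<nu> G"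
  shows "nice borel (step G)"
proof -
  have uG: "nice \<nu> (\<lambda>r. m (u r) (G r))" by (intro nice_m u_nice G)
  then obtain C where C: "C \<ge> 0" "\<forall>x\<in>space \<nu>. N (m (u x) (G x)) \<le> C" using niceD(3)[OF uG] by blast
  show ?thesis unfolding step_def
  proof (rule nice_wint[OF finite_\<nu>, of _ _ C])
    fix b assume b: "b \<in> B"
    have 1: "{p \<in> space (borel \<Otimes>\<^sub>M \<nu>). fst p \<le> F (snd p)} \<in> sets (borel \<Otimes>\<^sub>M \<nu>)"
      by (rule borel_measurable_le) (auto intro: measurable_compose[OF measurable_snd F_meas])
    have 2: "(\<lambda>p. indicator {p \<in> space (borel \<Otimes>\<^sub>M \<nu>). fst p \<le> F (snd p)} p * c b (m (u (snd p)) (G (snd p))))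
        \<in> borel_measurable (borel \<Otimes>\<^sub>M \<nu>)"
      by (intro borel_measurable_times borel_measurable_indicator 1 measurable_compose[OF measurable_snd niceD(2)[OF uG b]])
    show "(\<lambda>(x, r). c b (of_bool (x \<le> F r) *\<^sub>R m (u r) (G r))) \<in> borel_measurable (borel \<Otimes>\<^sub>M \<nu>)"
      by (rule measurable_cong[THEN iffD1, OF _ 2])
        (auto simp: linear_scale[OF c_linear[OF b]] indicator_def)
  next
    fix s r assume "r \<in> space \<nu>"
    then show "N (of_bool (s \<le> F r) *\<^sub>R m (u r) (G r)) \<le> C" using C by (auto simp: n(3) n(5))
  qed (auto intro!: V_closed m_V)
qed

text \<open>\<open>evol\<close> as a function of the cumulative norm: \<open>ek k x\<close> is the
  \<open>k\<close>-fold term over the part of \<open>I\<close> on which \<open>F\<close> is at least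
  \<open>x\<close>. Unlike \<open>evol\<close> it is defined for all \<open>x\<close> in
  \<open>{0..w}\<close>, a domain without gaps.\<close>

primrec ek :: "nat \<Rightarrow> real \<Rightarrow> 'v" where
  "ek 0 x = e"
| "ek (Suc k) x = step (\<lambda>r. ek k (F r)) x"

lemma ek_V: "ek k x \<in> V" by (cases k) (auto simp: e_V step_V)

lemma ek_nice: "nice borel (ek k)" and ek_F_nice: "nice \<nu> (\<lambda>r. ek k (F r))"
proof -
  have c: "nice \<nu> (\<lambda>r. G (F r))" if G: "nice borel G" for G
  proof -
    obtain C where C: "\<forall>x\<in>space borel. N (G x) \<le> C" using niceD(3)[OF G] by blast
    show ?thesis
      by (rule niceI[of _ _ C]) (use C niceD(1)[OF G] measurable_compose[OF F_meas niceD(2)[OF G]] in auto)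
  qed
  show "nice borel (ek k)"
  proof (induction k)
    case 0
    have "ek 0 = (\<lambda>_. e)" by auto
    then show ?case using nice_const[OF e_V] by simp
  next
    case (Suc k)
    have "ek (Suc k) = step (\<lambda>r. ek k (F r))" by auto
    then show ?case using step_nice_borel[OF c[OF Suc]] by simp
  qed
  then show "nice \<nu> (\<lambda>r. ek k (F r))" by (rule c)
qed

lemma evol_eq: "s \<in> I \<Longrightarrow> evol k s = ek k (F s)"
proof (induction k arbitrary: s)
  case (Suc k)
  have "evol (Suc k) s = kernel_op kle (evol k) s" by simp
  also have "\<dots> = kernel_op kle (\<lambda>r. ek k (F r)) s" by (rule kernel_op_cong) (rule Suc.IH)
  also have "\<dots> = ek (Suc k) (F s)" unfolding kernel_op_def ek.simps step_def
  proof (rule wint_cong_AE[OF kernel_nice[OF good_kle ek_F_nice] step_nice[OF ek_F_nice]])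
    show "AE r in \<nu>. kle s r *\<^sub>R m (u r) (ek k (F r)) = of_bool (F s \<le> F r) *\<^sub>R m (u r) (ek k (F r))"
      using AE_F_neq[of "F s"]
    proof eventually_elim
      case (elim r)
      have "s \<le> r \<longleftrightarrow> F s \<le> F r" using F_mono[of s r] F_mono[of r s] elim by linarith
      then show ?case by (simp add: kle_def)
    qed
  qed
  finally show ?case .
qed simp

lemma EE_ek: "EE k = ek k 0"
proof (cases k)
  case (Suc j)
  have "EE k = wint \<nu> (\<lambda>s. m (u s) (evol j s))" by (simp add: Suc total_def)
  also have "\<dots> = ek k 0"
    unfolding Suc ek.simps step_def by (rule wint_cong) (simp add: evol_eq space_\<nu> F_bounds(1))
  finally show ?thesis .
qed simp

lemma ek_w: "ek (Suc k) w = 0"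
proof -
  have "ek (Suc k) w = wint \<nu> (\<lambda>_. 0)" unfolding ek.simps step_def
  proof (rule wint_cong_AE[OF step_nice[OF ek_F_nice] nice_const[OF V_closed(1)]])
    show "AE r in \<nu>. of_bool (w \<le> F r) *\<^sub>R m (u r) (ek k (F r)) = 0"
      using AE_F_neq[of w]
    proof eventually_elim
      case (elim r)
      then have "F r < w" using F_bounds(2)[of r] by simp
      then show ?case by simp
    qed
  qed
  also have "\<dots> = 0" using wint_scale[of \<nu> 0 "\<lambda>_. 0"] by simp
  finally show ?thesis .
qed

lemma ek_bound: "0 \<le> x \<Longrightarrow> x \<le> w \<Longrightarrow> N (ek k x) \<le> N e * (K ^ k * (w - x) ^ k / fact k)"
proof (induction k arbitrary: x)
  case (Suc k)
  let ?g = "\<lambda>y. N e * (K ^ Suc k * (w - y) ^ k / fact k)"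
  have gc: "continuous_on {x..w} ?g" by (intro continuous_intros) auto
  note gi = integral_F[OF Suc.prems(1) order_refl gc]
  have "N (ek (Suc k) x) \<le> (\<integral>r. indicator {x..w} (F r) * ?g (F r) \<partial>\<nu>)"
    unfolding ek.simps step_def
  proof (rule wint_norm_le[OF finite_\<nu> step_nice[OF ek_F_nice] gi(1)])
    fix r assume r: "r \<in> space \<nu>"
    show "N (of_bool (x \<le> F r) *\<^sub>R m (u r) (ek k (F r))) \<le> indicator {x..w} (F r) * ?g (F r)"
    proof (cases "x \<le> F r")
      case True
      have "N (m (u r) (ek k (F r))) \<le> K * N (ek k (F r))" using mult_u r by (simp add: space_\<nu>)
      also have "\<dots> \<le> K * (N e * (K ^ k * (w - F r) ^ k / fact k))"
        using Suc.IH[of "F r"] F_bounds K by (intro mult_left_mono) auto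
      also have "\<dots> = ?g (F r)" by simp
      finally show ?thesis using True F_bounds(2)[of r] by simp
    qed (simp add: n(5))
  qed
  also have "\<dots> = integral {x..w} ?g" by (rule gi(2))
  also have "\<dots> = N e * (K ^ Suc k * (w - x) ^ Suc k / fact (Suc k))"
  proof (rule integral_unique)
    let ?G = "\<lambda>y. - (N e * (K ^ Suc k * (w - y) ^ Suc k / fact (Suc k)))"
    have "(?g has_integral (?G w - ?G x)) {x..w}"
    proof (rule fundamental_theorem_of_calculus[OF Suc.prems(2)])
      fix y
      have "(?G has_real_derivative - (N e * (K ^ Suc k * (real (Suc k) * ((0 - 1) * (w - y) ^ (Suc k - Suc 0))) / fact (Suc k)))) (at y within {x..w})"
        by (intro DERIV_minus DERIV_cmult DERIV_cdivide DERIV_power DERIV_diff DERIV_const DERIV_ident)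
      also have "- (N e * (K ^ Suc k * (real (Suc k) * ((0 - 1) * (w - y) ^ (Suc k - Suc 0))) / fact (Suc k))) = ?g y"
        by (simp add: fact_Suc del: of_nat_Suc power_Suc)
      finally show "(?G has_vector_derivative ?g y) (at y within {x..w})"
        by (simp add: has_real_derivative_iff_has_vector_derivative)
    qed
    then show "(?g has_integral N e * (K ^ Suc k * (w - x) ^ Suc k / fact (Suc k))) {x..w}" by (simp del: fact_Suc)
  qed
  finally show ?case .
qed simp

definition q :: "nat \<Rightarrow> real" where "q k = N e * ((K * w) ^ k / fact k)"

lemma q_summable: "summable q"
  unfolding q_def using summable_exp[of "K * w"] by (intro summable_mult) (simp add: field_simps)

lemma ek_q:
  assumes "0 \<le> x" "x \<le> w"
  shows "N (ek k x) \<le> q k"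
proof -
  have "K ^ k * (w - x) ^ k / fact k \<le> (K * w) ^ k / fact k"
    unfolding power_mult_distrib using assms K by (intro divide_right_mono mult_left_mono power_mono) auto
  then show ?thesis using ek_bound[OF assms, of k] n(9)[of e] unfolding q_def
    by (meson mult_left_mono order_trans)
qed

lemma EE_summable: "summable (\<lambda>k. N (EE k))"
  by (rule summable_comparison_test'[OF q_summable]) (use ek_q w_nonneg n(9) in \<open>simp add: EE_ek\<close>)

definition EXP :: 'v where "EXP = vsum EE"

lemma EXP_V: "EXP \<in> V" unfolding EXP_def by (rule vsum_V)

lemma time_ordered_exp_EXP: "time_ordered_exp m e I \<phi> = EXP"
proof -
  have "EE sums EXP" unfolding EXP_def by (rule vsum_sums[OF EE_V EE_summable])
  then have "(\<lambda>k. EE (Suc k)) sums (EXP - e)" by (subst sums_Suc_iff) simp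
  then show ?thesis unfolding time_ordered_exp_eq by (simp add: sums_iff)
qed

end

section \<open>Invertibility of the resolvent\<close>

context ordered_density
begin

text \<open>The exponential of the final segment from \<open>x\<close> on, applied to
  \<open>v\<close>. It runs from \<open>m EXP v\<close> at \<open>0\<close> to \<open>v\<close> at
  \<open>w\<close>, so a vector annihilated by the resolvent gives the boundary condition of a short
  curve.\<close>

definition yv :: "'v \<Rightarrow> real \<Rightarrow> 'v" where "yv v x = vsum (\<lambda>k. m (ek k x) v)"

definition mbound :: real where
  "mbound = (SOME C. C \<ge> 0 \<and> (\<forall>x\<in>V. \<forall>y\<in>V. N (m x y) \<le> C * N x * N y))"

lemma mbound: "0 \<le> mbound" "x \<in> V \<Longrightarrow> y \<in> V \<Longrightarrow> N (m x y) \<le> mbound * N x * N y"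
proof -
  have "mbound \<ge> 0 \<and> (\<forall>x\<in>V. \<forall>y\<in>V. N (m x y) \<le> mbound * N x * N y)"
    unfolding mbound_def by (rule someI_ex) (use m_bounded in blast)
  then show "0 \<le> mbound" "x \<in> V \<Longrightarrow> y \<in> V \<Longrightarrow> N (m x y) \<le> mbound * N x * N y" by blast+
qed

lemma mbound_v: "0 \<le> mbound * N v" using mbound(1) n(9) by simp

lemma yv_term_bound:
  assumes v: "v \<in> V" and x: "0 \<le> x" "x \<le> w"
  shows "N (m (ek k x) v) \<le> mbound * N v * q k"
proof -
  have "N (m (ek k x) v) \<le> mbound * N (ek k x) * N v" by (rule mbound(2)[OF ek_V v])
  also have "\<dots> = mbound * N v * N (ek k x)" by simp
  also have "\<dots> \<le> mbound * N v * q k" by (rule mult_left_mono[OF ek_q[OF x] mbound_v])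
  finally show ?thesis .
qed

lemma yv_summable:
  assumes v: "v \<in> V" and x: "0 \<le> x" "x \<le> w"
  shows "summable (\<lambda>k. N (m (ek k x) v))"
  by (rule summable_comparison_test'[OF summable_mult[OF q_summable, of "mbound * N v"]])
    (use yv_term_bound[OF assms] n(9) in simp)

lemma yv_bound:
  assumes v: "v \<in> V" and x: "0 \<le> x" "x \<le> w"
  shows "N (yv v x) \<le> mbound * N v * (\<Sum>k. q k)"
proof -
  have "N (yv v x) \<le> (\<Sum>k. N (m (ek k x) v))" unfolding yv_def by (rule N_vsum_le[OF m_V yv_summable[OF assms]])
  also have "\<dots> \<le> (\<Sum>k. mbound * N v * q k)"
    by (rule suminf_le[OF yv_term_bound[OF assms] yv_summable[OF assms] summable_mult[OF q_summable]])
  also have "\<dots> = mbound * N v * (\<Sum>k. q k)" by (rule suminf_mult[OF q_summable])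
  finally show ?thesis .
qed

lemma yv_V: "yv v x \<in> V" unfolding yv_def by (rule vsum_V)

lemma yv_F_nice: "v \<in> V \<Longrightarrow> nice \<nu> (\<lambda>r. yv v (F r))"
proof -
  assume v: "v \<in> V"
  show ?thesis
  proof (rule niceI[of _ _ "mbound * N v * (\<Sum>k. q k)"])
    fix b assume b: "b \<in> B"
    show "(\<lambda>r. c b (yv v (F r))) \<in> borel_measurable \<nu>"
      unfolding yv_def c_vsum[OF b]
      by (rule borel_measurable_suminf) (rule niceD(2)[OF nice_m[OF ek_F_nice nice_const[OF v]] b])
  qed (rule yv_V, rule yv_bound[OF v F_bounds])
qed

text \<open>For \<open>s \<le> t\<close> the indicator of a half-open interval, in the form in which
  the difference of two final segments produces it.\<close>

definition window :: "real \<Rightarrow> real \<Rightarrow> real \<Rightarrow> real" where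
  "window s t x = of_bool (s \<le> x) - of_bool (t \<le> x)"

lemma window_bound: "s \<le> t \<Longrightarrow> \<bar>window s t x\<bar> \<le> indicator {s..t} x"
  by (auto simp: window_def indicator_def)

lemma window_le_1: "s \<le> t \<Longrightarrow> \<bar>window s t x\<bar> \<le> 1"
  by (simp add: window_def)

lemma window_meas: "(\<lambda>r. window s t (F r)) \<in> borel_measurable \<nu>"
proof -
  have "{r \<in> space \<nu>. a \<le> F r} \<in> sets \<nu>" for a by (rule borel_measurable_le[OF _ F_meas]) simp
  then have "(\<lambda>r. indicator {r \<in> space \<nu>. s \<le> F r} r - indicator {r \<in> space \<nu>. t \<le> F r} r :: real) \<in> borel_measurable \<nu>"
    by (intro borel_measurable_diff borel_measurable_indicator)
  then show ?thesis
    by (rule measurable_cong[THEN iffD1, rotated]) (simp add: indicator_def window_def)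
qed

text \<open>A Volterra equation, obtained by summing the recursion for \<open>ek\<close> over
  \<open>k\<close>. The term \<open>k = 0\<close> is constant and cancels in the difference; the
  summable majorant \<open>q\<close> permits termwise integration.\<close>

lemma yv_equation:
  assumes v: "v \<in> V" and st: "0 \<le> s" "s \<le> t" "t \<le> w"
  shows "yv v s - yv v t = wint \<nu> (\<lambda>r. window s t (F r) *\<^sub>R m (u r) (yv v (F r)))"
proof (rule V_eqI)
  fix b assume b: "b \<in> B"
  define D where "D = mbound * N v"
  have D: "D \<ge> 0" "\<And>k x. 0 \<le> x \<Longrightarrow> x \<le> w \<Longrightarrow> N (m (ek k x) v) \<le> D * q k"
    "\<And>x. 0 \<le> x \<Longrightarrow> x \<le> w \<Longrightarrow> summable (\<lambda>k. N (m (ek k x) v))"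
    unfolding D_def by (rule mbound_v, rule yv_term_bound[OF v], assumption, assumption, rule yv_summable[OF v])
  obtain C where C: "C \<ge> 0" "\<forall>x\<in>V. \<forall>b\<in>B. \<bar>c b x\<bar> \<le> C * N x" using coord_bound by blast
  let ?f = "\<lambda>k r. window s t (F r) * c b (m (u r) (m (ek k (F r)) v))"
  have s: "(\<lambda>k. c b (m (ek k x) v)) sums c b (yv v x)" if "0 \<le> x" "x \<le> w" for x
    unfolding yv_def by (rule vsum_functional[OF c_linear[OF b] m_V D(3)[OF that]])
  have "(\<lambda>k. c b (m (ek k s) v) - c b (m (ek k t) v)) sums (c b (yv v s) - c b (yv v t))"
    using st by (intro sums_diff s) auto
  then have "(\<lambda>k. c b (m (ek (Suc k) s) v) - c b (m (ek (Suc k) t) v)) sums (c b (yv v s) - c b (yv v t))"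
    by (subst sums_Suc_iff) simp
  moreover have "c b (m (ek (Suc k) s) v) - c b (m (ek (Suc k) t) v) = (\<integral>r. ?f k r \<partial>\<nu>)" for k
  proof -
    note sn = step_nice[OF ek_F_nice[of k]]
    have eq: "c b (m (ek (Suc k) x) v) = (\<integral>r. c b (m (of_bool (x \<le> F r) *\<^sub>R m (u r) (ek k (F r))) v) \<partial>\<nu>)" for x
      unfolding ek.simps step_def wint_m_right[OF finite_\<nu> sn] by (rule c_wint[OF b])
    have i: "integrable \<nu> (\<lambda>r. c b (m (of_bool (x \<le> F r) *\<^sub>R m (u r) (ek k (F r))) v))" for x
      by (rule nice_integrable[OF finite_\<nu> nice_m[OF sn nice_const[OF v]] c_linear[OF b]])
    show ?thesis
      unfolding eq Bochner_Integration.integral_diff[OF i i, symmetric]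
      by (rule Bochner_Integration.integral_cong[OF refl])
        (simp add: m_simps linear_scale[OF c_linear[OF b]] m_assoc window_def left_diff_distrib)
  qed
  ultimately have L: "(\<lambda>k. \<integral>r. ?f k r \<partial>\<nu>) sums (c b (yv v s) - c b (yv v t))" by simp
  have bd: "\<bar>?f k r\<bar> \<le> C * K * D * q k" if r: "r \<in> space \<nu>" for k r
  proof -
    have "\<bar>c b (m (u r) (m (ek k (F r)) v))\<bar> \<le> C * N (m (u r) (m (ek k (F r)) v))" using C(2) b m_V by blast
    also have "\<dots> \<le> C * (K * N (m (ek k (F r)) v))" using mult_u r C(1) by (intro mult_left_mono) (auto simp: space_\<nu>)
    also have "\<dots> \<le> C * (K * (D * q k))" using D(2) F_bounds C(1) K by (intro mult_left_mono) auto
    finally have a: "\<bar>c b (m (u r) (m (ek k (F r)) v))\<bar> \<le> C * K * D * q k" by (simp add: mult_ac)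
    have "\<bar>window s t (F r)\<bar> \<le> 1" by (rule window_le_1[OF st(2)])
    then have "\<bar>window s t (F r)\<bar> * \<bar>c b (m (u r) (m (ek k (F r)) v))\<bar> \<le> 1 * (C * K * D * q k)"
      using a by (intro mult_mono) auto
    then show ?thesis by (simp add: abs_mult)
  qed
  have fm: "?f k \<in> borel_measurable \<nu>" for k
    by (intro borel_measurable_times window_meas niceD(2)[OF _ b] nice_m u_nice ek_F_nice nice_const v)
  have fi: "integrable \<nu> (?f k)" for k
    using bd fm by (intro \<nu>.integrable_const_bound[of _ "C * K * D * q k"]) auto
  have sq: "summable (\<lambda>k. C * K * D * q k)" by (rule summable_mult[OF q_summable])
  have "(\<integral>r. (\<Sum>k. ?f k r) \<partial>\<nu>) = (\<Sum>k. \<integral>r. ?f k r \<partial>\<nu>)"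
  proof (rule integral_suminf[OF fi])
    show "AE r in \<nu>. summable (\<lambda>k. norm (?f k r))"
      by (rule AE_I2, rule summable_comparison_test'[OF sq]) (use bd in auto)
    have "\<bar>\<integral>r. norm (?f k r) \<partial>\<nu>\<bar> \<le> C * K * D * q k * measure \<nu> (space \<nu>)" for k
    proof -
      have "(\<integral>r. norm (?f k r) \<partial>\<nu>) \<le> (\<integral>r. C * K * D * q k \<partial>\<nu>)"
        by (rule integral_mono) (use fi bd in auto)
      then show ?thesis by (simp add: mult_ac)
    qed
    then show "summable (\<lambda>k. \<integral>r. norm (?f k r) \<partial>\<nu>)"
      by (intro summable_comparison_test'[OF summable_mult2[OF sq, of "measure \<nu> (space \<nu>)"]]) auto
  qed
  moreover have "(\<Sum>k. ?f k r) = c b (window s t (F r) *\<^sub>R m (u r) (yv v (F r)))" for r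
  proof -
    have "linear (\<lambda>x. c b (m (u r) x))" using linear_compose[OF m_linear(1) c_linear[OF b]] by (simp add: o_def)
    from vsum_functional[OF this m_V D(3)[OF F_bounds]]
    have "(\<lambda>k. c b (m (u r) (m (ek k (F r)) v))) sums c b (m (u r) (yv v (F r)))" unfolding yv_def .
    from sums_mult[OF this] show ?thesis by (simp add: sums_iff linear_scale[OF c_linear[OF b]])
  qed
  ultimately have "(\<Sum>k. \<integral>r. ?f k r \<partial>\<nu>) = c b (wint \<nu> (\<lambda>r. window s t (F r) *\<^sub>R m (u r) (yv v (F r))))"
    by (simp add: c_wint[OF b])
  then show "c b (yv v s - yv v t) = c b (wint \<nu> (\<lambda>r. window s t (F r) *\<^sub>R m (u r) (yv v (F r))))"
    using L by (simp add: sums_iff linear_diff[OF c_linear[OF b]])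
qed (auto intro: V_closed yv_V wint_V)

text \<open>Formulated with a continuous majorant \<open>g\<close> because it is used twice: with a
  constant \<open>g\<close> it proves that \<open>N (yv v x)\<close> is continuous in
  \<open>x\<close>, and afterwards \<open>g\<close> can be that function itself.\<close>

lemma yv_increment:
  assumes v: "v \<in> V" and st: "0 \<le> s" "s \<le> t" "t \<le> w" and g: "continuous_on {s..t} g"
    and le: "\<And>x. s \<le> x \<Longrightarrow> x \<le> t \<Longrightarrow> N (yv v x) \<le> g x"
  shows "N (yv v t - yv v s) \<le> K * integral {s..t} g"
proof -
  have gc: "continuous_on {s..t} (\<lambda>x. K * g x)" by (intro continuous_intros g)
  note gi = integral_F[OF st(1,3) gc]
  have g0: "0 \<le> g x" if "s \<le> x" "x \<le> t" for x using order_trans[OF n(9) le[OF that]] .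
  have "N (yv v s - yv v t) \<le> (\<integral>r. indicator {s..t} (F r) * (K * g (F r)) \<partial>\<nu>)"
    unfolding yv_equation[OF v st]
  proof (rule wint_norm_le[OF finite_\<nu> _ gi(1)])
    show "nice \<nu> (\<lambda>r. window s t (F r) *\<^sub>R m (u r) (yv v (F r)))"
    proof (rule nice_scaleR[OF nice_m[OF u_nice yv_F_nice[OF v]] window_meas])
      fix r show "\<bar>window s t (F r)\<bar> \<le> 1" by (rule window_le_1[OF st(2)])
    qed
    fix r assume r: "r \<in> space \<nu>"
    show "N (window s t (F r) *\<^sub>R m (u r) (yv v (F r))) \<le> indicator {s..t} (F r) * (K * g (F r))"
    proof (cases "F r \<in> {s..t}")
      case True
      have "N (m (u r) (yv v (F r))) \<le> K * N (yv v (F r))" using mult_u r by (simp add: space_\<nu>)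
      also have "\<dots> \<le> K * g (F r)" using le True K by (intro mult_left_mono) auto
      finally have "\<bar>window s t (F r)\<bar> * N (m (u r) (yv v (F r))) \<le> indicator {s..t} (F r) * (K * g (F r))"
        using window_bound[OF st(2), of "F r"] n(9) by (intro mult_mono) auto
      then show ?thesis by (simp add: n(3))
    next
      case False
      then have "window s t (F r) = 0" using window_bound[OF st(2), of "F r"] by simp
      then show ?thesis using False by (simp add: n(5))
    qed
  qed
  also have "\<dots> = K * integral {s..t} g" unfolding gi(2) by simp
  finally show ?thesis using n(8)[of "yv v t" "yv v s"] by simp
qed

lemma yv_continuous: "v \<in> V \<Longrightarrow> continuous_on {0..w} (\<lambda>x. N (yv v x))"
proof -
  assume v: "v \<in> V"
  define Y where "Y = max 0 (mbound * N v * (\<Sum>k. q k))"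
  have D: "N (yv v x) \<le> Y" if "0 \<le> x" "x \<le> w" for x
    unfolding Y_def using yv_bound[OF v that] by (rule max.coboundedI2)
  have lip: "\<bar>N (yv v t) - N (yv v s)\<bar> \<le> K * Y * \<bar>t - s\<bar>" if st: "s \<in> {0..w}" "t \<in> {0..w}" for s t
  proof -
    have inc: "N (yv v t - yv v s) \<le> K * Y * (t - s)" if st: "0 \<le> s" "s \<le> t" "t \<le> w" for s t
    proof -
      have "N (yv v t - yv v s) \<le> K * integral {s..t} (\<lambda>_. Y)"
        by (rule yv_increment[OF v st]) (use D st in auto)
      then show ?thesis using st by (simp add: mult_ac)
    qed
    have "N (yv v t - yv v s) \<le> K * Y * \<bar>t - s\<bar>"
    proof (cases "s \<le> t")
      case True
      then show ?thesis using inc[of s t] st by simp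
    next
      case False
      then have "N (yv v s - yv v t) \<le> K * Y * (s - t)" using st by (intro inc) auto
      then show ?thesis unfolding n(8)[of "yv v t" "yv v s"] using False by (simp add: abs_if)
    qed
    moreover have "\<bar>N (yv v t) - N (yv v s)\<bar> \<le> N (yv v t - yv v s)"
      using n(10)[of "yv v t" "yv v s"] n(10)[of "yv v s" "yv v t"] n(8)[of "yv v t" "yv v s"] by (simp add: abs_le_iff)
    ultimately show ?thesis by simp
  qed
  show ?thesis
  proof (rule continuous_onI)
    fix x e' :: real assume x: "x \<in> {0..w}" "0 < e'"
    have KY: "0 \<le> K * Y" using K by (simp add: Y_def)
    show "\<exists>d>0. \<forall>x'\<in>{0..w}. dist x' x < d \<longrightarrow> dist (N (yv v x')) (N (yv v x)) \<le> e'"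
    proof (intro exI[of _ "e' / (K * Y + 1)"] conjI ballI impI)
      show "0 < e' / (K * Y + 1)" using KY x by simp
      fix x' assume x': "x' \<in> {0..w}" "dist x' x < e' / (K * Y + 1)"
      have "dist (N (yv v x')) (N (yv v x)) \<le> K * Y * \<bar>x' - x\<bar>" using lip[OF x(1) x'(1)] by (simp add: dist_real_def)
      also have "\<dots> \<le> (K * Y + 1) * \<bar>x' - x\<bar>" by (intro mult_right_mono) auto
      also have "\<dots> \<le> e'" using x'(2) KY by (simp add: dist_real_def field_simps)
      finally show "dist (N (yv v x')) (N (yv v x)) \<le> e'" .
    qed
  qed
qed

lemma yv_0: "v \<in> V \<Longrightarrow> yv v 0 = m EXP v"
proof -
  assume "v \<in> V"
  have "m (vsum EE) v = vsum (\<lambda>k. m (EE k) v)" by (rule vsum_linear[OF m_linear(2) m_V EE_V EE_summable])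
  then show ?thesis by (simp add: yv_def EXP_def EE_ek)
qed

lemma yv_w: "v \<in> V \<Longrightarrow> yv v w = v"
proof (rule V_eqI[OF yv_V])
  fix b assume v: "v \<in> V" and b: "b \<in> B"
  have "(\<Sum>k. c b (m (ek k w) v)) = (\<Sum>k\<in>{0}. c b (m (ek k w) v))"
  proof (rule suminf_finite)
    fix k :: nat assume "k \<notin> {0}"
    then obtain j where "k = Suc j" by (cases k) auto
    then show "c b (m (ek k w) v) = 0" by (simp only: ek_w m_simps linear_0[OF c_linear[OF b]])
  qed simp
  then show "c b (yv v w) = c b v" using v by (simp add: yv_def c_vsum[OF b] m_e)
qed

theorem resolvent_injective:
  assumes d: "card B \<le> d" "6 \<le> d" and Kw: "K * w < 2 + girth_gap d" and l: "l \<in> {0..1}"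
    and v: "v \<in> V" "m (l *\<^sub>R e + (1 - l) *\<^sub>R EXP) v = 0"
  shows "v = 0"
proof -
  have N': "norm_on (span B) N" using N B(3) by simp
  have "yv v w = 0"
  proof (rule short_curve_vanishes[OF B(1) d N' l w_nonneg K Kw])
    show "yv v r \<in> span B" for r using yv_V B(3) by simp
    show "continuous_on {0..w} (\<lambda>r. N (yv v r))" by (rule yv_continuous[OF v(1)])
    show "N (yv v t - yv v s) \<le> K * integral {s..t} (\<lambda>r. N (yv v r))" if st: "0 \<le> s" "s \<le> t" "t \<le> w" for s t
      by (rule yv_increment[OF v(1) st]) (rule continuous_on_subset[OF yv_continuous[OF v(1)]], use st in auto)
    show "l *\<^sub>R yv v w + (1 - l) *\<^sub>R yv v 0 = 0"
      using v by (simp add: yv_0 yv_w m_simps m_e)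
    show "w \<in> {0..w}" using w_nonneg by simp
  qed
  then show ?thesis using yv_w[OF v(1)] by simp
qed

theorem resolvent_invertible:
  assumes d: "card B \<le> d" "6 \<le> d" and Kw: "K * w < 2 + girth_gap d" and l: "l \<in> {0..1}"
  shows "\<exists>y\<in>V. m (l *\<^sub>R e + (1 - l) *\<^sub>R EXP) y = e \<and> m y (l *\<^sub>R e + (1 - l) *\<^sub>R EXP) = e"
  by (rule invertibleI) (use resolvent_injective[OF assms] in \<open>auto intro!: V_closed EXP_V e_V\<close>)

corollary log_defined_exp:
  assumes "card B \<le> d" "6 \<le> d" "K * w < 2 + girth_gap d"
  shows "log_defined m e (time_ordered_exp m e I \<phi>)"
  unfolding log_defined_def alg_invertible_def time_ordered_exp_EXP
  using resolvent_invertible[OF assms] by blast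

end

section \<open>The complexification with its Taylor norm\<close>

context fd_algebra
begin

definition mC :: "'v \<times> 'v \<Rightarrow> 'v \<times> 'v \<Rightarrow> 'v \<times> 'v" where
  "mC x y = (m (fst x) (fst y) - m (snd x) (snd y), m (fst x) (snd y) + m (snd x) (fst y))"

text \<open>The Taylor norm, for which multiplication by \<open>z a\<close>, with \<open>a\<close> in the real algebra, has operator norm
  at most \<open>cmod z\<close> times that of \<open>a\<close> for \<open>N\<close>.\<close>

definition NC :: "'v \<times> 'v \<Rightarrow> real" where
  "NC x = (SUP \<theta>. N (cos \<theta> *\<^sub>R fst x - sin \<theta> *\<^sub>R snd x))"

definition BC :: "('v \<times> 'v) set" where
  "BC = (\<lambda>b. (b, 0)) ` B \<union> (\<lambda>b. (0, b)) ` B"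

text \<open>The second component tells \<open>(b, 0)\<close> from \<open>(0, b)\<close>, since
  \<open>0\<close> is not in \<open>B\<close>.\<close>

definition cC :: "'v \<times> 'v \<Rightarrow> 'v \<times> 'v \<Rightarrow> real" where
  "cC b x = (if snd b = 0 then c (fst b) (fst x) else c (snd b) (snd x))"

lemma NC_upper: "N (cos \<theta> *\<^sub>R fst x - sin \<theta> *\<^sub>R snd x) \<le> NC x"
  unfolding NC_def
proof (rule cSUP_upper, simp, rule bdd_aboveI2)
  fix \<theta> :: real
  have "N (cos \<theta> *\<^sub>R fst x - sin \<theta> *\<^sub>R snd x) \<le> \<bar>cos \<theta>\<bar> * N (fst x) + \<bar>sin \<theta>\<bar> * N (snd x)"
    using n(7) n(3) by metis
  also have "\<dots> \<le> 1 * N (fst x) + 1 * N (snd x)" using n(9) by (intro add_mono mult_right_mono) auto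
  finally show "N (cos \<theta> *\<^sub>R fst x - sin \<theta> *\<^sub>R snd x) \<le> N (fst x) + N (snd x)" by simp
qed

lemma NC_least: "(\<And>\<theta>. N (cos \<theta> *\<^sub>R fst x - sin \<theta> *\<^sub>R snd x) \<le> C) \<Longrightarrow> NC x \<le> C"
  unfolding NC_def by (rule cSUP_least) auto

lemma norm_on_NC: "norm_on (V \<times> V) NC"
  unfolding norm_on_def
proof (intro conjI allI ballI impI)
  show "subspace (V \<times> V)" using n(1) by (rule subspace_Times[OF _ n(1)])
  show "NC (x + y) \<le> NC x + NC y" for x y
  proof (rule NC_least)
    fix \<theta>
    have "cos \<theta> *\<^sub>R fst (x + y) - sin \<theta> *\<^sub>R snd (x + y)
      = (cos \<theta> *\<^sub>R fst x - sin \<theta> *\<^sub>R snd x) + (cos \<theta> *\<^sub>R fst y - sin \<theta> *\<^sub>R snd y)" by (simp add: algebra_simps)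
    then have "N (cos \<theta> *\<^sub>R fst (x + y) - sin \<theta> *\<^sub>R snd (x + y))
      \<le> N (cos \<theta> *\<^sub>R fst x - sin \<theta> *\<^sub>R snd x) + N (cos \<theta> *\<^sub>R fst y - sin \<theta> *\<^sub>R snd y)" by (simp only: n(2))
    also have "\<dots> \<le> NC x + NC y" by (intro add_mono NC_upper)
    finally show "N (cos \<theta> *\<^sub>R fst (x + y) - sin \<theta> *\<^sub>R snd (x + y)) \<le> NC x + NC y" .
  qed
  have le: "NC (r *\<^sub>R x) \<le> \<bar>r\<bar> * NC x" for r x
  proof (rule NC_least)
    fix \<theta>
    have "cos \<theta> *\<^sub>R fst (r *\<^sub>R x) - sin \<theta> *\<^sub>R snd (r *\<^sub>R x) = r *\<^sub>R (cos \<theta> *\<^sub>R fst x - sin \<theta> *\<^sub>R snd x)"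
      by (simp add: scaleR_diff_right mult.commute)
    then show "N (cos \<theta> *\<^sub>R fst (r *\<^sub>R x) - sin \<theta> *\<^sub>R snd (r *\<^sub>R x)) \<le> \<bar>r\<bar> * NC x"
      using NC_upper[of \<theta> x] by (simp add: n(3) mult_left_mono)
  qed
  show "NC (r *\<^sub>R x) = \<bar>r\<bar> * NC x" for r x
  proof (cases "r = 0")
    case True
    then show ?thesis by (simp add: NC_def n(5))
  next
    case False
    have "\<bar>r\<bar> * NC ((1 / r) *\<^sub>R r *\<^sub>R x) \<le> \<bar>r\<bar> * (\<bar>1 / r\<bar> * NC (r *\<^sub>R x))" by (rule mult_left_mono[OF le]) simp
    then have "\<bar>r\<bar> * NC x \<le> NC (r *\<^sub>R x)" using False by simp
    then show ?thesis using le[of r x] by simp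
  qed
  fix x assume x: "x \<in> V \<times> V" "NC x = 0"
  have "N (fst x) \<le> 0" using NC_upper[of 0 x] x(2) by simp
  moreover have "N (- snd x) \<le> 0" using NC_upper[of "pi / 2" x] x(2) by simp
  ultimately have "N (fst x) = 0" "N (snd x) = 0" using n(9)[of "fst x"] n(9)[of "snd x"] n(6)[of "snd x"] by auto
  then have "fst x = 0" "snd x = 0" using n(4) x(1) by auto
  then show "x = 0" by (simp add: prod_eq_iff)
qed

lemma zero_notin_B: "0 \<notin> B"
  using c_delta[of 0 0] linear_0[OF c_linear[of 0]] by auto

lemma finite_BC: "finite BC" and card_BC: "card BC = 2 * card B"
proof -
  show "finite BC" using B(1) by (simp add: BC_def)
  have "card BC = card ((\<lambda>b. (b, 0 :: 'v)) ` B) + card ((\<lambda>b. (0 :: 'v, b)) ` B)"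
    unfolding BC_def using B(1) zero_notin_B by (intro card_Un_disjoint) auto
  also have "\<dots> = 2 * card B" by (simp add: card_image inj_on_def)
  finally show "card BC = 2 * card B" .
qed

lemma sum_BC: "(\<Sum>b\<in>BC. f b) = (\<Sum>b\<in>B. f (b, 0)) + (\<Sum>b\<in>B. f (0, b))"
  unfolding BC_def using B(1) zero_notin_B
  by (subst sum.union_disjoint) (auto simp: sum.reindex inj_on_def)

lemma complexification: "fd_algebra (V \<times> V) mC (e, 0) NC BC cC"
proof (rule fd_algebra.intro)
  show "norm_on (V \<times> V) NC" by (rule norm_on_NC)
  show "finite BC" by (rule finite_BC)
  show BV: "BC \<subseteq> V \<times> V" unfolding BC_def using B_V V_closed(1) by auto
  show lin: "linear (cC b)" if b: "b \<in> BC" for b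
  proof -
    consider b' where "b' \<in> B" "b = (b', 0)" | b' where "b' \<in> B" "b = (0, b')" using b by (auto simp: BC_def)
    then show ?thesis
    proof cases
      case 1
      then show ?thesis unfolding cC_def
        by (intro linearI) (simp_all add: linear_add[OF c_linear] linear_scale[OF c_linear])
    next
      case 2
      then have "b' \<noteq> 0" using zero_notin_B by auto
      then show ?thesis unfolding cC_def using 2
        by (intro linearI) (simp_all add: linear_add[OF c_linear] linear_scale[OF c_linear])
    qed
  qed
  have cC: "cC (b, 0) x = c b (fst x)" "cC (0, b) x = c b (snd x)" if "b \<in> B" for b x
    using that zero_notin_B by (auto simp: cC_def)
  show ex: "x = (\<Sum>b\<in>BC. cC b x *\<^sub>R b)" if x: "x \<in> V \<times> V" for x
  proof -
    have "(\<Sum>b\<in>BC. cC b x *\<^sub>R b) = (\<Sum>b\<in>B. c b (fst x) *\<^sub>R (b, 0)) + (\<Sum>b\<in>B. c b (snd x) *\<^sub>R (0, b))"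
      unfolding sum_BC using cC by simp
    also have "\<dots> = (fst x, snd x)"
      using c_expand[of "fst x"] c_expand[of "snd x"] x by (auto simp: prod_eq_iff fst_sum snd_sum)
    finally show ?thesis by simp
  qed
  show "span BC = V \<times> V"
  proof
    show "span BC \<subseteq> V \<times> V" by (rule span_minimal[OF BV]) (rule subspace_Times[OF n(1) n(1)])
    show "V \<times> V \<subseteq> span BC"
    proof
      fix x assume "x \<in> V \<times> V"
      then have "x = (\<Sum>b\<in>BC. cC b x *\<^sub>R b)" by (rule ex)
      also have "\<dots> \<in> span BC" by (intro span_sum span_scale span_base)
      finally show "x \<in> span BC" .
    qed
  qed
  show "cC b b' = (if b = b' then 1 else 0)" if "b \<in> BC" "b' \<in> BC" for b b'
    using that zero_notin_B unfolding BC_def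
    by (auto simp: cC c_delta linear_0[OF c_linear] split: if_splits)
  show "bilinear mC"
    unfolding bilinear_def mC_def by (auto intro!: linearI simp: m_simps algebra_simps)
  show "mC (mC x y) z = mC x (mC y z)" for x y z
    unfolding mC_def by (simp add: m_simps m_assoc algebra_simps)
  show "mC x y \<in> V \<times> V" for x y unfolding mC_def by (auto intro: V_closed m_V)
  show "(e, 0) \<in> V \<times> V" using e_V V_closed(1) by simp
  show "mC (e, 0) x = x" "mC x (e, 0) = x" if "x \<in> V \<times> V" for x
    using that by (auto simp: mC_def m_simps m_e)
qed

text \<open>The component of \<open>z a x\<close> at the angle \<theta> is \<open>cmod z\<close>
  times \<open>a\<close> applied to the component of \<open>x\<close> at the angle
  \<open>\<theta> + Arg z\<close>; a supremum over all angles does not see the rotation.\<close>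

lemma mC_scaled_real:
  assumes a: "\<And>x. N (m a x) \<le> K * N x" and K: "0 \<le> K"
  shows "NC (mC (Re z *\<^sub>R a, Im z *\<^sub>R a) x) \<le> (cmod z * K) * NC x"
proof (rule NC_least)
  fix \<theta>
  define \<alpha> where "\<alpha> = Arg z"
  have z: "Re z = cmod z * cos \<alpha>" "Im z = cmod z * sin \<alpha>"
    using rcis_cmod_Arg[of z] by (metis \<alpha>_def Re_rcis, metis \<alpha>_def rcis_cmod_Arg Im_rcis)
  have "cos \<theta> *\<^sub>R fst (mC (Re z *\<^sub>R a, Im z *\<^sub>R a) x) - sin \<theta> *\<^sub>R snd (mC (Re z *\<^sub>R a, Im z *\<^sub>R a) x)
     = cmod z *\<^sub>R m a (cos (\<theta> + \<alpha>) *\<^sub>R fst x - sin (\<theta> + \<alpha>) *\<^sub>R snd x)"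
    unfolding mC_def z cos_add sin_add by (simp add: m_simps algebra_simps)
  then have "N (cos \<theta> *\<^sub>R fst (mC (Re z *\<^sub>R a, Im z *\<^sub>R a) x) - sin \<theta> *\<^sub>R snd (mC (Re z *\<^sub>R a, Im z *\<^sub>R a) x))
     = cmod z * N (m a (cos (\<theta> + \<alpha>) *\<^sub>R fst x - sin (\<theta> + \<alpha>) *\<^sub>R snd x))" by (simp add: n(3))
  also have "\<dots> \<le> cmod z * (K * N (cos (\<theta> + \<alpha>) *\<^sub>R fst x - sin (\<theta> + \<alpha>) *\<^sub>R snd x))"
    by (intro mult_left_mono a) simp
  also have "\<dots> \<le> cmod z * (K * NC x)" using K by (intro mult_left_mono NC_upper) auto
  finally show "N (cos \<theta> *\<^sub>R fst (mC (Re z *\<^sub>R a, Im z *\<^sub>R a) x) - sin \<theta> *\<^sub>R snd (mC (Re z *\<^sub>R a, Im z *\<^sub>R a) x)) \<le> (cmod z * K) * NC x"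
    by (simp add: mult_ac)
qed

end

section \<open>Convergence of the Magnus expansion\<close>

text \<open>Determinants and adjugates are polynomials in the entries. One argument thus serves both
  for functions holomorphic in \<open>z\<close> and for functions continuous in the pair of
  \<open>l\<close> and \<open>z\<close>.\<close>

definition function_algebra :: "('x \<Rightarrow> complex) set \<Rightarrow> bool" where
  "function_algebra A \<longleftrightarrow> (\<forall>a. (\<lambda>_. a) \<in> A) \<and> (\<forall>f\<in>A. \<forall>g\<in>A. (\<lambda>x. f x + g x) \<in> A \<and> (\<lambda>x. f x * g x) \<in> A)"

lemma function_algebraD:
  assumes "function_algebra A"
  shows "(\<lambda>_. a) \<in> A" "f \<in> A \<Longrightarrow> g \<in> A \<Longrightarrow> (\<lambda>x. f x + g x) \<in> A" "f \<in> A \<Longrightarrow> g \<in> A \<Longrightarrow> (\<lambda>x. f x * g x) \<in> A"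
  using assms by (auto simp: function_algebra_def)

lemma function_algebra_sum:
  assumes A: "function_algebra A" and "\<And>i. i \<in> S \<Longrightarrow> f i \<in> A"
  shows "(\<lambda>x. \<Sum>i\<in>S. f i x) \<in> A" "(\<lambda>x. \<Prod>i\<in>S. f i x) \<in> A"
  using assms(2)
  by (induction S rule: infinite_finite_induct) (auto intro: function_algebraD[OF A])

lemma function_algebra_det:
  assumes A: "function_algebra A" and M: "\<And>x. M x \<in> carrier_mat n n"
    and e: "\<And>i j. i < n \<Longrightarrow> j < n \<Longrightarrow> (\<lambda>x. M x $$ (i, j)) \<in> A"
  shows "(\<lambda>x. Determinant.det (M x)) \<in> A"
  unfolding det_def'[OF M]
proof (intro function_algebra_sum[OF A] function_algebraD(3)[OF A] function_algebraD(1)[OF A])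
  fix p i assume p: "p \<in> {p. p permutes {0..<n}}" and i: "i \<in> {0..<n}"
  have "p i < n" using permutes_in_image[of p "{0..<n}" i] p i by simp
  then show "(\<lambda>x. M x $$ (i, p i)) \<in> A" using i by (intro e) auto
qed

lemma function_algebra_adj:
  assumes A: "function_algebra A" and M: "\<And>x. M x \<in> carrier_mat n n"
    and e: "\<And>i j. i < n \<Longrightarrow> j < n \<Longrightarrow> (\<lambda>x. M x $$ (i, j)) \<in> A" and ij: "i < n" "j < n"
  shows "(\<lambda>x. adj_mat (M x) $$ (i, j)) \<in> A"
proof -
  have "adj_mat (M x) $$ (i, j) = (- 1) ^ (j + i) * Determinant.det (mat_delete (M x) j i)" for x
    using M[of x] ij by (simp add: adj_mat_def cofactor_def)
  moreover have "(\<lambda>x. Determinant.det (mat_delete (M x) j i)) \<in> A"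
  proof (rule function_algebra_det[OF A, of _ "n - 1"])
    show "mat_delete (M x) j i \<in> carrier_mat (n - 1) (n - 1)" for x by (rule mat_delete_carrier[OF M])
    fix i' j' assume ij': "i' < n - 1" "j' < n - 1"
    have "mat_delete (M x) j i $$ (i', j') = M x $$ (if i' < j then i' else Suc i', if j' < i then j' else Suc j')" for x
      using M[of x] ij' by (simp add: mat_delete_def)
    then show "(\<lambda>x. mat_delete (M x) j i $$ (i', j')) \<in> A" using ij' by (simp add: e)
  qed
  ultimately show ?thesis using function_algebraD(1,3)[OF A] by simp
qed

lemma entire_power_series:
  fixes a :: "nat \<Rightarrow> complex"
  assumes "\<And>z. summable (\<lambda>k. z ^ k * a k)"
  shows "(\<lambda>z. \<Sum>k. z ^ k * a k) holomorphic_on UNIV" "(\<lambda>z. \<Sum>k. z ^ k * a k) has_fps_expansion Abs_fps a"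
proof -
  have s: "(\<lambda>k. a k * z ^ k) sums (\<Sum>k. z ^ k * a k)" for z
    using summable_sums[OF assms[of z]] by (simp add: mult.commute)
  have "(\<lambda>z. \<Sum>k. z ^ k * a k) holomorphic_on ball 0 r" for r
    by (rule power_series_holomorphic[where a=a]) (use s in simp)
  then have "(\<lambda>z. \<Sum>k. z ^ k * a k) holomorphic_on (\<Union>r. ball 0 r)"
    by (intro holomorphic_on_UN_open) auto
  moreover have "(\<Union>r. ball 0 r) = (UNIV :: complex set)"
    by (auto simp: gt_ex)
  ultimately show "(\<lambda>z. \<Sum>k. z ^ k * a k) holomorphic_on UNIV" by simp
  show "(\<lambda>z. \<Sum>k. z ^ k * a k) has_fps_expansion Abs_fps a"
    by (rule has_fps_expansionI) (use s in simp)
qed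

text \<open>Cramer's rule makes the solution of \<open>S r = g\<close> holomorphic on the disc on which \<open>S\<close> is
  nonsingular, and continuous in the parameter \<open>l\<close>; Cauchy's inequality then bounds its Taylor
  coefficients, which are the \<open>R l i k\<close> by the recursion.\<close>

theorem resolvent_coefficients:
  fixes s :: "nat \<Rightarrow> nat \<Rightarrow> nat \<Rightarrow> real" and \<gamma> :: "nat \<Rightarrow> nat \<Rightarrow> real" and R :: "real \<Rightarrow> nat \<Rightarrow> nat \<Rightarrow> real"
  assumes \<rho>: "1 < \<rho>"
    and ss: "\<And>i j z. i < n \<Longrightarrow> j < n \<Longrightarrow> summable (\<lambda>k. (z::complex) ^ k * complex_of_real (s i j k))"
    and sg: "\<And>i z. i < n \<Longrightarrow> summable (\<lambda>k. (z::complex) ^ k * complex_of_real (\<gamma> i k))"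
    and s0: "\<And>i j. i < n \<Longrightarrow> j < n \<Longrightarrow> s i j 0 = of_bool (i = j)"
    and nonsing: "\<And>l z v. l \<in> {0..1} \<Longrightarrow> cmod z \<le> \<rho> \<Longrightarrow>
       (\<And>i. i < n \<Longrightarrow> (\<Sum>j<n. (complex_of_real l * of_bool (i = j) + (1 - complex_of_real l) * (\<Sum>k. z ^ k * complex_of_real (s i j k))) * v j) = 0)
       \<Longrightarrow> \<forall>j<n. v j = 0"
    and rec: "\<And>l i k. l \<in> {0..1} \<Longrightarrow> i < n \<Longrightarrow> R l i k + (1 - l) * (\<Sum>q<k. \<Sum>j<n. s i j (k - q) * R l j q) = \<gamma> i k"
  obtains M where "\<And>l i k. l \<in> {0..1} \<Longrightarrow> i < n \<Longrightarrow> \<bar>R l i k\<bar> \<le> M / \<rho> ^ k"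
    "\<And>l i. l \<in> {0..1} \<Longrightarrow> i < n \<Longrightarrow> (\<Sum>j<n. (l * of_bool (i = j) + (1 - l) * (\<Sum>k. s i j k)) * (\<Sum>k. R l j k)) = (\<Sum>k. \<gamma> i k)"
proof -
  define SE where "SE = (\<lambda>i j z. \<Sum>k. z ^ k * complex_of_real (s i j k))"
  define g where "g = (\<lambda>i z. \<Sum>k. z ^ k * complex_of_real (\<gamma> i k))"
  define a where "a = (\<lambda>l i j z. complex_of_real l * of_bool (i = j) + (1 - complex_of_real l) * SE i j z)"
  define A where "A = (\<lambda>l z. mat n n (\<lambda>(i, j). a l i j z))"
  define dt where "dt = (\<lambda>l z. Determinant.det (A l z))"
  define r where "r = (\<lambda>l i z. (\<Sum>j<n. adj_mat (A l z) $$ (i, j) * g j z) / dt l z)"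
  have Ac: "A l z \<in> carrier_mat n n" for l z by (simp add: A_def)
  have Aij: "i < n \<Longrightarrow> j < n \<Longrightarrow> A l z $$ (i, j) = a l i j z" for i j l z by (simp add: A_def)
  have SEh: "SE i j holomorphic_on UNIV" if "i < n" "j < n" for i j
    unfolding SE_def by (rule entire_power_series(1)[OF ss[OF that]])
  have gh: "g i holomorphic_on UNIV" if "i < n" for i
    unfolding g_def by (rule entire_power_series(1)[OF sg[OF that]])
  have dt0: "dt l z \<noteq> 0" if l: "l \<in> {0..1}" and z: "cmod z \<le> \<rho>" for l z
  proof
    assume "dt l z = 0"
    then obtain v where v: "v \<in> carrier_vec n" "v \<noteq> 0\<^sub>v n" "A l z *\<^sub>v v = 0\<^sub>v n"
      using det_0_iff_vec_prod_zero_field[OF Ac] unfolding dt_def by blast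
    have "(\<Sum>j<n. a l i j z * vec_index v j) = 0" if i: "i < n" for i
    proof -
      have "vec_index (A l z *\<^sub>v v) i = (\<Sum>j<n. a l i j z * vec_index v j)"
        using v(1) i Ac[of l z] by (simp add: scalar_prod_def Aij lessThan_atLeast0)
      then show ?thesis using v(3) i by simp
    qed
    then have "\<forall>j<n. vec_index v j = 0" using nonsing[OF l z, of "vec_index v"] unfolding a_def SE_def by blast
    then have "v = 0\<^sub>v n" using v(1) by (intro eq_vecI) auto
    then show False using v(2) by simp
  qed
  have Ar: "(\<Sum>j<n. a l i j z * r l j z) = g i z" if l: "l \<in> {0..1}" and z: "cmod z \<le> \<rho>" and i: "i < n" for l z i
  proof -
    note adj = adj_mat[OF Ac[of l z]]
    have "(\<Sum>j<n. a l i j z * r l j z) = (\<Sum>j<n. \<Sum>k<n. a l i j z * adj_mat (A l z) $$ (j, k) * g k z) / dt l z"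
      by (simp add: r_def sum_distrib_left sum_divide_distrib mult.assoc)
    also have "(\<Sum>j<n. \<Sum>k<n. a l i j z * adj_mat (A l z) $$ (j, k) * g k z) = (\<Sum>k<n. (\<Sum>j<n. a l i j z * adj_mat (A l z) $$ (j, k)) * g k z)"
      by (subst sum.swap) (simp add: sum_distrib_right)
    also have "\<dots> = (\<Sum>k<n. (if k = i then dt l z else 0) * g k z)"
    proof (rule sum.cong[OF refl])
      fix k assume "k \<in> {..<n}"
      then have k: "k < n" by simp
      have "(A l z * adj_mat (A l z)) $$ (i, k) = (\<Sum>j<n. a l i j z * adj_mat (A l z) $$ (j, k))"
        using i k adj(1) Ac[of l z] by (simp add: scalar_prod_def Aij lessThan_atLeast0)
      moreover have "(A l z * adj_mat (A l z)) $$ (i, k) = (if k = i then dt l z else 0)"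
        unfolding adj(2) using i k by (simp add: dt_def)
      ultimately show "(\<Sum>j<n. a l i j z * adj_mat (A l z) $$ (j, k)) * g k z = (if k = i then dt l z else 0) * g k z" by simp
    qed
    also have "\<dots> = dt l z * g i z" using i by (simp add: if_distrib[where f="\<lambda>x. x * _"] cong: if_cong)
    finally show ?thesis using dt0[OF l z] by simp
  qed
  have rh: "r l i holomorphic_on ball 0 \<rho>" if l: "l \<in> {0..1}" and i: "i < n" for l i
  proof -
    let ?H = "{f. f holomorphic_on ball (0::complex) \<rho>}"
    have H: "function_algebra ?H" unfolding function_algebra_def by (auto intro!: holomorphic_intros)
    have el: "(\<lambda>z. A l z $$ (i, j)) \<in> ?H" if "i < n" "j < n" for i j
      unfolding Aij[OF that] a_def using holomorphic_on_subset[OF SEh[OF that]] by (auto intro!: holomorphic_intros)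
    have "(\<lambda>z. adj_mat (A l z) $$ (i, j)) holomorphic_on ball 0 \<rho>" if "j < n" for j
      using function_algebra_adj[OF H Ac el i that] by simp
    moreover have "dt l holomorphic_on ball 0 \<rho>" using function_algebra_det[OF H Ac el] unfolding dt_def by simp
    moreover have "g j holomorphic_on ball 0 \<rho>" if "j < n" for j using holomorphic_on_subset[OF gh[OF that]] by simp
    ultimately show ?thesis unfolding r_def using dt0[OF l] by (intro holomorphic_intros) auto
  qed
  let ?D = "{0..1::real} \<times> cball (0::complex) \<rho>"
  have rc: "continuous_on ?D (\<lambda>p. r (fst p) i (snd p))" if i: "i < n" for i
  proof -
    let ?H = "{f. continuous_on ?D f} :: (real \<times> complex \<Rightarrow> complex) set"
    have H: "function_algebra ?H" unfolding function_algebra_def by (auto intro!: continuous_intros)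
    have cs: "continuous_on ?D (\<lambda>p. f (snd p))" if "f holomorphic_on UNIV" for f
      by (rule continuous_on_compose2[OF holomorphic_on_imp_continuous_on[OF that]]) (auto intro: continuous_intros)
    have el: "(\<lambda>p. A (fst p) (snd p) $$ (i, j)) \<in> ?H" if "i < n" "j < n" for i j
      unfolding Aij[OF that] a_def using cs[OF SEh[OF that]] by (auto intro!: continuous_intros)
    have "continuous_on ?D (\<lambda>p. adj_mat (A (fst p) (snd p)) $$ (i, j))" if "j < n" for j
      using function_algebra_adj[OF H Ac el i that] by simp
    moreover have "continuous_on ?D (\<lambda>p. dt (fst p) (snd p))" using function_algebra_det[OF H Ac el] unfolding dt_def by simp
    ultimately show ?thesis unfolding r_def using dt0 cs[OF gh] by (intro continuous_intros) auto
  qed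
  \<comment> \<open>Compactness in \<open>l\<close> as well as in \<open>z\<close> makes the bound
    \<open>M\<close> uniform in \<open>l\<close>, as the later integration over \<open>l\<close>
    requires.\<close>
  have cD: "compact ?D" by (intro compact_Times) auto
  have "\<forall>i\<in>{..<n}. \<exists>C. \<forall>p\<in>?D. norm (r (fst p) i (snd p)) \<le> C"
  proof
    fix i assume "i \<in> {..<n}"
    then have "bounded ((\<lambda>p. r (fst p) i (snd p)) ` ?D)"
      by (intro compact_imp_bounded[OF compact_continuous_image[OF rc cD]]) simp
    then show "\<exists>C. \<forall>p\<in>?D. norm (r (fst p) i (snd p)) \<le> C" unfolding bounded_iff by auto
  qed
  then obtain C where C: "\<And>i p. i \<in> {..<n} \<Longrightarrow> p \<in> ?D \<Longrightarrow> norm (r (fst p) i (snd p)) \<le> C i"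
    using bchoice[of "{..<n}" "\<lambda>i C. \<forall>p\<in>?D. norm (r (fst p) i (snd p)) \<le> C"] by blast
  define M where "M = (\<Sum>i<n. \<bar>C i\<bar>)"
  have rM: "norm (r l i z) \<le> M" if "l \<in> {0..1}" "cmod z \<le> \<rho>" "i < n" for l i z
  proof -
    have "norm (r l i z) \<le> C i" using C[of i "(l, z)"] that by simp
    also have "\<dots> \<le> \<bar>C i\<bar>" by simp
    also have "\<dots> \<le> M" unfolding M_def using that by (intro member_le_sum) auto
    finally show ?thesis .
  qed
  define co where "co = (\<lambda>l i k. (deriv ^^ k) (r l i) 0 / fact k)"
  \<comment> \<open>Both sides obey the same recursion: by \<open>s0\<close> the matrix has the
    identity as its constant term, so the coefficient of \<open>z^k\<close> in the linear system
    determines \<open>co l i k\<close> from the earlier coefficients.\<close>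
  have co_eq: "co l i k = complex_of_real (R l i k)" if l: "l \<in> {0..1}" and i: "i < n" for l i k
    using i
  proof (induction k arbitrary: i rule: less_induct)
    case (less k)
    have rf: "r l j has_fps_expansion fps_expansion (r l j) 0" if "j < n" for j
      by (rule has_fps_expansion_fps_expansion[of "ball 0 \<rho>"]) (use rh[OF l that] \<rho> in auto)
    have af: "a l i j has_fps_expansion (fps_const (complex_of_real l * of_bool (i = j))
        + fps_const (1 - complex_of_real l) * Abs_fps (\<lambda>k. complex_of_real (s i j k)))" if "j < n" for j
      unfolding a_def SE_def
      by (intro has_fps_expansion_add has_fps_expansion_mult has_fps_expansion_const entire_power_series(2) ss less.prems that)
    let ?af = "\<lambda>j. fps_const (complex_of_real l * of_bool (i = j)) + fps_const (1 - complex_of_real l) * Abs_fps (\<lambda>k. complex_of_real (s i j k))"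
    have "(\<lambda>z. \<Sum>j<n. r l j z * a l i j z) has_fps_expansion (\<Sum>j<n. fps_expansion (r l j) 0 * ?af j)"
      by (intro has_fps_expansion_sum has_fps_expansion_mult rf af) auto
    moreover have "(\<lambda>z. \<Sum>j<n. r l j z * a l i j z) has_fps_expansion Abs_fps (\<lambda>k. complex_of_real (\<gamma> i k))"
    proof (rule has_fps_expansion_cong[THEN iffD1, OF _ refl entire_power_series(2)[OF sg[OF less.prems]]])
      have "eventually (\<lambda>z. z \<in> ball 0 \<rho>) (nhds (0::complex))" using \<rho> by (intro eventually_nhds_in_open) auto
      then show "eventually (\<lambda>z. (\<Sum>k. z ^ k * complex_of_real (\<gamma> i k)) = (\<Sum>j<n. r l j z * a l i j z)) (nhds 0)"
      proof eventually_elim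
        case (elim z)
        then show ?case using Ar[OF l _ less.prems, of z] by (simp add: g_def mult.commute)
      qed
    qed
    ultimately have "(\<Sum>j<n. fps_expansion (r l j) 0 * ?af j) = Abs_fps (\<lambda>k. complex_of_real (\<gamma> i k))"
      by (rule fps_expansion_unique_complex)
    then have "fps_nth (\<Sum>j<n. fps_expansion (r l j) 0 * ?af j) k = complex_of_real (\<gamma> i k)" by simp
    then have "(\<Sum>j<n. \<Sum>q=0..k. co l j q * fps_nth (?af j) (k - q)) = complex_of_real (\<gamma> i k)"
      by (simp add: fps_sum_nth fps_mult_nth co_def fps_expansion_def)
    also have "(\<Sum>j<n. \<Sum>q=0..k. co l j q * fps_nth (?af j) (k - q))
        = (\<Sum>j<n. co l j k * of_bool (i = j) + (\<Sum>q<k. (1 - complex_of_real l) * (complex_of_real (s i j (k - q)) * complex_of_real (R l j q))))"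
    proof (rule sum.cong[OF refl])
      fix j assume "j \<in> {..<n}"
      then have j: "j < n" by simp
      have "{0..k} = insert k {..<k}" by auto
      then have "(\<Sum>q=0..k. co l j q * fps_nth (?af j) (k - q)) = co l j k * fps_nth (?af j) 0 + (\<Sum>q<k. co l j q * fps_nth (?af j) (k - q))"
        by simp
      moreover have "fps_nth (?af j) 0 = of_bool (i = j)" using s0[OF less.prems j] by (simp add: algebra_simps)
      moreover have "(\<Sum>q<k. co l j q * fps_nth (?af j) (k - q)) = (\<Sum>q<k. (1 - complex_of_real l) * (complex_of_real (s i j (k - q)) * complex_of_real (R l j q)))"
        using less.IH[OF _ j] by (intro sum.cong refl) (simp add: fps_const_mult_left[symmetric] mult_ac)
      ultimately show "(\<Sum>q=0..k. co l j q * fps_nth (?af j) (k - q))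
         = co l j k * of_bool (i = j) + (\<Sum>q<k. (1 - complex_of_real l) * (complex_of_real (s i j (k - q)) * complex_of_real (R l j q)))" by simp
    qed
    also have "\<dots> = co l i k + (\<Sum>j<n. \<Sum>q<k. (1 - complex_of_real l) * (complex_of_real (s i j (k - q)) * complex_of_real (R l j q)))"
    proof -
      have "(\<Sum>j<n. co l j k * of_bool (i = j)) = co l i k" using less.prems by (simp add: of_bool_def if_distrib cong: if_cong)
      then show ?thesis by (simp add: sum.distrib)
    qed
    also have "(\<Sum>j<n. \<Sum>q<k. (1 - complex_of_real l) * (complex_of_real (s i j (k - q)) * complex_of_real (R l j q)))
       = complex_of_real ((1 - l) * (\<Sum>q<k. \<Sum>j<n. s i j (k - q) * R l j q))"
      by (subst sum.swap) (simp add: sum_distrib_left)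
    finally have "co l i k = complex_of_real (\<gamma> i k) - complex_of_real ((1 - l) * (\<Sum>q<k. \<Sum>j<n. s i j (k - q) * R l j q))"
      by (simp add: algebra_simps)
    also have "\<dots> = complex_of_real (R l i k)" unfolding rec[OF l less.prems, of k, symmetric] by simp
    finally show ?case .
  qed
  show ?thesis
  proof (rule that[of M])
    fix l i k assume l: "l \<in> {0..1::real}" and i: "i < n"
    have "norm ((deriv ^^ k) (r l i) 0) \<le> fact k * M / \<rho> ^ k"
    proof (rule Cauchy_inequality[OF rh[OF l i]])
      show "continuous_on (cball 0 \<rho>) (r l i)"
      proof -
        have 1: "continuous_on (cball 0 \<rho>) (\<lambda>z::complex. (l, z))"
          by (intro continuous_on_Pair continuous_on_const continuous_on_id)
        have 2: "(\<lambda>z. (l, z)) ` cball 0 \<rho> \<subseteq> ?D" using l by auto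
        from continuous_on_compose2[OF rc[OF i] 1 2] show ?thesis by simp
      qed
      show "norm (r l i x) \<le> M" if "norm (0 - x) = \<rho>" for x using rM[OF l _ i, of x] that by simp
    qed (use \<rho> in simp)
    then have "norm (co l i k) \<le> M / \<rho> ^ k" by (simp add: co_def norm_divide field_simps)
    then show "\<bar>R l i k\<bar> \<le> M / \<rho> ^ k" by (simp add: co_eq[OF l i])
  next
    fix l i assume l: "l \<in> {0..1::real}" and i: "i < n"
    \<comment> \<open>The second claim is the linear system at \<open>z = 1\<close>, a point inside
      the disc because \<open>1 < \<rho>\<close>.\<close>
    have Rs: "(\<lambda>k. complex_of_real (R l j k)) sums r l j 1" if j: "j < n" for j
    proof -
      have "(\<lambda>k. co l j k) sums r l j 1"
        using holomorphic_power_series[OF rh[OF l j], of 1] \<rho> by (simp add: co_def)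
      then show ?thesis by (simp add: co_eq[OF l j])
    qed
    have r1: "r l j 1 = complex_of_real (\<Sum>k. R l j k)" if j: "j < n" for j
    proof -
      have "(\<lambda>k. Re (complex_of_real (R l j k))) sums Re (r l j 1)" "(\<lambda>k. Im (complex_of_real (R l j k))) sums Im (r l j 1)"
        by (rule bounded_linear.sums[OF bounded_linear_Re Rs[OF j]], rule bounded_linear.sums[OF bounded_linear_Im Rs[OF j]])
      then have "Re (r l j 1) = (\<Sum>k. R l j k)" "Im (r l j 1) = 0" by (auto simp: sums_iff)
      then show ?thesis by (simp add: complex_eq_iff)
    qed
    have S1: "SE i j 1 = complex_of_real (\<Sum>k. s i j k)" if j: "j < n" for j
    proof -
      have "summable (\<lambda>k. complex_of_real (s i j k))" using ss[OF i j, of 1] by simp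
      then have "summable (s i j)" by (simp add: summable_complex_of_real)
      then show ?thesis unfolding SE_def by (simp add: suminf_of_real)
    qed
    have g1: "g i 1 = complex_of_real (\<Sum>k. \<gamma> i k)"
    proof -
      have "summable (\<lambda>k. complex_of_real (\<gamma> i k))" using sg[OF i, of 1] by simp
      then have "summable (\<gamma> i)" by (simp add: summable_complex_of_real)
      then show ?thesis unfolding g_def by (simp add: suminf_of_real)
    qed
    have "complex_of_real (\<Sum>j<n. (l * of_bool (i = j) + (1 - l) * (\<Sum>k. s i j k)) * (\<Sum>k. R l j k)) = (\<Sum>j<n. a l i j 1 * r l j 1)"
      unfolding of_real_sum by (rule sum.cong[OF refl]) (simp add: a_def r1 S1)
    also have "\<dots> = complex_of_real (\<Sum>k. \<gamma> i k)" using Ar[OF l _ i, of 1] \<rho> g1 by simp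
    finally show "(\<Sum>j<n. (l * of_bool (i = j) + (1 - l) * (\<Sum>k. s i j k)) * (\<Sum>k. R l j k)) = (\<Sum>k. \<gamma> i k)"
      by (simp only: of_real_eq_iff)
  qed
qed

section \<open>Complex multiples of the measure and absolute convergence of the Magnus
  series\<close>

context ordered_density
begin

interpretation C: fd_algebra "V \<times> V" mC "(e, 0)" NC BC cC by (rule complexification)

definition uC :: "complex \<Rightarrow> real \<Rightarrow> 'v \<times> 'v" where "uC z t = (Re z *\<^sub>R u t, Im z *\<^sub>R u t)"

lemma BC_cases:
  assumes "b \<in> BC"
  obtains b' where "b' \<in> B" "b = (b', 0)" "\<And>x. cC b x = c b' (fst x)"
  | b' where "b' \<in> B" "b = (0, b')" "\<And>x. cC b x = c b' (snd x)"
  using assms zero_notin_B by (force simp: BC_def cC_def)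

lemma cC_B: "b \<in> B \<Longrightarrow> cC (b, 0) x = c b (fst x)" "b \<in> B \<Longrightarrow> cC (0, b) x = c b (snd x)"
  using zero_notin_B by (auto simp: cC_def)

lemma wint_C: "C.wint M f = (wint M (\<lambda>x. fst (f x)), wint M (\<lambda>x. snd (f x)))"
  unfolding C.wint_def wint_def sum_BC by (simp add: cC_B fst_sum snd_sum prod_eq_iff)

definition \<phi>C :: "complex \<Rightarrow> real set \<Rightarrow> 'v \<times> 'v" where "\<phi>C z E = (Re z *\<^sub>R \<phi> E, Im z *\<^sub>R \<phi> E)"

lemma complex_density: "ordered_density (V \<times> V) mC (e, 0) NC BC cC I \<nu> (uC z) (\<phi>C z) (cmod z * K)"
proof (rule ordered_density.intro[OF complexification], rule ordered_density_axioms.intro)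
  show "sets \<nu> = sets (borel_on I)" "finite_measure \<nu>" by (rule sets_\<nu>, rule finite_\<nu>)
  show "emeasure \<nu> {t} = 0" if "t \<in> I" for t by (rule atomless[OF that])
  show "uC z t \<in> V \<times> V" if "t \<in> I" for t using u_V[OF that] by (auto simp: uC_def V_closed)
  show "(\<lambda>t. cC b (uC z t)) \<in> borel_measurable \<nu>" if "b \<in> BC" for b
    using that
  proof (cases rule: BC_cases)
    case (1 b')
    then show ?thesis using u_meas[OF 1(1)] by (simp add: uC_def linear_scale[OF c_linear])
  next
    case (2 b')
    then show ?thesis using u_meas[OF 2(1)] by (simp add: uC_def linear_scale[OF c_linear])
  qed
  show "0 \<le> cmod z * K" using K by simp
  show "NC (mC (uC z t) x) \<le> cmod z * K * NC x" if "t \<in> I" for t x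
    unfolding uC_def by (rule mC_scaled_real[OF mult_u[OF that] K])
  show "\<phi>C z E = C.wint \<nu> (\<lambda>t. indicator E t *\<^sub>R uC z t)" if "E \<in> sets \<nu>" for E
  proof -
    have "wint \<nu> (\<lambda>t. indicator E t *\<^sub>R a *\<^sub>R u t) = a *\<^sub>R \<phi> E" for a
      unfolding \<phi>[OF that] wint_scale[symmetric] by (simp add: mult.commute)
    then show ?thesis by (simp add: wint_C \<phi>C_def uC_def)
  qed
qed

lemma mC_powers: "mC (Re z *\<^sub>R a, Im z *\<^sub>R a) (Re z' *\<^sub>R b, Im z' *\<^sub>R b) = (Re (z * z') *\<^sub>R m a b, Im (z * z') *\<^sub>R m a b)"
  by (simp add: mC_def m_simps algebra_simps)

text \<open>\<open>P\<close> and \<open>Q\<close> are the real and imaginary part of the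
  time-ordered exponential of \<open>z \<phi>\<close>. They are described through real functionals
  so that the matrix of the resolvent can be expressed by the real coefficients \<open>EE k\<close>.
  The real dimension in play is that of the complexification, \<open>2 * card B\<close>.\<close>

lemma complex_exponential:
  obtains P Q where "P \<in> V" "Q \<in> V"
    "\<And>l. linear l \<Longrightarrow> (\<lambda>k. Re (z ^ k) * l (EE k)) sums l P"
    "\<And>l. linear l \<Longrightarrow> (\<lambda>k. Im (z ^ k) * l (EE k)) sums l Q"
    "\<And>d l X. 2 * card B \<le> d \<Longrightarrow> 6 \<le> d \<Longrightarrow> cmod z * K * w < 2 + girth_gap d \<Longrightarrow> l \<in> {0..1} \<Longrightarrow> X \<in> V \<times> V \<Longrightarrow>
       mC (l *\<^sub>R (e, 0) + (1 - l) *\<^sub>R (P, Q)) X = 0 \<Longrightarrow> X = 0"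
proof -
  interpret Z: ordered_density "V \<times> V" mC "(e, 0)" NC BC cC I \<nu> "uC z" "\<phi>C z" "cmod z * K"
    by (rule complex_density)
  have evol: "Z.evol k s = (Re (z ^ k) *\<^sub>R evol k s, Im (z ^ k) *\<^sub>R evol k s)" for k s
  proof (induction k arbitrary: s)
    case (Suc k)
    have "Z.evol (Suc k) s = C.wint \<nu> (\<lambda>r. kle s r *\<^sub>R mC (uC z r) (Z.evol k r))"
      by (simp add: Z.kernel_op_def)
    also have "(\<lambda>r. kle s r *\<^sub>R mC (uC z r) (Z.evol k r))
      = (\<lambda>r. (Re (z ^ Suc k) *\<^sub>R (kle s r *\<^sub>R m (u r) (evol k r)), Im (z ^ Suc k) *\<^sub>R (kle s r *\<^sub>R m (u r) (evol k r))))"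
      unfolding Suc.IH uC_def mC_powers by (simp add: mult.commute)
    also have "C.wint \<nu> \<dots> = (Re (z ^ Suc k) *\<^sub>R evol (Suc k) s, Im (z ^ Suc k) *\<^sub>R evol (Suc k) s)"
      unfolding wint_C fst_conv snd_conv wint_scale by (simp add: kernel_op_def)
    finally show ?case .
  qed simp
  have EE: "Z.EE k = (Re (z ^ k) *\<^sub>R EE k, Im (z ^ k) *\<^sub>R EE k)" for k
  proof (cases k)
    case (Suc j)
    have "Z.EE k = C.wint \<nu> (\<lambda>s. mC (uC z s) (Z.evol j s))" by (simp add: Suc Z.total_def)
    also have "(\<lambda>s. mC (uC z s) (Z.evol j s)) = (\<lambda>s. (Re (z ^ k) *\<^sub>R m (u s) (evol j s), Im (z ^ k) *\<^sub>R m (u s) (evol j s)))"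
      unfolding evol uC_def mC_powers Suc by simp
    also have "C.wint \<nu> \<dots> = (Re (z ^ k) *\<^sub>R EE k, Im (z ^ k) *\<^sub>R EE k)"
      unfolding wint_C fst_conv snd_conv wint_scale by (simp add: Suc total_def)
    finally show ?thesis .
  qed simp
  show ?thesis
  proof (rule that[of "fst Z.EXP" "snd Z.EXP"])
    show "fst Z.EXP \<in> V" "snd Z.EXP \<in> V" using Z.EXP_V by auto
    fix l :: "'v \<Rightarrow> real" assume l: "linear l"
    have f: "linear (\<lambda>X. l (fst X))" "linear (\<lambda>X. l (snd X))"
      using linear_compose[OF linear_fst l] linear_compose[OF linear_snd l] by (simp_all add: o_def)
    show "(\<lambda>k. Re (z ^ k) * l (EE k)) sums l (fst Z.EXP)"
    proof -
      have "(\<lambda>k. l (fst (Z.EE k))) sums l (fst Z.EXP)"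
        unfolding Z.EXP_def by (rule C.vsum_functional[OF f(1) Z.EE_V Z.EE_summable])
      then show ?thesis by (simp add: EE linear_scale[OF l])
    qed
    show "(\<lambda>k. Im (z ^ k) * l (EE k)) sums l (snd Z.EXP)"
    proof -
      have "(\<lambda>k. l (snd (Z.EE k))) sums l (snd Z.EXP)"
        unfolding Z.EXP_def by (rule C.vsum_functional[OF f(2) Z.EE_V Z.EE_summable])
      then show ?thesis by (simp add: EE linear_scale[OF l])
    qed
  next
    fix d l X assume "2 * card B \<le> d" "6 \<le> d" "cmod z * K * w < 2 + girth_gap d" "l \<in> {0..1::real}" "X \<in> V \<times> V"
       "mC (l *\<^sub>R (e, 0) + (1 - l) *\<^sub>R (fst Z.EXP, snd Z.EXP)) X = 0"
    then show "X = 0"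
      by (intro Z.resolvent_injective[of d l X]) (simp_all only: card_BC prod.collapse)
  qed
qed

corollary log_defined_complex:
  assumes "2 * card B \<le> d" "6 \<le> d" "K * w < 2 + girth_gap d" "cmod z \<le> 1"
  shows "log_defined mC (e, 0) (time_ordered_exp mC (e, 0) I (\<phi>C z))"
proof -
  interpret Z: ordered_density "V \<times> V" mC "(e, 0)" NC BC cC I \<nu> "uC z" "\<phi>C z" "cmod z * K"
    by (rule complex_density)
  have "cmod z * (K * w) \<le> K * w" using assms(4) K w_nonneg by (intro mult_left_le_one_le) auto
  then have "cmod z * K * w < 2 + girth_gap d" using assms(3) by (simp only: mult.assoc)
  then show ?thesis using assms(1,2) by (intro Z.log_defined_exp[of d]) (simp_all only: card_BC)
qed

lemma EE_exp_summable:
  assumes l: "linear (l :: 'v \<Rightarrow> real)"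
  shows "summable (\<lambda>k. (z::complex) ^ k * complex_of_real (l (EE k)))"
proof -
  obtain C where C: "C \<ge> 0" "\<forall>x\<in>V. \<bar>l x\<bar> \<le> C * N x" using functional_bounded[OF l] by blast
  have "summable (\<lambda>k. C * N e * (inverse (fact k) * (cmod z * (K * w)) ^ k))"
    by (rule summable_mult[OF summable_exp])
  then show ?thesis
  proof (rule summable_comparison_test')
    fix k
    have "\<bar>l (EE k)\<bar> \<le> C * N (EE k)" using C EE_V by blast
    also have "\<dots> \<le> C * q k" using ek_q[of 0 k] w_nonneg C(1) by (intro mult_left_mono) (auto simp: EE_ek)
    finally have "cmod z ^ k * \<bar>l (EE k)\<bar> \<le> cmod z ^ k * (C * q k)" by (intro mult_left_mono) auto
    then show "norm (z ^ k * complex_of_real (l (EE k))) \<le> C * N e * (inverse (fact k) * (cmod z * (K * w)) ^ k)"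
      by (simp add: norm_mult norm_power q_def power_mult_distrib field_simps)
  qed
qed

text \<open>\<open>RL l\<close> is the integrand of the logarithm, described by the linear equation
  it solves; this form makes sense also for a proper subspace \<open>V\<close> of the type.\<close>

theorem magnus_convergence:
  assumes d: "2 * card B \<le> d" "6 \<le> d" and Kw: "K * w < 2 + girth_gap d"
  obtains RL where "\<And>l. RL l \<in> V"
    "\<And>l. l \<in> {0..1} \<Longrightarrow> m (l *\<^sub>R e + (1 - l) *\<^sub>R EXP) (RL l) = EXP - e"
    "\<And>b. b \<in> B \<Longrightarrow> ((\<lambda>l. c b (RL l)) has_integral (\<Sum>k. c b (magnus_term m e I \<phi> (Suc k)))) {0..1}"
    "summable (\<lambda>k. N (magnus_term m e I \<phi> (Suc k)))"
proof -
  have gp: "0 < girth_gap d" by (simp add: girth_gap_def)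
  \<comment> \<open>The hypothesis is strict and leaves room for a radius beyond \<open>1\<close>.
    The case distinction keeps \<open>K * w = 0\<close> out of the denominator.\<close>
  obtain \<rho> where \<rho>: "1 < \<rho>" "\<rho> * (K * w) < 2 + girth_gap d"
  proof (cases "K * w \<le> 1")
    case True
    then show ?thesis using that[of 2] gp by simp
  next
    case False
    then have "1 < (2 + girth_gap d) / (K * w)" using Kw by simp
    then obtain \<rho> where "1 < \<rho>" "\<rho> < (2 + girth_gap d) / (K * w)" using dense by blast
    then show ?thesis using that[of \<rho>] False by (simp add: field_simps)
  qed
  obtain bs where bs: "set bs = B" "distinct bs" using finite_distinct_list[OF B(1)] by blast
  define n' where "n' = length bs"
  have bij: "bij_betw ((!) bs) {..<n'} B" using bs by (intro bij_betw_nth) (auto simp: n'_def)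
  have sumB: "(\<Sum>b\<in>B. f b) = (\<Sum>j<n'. f (bs ! j))" for f :: "'v \<Rightarrow> 'w::comm_monoid_add"
    by (rule sum.reindex_bij_betw[OF bij, symmetric])
  have bsB: "bs ! j \<in> B" if "j < n'" for j using that bs by (auto simp: n'_def)
  have Bbs: "\<exists>j<n'. b = bs ! j" if "b \<in> B" for b using that bs by (auto simp: n'_def in_set_conv_nth)
  define ci where "ci = (\<lambda>i. c (bs ! i))"
  have ci: "linear (ci i)" if "i < n'" for i unfolding ci_def by (rule c_linear[OF bsB[OF that]])
  have delta: "ci i (bs ! j) = of_bool (i = j)" if "i < n'" "j < n'" for i j
    unfolding ci_def using c_delta[OF bsB bsB] that bs(2) by (auto simp: nth_eq_iff_index_eq n'_def)
  define s where "s = (\<lambda>i j k. ci i (m (EE k) (bs ! j)))"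
  define \<gamma> where "\<gamma> = (\<lambda>i k. if k = 0 then 0 else ci i (EE k))"
  \<comment> \<open>Shifted by one: \<open>R l i k\<close> belongs to \<open>z^k\<close>, whereas
    \<open>total (klam l) k\<close> has \<open>k + 1\<close> factors.\<close>
  define R where "R = (\<lambda>l i k. case k of 0 \<Rightarrow> 0 | Suc k \<Rightarrow> ci i (total (klam l) k))"
  have lm: "linear (\<lambda>x. ci i (m x (bs ! j)))" if "i < n'" for i j
    using linear_compose[OF m_linear(2) ci[OF that]] by (simp add: o_def)
  have cm: "ci i (m x y) = (\<Sum>j<n'. ci i (m x (bs ! j)) * ci j y)" if "i < n'" "y \<in> V" for i x y
  proof -
    have "linear (\<lambda>y. ci i (m x y))" using linear_compose[OF m_linear(1) ci[OF that(1)]] by (simp add: o_def)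
    from linear_expand[OF this that(2)] show ?thesis by (simp add: sumB ci_def mult.commute)
  qed
  have ssum: "summable (\<lambda>k. z ^ k * complex_of_real (s i j k))" if "i < n'" for i j z
    unfolding s_def by (rule EE_exp_summable[OF lm[OF that]])
  have gsum: "summable (\<lambda>k. z ^ k * complex_of_real (\<gamma> i k))" if i: "i < n'" for i z
  proof -
    have "summable (\<lambda>k. z ^ Suc k * complex_of_real (ci i (EE (Suc k))))"
      using EE_exp_summable[OF ci[OF i], of z] summable_Suc_iff[of "\<lambda>k. z ^ k * complex_of_real (ci i (EE k))"] by blast
    then show ?thesis using summable_Suc_iff[of "\<lambda>k. z ^ k * complex_of_real (\<gamma> i k)"] by (simp add: \<gamma>_def)
  qed
  obtain M where M: "\<And>l i k. l \<in> {0..1} \<Longrightarrow> i < n' \<Longrightarrow> \<bar>R l i k\<bar> \<le> M / \<rho> ^ k"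
    and sol: "\<And>l i. l \<in> {0..1} \<Longrightarrow> i < n' \<Longrightarrow> (\<Sum>j<n'. (l * of_bool (i = j) + (1 - l) * (\<Sum>k. s i j k)) * (\<Sum>k. R l j k)) = (\<Sum>k. \<gamma> i k)"
  proof (rule resolvent_coefficients[where s=s and \<gamma>=\<gamma> and R=R and n=n', OF \<rho>(1) ssum gsum])
    show "s i j 0 = of_bool (i = j)" if "i < n'" "j < n'" for i j
      using delta[OF that] by (simp add: s_def m_e B_V bsB[OF that(2)])
    show "R l i k + (1 - l) * (\<Sum>q<k. \<Sum>j<n'. s i j (k - q) * R l j q) = \<gamma> i k" if l: "l \<in> {0..1}" and i: "i < n'" for l i k
    proof (cases k)
      case (Suc k')
      have "(\<Sum>q<k. \<Sum>j<n'. s i j (k - q) * R l j q) = (\<Sum>j<n'. s i j k * R l j 0) + (\<Sum>q<k'. \<Sum>j<n'. s i j (k' - q) * R l j (Suc q))"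
        unfolding Suc by (subst sum.lessThan_Suc_shift) simp
      also have "\<dots> = (\<Sum>q<k'. ci i (m (EE (k' - q)) (total (klam l) q)))"
        by (simp add: R_def s_def cm[OF i total_V])
      finally have a: "(\<Sum>q<k. \<Sum>j<n'. s i j (k - q) * R l j q) = (\<Sum>q<k'. ci i (m (EE (k' - q)) (total (klam l) q)))" .
      have "ci i (total (klam l) k') = ci i (EE (Suc k')) - (1 - l) * (\<Sum>q<k'. ci i (m (EE (k' - q)) (total (klam l) q)))"
        by (subst klam_total) (simp only: linear_diff[OF ci[OF i]] linear_scale[OF ci[OF i]] linear_sum[OF ci[OF i]] real_scaleR_def)
      then show ?thesis unfolding a by (simp add: R_def \<gamma>_def Suc del: EE_simps)
    qed (simp add: R_def \<gamma>_def)
    fix l z v assume l: "l \<in> {0..1::real}" and z: "cmod z \<le> \<rho>"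
      and v: "\<And>i. i < n' \<Longrightarrow> (\<Sum>j<n'. (complex_of_real l * of_bool (i = j) + (1 - complex_of_real l) * (\<Sum>k. z ^ k * complex_of_real (s i j k))) * v j) = 0"
    obtain P Q where P: "P \<in> V" "Q \<in> V"
      "\<And>l. linear l \<Longrightarrow> (\<lambda>k. Re (z ^ k) * l (EE k)) sums l P"
      "\<And>l. linear l \<Longrightarrow> (\<lambda>k. Im (z ^ k) * l (EE k)) sums l Q"
      and inj: "\<And>d l X. 2 * card B \<le> d \<Longrightarrow> 6 \<le> d \<Longrightarrow> cmod z * K * w < 2 + girth_gap d \<Longrightarrow> l \<in> {0..1} \<Longrightarrow> X \<in> V \<times> V \<Longrightarrow>
         mC (l *\<^sub>R (e, 0) + (1 - l) *\<^sub>R (P, Q)) X = 0 \<Longrightarrow> X = 0"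
      by (rule complex_exponential[of z]) blast
    have SE: "(\<Sum>k. z ^ k * complex_of_real (s i j k)) = Complex (ci i (m P (bs ! j))) (ci i (m Q (bs ! j)))" if i: "i < n'" for i j
    proof -
      have "(\<lambda>k. z ^ k * complex_of_real (s i j k)) sums Complex (ci i (m P (bs ! j))) (ci i (m Q (bs ! j)))"
        unfolding sums_complex_iff using P(3)[OF lm[OF i]] P(4)[OF lm[OF i]] by (simp add: s_def)
      then show ?thesis by (simp add: sums_iff)
    qed
    \<comment> \<open>A complex null vector of the resolvent matrix is turned into the element
      \<open>(x, y)\<close> of the complexification, on which the resolvent is injective.\<close>
    define x where "x = (\<Sum>j<n'. Re (v j) *\<^sub>R bs ! j)"
    define y where "y = (\<Sum>j<n'. Im (v j) *\<^sub>R bs ! j)"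
    have xy: "x \<in> V" "y \<in> V" unfolding x_def y_def by (auto intro!: V_closed(5) V_closed(4)[OF B_V[OF bsB]])
    have cix: "ci i (\<Sum>j<n'. f j *\<^sub>R bs ! j) = f i" if i: "i < n'" for i and f :: "nat \<Rightarrow> real"
    proof -
      have "ci i (\<Sum>j<n'. f j *\<^sub>R bs ! j) = (\<Sum>j<n'. if j = i then f j else 0)"
        unfolding linear_sum[OF ci[OF i]] linear_scale[OF ci[OF i]] using delta[OF i] by (intro sum.cong) auto
      then show ?thesis using i by simp
    qed
    have X: "(x, y) \<in> V \<times> V" using xy by simp
    have comp: "mC (l *\<^sub>R (e, 0) + (1 - l) *\<^sub>R (P, Q)) (x, y)
       = (l *\<^sub>R x + (1 - l) *\<^sub>R (m P x - m Q y), l *\<^sub>R y + (1 - l) *\<^sub>R (m P y + m Q x))"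
      using xy by (simp add: mC_def m_simps m_e algebra_simps)
    have Re0: "ci i (l *\<^sub>R x + (1 - l) *\<^sub>R (m P x - m Q y)) = 0" and Im0: "ci i (l *\<^sub>R y + (1 - l) *\<^sub>R (m P y + m Q x)) = 0" if i: "i < n'" for i
    proof -
      let ?t = "\<lambda>j. (complex_of_real l * of_bool (i = j) + (1 - complex_of_real l) * Complex (ci i (m P (bs ! j))) (ci i (m Q (bs ! j)))) * v j"
      have "(\<Sum>j<n'. ?t j) = 0" using v[OF i] by (simp add: SE[OF i])
      then have z0: "(\<Sum>j<n'. Re (?t j)) = 0" "(\<Sum>j<n'. Im (?t j)) = 0"
        by (simp_all only: Re_sum[symmetric] Im_sum[symmetric] zero_complex.sel)
      have rb: "Re (of_bool b) = of_bool b" "Im (of_bool b) = 0" for b by (cases b; simp)+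
      have lx: "l * Re (v i) = (\<Sum>j<n'. l * of_bool (i = j) * Re (v j))" "l * Im (v i) = (\<Sum>j<n'. l * of_bool (i = j) * Im (v j))"
        using i by (simp_all add: of_bool_def if_distrib[where f="\<lambda>x. _ * x"] if_distrib[where f="\<lambda>x. x * _"] cong: if_cong)
      have cx: "ci j x = Re (v j)" "ci j y = Im (v j)" if "j < n'" for j using cix[OF that] by (auto simp: x_def y_def)
      have "ci i (l *\<^sub>R x + (1 - l) *\<^sub>R (m P x - m Q y)) = (\<Sum>j<n'. Re (?t j))"
        unfolding linear_add[OF ci[OF i]] linear_scale[OF ci[OF i]] linear_diff[OF ci[OF i]] cm[OF i xy(1)] cm[OF i xy(2)] cx(1)[OF i]
        using cx lx(1) by (simp add: rb sum.distrib[symmetric] sum_subtractf[symmetric] sum_distrib_left algebra_simps)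
      then show "ci i (l *\<^sub>R x + (1 - l) *\<^sub>R (m P x - m Q y)) = 0" using z0(1) by (simp only:)
      have "ci i (l *\<^sub>R y + (1 - l) *\<^sub>R (m P y + m Q x)) = (\<Sum>j<n'. Im (?t j))"
        unfolding linear_add[OF ci[OF i]] linear_scale[OF ci[OF i]] cm[OF i xy(1)] cm[OF i xy(2)] cx(2)[OF i]
        using cx lx(2) by (simp add: rb sum.distrib[symmetric] sum_distrib_left algebra_simps)
      then show "ci i (l *\<^sub>R y + (1 - l) *\<^sub>R (m P y + m Q x)) = 0" using z0(2) by (simp only:)
    qed
    have V0: "a = 0" if a: "a \<in> V" "\<And>i. i < n' \<Longrightarrow> ci i a = 0" for a
    proof (rule V_eqI[OF a(1) V_closed(1)])
      fix b assume "b \<in> B"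
      then obtain j where "j < n'" "b = bs ! j" using Bbs by blast
      then show "c b a = c b 0" using a(2)[of j] linear_0[OF ci[of j]] by (simp add: ci_def)
    qed
    have "mC (l *\<^sub>R (e, 0) + (1 - l) *\<^sub>R (P, Q)) (x, y) = 0"
      unfolding comp zero_prod_def using Re0 Im0 xy
      by (intro arg_cong2[where f=Pair] V0) (auto intro!: V_closed m_V)
    moreover have "cmod z * K * w < 2 + girth_gap d"
    proof -
      have "cmod z * (K * w) \<le> \<rho> * (K * w)" using z K w_nonneg by (intro mult_right_mono) auto
      then show ?thesis using \<rho>(2) by (simp add: mult.assoc)
    qed
    ultimately have "(x, y) = 0" using inj[OF d _ l X] by blast
    then have "x = 0" "y = 0" by (auto simp: zero_prod_def)
    then have "Re (v j) = 0" "Im (v j) = 0" if "j < n'" for j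
      using cix[OF that, of "\<lambda>j. Re (v j)"] cix[OF that, of "\<lambda>j. Im (v j)"] linear_0[OF ci[OF that]] by (auto simp: x_def y_def)
    then show "\<forall>j<n'. v j = 0" by (auto simp: complex_eq_iff)
  next
    fix M
    assume a: "\<And>l i k. l \<in> {0..1} \<Longrightarrow> i < n' \<Longrightarrow> \<bar>R l i k\<bar> \<le> M / \<rho> ^ k"
      and b: "\<And>l i. l \<in> {0..1} \<Longrightarrow> i < n' \<Longrightarrow> (\<Sum>j<n'. (l * of_bool (i = j) + (1 - l) * (\<Sum>k. s i j k)) * (\<Sum>k. R l j k)) = (\<Sum>k. \<gamma> i k)"
    show thesis by (rule that[OF a b])
  qed
  define RL where "RL = (\<lambda>l. vsum (total (klam l)))"
  have geo: "summable (\<lambda>k. M / \<rho> ^ k)"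
    using summable_mult[OF summable_geometric[of "1 / \<rho>"], of M] \<rho>(1) by (simp add: power_divide)
  have geo': "summable (\<lambda>k. M / \<rho> ^ Suc k)" using geo by (subst summable_Suc_iff)
  have tb: "\<bar>ci i (total (klam l) k)\<bar> \<le> M / \<rho> ^ Suc k" if "l \<in> {0..1}" "i < n'" for l i k
    using M[OF that, of "Suc k"] by (simp add: R_def)
  have ts: "summable (\<lambda>k. ci i (total (klam l) k))" if "l \<in> {0..1}" "i < n'" for l i
    by (rule summable_comparison_test'[OF geo']) (use tb[OF that] in simp)
  have ciRL: "ci i (RL l) = (\<Sum>k. ci i (total (klam l) k))" if "i < n'" for i l
    unfolding RL_def ci_def by (rule c_vsum[OF bsB[OF that]])
  have RS: "(\<Sum>k. R l i k) = ci i (RL l)" if "l \<in> {0..1}" "i < n'" for l i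
  proof -
    have "(\<lambda>k. R l i (Suc k)) sums ci i (RL l)" using summable_sums[OF ts[OF that]] by (simp add: R_def ciRL[OF that(2)])
    then have "R l i sums ci i (RL l)" by (subst (asm) sums_Suc_iff) (simp add: R_def)
    then show ?thesis by (simp add: sums_iff)
  qed
  define \<mu> where "\<mu> = (\<lambda>k. magnus_term m e I \<phi> (Suc k))"
  have hi: "((\<lambda>l. ci i (total (klam l) k)) has_integral ci i (\<mu> k)) {0..1}" if "i < n'" for i k
    unfolding \<mu>_def by (rule magnus_term_has_integral[OF ci[OF that]])
  have mb: "\<bar>ci i (\<mu> k)\<bar> \<le> M / \<rho> ^ Suc k" if i: "i < n'" for i k
  proof -
    have "norm (ci i (\<mu> k)) \<le> M / \<rho> ^ Suc k * measure lborel (cbox 0 (1::real))"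
    proof (rule has_integral_bound)
      show "0 \<le> M / \<rho> ^ Suc k" using order_trans[OF abs_ge_zero tb[of 0 i k]] i by simp
      show "((\<lambda>l. ci i (total (klam l) k)) has_integral ci i (\<mu> k)) (cbox 0 1)" using hi[OF i] by simp
    qed (use tb i in auto)
    then show ?thesis by simp
  qed
  show ?thesis
  proof (rule that[of RL])
    show "RL l \<in> V" for l unfolding RL_def by (rule vsum_V)
    show "m (l *\<^sub>R e + (1 - l) *\<^sub>R EXP) (RL l) = EXP - e" if l: "l \<in> {0..1}" for l
    proof (rule V_eqI[OF m_V V_closed(3)[OF EXP_V e_V]])
      fix b assume "b \<in> B"
      then obtain i where i: "i < n'" "b = bs ! i" using Bbs by blast
      have RLV: "RL l \<in> V" unfolding RL_def by (rule vsum_V)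
      have sE: "(\<Sum>k. s i j k) = ci i (m EXP (bs ! j))" for j
        using vsum_functional[OF lm[OF i(1)] EE_V EE_summable] by (simp add: s_def EXP_def sums_iff)
      have gE: "(\<Sum>k. \<gamma> i k) = ci i EXP - ci i e"
      proof -
        have "(\<lambda>k. ci i (EE k)) sums ci i EXP" unfolding EXP_def by (rule vsum_functional[OF ci[OF i(1)] EE_V EE_summable])
        then have "(\<lambda>k. ci i (EE (Suc k))) sums (ci i EXP - ci i e)" by (subst sums_Suc_iff) simp
        then have "(\<lambda>k. \<gamma> i (Suc k)) sums (ci i EXP - ci i e)" by (simp add: \<gamma>_def del: EE_simps)
        then have "\<gamma> i sums (ci i EXP - ci i e)" by (subst (asm) sums_Suc_iff) (simp add: \<gamma>_def)
        then show ?thesis by (simp add: sums_iff)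
      qed
      have "ci i (m (l *\<^sub>R e + (1 - l) *\<^sub>R EXP) (RL l)) = (\<Sum>j<n'. ci i (m (l *\<^sub>R e + (1 - l) *\<^sub>R EXP) (bs ! j)) * ci j (RL l))"
        by (rule cm[OF i(1) RLV])
      also have "\<dots> = (\<Sum>j<n'. (l * of_bool (i = j) + (1 - l) * (\<Sum>k. s i j k)) * (\<Sum>k. R l j k))"
      proof (rule sum.cong[OF refl])
        fix j assume "j \<in> {..<n'}"
        then have j: "j < n'" by simp
        show "ci i (m (l *\<^sub>R e + (1 - l) *\<^sub>R EXP) (bs ! j)) * ci j (RL l) = (l * of_bool (i = j) + (1 - l) * (\<Sum>k. s i j k)) * (\<Sum>k. R l j k)"
          unfolding RS[OF l j] sE
          by (simp add: m_simps m_e B_V bsB[OF j] linear_add[OF ci[OF i(1)]] linear_scale[OF ci[OF i(1)]] delta[OF i(1) j])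
      qed
      also have "\<dots> = ci i (EXP - e)" unfolding sol[OF l i(1)] gE by (simp add: linear_diff[OF ci[OF i(1)]])
      finally show "c b (m (l *\<^sub>R e + (1 - l) *\<^sub>R EXP) (RL l)) = c b (EXP - e)" by (simp add: ci_def i(2))
    qed
    show "((\<lambda>l. c b (RL l)) has_integral (\<Sum>k. c b (magnus_term m e I \<phi> (Suc k)))) {0..1}" if b: "b \<in> B" for b
    proof -
      obtain i where i: "i < n'" "b = bs ! i" using Bbs[OF b] by blast
      \<comment> \<open>The partial sums converge for every \<open>l\<close> and are bounded by a
        geometric series independent of \<open>l\<close>; dominated convergence exchanges sum and
        integral.\<close>
      let ?f = "\<lambda>k l. \<Sum>q<k. ci i (total (klam l) q)"
      have fi: "(?f k has_integral (\<Sum>q<k. ci i (\<mu> q))) {0..1}" for k by (intro has_integral_sum hi i) auto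
      have bd: "norm (?f k l) \<le> (\<Sum>k. M / \<rho> ^ Suc k)" if l: "l \<in> {0..1}" for k l
      proof -
        have "norm (?f k l) \<le> (\<Sum>q<k. M / \<rho> ^ Suc q)"
          by (rule order_trans[OF norm_sum], rule sum_mono) (use tb[OF l i(1)] in simp)
        also have "\<dots> \<le> (\<Sum>k. M / \<rho> ^ Suc k)"
          by (rule sum_le_suminf[OF geo']) (use order_trans[OF abs_ge_zero tb[OF l i(1)]] in auto)
        finally show ?thesis .
      qed
      have cv: "(\<lambda>k. ?f k l) \<longlonglongrightarrow> ci i (RL l)" if l: "l \<in> {0..1}" for l
        using summable_LIMSEQ[OF ts[OF l i(1)]] by (simp add: ciRL[OF i(1)])
      have ii: "(\<lambda>l::real. \<Sum>k. M / \<rho> ^ Suc k) integrable_on {0..1}" by (rule integrable_const_ivl)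
      have fk: "?f k integrable_on {0..1}" for k using fi by blast
      note dc = dominated_convergence[OF fk ii bd cv]
      have "(\<lambda>k. \<Sum>q<k. ci i (\<mu> q)) \<longlonglongrightarrow> integral {0..1} (\<lambda>l. ci i (RL l))"
        using dc(2) by (simp add: integral_unique[OF fi])
      then have "(\<Sum>k. ci i (\<mu> k)) = integral {0..1} (\<lambda>l. ci i (RL l))" by (simp add: sums_def[symmetric] sums_iff)
      then show ?thesis using integrable_integral[OF dc(1)] by (simp add: ci_def i(2) \<mu>_def)
    qed
    show "summable (\<lambda>k. N (magnus_term m e I \<phi> (Suc k)))"
    proof (rule summable_comparison_test'[OF summable_mult2[OF geo', of "\<Sum>b\<in>B. N b"]])
      fix k
      have "N (\<mu> k) \<le> (\<Sum>b\<in>B. \<bar>c b (\<mu> k)\<bar> * N b)" unfolding \<mu>_def by (rule N_le_coord[OF magnus_term_V])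
      also have "\<dots> \<le> (\<Sum>b\<in>B. M / \<rho> ^ Suc k * N b)"
      proof (rule sum_mono, rule mult_right_mono[OF _ n(9)])
        fix b assume "b \<in> B"
        then obtain i where "i < n'" "b = bs ! i" using Bbs by blast
        then show "\<bar>c b (\<mu> k)\<bar> \<le> M / \<rho> ^ Suc k" using mb[of i k] by (simp add: ci_def)
      qed
      finally show "norm (N (magnus_term m e I \<phi> (Suc k))) \<le> M / \<rho> ^ Suc k * (\<Sum>b\<in>B. N b)"
        using n(9) by (simp add: \<mu>_def sum_distrib_left)
    qed
  qed
qed

text \<open>Here \<open>V\<close> must be everything, for otherwise inverses are not unique in the whole type.\<close>

corollary magnus_logarithm:
  assumes d: "2 * card B \<le> d" "6 \<le> d" and Kw: "K * w < 2 + girth_gap d" and V: "V = UNIV"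
  shows "summable (\<lambda>k. magnus_term m e I \<phi> (Suc k))"
    "alg_log m e (time_ordered_exp m e I \<phi>) = (\<Sum>k. magnus_term m e I \<phi> (Suc k))"
proof -
  obtain RL where RL: "\<And>l. l \<in> {0..1} \<Longrightarrow> m (l *\<^sub>R e + (1 - l) *\<^sub>R EXP) (RL l) = EXP - e"
    "\<And>b. b \<in> B \<Longrightarrow> ((\<lambda>l. c b (RL l)) has_integral (\<Sum>k. c b (magnus_term m e I \<phi> (Suc k)))) {0..1}"
    "summable (\<lambda>k. N (magnus_term m e I \<phi> (Suc k)))"
    using magnus_convergence[OF d Kw] by metis
  note vs = vsum_sums[OF magnus_term_V RL(3)]
  then show "summable (\<lambda>k. magnus_term m e I \<phi> (Suc k))" by (simp add: sums_iff)
  have mV: "m e x = x" "m x e = x" for x using m_e[of x] V by auto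
  have integrand: "m (EXP - e) (alg_inverse m e (l *\<^sub>R e + (1 - l) *\<^sub>R EXP)) = RL l" if l: "l \<in> {0..1}" for l
  proof -
    define S where "S = l *\<^sub>R e + (1 - l) *\<^sub>R EXP"
    define D where "D = EXP - e"
    have "card B \<le> d" using d by simp
    then obtain y where y: "m S y = e" "m y S = e" using resolvent_invertible[OF _ d(2) Kw l] unfolding S_def by blast
    have "alg_inverse m e S = y" unfolding alg_inverse_def
    proof (rule the_equality)
      fix y' assume "m S y' = e \<and> m y' S = e"
      then have "m (m y' S) y = y" by (simp add: mV)
      then show "y' = y" by (simp add: m_assoc y mV)
    qed (use y in simp)
    \<comment> \<open>\<open>D\<close> and \<open>S\<close> are both affine in \<open>EXP\<close>.
      Hence the inverse of \<open>S\<close> may stand on either side of \<open>D\<close>, as needed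
      to match \<open>alg_log\<close> with the equation for \<open>RL\<close>.\<close>
    moreover have "m D S = m S D" unfolding D_def S_def by (simp add: m_simps mV algebra_simps)
    then have "m D y = m y D"
    proof -
      assume c: "m D S = m S D"
      have "m y D = m y (m D (m S y))" by (simp add: y mV)
      also have "\<dots> = m y (m (m S D) y)" using c by (simp flip: m_assoc)
      also have "\<dots> = m (m y S) (m D y)" by (simp add: m_assoc)
      finally show ?thesis by (simp add: y mV)
    qed
    moreover have "m y D = RL l"
    proof -
      have "m y D = m y (m S (RL l))" using RL(1)[OF l] by (simp add: S_def D_def)
      also have "\<dots> = m (m y S) (RL l)" by (simp add: m_assoc)
      finally show ?thesis by (simp add: y mV)
    qed
    ultimately show ?thesis by (simp add: S_def D_def)
  qed
  have "((\<lambda>l. \<Sum>b\<in>B. c b (RL l) *\<^sub>R b) has_integral (\<Sum>b\<in>B. (\<Sum>k. c b (magnus_term m e I \<phi> (Suc k))) *\<^sub>R b)) {0..1}"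
    by (intro has_integral_sum has_integral_scaleR_left RL(2) B(1))
  moreover have "(\<Sum>b\<in>B. c b (RL l) *\<^sub>R b) = RL l" for l using c_expand[of "RL l"] V by simp
  moreover have "(\<Sum>b\<in>B. (\<Sum>k. c b (magnus_term m e I \<phi> (Suc k))) *\<^sub>R b) = (\<Sum>k. magnus_term m e I \<phi> (Suc k))"
    using vs by (simp add: vsum_def sums_iff)
  ultimately have "(RL has_integral (\<Sum>k. magnus_term m e I \<phi> (Suc k))) {0..1}" by simp
  then have "((\<lambda>l. m (EXP - e) (alg_inverse m e (l *\<^sub>R e + (1 - l) *\<^sub>R EXP))) has_integral (\<Sum>k. magnus_term m e I \<phi> (Suc k))) {0..1}"
    by (rule has_integral_eq[rotated]) (rule integrand[symmetric])
  then show "alg_log m e (time_ordered_exp m e I \<phi>) = (\<Sum>k. magnus_term m e I \<phi> (Suc k))"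
    unfolding alg_log_def time_ordered_exp_EXP by (rule integral_unique)
qed

end

section \<open>Ordered measures on normed algebras\<close>

text \<open>\<open>normed_algebra_on\<close> says nothing about arguments outside \<open>V\<close>.
  Composition with the coordinate projection \<open>p\<close> onto \<open>V\<close> gives a product
  and a seminorm with the required laws on the whole type, unchanged on \<open>V\<close>.\<close>

lemma normed_algebra_on_fd:
  fixes V :: "'v::real_normed_vector set"
  assumes A: "normed_algebra_on V m e N" and S: "finite S" "span S = V"
  obtains m' N' B c where "fd_algebra V m' e N' B c" "card B = dim V"
    "\<And>x y. x \<in> V \<Longrightarrow> y \<in> V \<Longrightarrow> m' x y = m x y" "\<And>x. x \<in> V \<Longrightarrow> N' x = N x"
    "\<And>x y. N' (m' x y) \<le> N' x * N' y"
proof -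
  note a = A[unfolded normed_algebra_on_def]
  have sV: "subspace V" and eV: "e \<in> V" using a by auto
  have "\<forall>x\<in>V. \<forall>y\<in>V. m x y \<in> V" using a by (elim conjE)
  then have mV: "m x y \<in> V" if "x \<in> V" "y \<in> V" for x y using that by simp
  have "\<forall>x\<in>V. \<forall>y\<in>V. \<forall>z\<in>V. m (x + y) z = m x z + m y z \<and> m z (x + y) = m z x + m z y" using a by (elim conjE)
  then have madd: "m (x + y) z = m x z + m y z" "m z (x + y) = m z x + m z y" if "x \<in> V" "y \<in> V" "z \<in> V" for x y z
    using that by simp_all
  have "\<forall>x\<in>V. \<forall>y\<in>V. \<forall>r. m (r *\<^sub>R x) y = r *\<^sub>R m x y \<and> m x (r *\<^sub>R y) = r *\<^sub>R m x y" using a by (elim conjE)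
  then have mscale: "m (r *\<^sub>R x) y = r *\<^sub>R m x y" "m x (r *\<^sub>R y) = r *\<^sub>R m x y" if "x \<in> V" "y \<in> V" for r x y
    using that by simp_all
  have "\<forall>x\<in>V. \<forall>y\<in>V. \<forall>z\<in>V. m (m x y) z = m x (m y z)" using a by (elim conjE)
  then have massoc: "m (m x y) z = m x (m y z)" if "x \<in> V" "y \<in> V" "z \<in> V" for x y z using that by simp
  have "\<forall>x\<in>V. m e x = x \<and> m x e = x" using a by (elim conjE)
  then have me: "m e x = x" "m x e = x" if "x \<in> V" for x using that by simp_all
  have "\<forall>x\<in>V. 0 \<le> N x \<and> (N x = 0 \<longleftrightarrow> x = 0)" using a by (elim conjE)
  then have Nz: "N x = 0 \<longleftrightarrow> x = 0" if "x \<in> V" for x using that by simp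
  have "\<forall>x\<in>V. \<forall>r. N (r *\<^sub>R x) = \<bar>r\<bar> * N x" using a by (elim conjE)
  then have Ns: "N (r *\<^sub>R x) = \<bar>r\<bar> * N x" if "x \<in> V" for r x using that by simp
  have "\<forall>x\<in>V. \<forall>y\<in>V. N (x + y) \<le> N x + N y \<and> N (m x y) \<le> N x * N y" using a by (elim conjE)
  then have Nt: "N (x + y) \<le> N x + N y" "N (m x y) \<le> N x * N y" if "x \<in> V" "y \<in> V" for x y using that by simp_all
  obtain B and c :: "'v \<Rightarrow> 'v \<Rightarrow> real" where B: "finite B" "B \<subseteq> V" "independent B" "card B = dim V"
      and cl: "\<And>b. b \<in> B \<Longrightarrow> linear (c b)" and ce: "\<And>x. x \<in> V \<Longrightarrow> x = (\<Sum>b\<in>B. c b x *\<^sub>R b)"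
      and cd: "\<And>b b'. b \<in> B \<Longrightarrow> b' \<in> B \<Longrightarrow> c b b' = (if b = b' then 1 else 0)"
    by (rule exists_coordinates[OF S(1), unfolded S(2)], rule that)
  define p where "p = (\<lambda>x. \<Sum>b\<in>B. c b x *\<^sub>R b)"
  have pV: "p x \<in> V" for x unfolding p_def using B(2) by (intro subspace_sum[OF sV] subspace_scale[OF sV]) auto
  have pid: "p x = x" if "x \<in> V" for x using ce[OF that] by (simp add: p_def)
  have padd: "p (x + y) = p x + p y" for x y
    by (simp add: p_def linear_add[OF cl] scaleR_add_left sum.distrib)
  have pscale: "p (r *\<^sub>R x) = r *\<^sub>R p x" for r x
    by (simp add: p_def linear_scale[OF cl] scaleR_sum_right)
  have spanB: "span B = V"
  proof
    show "span B \<subseteq> V" using span_minimal[OF B(2) sV] .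
    show "V \<subseteq> span B"
    proof
      fix x assume "x \<in> V"
      then have "x = (\<Sum>b\<in>B. c b x *\<^sub>R b)" by (rule ce)
      also have "\<dots> \<in> span B" by (intro span_sum span_scale span_base)
      finally show "x \<in> span B" .
    qed
  qed
  have bil: "bilinear (\<lambda>x y. m (p x) (p y))"
    unfolding bilinear_def by (auto intro!: linearI simp: padd pscale madd mscale pV)
  have no: "norm_on V (\<lambda>x. N (p x))"
    unfolding norm_on_def using sV by (auto simp: padd pscale Nt Ns pV pid Nz)
  have "fd_algebra V (\<lambda>x y. m (p x) (p y)) e (\<lambda>x. N (p x)) B c"
    by (rule fd_algebra.intro)
      (use no B(1,2) spanB cl ce cd bil in \<open>simp_all add: pid pV mV massoc eV me\<close>)
  then show thesis by (rule that) (use B(4) in \<open>auto simp: pid pV mV Nt\<close>)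
qed

lemma foldr_eq_on:
  assumes "\<And>x y. x \<in> V \<Longrightarrow> y \<in> V \<Longrightarrow> m x y \<in> V \<and> m' x y = m x y" "e \<in> V" "set xs \<subseteq> V"
  shows "foldr m' xs e = foldr m xs e" "foldr m xs e \<in> V"
  using assms(3) by (induction xs) (use assms(1,2) in auto)

text \<open>The product measure is characterized by its values on rectangles, and these involve only
  products inside \<open>V\<close>.\<close>

lemma magnus_term_eq_on:
  assumes m: "\<And>x y. x \<in> V \<Longrightarrow> y \<in> V \<Longrightarrow> m x y \<in> V \<and> m' x y = m x y" "e \<in> V"
    and \<phi>: "\<And>E. E \<in> sets (borel_on I) \<Longrightarrow> \<phi> E \<in> V"
  shows "magnus_term m' e I \<phi> k = magnus_term m e I \<phi> k"
proof -
  have "foldr m' (map (\<lambda>i. \<phi> (E i)) [0..<k]) e = foldr m (map (\<lambda>i. \<phi> (E i)) [0..<k]) e"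
    if "\<forall>i<k. E i \<in> sets (borel_on I)" for E
    by (rule foldr_eq_on(1)[OF m]) (use that \<phi> in auto)
  then have "product_measure_of m' e I \<phi> k = product_measure_of m e I \<phi> k"
    unfolding product_measure_of_def by (intro arg_cong[where f=The] ext) (auto 5 0)
  then show ?thesis by (simp add: magnus_term_def)
qed

text \<open>\<open>variation\<close> ranges over partitions. A finite disjoint family becomes a
  partition by adding the rest of \<open>I\<close> and removing the empty set.\<close>

lemma variation_upper:
  assumes "finite P" "P \<subseteq> sets (borel_on I)" "disjoint P" "N (\<phi> {}) = 0" "\<And>E. E \<in> sets (borel_on I) \<Longrightarrow> 0 \<le> N (\<phi> E)"
  shows "ereal (\<Sum>A\<in>P. N (\<phi> A)) \<le> variation N I \<phi>"
proof -
  define Q where "Q = insert (I - \<Union>P) P - {{}}"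
  have I: "I \<in> sets (borel_on I)" using sets.top[of "borel_on I"] by (simp add: space_restrict_space)
  have UP: "\<Union>P \<in> sets (borel_on I)" using assms(1,2) by (intro sets.finite_Union) auto
  have PI: "\<Union>P \<subseteq> I" using sets.sets_into_space[OF UP] by (simp add: space_restrict_space)
  have Qs: "Q \<subseteq> sets (borel_on I)" using assms(2) sets.Diff[OF I UP] by (auto simp: Q_def)
  have "disjoint (insert (I - \<Union>P) P)" using assms(3) unfolding disjoint_def by blast
  then have "disjoint Q" unfolding Q_def by (rule pairwise_subset) auto
  then have Q: "partition_on I Q" using PI unfolding partition_on_def Q_def by auto
  have "(\<Sum>A\<in>P. N (\<phi> A)) = (\<Sum>A\<in>P - {{}}. N (\<phi> A))"
    using assms(1,4) by (intro sum.mono_neutral_right) auto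
  also have "\<dots> \<le> (\<Sum>A\<in>Q. N (\<phi> A))"
    using assms(1,5) Qs by (intro sum_mono2) (auto simp: Q_def)
  finally have "ereal (\<Sum>A\<in>P. N (\<phi> A)) \<le> ereal (\<Sum>A\<in>Q. N (\<phi> A))" by simp
  also have "\<dots> \<le> variation N I \<phi>" unfolding variation_def
    using Q Qs assms(1) by (intro SUP_upper) (auto simp: Q_def)
  finally show ?thesis .
qed

lemma (in fd_algebra) ordered_measure_density:
  assumes om: "ordered_measure N I \<phi>" and \<phi>V: "\<And>E. E \<in> sets (borel_on I) \<Longrightarrow> \<phi> E \<in> V"
    and sub: "\<And>x y. N (m x y) \<le> N x * N y"
  obtains \<nu> u where "ordered_density V m e N B c I \<nu> u \<phi> 1" "ereal (measure \<nu> I) \<le> variation N I \<phi>"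
proof -
  have vm: "vector_measure (borel_on I) \<phi>" and at: "\<And>t. t \<in> I \<Longrightarrow> \<phi> {t} = 0" and fin: "variation N I \<phi> < \<infinity>"
    using om by (auto simp: ordered_measure_def)
  have \<phi>0: "\<phi> {} = 0" by (rule vector_measure_empty[OF vm])
  note up = variation_upper[where N=N and \<phi>=\<phi>, unfolded \<phi>0, OF _ _ _ n(5) n(9)]
  have "0 \<le> variation N I \<phi>" using up[of "{}" I] by (simp add: zero_ereal_def)
  then obtain w where w: "variation N I \<phi> = ereal w" using fin by (cases "variation N I \<phi>") auto
  interpret vmeas V m e N B c "borel_on I" \<phi> w
    by (unfold_locales) (use vm \<phi>V up[of _ I] w in auto)
  have I: "I \<in> sets (borel_on I)" using sets.top[of "borel_on I"] by (simp add: space_restrict_space)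
  obtain \<nu> u where d: "sets \<nu> = sets (borel_on I)" "finite_measure \<nu>" "\<And>E. E \<in> sets (borel_on I) \<Longrightarrow> emeasure \<nu> E = ennreal (tv E)"
    "\<And>t. u t \<in> V" "\<And>t. N (u t) \<le> 1" "\<And>b. b \<in> B \<Longrightarrow> (\<lambda>t. c b (u t)) \<in> borel_measurable \<nu>"
    "\<And>E. E \<in> sets (borel_on I) \<Longrightarrow> \<phi> E = wint \<nu> (\<lambda>t. indicator E t *\<^sub>R u t)"
    by (rule density_exists, rule that)
  have "emeasure \<nu> {t} = 0" if t: "t \<in> I" for t
  proof -
    have "{t} = I \<inter> {t}" using t by blast
    also have "\<dots> \<in> sets (borel_on I)" unfolding sets_restrict_space by (rule imageI) simp
    finally have ts: "{t} \<in> sets (borel_on I)" .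
    have "tv {t} \<le> 0"
    proof (rule tv_least)
      fix P assume P: "P \<in> parts {t}"
      have "N (\<phi> A) = 0" if "A \<in> P" for A
      proof -
        have "A = {} \<or> A = {t}" using P that by (auto simp: parts_def)
        then show ?thesis using \<phi>0 at[OF t] by (auto simp: n(5))
      qed
      then show "(\<Sum>A\<in>P. N (\<phi> A)) \<le> 0" by simp
    qed
    then show ?thesis using d(3)[OF ts] tv_nonneg[of "{t}"] by simp
  qed
  moreover have "N (m (u t) x) \<le> 1 * N x" for t x
    using order_trans[OF sub[of "u t" x] mult_right_mono[OF d(5)[of t] n(9)[of x]]] .
  ultimately have "ordered_density V m e N B c I \<nu> u \<phi> 1"
    by (intro ordered_density.intro fd_algebra_axioms ordered_density_axioms.intro) (use d in auto)
  moreover have "measure \<nu> I \<le> w" using d(3)[OF I] tv_nonneg[of I] tv_le_w[of I] by (simp add: measure_def)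
  ultimately show thesis using w by (intro that) auto
qed

lemma girth_gap_pos: "0 < girth_gap d" by (simp add: girth_gap_def)

lemma variation_cong:
  assumes "\<And>E. E \<in> sets (borel_on I) \<Longrightarrow> N' (\<phi> E) = N (\<phi> E)"
  shows "variation N' I \<phi> = variation N I \<phi>"
  unfolding variation_def using assms by (intro SUP_cong refl arg_cong[where f=ereal] sum.cong) auto

text \<open>A measure of variation below \<open>2\<close> has \<open>w < 2\<close>, which is inside
  the range of \<open>magnus_convergence\<close> because the gap is positive.\<close>

lemma C_fin_ge_2:
  assumes d: "3 \<le> d"
  shows "2 \<le> C_fin d"
  unfolding C_fin_def
proof (rule Inf_greatest, safe)
  fix V :: "(nat \<Rightarrow>\<^sub>C real) set" and m e N I \<phi>
  assume A: "normed_algebra_on V m e N" and dim: "d = dim V" and om: "ordered_measure N I \<phi>"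
    and \<phi>: "\<forall>E\<in>sets (borel_on I). \<phi> E \<in> V" and ns: "\<not> summable (\<lambda>k. N (magnus_term m e I \<phi> (Suc k)))"
  note a = A[unfolded normed_algebra_on_def]
  have sV: "subspace V" using a by (elim conjE)
  have closed: "e \<in> V \<and> (\<forall>x\<in>V. \<forall>y\<in>V. m x y \<in> V)" using a by (elim conjE, intro conjI)
  obtain S where S: "S \<subseteq> V" "independent S" "V \<subseteq> span S" "card S = dim V" using basis_exists by blast
  \<comment> \<open>A basis whose cardinality is the positive number \<open>d\<close> is finite,
    since an infinite set has \<open>card\<close> equal to \<open>0\<close>.\<close>
  have fS: "finite S" using S(4) d dim by (intro card_ge_0_finite) simp
  have "span S = V" using S(3) span_minimal[OF S(1) sV] by blast
  from normed_algebra_on_fd[OF A fS this] obtain m' N' B c where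
    fd: "fd_algebra V m' e N' B c" and cB: "card B = dim V"
    and m': "\<And>x y. x \<in> V \<Longrightarrow> y \<in> V \<Longrightarrow> m' x y = m x y" and N': "\<And>x. x \<in> V \<Longrightarrow> N' x = N x"
    and sub: "\<And>x y. N' (m' x y) \<le> N' x * N' y" by blast
  interpret fd_algebra V m' e N' B c by (rule fd)
  have var: "variation N' I \<phi> = variation N I \<phi>" by (rule variation_cong) (use \<phi> N' in auto)
  have mt: "magnus_term m' e I \<phi> k = magnus_term m e I \<phi> k" for k
    by (rule magnus_term_eq_on[where V=V]) (use closed m' \<phi> in auto)
  show "2 \<le> variation N I \<phi>"
  proof (rule ccontr)
    assume "\<not> 2 \<le> variation N I \<phi>"
    then have lt: "variation N I \<phi> < 2" by simp
    have om': "ordered_measure N' I \<phi>" using om unfolding ordered_measure_def var .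
    obtain \<nu> u where od: "ordered_density V m' e N' B c I \<nu> u \<phi> 1" and \<nu>: "ereal (measure \<nu> I) \<le> variation N' I \<phi>"
      using ordered_measure_density[OF om' _ sub] \<phi> by blast
    interpret ordered_density V m' e N' B c I \<nu> u \<phi> 1 by (rule od)
    have "w < 2" using le_less_trans[OF \<nu>[unfolded var] lt] unfolding numeral_eq_ereal w_def by simp
    then have "1 * w < 2 + girth_gap (2 * d)" using girth_gap_pos[of "2 * d"] by simp
    then have "summable (\<lambda>k. N' (magnus_term m' e I \<phi> (Suc k)))"
      using magnus_convergence[of "2 * d"] cB dim d by (metis dual_order.refl mult_2 add_mono numeral_Bit0)
    then show False using ns magnus_term_V by (simp add: mt N')
  qed
qed

section \<open>Real multiples of the measure and the divergent example\<close>

context ordered_density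
begin

lemma scaled_density: "ordered_density V m e N B c I \<nu> (\<lambda>t. z *\<^sub>R u t) (\<lambda>E. z *\<^sub>R \<phi> E) (\<bar>z\<bar> * K)"
proof (rule ordered_density.intro[OF fd_algebra_axioms], rule ordered_density_axioms.intro)
  show "sets \<nu> = sets (borel_on I)" "finite_measure \<nu>" by (rule sets_\<nu>, rule finite_\<nu>)
  show "emeasure \<nu> {t} = 0" if "t \<in> I" for t by (rule atomless[OF that])
  show "z *\<^sub>R u t \<in> V" if "t \<in> I" for t using u_V[OF that] by (rule V_closed(4))
  show "(\<lambda>t. c b (z *\<^sub>R u t)) \<in> borel_measurable \<nu>" if "b \<in> B" for b
    using u_meas[OF that] by (simp add: linear_scale[OF c_linear[OF that]])
  show "0 \<le> \<bar>z\<bar> * K" using K by simp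
  show "N (m (z *\<^sub>R u t) x) \<le> \<bar>z\<bar> * K * N x" if "t \<in> I" for t x
    using mult_left_mono[OF mult_u[OF that, of x], of "\<bar>z\<bar>"] by (simp add: m_simps n(3) mult.assoc)
  show "z *\<^sub>R \<phi> E = wint \<nu> (\<lambda>t. indicator E t *\<^sub>R z *\<^sub>R u t)" if "E \<in> sets \<nu>" for E
    unfolding \<phi>[OF that] wint_scale[symmetric] by (simp add: mult.commute)
qed

lemma magnus_term_scale: "magnus_term m e I (\<lambda>E. z *\<^sub>R \<phi> E) (Suc k) = z ^ Suc k *\<^sub>R magnus_term m e I \<phi> (Suc k)"
proof -
  interpret Z: ordered_density V m e N B c I \<nu> "\<lambda>t. z *\<^sub>R u t" "\<lambda>E. z *\<^sub>R \<phi> E" "\<bar>z\<bar> * K" by (rule scaled_density)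
  have fo: "foldr m (map (\<lambda>i. z *\<^sub>R f i) xs) e = z ^ length xs *\<^sub>R foldr m (map f xs) e" for f :: "nat \<Rightarrow> 'v" and xs
    by (induction xs) (simp_all add: m_simps mult.commute)
  have "Z.Uk k t = z ^ k *\<^sub>R Uk k t" for k t
    unfolding Z.Uk_def Uk_def using fo[of "\<lambda>i. u (t i)" "[0..<k]"] by simp
  then have "Z.asc_part k a = z ^ Suc k *\<^sub>R asc_part k a" for a
    unfolding Z.asc_part_def asc_part_def wint_scale[symmetric] by (simp add: mult.commute)
  then show ?thesis unfolding Z.magnus_term_eq magnus_term_eq
    by (simp add: scaleR_sum_right mult.commute del: power_Suc)
qed

end

context ordered_density
begin

lemma EE_scale:
  assumes "ordered_density V m e N B c I \<nu> (\<lambda>t. z *\<^sub>R u t) (\<lambda>E. z *\<^sub>R \<phi> E) K'"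
  shows "ordered_density.EE m e B c \<nu> (\<lambda>t. z *\<^sub>R u t) k = z ^ k *\<^sub>R EE k"
proof -
  interpret Z: ordered_density V m e N B c I \<nu> "\<lambda>t. z *\<^sub>R u t" "\<lambda>E. z *\<^sub>R \<phi> E" K' by (rule assms)
  have ev: "Z.evol k s = z ^ k *\<^sub>R evol k s" for k s
  proof (induction k arbitrary: s)
    case (Suc k)
    have "Z.evol (Suc k) s = wint \<nu> (\<lambda>r. z ^ Suc k *\<^sub>R (kle s r *\<^sub>R m (u r) (evol k r)))"
      by (simp add: Z.kernel_op_def Suc m_simps mult_ac)
    then show ?case by (simp only: wint_scale kernel_op_def[symmetric] funpow.simps o_apply)
  qed simp
  show ?thesis
  proof (cases k)
    case (Suc j)
    have "Z.total kle j = wint \<nu> (\<lambda>s. z ^ Suc j *\<^sub>R m (u s) (evol j s))"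
      unfolding Z.total_def by (simp add: ev m_simps mult.commute)
    then show ?thesis by (simp only: Suc Z.EE_simps EE_simps wint_scale total_def)
  qed simp
qed

lemma functional_has_integral:
  fixes l :: "'v \<Rightarrow> real"
  assumes l: "linear l" and f: "\<And>x. f x \<in> V" and i: "\<And>b. b \<in> B \<Longrightarrow> ((\<lambda>x. c b (f x)) has_integral c b y) S" and y: "y \<in> V"
  shows "((\<lambda>x. l (f x)) has_integral l y) S"
proof -
  have "((\<lambda>x. \<Sum>b\<in>B. c b (f x) * l b) has_integral (\<Sum>b\<in>B. c b y * l b)) S"
    by (intro has_integral_sum B(1) has_integral_mult_left i)
  moreover have "(\<Sum>b\<in>B. c b (f x) * l b) = l (f x)" for x using linear_expand[OF l f] by simp
  moreover have "(\<Sum>b\<in>B. c b y * l b) = l y" using linear_expand[OF l y] by simp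
  ultimately show ?thesis by simp
qed

lemma evol_total: "\<forall>r\<in>I. s \<le> r \<Longrightarrow> evol (Suc k) s = EE (Suc k)"
proof -
  assume "\<forall>r\<in>I. s \<le> r"
  then have "wint \<nu> (\<lambda>r. kle s r *\<^sub>R m (u r) (evol k r)) = wint \<nu> (\<lambda>r. m (u r) (evol k r))"
    by (intro wint_cong) (simp add: kle_def space_\<nu>)
  then show ?thesis by (simp add: kernel_op_def total_def)
qed

end

text \<open>The scalar case of the integral that defines the logarithm, divided by
  \<open>E - 1\<close>.\<close>

lemma has_integral_inverse_segment:
  fixes E :: real
  assumes "1 < E"
  shows "((\<lambda>l. 1 / (l + (1 - l) * E)) has_integral ln E / (E - 1)) {0..1}"
proof -
  have pos: "0 < l + (1 - l) * E" if "l \<in> {0..1}" for l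
  proof -
    have "l * 1 + (1 - l) * 1 \<le> l * 1 + (1 - l) * E" using that assms by (intro add_mono mult_left_mono) auto
    then show ?thesis by simp
  qed
  have "((\<lambda>l. 1 / (l + (1 - l) * E)) has_integral
     (- ln (1 + (1 - 1) * E) / (E - 1) - - ln (0 + (1 - 0) * E) / (E - 1))) {0..1}"
  proof (rule fundamental_theorem_of_calculus)
    fix l :: real assume l: "l \<in> {0..1}"
    have "((\<lambda>l. - ln (l + (1 - l) * E) / (E - 1)) has_real_derivative - ((1 - E) / (l + (1 - l) * E)) / (E - 1)) (at l within {0..1})"
      using pos[OF l] assms by (auto intro!: derivative_eq_intros simp: divide_simps)
    moreover have "- ((1 - E) / (l + (1 - l) * E)) / (E - 1) = 1 / (l + (1 - l) * E)"
      using pos[OF l] assms by (simp add: divide_simps)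
    ultimately show "((\<lambda>l. - ln (l + (1 - l) * E) / (E - 1)) has_vector_derivative 1 / (l + (1 - l) * E)) (at l within {0..1})"
      by (simp add: has_real_derivative_iff_has_vector_derivative)
  qed simp
  then show ?thesis by simp
qed

text \<open>The series of the integral of \<open>t * exp t\<close> from \<open>0\<close> to
  \<open>x\<close>. It arises here as the difference of the series of \<open>x * (exp x - 1)\<close>
  and of \<open>exp x - 1 - x\<close>.\<close>

lemma exp_moment_sums: "(\<lambda>k. x ^ (k + 2) / (fact k * (k + 2))) sums (x * exp x - exp x + (1::real))"
proof -
  have e: "(\<lambda>n. x ^ n / fact n) sums exp x" using exp_converges[of x] by (simp add: divide_inverse mult.commute)
  have "(\<lambda>n. x ^ Suc n / fact (Suc n)) sums (exp x - 1)" using e by (subst sums_Suc_iff) simp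
  then have e1: "(\<lambda>n. x ^ Suc n / fact (Suc n)) sums (exp x - 1)" .
  then have "(\<lambda>n. x ^ Suc (Suc n) / fact (Suc (Suc n))) sums (exp x - 1 - x)" by (subst sums_Suc_iff) simp
  then have "(\<lambda>n. x * (x ^ Suc n / fact (Suc n)) - x ^ Suc (Suc n) / fact (Suc (Suc n))) sums (x * (exp x - 1) - (exp x - 1 - x))"
    by (intro sums_diff sums_mult e1)
  moreover have "x * (x ^ Suc n / fact (Suc n)) - x ^ Suc (Suc n) / fact (Suc (Suc n)) = x ^ (n + 2) / (fact n * (n + 2))" for n
  proof -
    have "y / (p * A) - y / (q * (p * A)) = y / (A * q)" if "A \<noteq> 0" "p \<noteq> 0" "q \<noteq> 0" "q = p + 1" for y p q A :: real
      by (simp add: divide_simps that(1-3)) (simp add: that(4) algebra_simps)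
    from this[of "fact n" "real n + 1" "real n + 2" "x ^ (n + 2)"]
    have "x ^ (n + 2) / ((real n + 1) * fact n) - x ^ (n + 2) / ((real n + 2) * ((real n + 1) * fact n)) = x ^ (n + 2) / (fact n * (real n + 2))"
      by simp
    then show ?thesis by (simp add: add.commute) (simp add: algebra_simps)
  qed
  ultimately show ?thesis by (simp add: algebra_simps)
qed

lemma integral_tail_power:
  fixes s :: real
  assumes "s \<in> {0..1}"
  shows "(\<integral>r. of_bool (s \<le> r) * (1 - r) ^ k \<partial>restrict_space lborel {0..1}) = (1 - s) ^ Suc k / Suc k"
proof -
  have "(\<integral>r. of_bool (s \<le> r) * (1 - r) ^ k \<partial>restrict_space lborel {0..1})
     = (\<integral>r. indicator {0..1} r *\<^sub>R (of_bool (s \<le> r) * (1 - r) ^ k) \<partial>lborel)"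
    by (rule integral_restrict_space) simp
  also have "\<dots> = (\<integral>r. indicator {s..1} r *\<^sub>R (1 - r) ^ k \<partial>lborel)"
    using assms by (intro Bochner_Integration.integral_cong) (auto simp: indicator_def)
  also have "\<dots> = - ((1 - 1) ^ Suc k) / Suc k - (- ((1 - s) ^ Suc k) / Suc k)"
  proof (rule integral_FTC_atLeastAtMost)
    fix x :: real
    have "((\<lambda>r. - ((1 - r) ^ Suc k) / Suc k) has_real_derivative (1 - x) ^ k) (at x within {s..1})"
      by (auto intro!: derivative_eq_intros simp: divide_simps simp del: power_Suc) 
    then show "((\<lambda>r. - ((1 - r) ^ Suc k) / Suc k) has_vector_derivative (1 - x) ^ k) (at x within {s..1})"
      by (simp add: has_real_derivative_iff_has_vector_derivative)
  qed (use assms in \<open>auto intro!: continuous_intros\<close>)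
  finally show ?thesis by simp
qed

text \<open>The functionals \<open>\<pi>'\<close>, \<open>\<xi>\<close>, \<open>\<psi>\<close> are the entries of a representation by triangular
  \<open>2 \<times> 2\<close> matrices. For the density with entries \<open>8\<close>, \<open>0\<close>, \<open>1 - t\<close>, the power series
  \<open>F(z)\<close> of the off-diagonal entry of the Magnus expansion of \<open>z\<phi>\<close> satisfies
  \<open>8 (exp (8z) - 1) F(z) = 8z exp (8z) - exp (8z) + 1\<close>, which fails at \<open>z = \<i> pi / 4\<close>.\<close>

lemma (in ordered_density) divergent_magnus_expansion:
  fixes \<pi>' \<xi> \<psi> :: "'v \<Rightarrow> real"
  assumes I: "I = {0..1}" and \<nu>: "\<nu> = restrict_space lborel {0..1}"
    and lin: "linear \<pi>'" "linear \<xi>" "linear \<psi>"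
    and mult: "\<And>x y. x \<in> V \<Longrightarrow> y \<in> V \<Longrightarrow> \<pi>' (m x y) = \<pi>' x * \<pi>' y"
      "\<And>x y. x \<in> V \<Longrightarrow> y \<in> V \<Longrightarrow> \<xi> (m x y) = \<xi> x * \<xi> y"
      "\<And>x y. x \<in> V \<Longrightarrow> y \<in> V \<Longrightarrow> \<psi> (m x y) = \<xi> x * \<psi> y + \<pi>' y * \<psi> x"
    and unit: "\<pi>' e = 1" "\<xi> e = 1" "\<psi> e = 0"
    and u: "\<And>t. t \<in> I \<Longrightarrow> \<pi>' (u t) = 8" "\<And>t. t \<in> I \<Longrightarrow> \<xi> (u t) = 0" "\<And>t. t \<in> I \<Longrightarrow> \<psi> (u t) = 1 - t"
  shows "\<not> summable (\<lambda>k. N (magnus_term m e I \<phi> (Suc k)))"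
proof
  define \<mu> where "\<mu> = (\<lambda>k. magnus_term m e I \<phi> (Suc k))"
  assume "summable (\<lambda>k. N (magnus_term m e I \<phi> (Suc k)))"
  then have sN: "summable (\<lambda>k. N (\<mu> k))" by (simp add: \<mu>_def)
  have \<mu>V: "\<mu> k \<in> V" for k unfolding \<mu>_def by (rule magnus_term_V)
  have ne: "nice \<nu> (\<lambda>_. e)" by (rule nice_const[OF e_V])
  have evn: "nice \<nu> (evol k)" for k by (rule kernel_iter_nice[OF good_kle ne])
  have evV: "evol k r \<in> V" if "r \<in> I" for k r using niceD(1)[OF evn] that by (simp add: space_\<nu>)
  have step: "l (evol (Suc k) s) = (\<integral>r. of_bool (s \<le> r) * l (m (u r) (evol k r)) \<partial>\<nu>)" if "linear l" for l :: "'v \<Rightarrow> real" and k s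
    using functional_wint[OF finite_\<nu> kernel_nice[OF good_kle evn] that]
    by (simp add: kernel_op_def kle_def linear_scale[OF that])
  have \<pi>ev: "\<pi>' (evol k s) = 8 ^ k * (1 - s) ^ k / fact k" if "s \<in> I" for k s
    using that
  proof (induction k arbitrary: s)
    case (Suc k)
    have "\<pi>' (evol (Suc k) s) = (\<integral>r. 8 ^ Suc k / fact k * (of_bool (s \<le> r) * (1 - r) ^ k) \<partial>\<nu>)"
      unfolding step[OF lin(1)]
      by (rule Bochner_Integration.integral_cong[OF refl])
        (use Suc.IH mult(1) u(1) evV u_V in \<open>simp add: space_\<nu>\<close>)
    also have "\<dots> = 8 ^ Suc k / fact k * ((1 - s) ^ Suc k / Suc k)"
      unfolding integral_mult_right_zero \<nu> using integral_tail_power[of s k] Suc.prems I by simp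
    finally show ?case by simp
  qed (simp add: unit)
  have I0: "0 \<in> I" "\<forall>r\<in>I. 0 \<le> r" by (auto simp: I)
  have \<pi>EE: "\<pi>' (EE k) = 8 ^ k / fact k" for k
    using \<pi>ev[OF I0(1), of k] evol_total[OF I0(2)] by (cases k) (simp_all add: unit del: EE_simps(2))
  have \<xi>EE: "\<xi> (EE (Suc k)) = 0" for k
  proof -
    have "\<xi> (evol (Suc k) 0) = (\<integral>r. 0 \<partial>\<nu>)" unfolding step[OF lin(2)]
      by (rule Bochner_Integration.integral_cong[OF refl]) (use mult(2) u(2) evV u_V in \<open>simp add: space_\<nu>\<close>)
    then show ?thesis by (simp only: evol_total[OF I0(2)]) simp
  qed
  have \<psi>EE: "\<psi> (EE (Suc k)) = 8 ^ k / (fact k * (k + 2))" for k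
  proof -
    have "\<psi> (evol (Suc k) 0) = (\<integral>r. 8 ^ k / fact k * (of_bool (0 \<le> r) * (1 - r) ^ Suc k) \<partial>\<nu>)" unfolding step[OF lin(3)]
      by (rule Bochner_Integration.integral_cong[OF refl]) (use mult(3) u(2,3) \<pi>ev evV u_V in \<open>simp add: space_\<nu>\<close>)
    also have "\<dots> = 8 ^ k / fact k * ((1 - 0) ^ Suc (Suc k) / Suc (Suc k))"
      unfolding integral_mult_right_zero \<nu> using integral_tail_power[of 0 "Suc k"] by simp
    finally show ?thesis unfolding evol_total[OF I0(2)] by (simp add: add.commute)
  qed
  \<comment> \<open>For \<open>0 < z < \<delta>\<close> the number \<open>z * (K * w)\<close> is
    below \<open>1\<close>. Then \<open>magnus_convergence\<close> applies to
    \<open>z \<phi>\<close>, and the sum can be computed from the integral of the logarithm.\<close>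
  define \<delta> where "\<delta> = 1 / (1 + K * w)"
  have Kw: "0 \<le> K * w" using K w_nonneg by simp
  then have \<delta>: "0 < \<delta>" by (simp add: \<delta>_def)
  have real_identity: "8 * (exp (8 * z) - 1) * (\<Sum>k. z ^ Suc k * \<psi> (\<mu> k)) = 8 * z * exp (8 * z) - exp (8 * z) + 1"
    if z: "0 < z" "z < \<delta>" for z
  proof -
    note sd = scaled_density[of z]
    interpret Z: ordered_density V m e N B c I \<nu> "\<lambda>t. z *\<^sub>R u t" "\<lambda>E. z *\<^sub>R \<phi> E" "\<bar>z\<bar> * K" by (rule sd)
    have EEz: "Z.EE = (\<lambda>k. z ^ k *\<^sub>R EE k)" by (rule ext) (rule EE_scale[OF sd])
    define d where "d = max 6 (2 * card B)"
    have "z * (1 + K * w) < 1" using z Kw by (simp add: \<delta>_def field_simps)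
    then have "z * (K * w) < 1" using z by (simp add: algebra_simps)
    then have Kwz: "\<bar>z\<bar> * K * w < 2 + girth_gap d" using z girth_gap_pos[of d] by simp
    have d: "2 * card B \<le> d" "6 \<le> d" by (simp_all add: d_def)
    have mz: "magnus_term m e I (\<lambda>E. z *\<^sub>R \<phi> E) (Suc k) = z ^ Suc k *\<^sub>R \<mu> k" for k
      unfolding \<mu>_def by (rule magnus_term_scale)
    obtain RL where RV: "\<And>l. RL l \<in> V"
      and eq: "\<And>l. l \<in> {0..1} \<Longrightarrow> m (l *\<^sub>R e + (1 - l) *\<^sub>R Z.EXP) (RL l) = Z.EXP - e"
      and int: "\<And>b. b \<in> B \<Longrightarrow> ((\<lambda>l. c b (RL l)) has_integral (\<Sum>k. c b (z ^ Suc k *\<^sub>R \<mu> k))) {0..1}"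
      and sz: "summable (\<lambda>k. N (z ^ Suc k *\<^sub>R \<mu> k))"
      by (rule Z.magnus_convergence[OF d Kwz, unfolded mz], rule that)
    have zV: "z ^ Suc k *\<^sub>R \<mu> k \<in> V" for k by (rule V_closed(4)[OF \<mu>V])
    have EXPl: "(\<lambda>k. z ^ k * l (EE k)) sums l Z.EXP" if "linear l" for l :: "'v \<Rightarrow> real"
      using vsum_functional[OF that Z.EE_V Z.EE_summable] by (simp add: EEz linear_scale[OF that] Z.EXP_def)
    define E where "E = exp (8 * z)"
    have E: "1 < E" using z by (simp add: E_def)
    have "(\<lambda>k. (8 * z) ^ k / fact k) sums E" using exp_converges[of "8 * z"] by (simp add: E_def divide_inverse mult.commute)
    moreover have "(\<lambda>k. (8 * z) ^ k / fact k) sums \<pi>' Z.EXP"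
      using EXPl[OF lin(1)] by (simp add: \<pi>EE power_mult_distrib mult.commute)
    ultimately have \<pi>E: "\<pi>' Z.EXP = E" by (rule sums_unique2[symmetric])
    have "(\<lambda>k. z ^ k * \<xi> (EE k)) sums (\<Sum>k\<in>{0}. z ^ k * \<xi> (EE k))"
    proof (rule sums_finite)
      show "z ^ k * \<xi> (EE k) = 0" if "k \<notin> {0}" for k using that \<xi>EE[of "k - 1"] by (cases k) (simp_all del: EE_simps(2))
    qed simp
    from sums_unique2[OF this EXPl[OF lin(2)]] have \<xi>E: "\<xi> Z.EXP = 1" by (simp add: unit)
    define P where "P = \<psi> Z.EXP"
    have "(\<lambda>k. z ^ Suc k * \<psi> (EE (Suc k))) sums P"
      using EXPl[OF lin(3)] by (subst sums_Suc_iff) (simp add: unit P_def)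
    then have "(\<lambda>k. 64 * z * (z ^ Suc k * \<psi> (EE (Suc k)))) sums (64 * z * P)" by (rule sums_mult)
    moreover have "64 * z * (z ^ Suc k * \<psi> (EE (Suc k))) = (8 * z) ^ (k + 2) / (fact k * (k + 2))" for k
      unfolding \<psi>EE by (simp add: power_mult_distrib power_add power2_eq_square) (simp add: algebra_simps)
    ultimately have "(\<lambda>k. (8 * z) ^ (k + 2) / (fact k * (k + 2))) sums (64 * z * P)" by simp
    from sums_unique2[OF this exp_moment_sums] have PE: "64 * z * P = 8 * z * E - E + 1" by (simp add: E_def)
    have pos: "0 < l + (1 - l) * E" if "l \<in> {0..1}" for l
    proof -
      have "l * 1 + (1 - l) * 1 \<le> l * 1 + (1 - l) * E" using that E by (intro add_mono mult_left_mono) auto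
      then show ?thesis by simp
    qed
    \<comment> \<open>The resolvent equation is triangular: it is solved first for the diagonal
      entry \<open>\<pi>'\<close>, then for \<open>\<psi>\<close>.\<close>
    have \<psi>R: "\<psi> (RL l) = P * (1 / (l + (1 - l) * E))" if l: "l \<in> {0..1}" for l
    proof -
      define S where "S = l *\<^sub>R e + (1 - l) *\<^sub>R Z.EXP"
      have SV: "S \<in> V" unfolding S_def by (intro V_closed(2,4) e_V Z.EXP_V)
      have S: "\<pi>' S = l + (1 - l) * E" "\<xi> S = 1" "\<psi> S = (1 - l) * P"
        unfolding S_def using lin by (simp_all add: linear_add linear_scale unit \<pi>E \<xi>E P_def)
      have q: "m S (RL l) = Z.EXP - e" using eq[OF l] by (simp add: S_def)
      have 1: "(l + (1 - l) * E) * \<pi>' (RL l) = E - 1"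
        using mult(1)[OF SV RV, of l] unfolding q by (simp add: S linear_diff[OF lin(1)] \<pi>E unit)
      have 2: "\<psi> (RL l) + \<pi>' (RL l) * ((1 - l) * P) = P"
        using mult(3)[OF SV RV, of l] unfolding q by (simp add: S linear_diff[OF lin(3)] P_def unit)
      have "(l + (1 - l) * E) * \<psi> (RL l) = (l + (1 - l) * E) * P - ((l + (1 - l) * E) * \<pi>' (RL l)) * ((1 - l) * P)"
      proof -
        have "\<psi> (RL l) = P - \<pi>' (RL l) * ((1 - l) * P)" using 2 by linarith
        then show ?thesis by (simp only: right_diff_distrib mult.assoc)
      qed
      also have "\<dots> = P" unfolding 1 by (simp add: algebra_simps)
      finally show ?thesis using pos[OF l] by (simp add: field_simps)
    qed
    have "((\<lambda>l. c b (RL l)) has_integral c b (vsum (\<lambda>k. z ^ Suc k *\<^sub>R \<mu> k))) {0..1}" if "b \<in> B" for b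
      using int[OF that] by (simp only: c_vsum[OF that])
    from functional_has_integral[OF lin(3) RV this vsum_V]
    have "((\<lambda>l. \<psi> (RL l)) has_integral \<psi> (vsum (\<lambda>k. z ^ Suc k *\<^sub>R \<mu> k))) {0..1}" by simp
    moreover have "((\<lambda>l. \<psi> (RL l)) has_integral P * (ln E / (E - 1))) {0..1}"
      by (rule has_integral_eq[OF _ has_integral_mult_right[OF has_integral_inverse_segment[OF E]]]) (simp add: \<psi>R)
    ultimately have "\<psi> (vsum (\<lambda>k. z ^ Suc k *\<^sub>R \<mu> k)) = P * (ln E / (E - 1))" by (rule has_integral_unique)
    moreover have "(\<lambda>k. z ^ Suc k * \<psi> (\<mu> k)) sums \<psi> (vsum (\<lambda>k. z ^ Suc k *\<^sub>R \<mu> k))"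
      using vsum_functional[OF lin(3) zV sz] by (simp only: linear_scale[OF lin(3)] real_scaleR_def)
    ultimately have "(\<Sum>k. z ^ Suc k * \<psi> (\<mu> k)) = P * (8 * z / (E - 1))" by (simp add: sums_iff E_def)
    then have "8 * (E - 1) * (\<Sum>k. z ^ Suc k * \<psi> (\<mu> k)) = 8 * P * ((E - 1) * (8 * z / (E - 1)))" by (simp only: mult_ac)
    also have "(E - 1) * (8 * z / (E - 1)) = 8 * z" using E by simp
    finally have "8 * (E - 1) * (\<Sum>k. z ^ Suc k * \<psi> (\<mu> k)) = 64 * z * P" by simp
    then show ?thesis unfolding PE by (simp add: E_def)
  qed
  have abs: "summable (\<lambda>k. \<bar>\<psi> (\<mu> k)\<bar>)" by (rule functional_summable[OF lin(3) \<mu>V sN])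
  define f where "f = (\<lambda>z::complex. \<Sum>k. of_real (\<psi> (\<mu> k)) * z ^ k)"
  have fs: "(\<lambda>k. of_real (\<psi> (\<mu> k)) * z ^ k) sums f z" if "cmod z \<le> 1" for z
  proof -
    have "summable (\<lambda>k. of_real (\<psi> (\<mu> k)) * z ^ k)"
    proof (rule summable_comparison_test'[OF abs])
      fix k
      show "cmod (of_real (\<psi> (\<mu> k)) * z ^ k) \<le> \<bar>\<psi> (\<mu> k)\<bar>"
        using mult_left_mono[OF power_le_one[OF norm_ge_zero that, of k], of "\<bar>\<psi> (\<mu> k)\<bar>"] by (simp add: norm_mult norm_power)
    qed
    then show ?thesis unfolding f_def by (rule summable_sums)
  qed
  have fh: "f holomorphic_on ball 0 1"
    by (rule power_series_holomorphic[where a="\<lambda>k. of_real (\<psi> (\<mu> k))"]) (use fs in simp)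
  define G where "G = (\<lambda>z. 8 * (exp (8 * z) - 1) * (z * f z) - (8 * z * exp (8 * z) - exp (8 * z) + 1))"
  \<comment> \<open>The assumed summability makes \<open>f\<close> holomorphic on the unit disc, so
    the identity continues to \<open>z0\<close>, which lies in it because \<open>pi < 4\<close>.
    There \<open>exp (8 * z0) = 1\<close> leaves \<open>0\<close> on one side and
    \<open>8 * z0\<close> on the other.\<close>
  define z0 where "z0 = of_real (pi / 4) * \<i>"
  have "G z0 = 0"
  proof (rule analytic_continuation[of G "ball 0 1" "of_real ` {0<..<min 1 \<delta>}" 0])
    show "G holomorphic_on ball 0 1" unfolding G_def by (intro holomorphic_intros fh)
    show "of_real ` {0<..<min 1 \<delta>} \<subseteq> ball (0::complex) 1" by auto
    show "(0::complex) islimpt of_real ` {0<..<min 1 \<delta>}" unfolding islimpt_approachable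
    proof (intro allI impI)
      fix \<epsilon> :: real assume "0 < \<epsilon>"
      then show "\<exists>x'\<in>of_real ` {0<..<min 1 \<delta>}. x' \<noteq> (0::complex) \<and> dist x' 0 < \<epsilon>"
        using \<delta> by (intro bexI[OF _ imageI[of "min \<epsilon> (min 1 \<delta>) / 2"]]) auto
    qed
    fix z :: complex assume "z \<in> of_real ` {0<..<min 1 \<delta>}"
    then obtain x where x: "z = of_real x" "0 < x" "x < 1" "x < \<delta>" by auto
    have "(\<lambda>k. of_real (x ^ k * \<psi> (\<mu> k))) sums f z" using fs[of z] x by (simp add: mult.commute)
    then have "(\<lambda>k. x ^ k * \<psi> (\<mu> k)) sums Re (f z)" and "f z = of_real (Re (f z))"
      using sums_Re[of "\<lambda>k. of_real (x ^ k * \<psi> (\<mu> k))"] sums_Im[of "\<lambda>k. of_real (x ^ k * \<psi> (\<mu> k))"] sums_unique2[OF sums_zero]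
      by (fastforce simp: complex_eq_iff)+
    then obtain y where y: "(\<lambda>k. x ^ k * \<psi> (\<mu> k)) sums y" "f z = of_real y" by blast
    have "(\<Sum>k. x ^ Suc k * \<psi> (\<mu> k)) = x * y" using sums_mult[OF y(1), of x] by (simp add: sums_iff mult.assoc)
    then have "8 * (exp (8 * x) - 1) * (x * y) - (8 * x * exp (8 * x) - exp (8 * x) + 1) = 0"
      using real_identity[OF x(2,4)] by simp
    then have "of_real (8 * (exp (8 * x) - 1) * (x * y) - (8 * x * exp (8 * x) - exp (8 * x) + 1)) = (0::complex)" by simp
    then show "G z = 0" unfolding G_def x(1) y(2)[unfolded x(1)] by (simp add: exp_of_real[symmetric])
  next
    show "z0 \<in> ball 0 1" using pi_less_4 pi_gt_zero by (simp add: z0_def norm_mult)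
  qed auto
  moreover have "exp (8 * z0) = 1"
  proof -
    have "8 * z0 = 2 * of_real pi * \<i>" by (simp add: z0_def)
    then show ?thesis by (simp only: exp_two_pi_i)
  qed
  ultimately show False by (simp add: G_def z0_def)
qed

section \<open>The critical cumulative norm is finite\<close>

definition unit_seq :: "nat \<Rightarrow> (nat \<Rightarrow>\<^sub>C real)" where
  "unit_seq i = Bcontfun (\<lambda>j. of_bool (j = i))"

lemma unit_seq_apply [simp]: "apply_bcontfun (unit_seq i) j = of_bool (j = i)"
  unfolding unit_seq_def by (subst Bcontfun_inverse) (auto intro!: bcontfun_normI[of _ 1])

lemma linear_apply_bcontfun: "linear (\<lambda>x :: nat \<Rightarrow>\<^sub>C real. apply_bcontfun x j)"
  by (rule linearI) simp_all

lemma norm_unit_seq: "norm (unit_seq i) \<le> 1"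
  by (rule norm_bound) simp

lemma dim_span_unit_seq: "dim (span (unit_seq ` {..<n})) = n"
proof -
  have inj: "inj_on unit_seq A" for A
  proof (rule inj_onI)
    fix i j assume "unit_seq i = unit_seq j"
    then have "apply_bcontfun (unit_seq i) i = apply_bcontfun (unit_seq j) i" by simp
    then show "i = j" by (simp split: if_splits)
  qed
  have "independent (unit_seq ` {..<n})"
  proof (rule independent_if_scalars_zero)
    fix f x assume s: "(\<Sum>x\<in>unit_seq ` {..<n}. f x *\<^sub>R x) = 0" and "x \<in> unit_seq ` {..<n}"
    then obtain i where i: "i < n" "x = unit_seq i" by auto
    have "0 = apply_bcontfun (\<Sum>j<n. f (unit_seq j) *\<^sub>R unit_seq j) i" using s by (simp add: sum.reindex[OF inj])
    also have "\<dots> = (\<Sum>j<n. f (unit_seq j) * of_bool (i = j))" by (simp add: linear_sum[OF linear_apply_bcontfun])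
    also have "\<dots> = f x" using i by (simp add: of_bool_def if_distrib[where f="\<lambda>x. _ * x"] cong: if_cong)
    finally show "f x = 0" by simp
  qed simp
  then show ?thesis by (simp add: dim_eq_card_independent card_image[OF inj])
qed

text \<open>Coordinate \<open>0\<close> and coordinate \<open>1\<close> are the diagonal entries of
  a triangular matrix; the others together form its vector-valued off-diagonal entry, as coordinate
  \<open>j\<close> of the product is \<open>x 1 * y j + x j * y 0\<close> for
  \<open>j \<ge> 2\<close>. This supplies an algebra in every dimension from \<open>2\<close>
  on.\<close>

definition tri_mult :: "(nat \<Rightarrow>\<^sub>C real) \<Rightarrow> (nat \<Rightarrow>\<^sub>C real) \<Rightarrow> (nat \<Rightarrow>\<^sub>C real)" where
  "tri_mult x y = apply_bcontfun x 1 *\<^sub>R y + apply_bcontfun y 0 *\<^sub>R x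
     - (apply_bcontfun x 1 * apply_bcontfun y 0) *\<^sub>R (unit_seq 0 + unit_seq 1)"

lemma norm_tri_mult: "norm (tri_mult x y) \<le> 3 * (norm x * norm y)"
proof (unfold mult.commute[of 3], rule norm_bound)
  fix j
  have b: "\<bar>apply_bcontfun z i\<bar> \<le> norm z" for z :: "nat \<Rightarrow>\<^sub>C real" and i using norm_bounded[of z i] by simp
  have "\<bar>apply_bcontfun (tri_mult x y) j\<bar> \<le> \<bar>apply_bcontfun x 1 * apply_bcontfun y j\<bar> + \<bar>apply_bcontfun y 0 * apply_bcontfun x j\<bar>
      + \<bar>apply_bcontfun x 1 * apply_bcontfun y 0\<bar>"
    unfolding tri_mult_def by (auto simp: of_bool_def)
  also have "\<dots> \<le> norm x * norm y + norm y * norm x + norm x * norm y"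
    unfolding abs_mult by (intro add_mono mult_mono b) auto
  finally show "norm (apply_bcontfun (tri_mult x y) j) \<le> norm x * norm y * 3" by simp
qed

text \<open>The factor \<open>3\<close> in the norm absorbs the constant of
  \<open>norm_tri_mult\<close>.\<close>

lemma tri_algebra:
  assumes n: "2 \<le> n"
  shows "normed_algebra_on (span (unit_seq ` {..<n})) tri_mult (unit_seq 0 + unit_seq 1) (\<lambda>x. 3 * norm x)"
proof -
  let ?V = "span (unit_seq ` {..<n})"
  have e: "unit_seq 0 + unit_seq 1 \<in> ?V" using n by (intro span_add span_base) auto
  have cl: "tri_mult x y \<in> ?V" if "x \<in> ?V" "y \<in> ?V" for x y
    unfolding tri_mult_def by (intro span_add span_diff span_scale e that)
  have ad: "tri_mult (x + y) z = tri_mult x z + tri_mult y z" "tri_mult z (x + y) = tri_mult z x + tri_mult z y" for x y z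
    by (simp_all add: tri_mult_def algebra_simps)
  have sc: "tri_mult (r *\<^sub>R x) y = r *\<^sub>R tri_mult x y" "tri_mult x (r *\<^sub>R y) = r *\<^sub>R tri_mult x y" for r x y
    by (simp_all add: tri_mult_def algebra_simps)
  have as: "tri_mult (tri_mult x y) z = tri_mult x (tri_mult y z)" for x y z
    by (rule bcontfun_eqI) (simp add: tri_mult_def algebra_simps)
  have un: "tri_mult (unit_seq 0 + unit_seq 1) x = x" "tri_mult x (unit_seq 0 + unit_seq 1) = x" for x
    by (simp_all add: tri_mult_def)
  have nt: "3 * norm (x + y) \<le> 3 * norm x + 3 * norm y" for x y :: "nat \<Rightarrow>\<^sub>C real" using norm_triangle_ineq[of x y] by simp
  have nm: "3 * norm (tri_mult x y) \<le> 3 * norm x * (3 * norm y)" for x y using norm_tri_mult[of x y] by simp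
  show ?thesis unfolding normed_algebra_on_def
    by (intro conjI ballI allI subspace_span e cl ad sc as un nt nm) auto
qed

lemma C_fin_finite:
  assumes n3: "3 \<le> n"
  shows "C_fin n < \<infinity>"
proof -
  define V where "V = span (unit_seq ` {..<n})"
  define e where "e = unit_seq 0 + unit_seq 1"
  have dimV: "dim V = n" unfolding V_def by (rule dim_span_unit_seq)
  have A: "normed_algebra_on V tri_mult e (\<lambda>x. 3 * norm x)" unfolding V_def e_def using n3 by (intro tri_algebra) simp
  have uV: "unit_seq i \<in> V" if "i < n" for i using that unfolding V_def by (intro span_base) auto
  obtain m N B c where fd: "fd_algebra V m e N B c" and cB: "card B = dim V"
    and m: "\<And>x y. x \<in> V \<Longrightarrow> y \<in> V \<Longrightarrow> m x y = tri_mult x y" and Nn: "\<And>x. x \<in> V \<Longrightarrow> N x = 3 * norm x"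
    and sub: "\<And>x y. N (m x y) \<le> N x * N y"
    by (rule normed_algebra_on_fd[OF A _ V_def[symmetric]], simp, rule that)
  interpret fd_algebra V m e N B c by (rule fd)
  define \<nu> where "\<nu> = restrict_space lborel {0..1::real}"
  have I: "{0..1::real} \<in> sets (borel_on {0..1})" using sets.top[of "borel_on {0..1}"] by (simp add: space_restrict_space)
  have sets\<nu>: "sets \<nu> = sets (borel_on {0..1})" unfolding \<nu>_def by (rule sets_restrict_space_cong) simp
  have sp: "space \<nu> = {0..1}" by (simp add: \<nu>_def space_restrict_space)
  have em: "emeasure \<nu> {0..1} = 1" unfolding \<nu>_def by (subst emeasure_restrict_space) auto
  have fin: "finite_measure \<nu>" by (rule finite_measureI) (simp add: sp em)
  interpret \<nu>: finite_measure \<nu> by (rule fin)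
  \<comment> \<open>The density required by \<open>divergent_magnus_expansion\<close>, with the
    off-diagonal part in coordinate \<open>2\<close>. The bound \<open>27\<close> is three times
    \<open>8 + 1\<close>.\<close>
  define u where "u = (\<lambda>t. 8 *\<^sub>R unit_seq 0 + (1 - t) *\<^sub>R unit_seq 2)"
  have u: "u t \<in> V" for t unfolding u_def using n3 by (intro V_closed(2,4) uV) auto
  have Nu: "N (u t) \<le> 27" if "t \<in> {0..1}" for t
  proof -
    have "norm (u t) \<le> norm (8 *\<^sub>R unit_seq 0) + norm ((1 - t) *\<^sub>R unit_seq 2)" unfolding u_def by (rule norm_triangle_ineq)
    also have "\<dots> \<le> 8 * 1 + 1 * 1" unfolding norm_scaleR using that norm_unit_seq by (intro add_mono mult_mono) auto
    finally show ?thesis by (simp add: Nn[OF u])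
  qed
  have um: "(\<lambda>t. c b (u t)) \<in> borel_measurable \<nu>" if "b \<in> B" for b
  proof -
    have "(\<lambda>t. t) \<in> borel_measurable \<nu>" unfolding \<nu>_def by (intro measurable_restrict_space1) simp
    then show ?thesis unfolding u_def by (simp add: linear_add[OF c_linear[OF that]] linear_scale[OF c_linear[OF that]])
  qed
  have un: "nice \<nu> u" by (rule niceI[of _ _ 27]) (use u um Nu in \<open>auto simp: sp\<close>)
  define \<phi> where "\<phi> = (\<lambda>E. wint \<nu> (\<lambda>t. indicator E t *\<^sub>R u t))"
  have \<phi>V: "\<phi> E \<in> V" for E unfolding \<phi>_def by (rule wint_V)
  have \<phi>le: "N (\<phi> E) \<le> 27 * measure \<nu> E" if E: "E \<in> sets \<nu>" for E
  proof -
    have "N (\<phi> E) \<le> (\<integral>t. 27 * indicator E t \<partial>\<nu>)" unfolding \<phi>_def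
    proof (rule wint_norm_le[OF fin nice_indicator[OF un E]])
      show "integrable \<nu> (\<lambda>t. 27 * indicator E t :: real)" using E by (simp add: \<nu>.emeasure_eq_measure)
      show "N (indicator E t *\<^sub>R u t) \<le> 27 * indicator E t" if "t \<in> space \<nu>" for t
        using Nu[of t] that by (cases "t \<in> E") (simp_all add: sp n(5))
    qed
    also have "\<dots> = 27 * measure \<nu> E" using E sets.sets_into_space[OF E] by (simp add: Int_absorb2)
    finally show ?thesis .
  qed
  have pt: "emeasure \<nu> {t} = 0" if "t \<in> {0..1}" for t
    unfolding \<nu>_def using that by (subst emeasure_restrict_space) auto
  have ts: "{t} \<in> sets \<nu>" if "t \<in> {0..1}" for t
    unfolding \<nu>_def using that by (subst sets_restrict_space_iff) auto
  have od: "ordered_density V m e N B c {0..1} \<nu> u \<phi> 27"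
  proof (rule ordered_density.intro[OF fd], rule ordered_density_axioms.intro)
    show "N (m (u t) x) \<le> 27 * N x" if "t \<in> {0..1}" for t x
      using order_trans[OF sub[of "u t" x] mult_right_mono[OF Nu[OF that] n(9)[of x]]] .
  qed (use sets\<nu> fin pt u um \<phi>_def in auto)
  interpret ordered_density V m e N B c "{0..1}" \<nu> u \<phi> 27 by (rule od)
  have "\<not> summable (\<lambda>k. N (magnus_term m e {0..1} \<phi> (Suc k)))"
  proof (rule divergent_magnus_expansion[where \<pi>'="\<lambda>x. apply_bcontfun x 0" and \<xi>="\<lambda>x. apply_bcontfun x 1" and \<psi>="\<lambda>x. apply_bcontfun x 2"])
    show "\<nu> = restrict_space lborel {0..1}" by (rule \<nu>_def)
  qed (auto simp: linear_apply_bcontfun m tri_mult_def e_def u_def)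
  moreover have mt: "magnus_term m e {0..1} \<phi> k = magnus_term tri_mult e {0..1} \<phi> k" for k
  proof (rule magnus_term_eq_on[where V=V])
    show "tri_mult x y \<in> V \<and> m x y = tri_mult x y" if "x \<in> V" "y \<in> V" for x y using m_V[of x y] m[OF that] by simp
  qed (simp_all add: e_V \<phi>V)
  ultimately have ns: "\<not> summable (\<lambda>k. 3 * norm (magnus_term tri_mult e {0..1} \<phi> (Suc k)))"
    using magnus_term_V by (simp add: Nn)
  have "variation (\<lambda>x. 3 * norm x) {0..1} \<phi> = variation N {0..1} \<phi>" by (rule variation_cong) (simp add: Nn \<phi>V)
  also have "\<dots> \<le> ereal 27" unfolding variation_def
  proof (rule SUP_least)
    fix P assume P: "P \<in> {P. finite P \<and> partition_on {0..1::real} P \<and> P \<subseteq> sets (borel_on {0..1})}"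
    have "(\<Sum>E\<in>P. N (\<phi> E)) \<le> (\<Sum>E\<in>P. 27 * measure \<nu> E)" using P sets\<nu> by (intro sum_mono \<phi>le) auto
    also have "\<dots> = 27 * measure \<nu> (\<Union>E\<in>P. E)" unfolding sum_distrib_left[symmetric]
      using P sets\<nu> by (subst \<nu>.finite_measure_finite_Union) (auto simp: partition_on_def disjoint_family_on_def disjoint_def)
    also have "(\<Union>E\<in>P. E) = {0..1}" using P by (auto simp: partition_on_def)
    also have "measure \<nu> {0..1} = 1" using em by (simp add: measure_def)
    finally show "ereal (\<Sum>E\<in>P. N (\<phi> E)) \<le> ereal 27" by simp
  qed
  finally have var: "variation (\<lambda>x. 3 * norm x) {0..1} \<phi> \<le> ereal 27" .
  have "vector_measure \<nu> \<phi>" by (rule vector_measure_wint[OF fin un]) (simp add: \<phi>_def)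
  then have vm: "vector_measure (borel_on {0..1}) \<phi>" by (simp add: vector_measure_def sets\<nu>)
  have "\<phi> {t} = 0" if "t \<in> {0..1}" for t
    using \<phi>le[OF ts[OF that]] pt[OF that] n(4)[OF \<phi>V, of "{t}"] n(9)[of "\<phi> {t}"] by (simp add: measure_def)
  moreover have "variation (\<lambda>x. 3 * norm x) {0..1} \<phi> < \<infinity>" using var by (rule le_less_trans) simp
  ultimately have om: "ordered_measure (\<lambda>x. 3 * norm x) {0..1} \<phi>"
    unfolding ordered_measure_def using vm by (simp add: is_interval_cc)
  have "C_fin n \<le> variation (\<lambda>x. 3 * norm x) {0..1} \<phi>" unfolding C_fin_def
    by (rule Inf_lower) (use A dimV om \<phi>V ns in blast)
  from order_trans[OF this var] show ?thesis by (rule le_less_trans) simp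
qed

section \<open>The constants and the theorem\<close>

lemma ln_ratio_deriv:
  fixes z :: real
  assumes "-1 < z" "z < 1"
  shows "((\<lambda>z. ln (1 + z) - ln (1 - z)) has_real_derivative 2 / (1 - z\<^sup>2)) (at z)"
proof -
  have p: "0 < 1 + z" "0 < 1 - z" using assms by auto
  have "1 - z\<^sup>2 = (1 + z) * (1 - z)" by (simp add: power2_eq_square algebra_simps)
  then have "1 / (1 + z) + 1 / (1 - z) = 2 / (1 - z\<^sup>2)" using p by (simp only:) (simp add: add_frac_eq)
  moreover have "((\<lambda>z. ln (1 + z) - ln (1 - z)) has_real_derivative 1 / (1 + z) + 1 / (1 - z)) (at z)"
    using p by (auto intro!: derivative_eq_intros simp: divide_simps)
  ultimately show ?thesis by simp
qed

lemma one_minus_square_pos: "\<bar>z\<bar> < 1 \<Longrightarrow> 0 < 1 - (z::real)\<^sup>2"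
  using abs_square_less_1[of z] by simp

text \<open>The difference of the two sides is the derivative of \<open>ln_ratio\<close> up to a
  positive factor.\<close>

lemma ln_ratio_less:
  fixes z :: real
  assumes z: "0 < z" "z < 1"
  shows "ln (1 + z) - ln (1 - z) < 2 * z / (1 - z\<^sup>2)"
proof -
  let ?k = "\<lambda>z::real. 2 * z / (1 - z\<^sup>2) - (ln (1 + z) - ln (1 - z))"
  have d: "(?k has_real_derivative 4 * x\<^sup>2 / (1 - x\<^sup>2)\<^sup>2) (at x)" if x: "0 \<le> x" "x < 1" for x
  proof -
    have p: "1 - x\<^sup>2 \<noteq> 0" using one_minus_square_pos[of x] x by simp
    have "((\<lambda>z. 2 * z / (1 - z\<^sup>2)) has_real_derivative (2 * (1 - x\<^sup>2) - 2 * x * (- (2 * x))) / (1 - x\<^sup>2)\<^sup>2) (at x)"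
      using p by (auto intro!: derivative_eq_intros simp: power2_eq_square)
    from DERIV_diff[OF this ln_ratio_deriv[of x]] x
    have "(?k has_real_derivative (2 * (1 - x\<^sup>2) - 2 * x * (- (2 * x))) / (1 - x\<^sup>2)\<^sup>2 - 2 / (1 - x\<^sup>2)) (at x)" by simp
    moreover have "(2 * (1 - x\<^sup>2) - 2 * x * (- (2 * x))) / (1 - x\<^sup>2)\<^sup>2 - 2 / (1 - x\<^sup>2) = 4 * x\<^sup>2 / (1 - x\<^sup>2)\<^sup>2"
    proof -
      have "2 / A = 2 * A / A\<^sup>2" if "A \<noteq> 0" for A :: real using that by (simp add: power2_eq_square)
      from this[OF p] have "2 / (1 - x\<^sup>2) = 2 * (1 - x\<^sup>2) / (1 - x\<^sup>2)\<^sup>2" .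
      then show ?thesis by (simp add: diff_divide_distrib[symmetric] power2_eq_square[of x])
    qed
    ultimately show ?thesis by (simp only:)
  qed
  have "?k 0 < ?k z"
  proof (rule DERIV_pos_imp_increasing_open[OF z(1)])
    fix x assume "0 < x" "x < z"
    moreover from this have "0 < 4 * x\<^sup>2 / (1 - x\<^sup>2)\<^sup>2" using one_minus_square_pos[of x] z by simp
    ultimately show "\<exists>y. (?k has_real_derivative y) (at x) \<and> 0 < y" using d[of x] z by (intro exI[of _ "4 * x\<^sup>2 / (1 - x\<^sup>2)\<^sup>2"]) auto
  next
    show "continuous_on {0..z} ?k"
      by (rule continuous_at_imp_continuous_on) (use d z DERIV_isCont in fastforce)
  qed
  then show ?thesis by simp
qed

text \<open>\<open>C_inf l\<close> in the variable \<open>z = 1 - 2 * l\<close>, that is,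
  \<open>2 artanh z\<close> divided by \<open>z\<close>.\<close>

definition ln_ratio :: "real \<Rightarrow> real" where "ln_ratio z = (ln (1 + z) - ln (1 - z)) / z"

lemma ln_ratio_strict_mono:
  assumes "0 < x" "x < y" "y < 1"
  shows "ln_ratio x < ln_ratio y"
proof (rule DERIV_pos_imp_increasing[OF assms(2)])
  fix z assume z: "x \<le> z" "z \<le> y"
  then have z': "0 < z" "z < 1" using assms by auto
  let ?h = "ln (1 + z) - ln (1 - z)"
  have "(ln_ratio has_real_derivative (2 / (1 - z\<^sup>2) * z - ?h * 1) / (z * z)) (at z)"
    unfolding ln_ratio_def using ln_ratio_deriv[of z] z' by (intro DERIV_divide) auto
  moreover have "0 < (2 / (1 - z\<^sup>2) * z - ?h * 1) / (z * z)" using ln_ratio_less[OF z'] z' by simp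
  ultimately show "\<exists>d. (ln_ratio has_real_derivative d) (at z) \<and> 0 < d" by blast
qed

lemma ln_ratio_gt_2:
  assumes z: "0 < z" "z < 1"
  shows "2 < ln_ratio z"
proof -
  let ?k = "\<lambda>z::real. ln (1 + z) - ln (1 - z) - 2 * z"
  have d: "(?k has_real_derivative 2 / (1 - x\<^sup>2) - 2) (at x)" if x: "0 \<le> x" "x < 1" for x
  proof -
    have "((\<lambda>z. 2 * z) has_real_derivative 2) (at x)" by (auto intro!: derivative_eq_intros)
    from DERIV_diff[OF ln_ratio_deriv this] show ?thesis using x by simp
  qed
  have "?k 0 < ?k z"
  proof (rule DERIV_pos_imp_increasing_open[OF z(1)])
    fix x assume x: "0 < x" "x < z"
    then have "2 < 2 / (1 - x\<^sup>2)" using one_minus_square_pos[of x] z by (simp add: less_divide_eq)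
    then show "\<exists>y. (?k has_real_derivative y) (at x) \<and> 0 < y" using d[of x] x z by (intro exI[of _ "2 / (1 - x\<^sup>2) - 2"]) auto
  next
    show "continuous_on {0..z} ?k"
      by (rule continuous_at_imp_continuous_on) (use d z DERIV_isCont in fastforce)
  qed
  then show ?thesis using z by (simp add: ln_ratio_def less_divide_eq)
qed

lemma ln_ratio_attains:
  assumes c: "2 < c"
  shows "\<exists>z. 0 < z \<and> z < 1 \<and> ln_ratio z = c"
proof -
  \<comment> \<open>Since \<open>2 / (1 - z1\<^sup>2) = c\<close>, the bound
    \<open>ln_ratio_less\<close> keeps \<open>ln_ratio\<close> below \<open>c\<close> at
    \<open>z1\<close>; at \<open>z2\<close> it is at least \<open>c\<close> because
    \<open>- ln (1 - z2)\<close> is.\<close>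
  define z1 where "z1 = sqrt (1 - 2 / c)"
  have z1: "0 < z1" "z1 < 1" using c by (auto simp: z1_def)
  have "1 - z1\<^sup>2 = 2 / c" using c by (simp add: z1_def)
  then have l: "ln (1 + z1) - ln (1 - z1) - c * z1 \<le> 0" using ln_ratio_less[OF z1] c by (simp add: mult.commute)
  define z2 where "z2 = max z1 (1 - exp (- c))"
  have z2: "z1 \<le> z2" "z2 < 1" using z1 by (auto simp: z2_def)
  have "ln (1 - z2) \<le> ln (exp (- c))" using z2 by (intro ln_mono) (auto simp: z2_def)
  moreover have "0 \<le> ln (1 + z2)" using z1 z2 by simp
  moreover have "c * z2 \<le> c * 1" using z2 c by (intro mult_left_mono) auto
  ultimately have r: "0 \<le> ln (1 + z2) - ln (1 - z2) - c * z2" by simp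
  have "\<exists>z\<ge>z1. z \<le> z2 \<and> ln (1 + z) - ln (1 - z) - c * z = 0"
  proof (rule IVT'[OF l r z2(1)])
    show "continuous_on {z1..z2} (\<lambda>z. ln (1 + z) - ln (1 - z) - c * z)"
      using z1 z2 by (auto intro!: continuous_intros)
  qed
  then obtain z where z: "z1 \<le> z" "z \<le> z2" "ln (1 + z) - ln (1 - z) = c * z" by auto
  then show ?thesis using z1 z2 by (intro exI[of _ z]) (auto simp: ln_ratio_def)
qed

lemma C_inf_eq: "0 < l \<Longrightarrow> l \<le> 1/2 \<Longrightarrow> C_inf l = (if l = 1/2 then 2 else ereal (ln_ratio (1 - 2 * l)))"
proof -
  assume l: "0 < l" "l \<le> 1/2"
  have "ln (1 + (1 - 2 * l)) - ln (1 - (1 - 2 * l)) = ln ((2 * (1 - l)) / (2 * l))"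
    using l by (subst ln_div) auto
  also have "(2 * (1 - l)) / (2 * l) = (1 - l) / l" by (rule mult_divide_mult_cancel_left) simp
  finally have "ln (1 + (1 - 2 * l)) - ln (1 - (1 - 2 * l)) = ln ((1 - l) / l)" .
  then show ?thesis using l by (auto simp: C_inf_def ln_ratio_def)
qed

lemma Lambda_bounds:
  assumes n: "3 \<le> n"
  shows "0 < Lambda n" "Lambda n \<le> 1/2"
proof -
  obtain c where c: "C_fin n = ereal c" "2 \<le> c"
    using C_fin_ge_2[OF n] C_fin_finite[OF n] by (cases "C_fin n") auto
  have ex: "\<exists>l. 0 < l \<and> l \<le> 1/2 \<and> C_inf l = C_fin n"
  proof (cases "c = 2")
    case True
    then show ?thesis using c C_inf_eq[of "1/2"] by (intro exI[of _ "1/2"]) auto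
  next
    case False
    then obtain z where z: "0 < z" "z < 1" "ln_ratio z = c" using ln_ratio_attains[of c] c by auto
    then have "C_inf ((1 - z) / 2) = ereal c" using C_inf_eq[of "(1 - z) / 2"] by (simp add: field_simps)
    then show ?thesis using z c by (intro exI[of _ "(1 - z) / 2"]) auto
  qed
  have le: False if l: "0 < l" "l < l'" "l' \<le> 1/2" "C_inf l = C_inf l'" for l l'
  proof (cases "l' = 1/2")
    case True
    then show False using l ln_ratio_gt_2[of "1 - 2 * l"] C_inf_eq[of l] C_inf_eq[of l'] unfolding numeral_eq_ereal by simp
  next
    case False
    then show False using l ln_ratio_strict_mono[of "1 - 2 * l'" "1 - 2 * l"] C_inf_eq[of l] C_inf_eq[of l'] by simp
  qed
  have "0 < Lambda n \<and> Lambda n \<le> 1/2 \<and> C_inf (Lambda n) = C_fin n"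
    unfolding Lambda_def
  proof (rule theI', rule ex_ex1I[OF ex])
    show "l = l'" if "0 < l \<and> l \<le> 1/2 \<and> C_inf l = C_fin n" "0 < l' \<and> l' \<le> 1/2 \<and> C_inf l' = C_fin n" for l l'
      using le[of l l'] le[of l' l] that by (cases l l' rule: linorder_cases) auto
  qed
  then show "0 < Lambda n" "Lambda n \<le> 1/2" by auto
qed

section \<open>The bound of the theorem compared with the gap\<close>

lemma rogers_bounds_ge_4:
  assumes n: "3 \<le> n" and \<theta>: "\<theta> \<in> rogers_bounds n"
  shows "4 \<le> \<theta>"
proof -
  have r: "3 \<le> real n" using n by simp
  have "exp 1 \<le> real n" using exp_le r by linarith
  then have L: "1 \<le> ln (real n)" using r by (simp add: ln_ge_iff)
  have nL: "3 * 1 \<le> real n * ln (real n)" using r L by (intro mult_mono) auto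
  have nLL: "0 \<le> real n * ln (ln (real n))" using r L by simp
  have 1: "4 \<le> (1 + \<eta>) ^ n * (1 + n * x)" if "0 \<le> \<eta>" "1 \<le> x" for \<eta> x :: real
  proof -
    have "3 * 1 \<le> real n * x" using r that by (intro mult_mono) auto
    then have "1 * 4 \<le> (1 + \<eta>) ^ n * (1 + n * x)" using that by (intro mult_mono one_le_power) auto
    then show ?thesis by simp
  qed
  have a: "4 \<le> (INF \<eta>\<in>{0<..<1 / real n}. (1 + \<eta>) ^ n * (1 + n * ln (1 / \<eta>)))"
  proof (rule cINF_greatest)
    show "{0<..<1 / real n} \<noteq> {}" using r by simp
    fix \<eta> assume \<eta>: "\<eta> \<in> {0<..<1 / real n}"
    then have "real n \<le> 1 / \<eta>" using r by (simp add: field_simps)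
    then have "ln (real n) \<le> ln (1 / \<eta>)" using r by (intro ln_mono) auto
    then show "4 \<le> (1 + \<eta>) ^ n * (1 + n * ln (1 / \<eta>))" using L \<eta> by (intro 1) auto
  qed
  have "real n * 1 \<le> real n * ln (real n)" using L r by (intro mult_left_mono) auto
  then have "ln (real n) \<le> ln (real n * ln (real n))" using r by simp
  then have b: "4 \<le> (1 + 1 / (real n * ln (real n))) ^ n * (1 + n * ln (real n * ln (real n)))" using L nL by (intro 1) auto
  from \<theta> consider "\<theta> = (INF \<eta>\<in>{0<..<1 / real n}. (1 + \<eta>) ^ n * (1 + n * ln (1 / \<eta>)))"
    | "\<theta> = (1 + 1 / (real n * ln (real n))) ^ n * (1 + n * ln (real n * ln (real n)))"
    | "\<theta> = n * ln n + n * ln (ln n) + 2 * n + 1" | "\<theta> = n * ln n + n * ln (ln n) + 5 * n"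
    unfolding rogers_bounds_def by auto
  then show ?thesis by cases (use a b nL nLL r in auto)
qed

lemma power_dominates_quartic:
  assumes "3 \<le> n"
  shows "13 * ((real n - 2) * (real n + 2) * (2 * real n + 1) * (2 * real n + 3)) \<le> 64 * 2 ^ n * (real n)\<^sup>2"
proof -
  consider "n = 3" | "n = 4" | "5 \<le> n" using assms by linarith
  then show ?thesis
  proof cases
    \<comment> \<open>From \<open>5\<close> on, \<open>(n - 2) * (n + 2) \<le> n\<^sup>2\<close>
      reduces the claim to \<open>13 * ((2 n + 1) * (2 n + 3)) \<le> 64 * 2 ^ n\<close>, which fails
      for \<open>3\<close> and \<open>4\<close>.\<close>
    case 3
    then have "13 * ((2 * real n + 1) * (2 * real n + 3)) \<le> 64 * 2 ^ n"
    proof (induction n rule: nat_induct_at_least)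
      case (Suc n)
      have "13 * ((2 * real (Suc n) + 1) * (2 * real (Suc n) + 3)) \<le> 2 * (13 * ((2 * real n + 1) * (2 * real n + 3)))"
      proof -
        have "5 * 5 \<le> real n * real n" using Suc.hyps by (intro mult_mono) auto
        then have "0 \<le> 13 * (4 * (real n * real n) - 9)" by simp
        moreover have "2 * (13 * ((2 * real n + 1) * (2 * real n + 3))) - 13 * ((2 * real (Suc n) + 1) * (2 * real (Suc n) + 3)) = 13 * (4 * (real n * real n) - 9)"
          by (simp add: algebra_simps)
        ultimately show ?thesis by - (rule diff_ge_0_iff_ge[THEN iffD1], simp only:)
      qed
      then show ?case using Suc.IH by simp
    qed simp
    then have "(real n)\<^sup>2 * (13 * ((2 * real n + 1) * (2 * real n + 3))) \<le> (real n)\<^sup>2 * (64 * 2 ^ n)"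
      by (intro mult_left_mono) auto
    moreover have "((real n)\<^sup>2 - 4) * (13 * ((2 * real n + 1) * (2 * real n + 3))) \<le> (real n)\<^sup>2 * (13 * ((2 * real n + 1) * (2 * real n + 3)))"
      by (intro mult_right_mono) auto
    moreover have "13 * ((real n - 2) * (real n + 2) * (2 * real n + 1) * (2 * real n + 3)) = ((real n)\<^sup>2 - 4) * (13 * ((2 * real n + 1) * (2 * real n + 3)))"
      by (simp add: power2_eq_square algebra_simps)
    ultimately have "13 * ((real n - 2) * (real n + 2) * (2 * real n + 1) * (2 * real n + 3)) \<le> (real n)\<^sup>2 * (64 * 2 ^ n)" by linarith
    then show ?thesis by (simp only: mult.commute)
  qed (simp_all add: power2_eq_square)
qed

text \<open>With \<open>exp 1 \<ge> 2\<close>, \<open>\<Lambda> \<le> 1/2\<close> and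
  \<open>\<theta> \<ge> 4\<close> the number \<epsilon> is at most \<open>1 / (13 A)\<close>,
  whereas the gap is \<open>g = 1 / (6 A)\<close>. Hence \<epsilon> is at most \<open>6/13\<close>
  of \<open>g\<close>, and \<open>(2 + g) * 6/13 \<le> 1\<close> because \<open>g \<le> 1/6\<close>;
  this is the origin of the \<open>13\<close>.\<close>

lemma covering_bound_le:
  assumes n: "3 \<le> n" and L: "0 < \<Lambda>" "\<Lambda> \<le> 1/2" and \<theta>: "4 \<le> \<theta>"
  shows "2 / (1 - (2 powr (- 2 - real n) / real n) * ((1 - 2 / real n) / exp 1) * (\<Lambda> / \<theta>)) \<le> 2 + girth_gap (2 * n)"
proof -
  define \<epsilon> where "\<epsilon> = (2 powr (- 2 - real n) / real n) * ((1 - 2 / real n) / exp 1) * (\<Lambda> / \<theta>)"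
  define g where "g = girth_gap (2 * n)"
  define A where "A = (real n + 2) * (2 * real n + 1) * (2 * real n + 3)"
  have r: "3 \<le> real n" using n by simp
  have A: "5 * 7 * 9 \<le> A" unfolding A_def using r by (intro mult_mono) auto
  have "3 * (real (2 * n) + 1) * (real (2 * n) + 3) * (real (2 * n) + 4) = 6 * A" by (simp add: A_def algebra_simps)
  then have g: "g = 1 / (6 * A)" by (simp add: g_def girth_gap_def)
  have e: "2 \<le> exp (1::real)" using exp_ge_add_one_self[of 1] by simp
  have p: "2 powr (- 2 - real n) = 1 / (4 * 2 ^ n)" by (simp add: powr_diff powr_minus powr_realpow divide_simps)
  have q: "1 - 2 / real n = (real n - 2) / real n" using r by (simp add: diff_divide_distrib)
  have "(1 - 2 / real n) / exp 1 \<le> (1 - 2 / real n) / 2" using e r by (intro divide_left_mono) auto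
  moreover have "\<Lambda> / \<theta> \<le> (1 / 2) / 4" using L \<theta> by (intro frac_le) auto
  ultimately have "\<epsilon> \<le> (2 powr (- 2 - real n) / real n) * ((1 - 2 / real n) / 2) * ((1 / 2) / 4)"
    unfolding \<epsilon>_def using L \<theta> r by (intro mult_mono mult_nonneg_nonneg) auto
  also have "\<dots> = (real n - 2) / (64 * 2 ^ n * (real n)\<^sup>2)" unfolding p q by (simp add: power2_eq_square)
  also have "\<dots> \<le> 1 / (13 * A)"
  proof -
    have "(real n - 2) * (13 * A) \<le> 1 * (64 * 2 ^ n * (real n)\<^sup>2)"
      using power_dominates_quartic[OF n] by (simp add: A_def mult_ac)
    moreover have "x / b \<le> 1 / a" if "x * a \<le> 1 * b" "0 < a" "0 < b" for x a b :: real using that by (simp add: field_simps)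
    ultimately show ?thesis using r A by auto
  qed
  finally have \<epsilon>: "\<epsilon> \<le> 1 / (13 * A)" .
  have "1 / (13 * A) \<le> 1 / 13" using A by (simp add: field_simps)
  then have \<epsilon>1: "\<epsilon> < 1" using \<epsilon> by simp
  have gp: "0 < g" "g \<le> 1 / 6" using A by (auto simp: g field_simps)
  have "(2 + g) * \<epsilon> \<le> (2 + g) * (6 / 13 * g)" using \<epsilon> gp by (intro mult_left_mono) (auto simp: g)
  also have "\<dots> = (2 + g) * (6 / 13) * g" by simp
  also have "\<dots> \<le> 1 * g" using gp by (intro mult_right_mono) auto
  finally have "2 \<le> (2 + g) * (1 - \<epsilon>)" by (simp add: algebra_simps)
  then have "2 / (1 - \<epsilon>) \<le> 2 + g" using \<epsilon>1 by (simp add: divide_le_eq)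
  then show ?thesis by (simp only: \<epsilon>_def g_def)
qed

theorem theorem2p3:
  fixes I :: "real set"
    and \<phi> :: "real set \<Rightarrow> 'a::{real_normed_algebra, real_algebra_1, banach}"
    and n :: nat and \<theta> :: real
  assumes "dim (UNIV :: 'a set) = n" and "n \<ge> 3"
    and "\<theta> \<in> rogers_bounds n"
    and "ordered_measure norm I \<phi>"
    and "variation norm I \<phi> <
           ereal (2 / (1 - (2 powr (- 2 - real n) / real n) * ((1 - 2 / real n) / exp 1)
                            * (Lambda n / \<theta>)))"
  shows "M_controlled I \<phi>
    \<and> (\<forall>s. complex_structure s \<longrightarrow> M_controlled_complex (*) 1 s I \<phi>)
    \<and> summable (\<lambda>k. magnus_term (*) 1 I \<phi> (Suc k))
    \<and> log_defined (*) 1 (time_ordered_exp (*) 1 I \<phi>)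
    \<and> alg_log (*) 1 (time_ordered_exp (*) 1 I \<phi>) = (\<Sum>k. magnus_term (*) 1 I \<phi> (Suc k))"
proof -
  \<comment> \<open>The real dimension of the complexification; the algebra itself has dimension
    below it.\<close>
  define d where "d = 2 * n"
  have d6: "6 \<le> d" using assms(2) by (simp add: d_def)
  have "variation norm I \<phi> < ereal (2 + girth_gap d)"
    using less_le_trans[OF assms(5)] covering_bound_le[OF assms(2) Lambda_bounds[OF assms(2)] rogers_bounds_ge_4[OF assms(2,3)]]
    by (simp only: d_def ereal_less_eq(3))
  note var = this
  obtain S :: "'a set" where "S \<subseteq> UNIV" and S: "independent S" "UNIV \<subseteq> span S" "card S = dim (UNIV :: 'a set)"
    by (rule basis_exists[of "UNIV :: 'a set"], rule that)
  have fS: "finite S" using S(3) assms(1,2) by (intro card_ge_0_finite) simp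
  have sS: "span S = UNIV" using S(2) by blast
  have A: "normed_algebra_on (UNIV :: 'a set) (*) 1 norm"
    by (simp add: normed_algebra_on_def algebra_simps norm_triangle_ineq norm_mult_ineq)
  obtain m' N' B and c :: "'a \<Rightarrow> 'a \<Rightarrow> real" where fd': "fd_algebra UNIV m' 1 N' B c" and cB: "card B = dim (UNIV :: 'a set)"
    and m': "\<And>x y. x \<in> UNIV \<Longrightarrow> y \<in> UNIV \<Longrightarrow> m' x y = x * y" and N': "\<And>x. x \<in> UNIV \<Longrightarrow> N' x = norm x"
    and "\<And>x y. N' (m' x y) \<le> N' x * N' y"
    by (rule normed_algebra_on_fd[OF A fS sS], rule that)
  have "m' = (*)" "N' = norm" using m' N' by auto
  then have fd: "fd_algebra (UNIV :: 'a set) (*) 1 norm B c" using fd' by simp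
  interpret fd_algebra "UNIV :: 'a set" "(*)" 1 norm B c by (rule fd)
  obtain \<nu> u where od: "ordered_density UNIV (*) 1 norm B c I \<nu> u \<phi> 1" and \<nu>: "ereal (measure \<nu> I) \<le> variation norm I \<phi>"
    using ordered_measure_density[OF assms(4) _ norm_mult_ineq] by blast
  interpret ordered_density "UNIV :: 'a set" "(*)" 1 norm B c I \<nu> u \<phi> 1 by (rule od)
  have w: "w < 2 + girth_gap d" using le_less_trans[OF \<nu> var] by (simp add: w_def)
  have card: "2 * card B \<le> d" "card B \<le> d" using cB assms(1) by (simp_all add: d_def)
  have "M_controlled I \<phi>" unfolding M_controlled_def M_controlled_complex_def
  proof (intro allI impI)
    fix t :: complex assume "cmod t \<le> 1"
    then have "log_defined mC (1, 0) (time_ordered_exp mC (1, 0) I (\<phi>C t))"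
      using log_defined_complex[OF card(1) d6] w by simp
    moreover have "mC = cplx_mult" by (auto simp: mC_def cplx_mult_def fun_eq_iff split: prod.splits)
    moreover have "\<phi>C t = (\<lambda>E. cplx_scale t (\<phi> E, 0))" by (auto simp: \<phi>C_def cplx_scale_def)
    ultimately show "log_defined cplx_mult (1, 0) (time_ordered_exp cplx_mult (1, 0) I (\<lambda>E. cplx_scale t (\<phi> E, 0)))" by simp
  qed
  moreover have "M_controlled_complex (*) 1 s I \<phi>" if s: "complex_structure s" for s
    unfolding M_controlled_complex_def
  proof (intro allI impI)
    fix t assume t: "cmod t \<le> 1"
    interpret s: vector_space s using s by (simp add: complex_structure_def)
    have sr: "s (of_real r) a = r *\<^sub>R a" and sm: "s z a * b = s z (a * b)" and sn: "norm (s z a) = cmod z * norm a" for r z a b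
      using s by (auto simp: complex_structure_def)
    have lin: "linear (s t)"
    proof (rule linearI)
      show "s t (r *\<^sub>R a) = r *\<^sub>R s t a" for r a by (simp add: sr[symmetric] s.scale_left_commute)
    qed (rule s.scale_right_distrib)
    \<comment> \<open>In a complex algebra the multiple \<open>t \<phi>\<close> is formed inside the
      algebra. As \<open>s t\<close> multiplies norms by \<open>cmod t\<close>, its density is
      \<open>s t (u x)\<close> with the same \<nu> and with \<open>cmod t\<close> as the bound on
      multiplication.\<close>
    have "ordered_density UNIV (*) 1 norm B c I \<nu> (\<lambda>x. s t (u x)) (\<lambda>E. s t (\<phi> E)) (cmod t)"
    proof (rule ordered_density.intro[OF fd], rule ordered_density_axioms.intro)
      show "(\<lambda>x. c b (s t (u x))) \<in> borel_measurable \<nu>" if "b \<in> B" for b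
        using nice_functional(1)[OF u_nice linear_compose[OF lin c_linear[OF that]]] by (simp add: o_def)
      show "norm (s t (u x) * y) \<le> cmod t * norm y" if "x \<in> I" for x y
        using mult_left_mono[OF mult_u[OF that, of y], of "cmod t"] by (simp add: sm sn)
      show "s t (\<phi> E) = wint \<nu> (\<lambda>x. indicator E x *\<^sub>R s t (u x))" if "E \<in> sets \<nu>" for E
        unfolding \<phi>[OF that] using linear_wint[OF finite_\<nu> nice_indicator[OF u_nice that] lin] by (simp add: linear_scale[OF lin])
    qed (use sets_\<nu> finite_\<nu> atomless in auto)
    then interpret Z: ordered_density "UNIV :: 'a set" "(*)" 1 norm B c I \<nu> "\<lambda>x. s t (u x)" "\<lambda>E. s t (\<phi> E)" "cmod t" .
    have "cmod t * w \<le> 1 * w" using t w_nonneg by (intro mult_right_mono)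
    then have "cmod t * w < 2 + girth_gap d" using w by simp
    then show "log_defined (*) 1 (time_ordered_exp (*) 1 I (\<lambda>E. s t (\<phi> E)))" by (rule Z.log_defined_exp[OF card(2) d6])
  qed
  ultimately show ?thesis
    using log_defined_exp[OF card(2) d6] magnus_logarithm[OF card(1) d6] w by simp
qed

end
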